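(* For every $k\in\mathbb{N}$ there are numbers $\epsilon_k>0$ and $C_k>0$ such that for every $\epsilon\in(0,\epsilon_k)$ and every $\eta\in[0,2\pi)$ the $k$-th eigenvalue $\Lambda_k^\epsilon(\eta)$ of the quasi-periodic model problem and the $k$-th eigenvalue $\Lambda_k^0$ of the limit problem are related by $$\Lambda_k^0\le \Lambda_k^\epsilon(\eta)\le \Lambda_k^0+C_k\,\epsilon .$$
   Context: Geometry. Points are $x=(x_1,x_2,x_3)$, $x'=(x_2,x_3)$, $z=x_3$. Let $\varpi_\bullet\subset\mathbb{R}^3$ be a domain with Lipschitz boundary and compact closure whose intersections with the planes $\{x_1=0\}$ and $\{x_1=1\}$ are simply connected planar domains of positive area containing $P^0=(0,P_2,P_3)$ and $P^1=(1,P_2,P_3)$ respectively, with $P_3<0$. The periodicity cell is the bounded domain $\varpi=\{x\in\varpi_\bullet: x_3<0,\ 0<x_1<1\}$; its free surface is $\gamma$, the part of $\partial\varpi$ in $\{x_3=0\}$ (of positive area). It is a standing fact that the form $(\nabla u,\nabla v)_{L^2(\varpi)}+(u,v)_{L^2(\gamma)}$ induces a norm equivalent to the $H^1(\varpi)$-norm and that the trace map $H^1(\varpi)\to L^2(\gamma)$ is compact. Let $\theta\subset\mathbb{R}^2$ be a bounded planar domain containing the origin, with $C^2$ boundary, so small that $\{j\}\times\overline{(2\theta+(P_2,P_3))}\subset\partial\varpi$ for $j=0,1$ and $\sup_{(x_2,x_3)\in\theta}(x_3+P_3)<0$; moreover the set $\{0\}\times\overline\theta+P^0$ has a neighbourhood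 $N_0$ with $N_0\cap\{x_1=0\}\subset\partial\varpi$ and $N_0\cap\{x_1>0\}\subset\varpi$, and analogously at $P^1$ with $\{x_1=1\}$, $\{x_1<1\}$. For small $\epsilon>0$ the apertures are $\theta_j^\epsilon=\{(j,x'):\epsilon^{-1}(x'-(P_2,P_3))\in\theta\}$, $j=0,1$. Model problem. For $\eta\in[0,2\pi)$ let $H^1_{\epsilon,\eta}(\varpi)$ be the space of (complex-valued) $u\in H^1(\varpi)$ with $u(0,x')=e^{-i\eta}u(1,x')$ for $(0,x')\in\theta_0^\epsilon$ (in the sense of traces). The model problem is: find $\Lambda$ and $0\ne U\in H^1_{\epsilon,\eta}(\varpi)$ with $(\nabla U,\nabla V)_{L^2(\varpi)}=\Lambda\,(U,V)_{L^2(\gamma)}$ for all $V\in H^1_{\epsilon,\eta}(\varpi)$. Its eigenvalues, repeated according to multiplicity, form an unbounded sequence $0\le\Lambda_1^\epsilon(\eta)\le\Lambda_2^\epsilon(\eta)\le\dots$. Limit problem. Find $\Lambda$ and $0\ne U\in H^1(\varpi)$ with $(\nabla U,\nabla V)_{L^2(\varpi)}=\Lambda\,(U,V)_{L^2(\gamma)}$ for all $V\in H^1(\varpi)$. Its eigenvalues, repeated according to multiplicity, are $0=\Lambda_1^0\le\Lambda_2^0\le\dots\to+\infty$. *)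

theory Defs
  imports "HOL-Analysis.Analysis"
begin

section \<open>Regularity of functions and of boundaries\<close>

definition partial :: "'n::finite \<Rightarrow> (real^'n \<Rightarrow> real) \<Rightarrow> real^'n \<Rightarrow> real" where
  "partial i f x = frechet_derivative f (at x) (axis i 1)"

fun C_k :: "nat \<Rightarrow> (real^'n::finite \<Rightarrow> real) \<Rightarrow> bool" where
  "C_k 0 f \<longleftrightarrow> continuous_on UNIV f"
| "C_k (Suc k) f \<longleftrightarrow> (\<forall>x. f differentiable (at x)) \<and> (\<forall>i. C_k k (partial i f))"

definition test_function :: "(real^'n::finite) set \<Rightarrow> (real^'n \<Rightarrow> real) \<Rightarrow> bool" where
  "test_function \<Omega> \<phi> \<longleftrightarrow> (\<forall>k. C_k k \<phi>) \<and> (\<exists>K. compact K \<and> K \<subseteq> \<Omega> \<and> (\<forall>x. x \<notin> K \<longrightarrow> \<phi> x = 0))"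

text \<open>Near each boundary point the set is the strict subgraph, in the direction of a unit vector
  \<open>e\<close>, of a function \<open>\<phi>\<close> of the component orthogonal to \<open>e\<close>; the predicate \<open>R\<close> prescribes the
  regularity of \<open>\<phi>\<close>. Taking \<open>\<phi>\<close> on the whole space is no restriction, since a locally given
  Lipschitz or \<open>C\<^sup>2\<close> function can be extended after shrinking \<open>U\<close>.\<close>
definition graph_boundary ::
    "((real^'n::finite \<Rightarrow> real) \<Rightarrow> bool) \<Rightarrow> (real^'n) set \<Rightarrow> bool" where
  "graph_boundary R \<Omega> \<longleftrightarrow>
    (\<forall>p\<in>frontier \<Omega>. \<exists>U e \<phi>. open U \<and> p \<in> U \<and> norm e = 1 \<and> R \<phi> \<and>
       \<Omega> \<inter> U = {x \<in> U. x \<bullet> e < \<phi> (x - (x \<bullet> e) *\<^sub>R e)})"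

abbreviation Lipschitz_boundary :: "(real^'n::finite) set \<Rightarrow> bool" where
  "Lipschitz_boundary \<equiv> graph_boundary (\<lambda>\<phi>. \<exists>L. L-lipschitz_on UNIV \<phi>)"

abbreviation C2_boundary :: "(real^'n::finite) set \<Rightarrow> bool" where
  "C2_boundary \<equiv> graph_boundary (C_k 2)"

definition domain :: "'a::topological_space set \<Rightarrow> bool" where
  "domain S \<longleftrightarrow> open S \<and> connected S \<and> S \<noteq> {}"

section \<open>Lebesgue and Sobolev spaces, traces\<close>

text \<open>Elements of the function spaces are functions, not classes; equality is understood almost
  everywhere.\<close>

definition L2_space :: "'a measure \<Rightarrow> 'a set \<Rightarrow> ('a \<Rightarrow> complex) set" where
  "L2_space M A =
     {f. set_borel_measurable M A f \<and> set_integrable M A (\<lambda>x. (cmod (f x))\<^sup>2)}"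

definition L2_inner :: "'a measure \<Rightarrow> 'a set \<Rightarrow> ('a \<Rightarrow> complex) \<Rightarrow> ('a \<Rightarrow> complex) \<Rightarrow> complex" where
  "L2_inner M A f g = (LINT x:A|M. f x * cnj (g x))"

definition L2_norm :: "'a measure \<Rightarrow> 'a set \<Rightarrow> ('a \<Rightarrow> complex) \<Rightarrow> real" where
  "L2_norm M A f = sqrt (LINT x:A|M. (cmod (f x))\<^sup>2)"

definition has_weak_gradient ::
    "(real^'n::finite) set \<Rightarrow> (real^'n \<Rightarrow> complex) \<Rightarrow> (real^'n \<Rightarrow> complex^'n) \<Rightarrow> bool" where
  "has_weak_gradient \<Omega> u G \<longleftrightarrow>
     (\<forall>i. (\<lambda>x. G x $ i) \<in> L2_space lborel \<Omega> \<and>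
       (\<forall>\<phi>. test_function \<Omega> \<phi> \<longrightarrow>
         (LINT x:\<Omega>|lborel. partial i \<phi> x *\<^sub>R u x) = - (LINT x:\<Omega>|lborel. \<phi> x *\<^sub>R G x $ i)))"

definition H1 :: "(real^'n::finite) set \<Rightarrow> (real^'n \<Rightarrow> complex) set" where
  "H1 \<Omega> = {u \<in> L2_space lborel \<Omega>. \<exists>G. has_weak_gradient \<Omega> u G}"

definition weak_gradient ::
    "(real^'n::finite) set \<Rightarrow> (real^'n \<Rightarrow> complex) \<Rightarrow> real^'n \<Rightarrow> complex^'n" where
  "weak_gradient \<Omega> u = (SOME G. has_weak_gradient \<Omega> u G)"

definition grad_inner ::
    "(real^'n::finite) set \<Rightarrow> (real^'n \<Rightarrow> complex) \<Rightarrow> (real^'n \<Rightarrow> complex) \<Rightarrow> complex" where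
  "grad_inner \<Omega> u v =
     (\<Sum>i\<in>UNIV. L2_inner lborel \<Omega> (\<lambda>x. weak_gradient \<Omega> u x $ i) (\<lambda>x. weak_gradient \<Omega> v x $ i))"

definition grad_norm :: "(real^'n::finite) set \<Rightarrow> (real^'n \<Rightarrow> complex) \<Rightarrow> real" where
  "grad_norm \<Omega> u = sqrt (\<Sum>i\<in>UNIV. (L2_norm lborel \<Omega> (\<lambda>x. weak_gradient \<Omega> u x $ i))\<^sup>2)"

definition H1_norm :: "(real^'n::finite) set \<Rightarrow> (real^'n \<Rightarrow> complex) \<Rightarrow> real" where
  "H1_norm \<Omega> u = sqrt ((L2_norm lborel \<Omega> u)\<^sup>2 + (grad_norm \<Omega> u)\<^sup>2)"

text \<open>\<open>g\<close> is a trace on \<open>S \<subseteq> frontier \<Omega>\<close> of \<open>u\<close>: the closure, in \<open>H\<^sup>1(\<Omega>) \<times> L\<^sup>2(S)\<close>, of the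
  restriction to \<open>S\<close> of those \<open>H\<^sup>1\<close>-functions which are continuous up to \<open>S\<close>. The measure \<open>M\<close> is
  the surface measure.\<close>
definition has_trace ::
    "(real^'n::finite) set \<Rightarrow> (real^'n) measure \<Rightarrow> (real^'n) set \<Rightarrow>
     (real^'n \<Rightarrow> complex) \<Rightarrow> (real^'n \<Rightarrow> complex) \<Rightarrow> bool" where
  "has_trace \<Omega> M S u g \<longleftrightarrow> u \<in> H1 \<Omega> \<and> g \<in> L2_space M S \<and>
     (\<exists>v. (\<forall>n::nat. v n \<in> H1 \<Omega> \<and> continuous_on (\<Omega> \<union> S) (v n) \<and> v n \<in> L2_space M S) \<and>
          (\<lambda>n. H1_norm \<Omega> (\<lambda>x. v n x - u x)) \<longlonglongrightarrow> 0 \<and>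
          (\<lambda>n. L2_norm M S (\<lambda>x. v n x - g x)) \<longlonglongrightarrow> 0)"

section \<open>Spectral problems with a spectral boundary condition\<close>

text \<open>The eigenspace, zero included, for the problem posed in the space \<open>W \<subseteq> H\<^sup>1(\<Omega>)\<close> with the
  spectral parameter on the boundary part \<open>S\<close>.\<close>
definition eigenspace ::
    "(real^'n::finite) set \<Rightarrow> (real^'n) measure \<Rightarrow> (real^'n) set \<Rightarrow> (real^'n \<Rightarrow> complex) set \<Rightarrow>
     complex \<Rightarrow> (real^'n \<Rightarrow> complex) set" where
  "eigenspace \<Omega> M S W \<mu> =
     {U \<in> W. \<forall>V\<in>W. \<forall>f g. has_trace \<Omega> M S U f \<longrightarrow> has_trace \<Omega> M S V g \<longrightarrow>
        grad_inner \<Omega> U V = \<mu> * L2_inner M S f g}"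

text \<open>\<open>E\<close> has complex dimension \<open>n\<close> after identifying functions equal almost everywhere in \<open>\<Omega>\<close>.\<close>
definition has_dim_ae :: "(real^'n::finite) set \<Rightarrow> (real^'n \<Rightarrow> complex) set \<Rightarrow> nat \<Rightarrow> bool" where
  "has_dim_ae \<Omega> E n \<longleftrightarrow>
     (\<exists>b. (\<forall>i<n. b i \<in> E) \<and>
        (\<forall>c. (AE x\<in>\<Omega> in lborel. (\<Sum>i<n. c i * b i x) = 0) \<longrightarrow> (\<forall>i<n. c i = 0)) \<and>
        (\<forall>u\<in>E. \<exists>c. AE x\<in>\<Omega> in lborel. u x = (\<Sum>i<n. c i * b i x)))"

text \<open>\<open>\<Lambda>\<close> lists all eigenvalues in nondecreasing order, each as often as its multiplicity (a
  \<open>\<mu>\<close> with trivial eigenspace occurs zero times). Such a list is unique if it exists.\<close>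
definition eigenvalue_sequence ::
    "(real^'n::finite) set \<Rightarrow> (real^'n) measure \<Rightarrow> (real^'n) set \<Rightarrow> (real^'n \<Rightarrow> complex) set \<Rightarrow>
     (nat \<Rightarrow> real) \<Rightarrow> bool" where
  "eigenvalue_sequence \<Omega> M S W \<Lambda> \<longleftrightarrow> mono \<Lambda> \<and>
     (\<forall>\<mu>. finite {j. complex_of_real (\<Lambda> j) = \<mu>} \<and>
          has_dim_ae \<Omega> (eigenspace \<Omega> M S W \<mu>) (card {j. complex_of_real (\<Lambda> j) = \<mu>}))"

text \<open>Eigenvalues are numbered from \<open>k = 1\<close>.\<close>
definition kth_eigenvalue ::
    "(real^'n::finite) set \<Rightarrow> (real^'n) measure \<Rightarrow> (real^'n) set \<Rightarrow> (real^'n \<Rightarrow> complex) set \<Rightarrow>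
     nat \<Rightarrow> real" where
  "kth_eigenvalue \<Omega> M S W k = (THE \<Lambda>. eigenvalue_sequence \<Omega> M S W \<Lambda>) (k - 1)"

section \<open>The periodicity cell, its free surface and the apertures\<close>

definition at_x1 :: "real \<Rightarrow> real^2 \<Rightarrow> real^3" where
  "at_x1 a y = vector [a, y $ 1, y $ 2]"

definition at_x3 :: "real \<Rightarrow> real^2 \<Rightarrow> real^3" where
  "at_x3 a y = vector [y $ 1, y $ 2, a]"

text \<open>Area on the planes \<open>x\<^sub>1 = a\<close> and \<open>x\<^sub>3 = 0\<close>.\<close>
definition area_x1 :: "real \<Rightarrow> (real^3) measure" where
  "area_x1 a = distr lborel borel (at_x1 a)"

definition area_x3 :: "(real^3) measure" where
  "area_x3 = distr lborel borel (at_x3 0)"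

text \<open>\<open>D\<close> is the ambient domain, of which the periodicity cell is the part below \<open>x\<^sub>3 = 0\<close>
  between the planes \<open>x\<^sub>1 = 0\<close> and \<open>x\<^sub>1 = 1\<close>.\<close>
definition cell :: "(real^3) set \<Rightarrow> (real^3) set" where
  "cell D = {x \<in> D. x $ 3 < 0 \<and> 0 < x $ 1 \<and> x $ 1 < 1}"

definition free_surface :: "(real^3) set \<Rightarrow> (real^3) set" where
  "free_surface D = frontier (cell D) \<inter> {x. x $ 3 = 0}"

text \<open>The point \<open>P\<close> stands for \<open>(P\<^sub>2, P\<^sub>3)\<close>.\<close>
definition aperture :: "real^2 \<Rightarrow> (real^2) set \<Rightarrow> real \<Rightarrow> real \<Rightarrow> (real^3) set" where
  "aperture P \<theta> \<epsilon> j = at_x1 j ` {y. (1 / \<epsilon>) *\<^sub>R (y - P) \<in> \<theta>}"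

locale cell_geometry =
  fixes D :: "(real^3) set" and P :: "real^2" and \<theta> :: "(real^2) set"
  assumes domain_D: "domain D" "compact (closure D)" "Lipschitz_boundary D"
    and sections: "\<And>j. j \<in> {0, 1} \<Longrightarrow>
        domain (at_x1 j -` D) \<and> simply_connected (at_x1 j -` D) \<and>
        emeasure lborel (at_x1 j -` D) > 0 \<and> at_x1 j P \<in> D"
    and P3_neg: "P $ 2 < 0"
    and domain_cell: "domain (cell D)" "bounded (cell D)"
    and free_surface_pos: "emeasure area_x3 (free_surface D) > 0"
    and domain_\<theta>: "domain \<theta>" "bounded \<theta>" "0 \<in> \<theta>" "C2_boundary \<theta>"
    and \<theta>_small: "\<And>j. j \<in> {0, 1} \<Longrightarrow>
        at_x1 j ` closure ((\<lambda>y. 2 *\<^sub>R y + P) ` \<theta>) \<subseteq> frontier (cell D)"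
    and \<theta>_below: "(SUP y\<in>\<theta>. y $ 2 + P $ 2) < 0"
    and neighbourhood_0: "\<exists>N. open N \<and> at_x1 0 ` ((\<lambda>y. y + P) ` closure \<theta>) \<subseteq> N \<and>
        N \<inter> {x. x $ 1 = 0} \<subseteq> frontier (cell D) \<and> N \<inter> {x. x $ 1 > 0} \<subseteq> cell D"
    and neighbourhood_1: "\<exists>N. open N \<and> at_x1 1 ` ((\<lambda>y. y + P) ` closure \<theta>) \<subseteq> N \<and>
        N \<inter> {x. x $ 1 = 1} \<subseteq> frontier (cell D) \<and> N \<inter> {x. x $ 1 < 1} \<subseteq> cell D"

text \<open>The cell need not itself have a Lipschitz boundary, so that the trace theorem on the free
  surface is a property to be required: every \<open>H\<^sup>1\<close>-function has a trace, the form
  \<open>(\<nabla>u, \<nabla>v) + (u, v)\<^sub>\<gamma>\<close> induces an equivalent norm (in particular traces are unique), and the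
  trace map is compact.\<close>
locale trace_properties =
  fixes \<Omega> :: "(real^'n::finite) set" and M :: "(real^'n) measure" and S :: "(real^'n) set"
  assumes trace_exists: "\<And>u. u \<in> H1 \<Omega> \<Longrightarrow> \<exists>g. has_trace \<Omega> M S u g"
    and norm_equivalence: "\<exists>c>0. \<exists>C>0. \<forall>u g. has_trace \<Omega> M S u g \<longrightarrow>
        c * H1_norm \<Omega> u \<le> sqrt ((grad_norm \<Omega> u)\<^sup>2 + (L2_norm M S g)\<^sup>2) \<and>
        sqrt ((grad_norm \<Omega> u)\<^sup>2 + (L2_norm M S g)\<^sup>2) \<le> C * H1_norm \<Omega> u"
    and trace_compact: "\<And>u g. (\<And>n::nat. has_trace \<Omega> M S (u n) (g n)) \<Longrightarrow>
        bounded (range (\<lambda>n. H1_norm \<Omega> (u n))) \<Longrightarrow>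
        \<exists>r h. strict_mono r \<and> h \<in> L2_space M S \<and>
          (\<lambda>n. L2_norm M S (\<lambda>x. g (r n) x - h x)) \<longlonglongrightarrow> 0"

definition H1_quasiperiodic ::
    "(real^3) set \<Rightarrow> real^2 \<Rightarrow> (real^2) set \<Rightarrow> real \<Rightarrow> real \<Rightarrow> (real^3 \<Rightarrow> complex) set" where
  "H1_quasiperiodic D P \<theta> \<epsilon> \<eta> =
     {u \<in> H1 (cell D). \<exists>g0 g1.
        has_trace (cell D) (area_x1 0) (aperture P \<theta> \<epsilon> 0) u g0 \<and>
        has_trace (cell D) (area_x1 1) (aperture P \<theta> \<epsilon> 1) u g1 \<and>
        (AE y in lborel. at_x1 0 y \<in> aperture P \<theta> \<epsilon> 0 \<longrightarrow>
           g0 (at_x1 0 y) = exp (- \<i> * of_real \<eta>) * g1 (at_x1 1 y))}"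

definition model_eigenvalue ::
    "(real^3) set \<Rightarrow> real^2 \<Rightarrow> (real^2) set \<Rightarrow> real \<Rightarrow> real \<Rightarrow> nat \<Rightarrow> real" where
  "model_eigenvalue D P \<theta> \<epsilon> \<eta> =
     kth_eigenvalue (cell D) area_x3 (free_surface D) (H1_quasiperiodic D P \<theta> \<epsilon> \<eta>)"

definition limit_eigenvalue :: "(real^3) set \<Rightarrow> nat \<Rightarrow> real" where
  "limit_eigenvalue D =
     kth_eigenvalue (cell D) area_x3 (free_surface D) (H1 (cell D))"

end

theory Submission
  imports Defs "HOL-Library.Function_Algebras"
begin

text \<open>The lower bound is the max-min principle, since the quasi-periodic functions form a subspace of
  \<open>H\<^sup>1\<close>. For the upper bound, limit eigenfunctions are multiplied by a function \<open>X\<close> which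
  vanishes on balls of radius \<open>a\<close>, proportional to \<open>\<epsilon>\<close>, around the two apertures and is \<open>1\<close> outside
  the balls of radius \<open>2a\<close>; the products are quasi-periodic for every \<open>\<eta>\<close> and have the same
  traces on the free surface. For a combination \<open>U\<close> of limit eigenfunctions, testing with
  \<open>X\<^sup>2 U\<close> gives \<open>|grad (X U)|\<^sup>2 = |grad U|\<^sup>2 + |U grad X|\<^sup>2\<close> after integration, so that only
  \<open>\<integral> |U|\<^sup>2 |grad X|\<^sup>2\<close> has to be bounded. Here \<open>|grad X|\<^sup>2\<close> is of order \<open>a\<^sup>-\<^sup>2\<close>, and the
  integral of \<open>|U|\<^sup>2\<close> over the balls of radius \<open>2a\<close> is of order \<open>a\<^sup>3\<close>: it suffices that
  \<open>|U|\<^sup>2\<close> is weakly subharmonic with a Neumann condition on the flat boundary near the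
  apertures, and no regularity theory for \<open>U\<close> is needed.\<close>

section \<open>Eigenvalue sequences\<close>

text \<open>The eigenvalue lists are given by a definite description, so
  \<open>kth_eigenvalue\<close> has a usable value only after a full list has been constructed in
  each space. This forces the complete spectral theory: closedness of the space in H1, compactness
  of the trace, and arbitrarily many independent boundary values. Closedness of the quasi-periodic
  space is the delicate point, because continuity of the trace is assumed on the free surface only;
  on the apertures it has to be derived from the flatness of the boundary there. What a combination
  U of limit eigenfunctions has beyond membership in H1 is that (grad U, grad v) depends on v only
  through its trace on the free surface. Hence v = X^2 U may be exchanged for U, and v = \<Psi> U
  gives zero when \<Psi> lives near an aperture. The second fact yields a mean value inequality for
  |U|^2 with centre on the boundary, in place of pointwise bounds for U. As X U and U have equal
  traces on the free surface, the denominator of the Rayleigh quotient does not change, and only the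
  energy has to be compared.\<close>

lemma homogeneous_system_nontrivial_solution:
  fixes A :: "nat \<Rightarrow> nat \<Rightarrow> 'a::field"
  assumes "m < n"
  shows "\<exists>d. (\<exists>i<n. d i \<noteq> 0) \<and> (\<forall>j<m. (\<Sum>i<n. d i * A i j) = 0)"
  using assms
proof (induction m arbitrary: n A)
  case 0
  then show ?case by (intro exI[of _ "\<lambda>_. 1"]) auto
next
  case (Suc m)
  then obtain n' where n: "n = Suc n'" "m < n'" by (cases n) auto
  show ?case
  proof (cases "\<exists>p<n. A p m \<noteq> 0")
    case False
    from Suc.IH[of n A] Suc.prems obtain d where "\<exists>i<n. d i \<noteq> 0" "\<forall>j<m. (\<Sum>i<n. d i * A i j) = 0"
      by auto
    with False show ?thesis
      by (intro exI[of _ d]) (auto simp: less_Suc_eq)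
  next
    case True
    then obtain p where p: "p < n" "A p m \<noteq> 0" by blast
    \<comment> \<open>The transposition of the pivot \<open>p\<close> and the last index: the
      unknown with a nonzero coefficient in equation \<open>m\<close> comes last, \<open>C\<close>
      is the system left after its elimination, and \<open>d'\<close> recovers it from equation
      \<open>m\<close>.\<close>
    define \<pi> where "\<pi> i = (if i = p then n' else if i = n' then p else i)" for i
    have bij: "bij_betw \<pi> {..<n} {..<n}"
      by (rule bij_betwI[where g = \<pi>]) (use p n in \<open>auto simp: \<pi>_def split: if_splits\<close>)
    define C where "C i j = A (\<pi> i) j - A (\<pi> i) m / A p m * A p j" for i j
    from Suc.IH[of n' C] n obtain d where d: "\<exists>i<n'. d i \<noteq> 0" "\<forall>j<m. (\<Sum>i<n'. d i * C i j) = 0"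
      by auto
    define d' where "d' i = (if i < n' then d i else - (\<Sum>i<n'. d i * A (\<pi> i) m) / A p m)" for i
    have \<pi>n': "\<pi> n' = p" by (auto simp: \<pi>_def)
    have eq: "(\<Sum>i<n. d' i * A (\<pi> i) j) = (\<Sum>i<n'. d i * C i j)" for j
      by (simp add: n \<pi>n' d'_def C_def algebra_simps sum_subtractf sum_distrib_left sum_distrib_right
          sum_divide_distrib)
    have "C i m = 0" for i using p by (simp add: C_def)
    then have z: "(\<Sum>i<n. d' i * A (\<pi> i) j) = 0" if "j < Suc m" for j
      using that d(2) eq[of j] by (cases "j = m") auto
    have inv: "\<pi> (\<pi> i) = i" for i by (auto simp: \<pi>_def)
    have "(\<Sum>i<n. d' (\<pi> i) * A i j) = (\<Sum>i<n. d' i * A (\<pi> i) j)" for j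
      using sum.reindex_bij_betw[OF bij, of "\<lambda>i. d' (\<pi> i) * A i j"] by (simp add: inv)
    moreover obtain i where i: "i < n'" "d i \<noteq> 0" using d by blast
    ultimately show ?thesis
    proof (intro exI[of _ "\<lambda>i. d' (\<pi> i)"] conjI)
      have "\<pi> i < n" using bij i n by (auto simp: bij_betw_def)
      moreover have "d' (\<pi> (\<pi> i)) \<noteq> 0" using i by (simp add: inv d'_def)
      ultimately show "\<exists>i<n. d' (\<pi> i) \<noteq> 0" by blast
    qed (use z in auto)
  qed
qed

lemma AE_sum_cong:
  fixes f :: "nat \<Rightarrow> 'a \<Rightarrow> complex"
  assumes "\<And>i. i < n \<Longrightarrow> AE x\<in>A in M. u i x = f i x"
  shows "AE x\<in>A in M. (\<Sum>i<n. d i * u i x) = (\<Sum>i<n. d i * f i x)"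
proof -
  have "AE x in M. \<forall>i<n. x \<in> A \<longrightarrow> u i x = f i x"
    using assms by (subst AE_all_countable) (auto simp: AE_all_countable intro!: AE_impI)
  then show ?thesis
    by eventually_elim (auto intro!: sum.cong)
qed

text \<open>Expanding \<open>n\<close> independent elements in \<open>m\<close> generators gives an
  \<open>n\<close> by \<open>m\<close> array of coefficients; for \<open>n > m\<close> some nonzero
  vector annihilates it, and the corresponding combination vanishes almost everywhere. Working with
  arrays avoids passing to classes of functions.\<close>

lemma has_dim_ae_le:
  assumes "has_dim_ae \<Omega> E n" "has_dim_ae \<Omega> E m"
  shows "n \<le> m"
proof (rule ccontr)
  assume "\<not> n \<le> m"
  then have "m < n" by simp
  obtain b where b: "\<And>i. i < n \<Longrightarrow> b i \<in> E"
      "\<And>c. (AE x\<in>\<Omega> in lborel. (\<Sum>i<n. c i * b i x) = 0) \<Longrightarrow> (\<forall>i<n. c i = 0)"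
    using assms(1) unfolding has_dim_ae_def by blast
  obtain b' where b': "\<And>u. u \<in> E \<Longrightarrow> \<exists>c. AE x\<in>\<Omega> in lborel. u x = (\<Sum>i<m. c i * b' i x)"
    using assms(2) unfolding has_dim_ae_def by blast
  have "\<forall>i. \<exists>c. i < n \<longrightarrow> (AE x\<in>\<Omega> in lborel. b i x = (\<Sum>j<m. c j * b' j x))"
    using b(1) b' by blast
  from choice[OF this] obtain A
    where A: "\<And>i. i < n \<Longrightarrow> AE x\<in>\<Omega> in lborel. b i x = (\<Sum>j<m. A i j * b' j x)"
    by blast
  from homogeneous_system_nontrivial_solution[OF \<open>m < n\<close>, of A] obtain d
    where d: "\<exists>i<n. d i \<noteq> 0" "\<forall>j<m. (\<Sum>i<n. d i * A i j) = 0" by blast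
  have "(\<Sum>i<n. d i * (\<Sum>j<m. A i j * b' j x)) = 0" for x
  proof -
    have "(\<Sum>i<n. d i * (\<Sum>j<m. A i j * b' j x)) = (\<Sum>j<m. (\<Sum>i<n. d i * A i j) * b' j x)"
      unfolding sum_distrib_left sum_distrib_right by (subst sum.swap) (simp add: mult.assoc)
    then show ?thesis using d by simp
  qed
  moreover have "AE x\<in>\<Omega> in lborel. (\<Sum>i<n. d i * b i x) = (\<Sum>i<n. d i * (\<Sum>j<m. A i j * b' j x))"
    by (rule AE_sum_cong) (rule A)
  ultimately have "AE x\<in>\<Omega> in lborel. (\<Sum>i<n. d i * b i x) = 0"
    by simp
  with b(2) d show False by blast
qed

text \<open>At the first index \<open>j\<close> where two lists differ, say
  \<open>\<Lambda> j < \<Lambda>' j\<close>, monotonicity confines the value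
  \<open>\<Lambda> j\<close> in the second list to indices below \<open>j\<close>, where both lists
  agree; the first list has it at \<open>j\<close> in addition. The two counts of the same
  multiplicity then differ.\<close>

lemma eigenvalue_sequence_unique:
  assumes "eigenvalue_sequence \<Omega> M S W \<Lambda>" "eigenvalue_sequence \<Omega> M S W \<Lambda>'"
  shows "\<Lambda> = \<Lambda>'"
proof -
  have step: "\<not> \<Lambda> j < \<Lambda>' j"
    if 1: "eigenvalue_sequence \<Omega> M S W \<Lambda>" and 2: "eigenvalue_sequence \<Omega> M S W \<Lambda>'"
      and eq: "\<And>i. i < j \<Longrightarrow> \<Lambda> i = \<Lambda>' i" for \<Lambda> \<Lambda>' j
  proof
    assume less: "\<Lambda> j < \<Lambda>' j"
    let ?\<mu> = "complex_of_real (\<Lambda> j)"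
    let ?S = "{i. complex_of_real (\<Lambda> i) = ?\<mu>}" and ?S' = "{i. complex_of_real (\<Lambda>' i) = ?\<mu>}"
    have mono: "mono \<Lambda>'" using 2 by (simp add: eigenvalue_sequence_def)
    have sub: "?S' \<subseteq> ?S - {j}"
    proof
      fix i assume "i \<in> ?S'"
      then have i: "\<Lambda>' i = \<Lambda> j" by simp
      have "i < j"
      proof (rule ccontr)
        assume "\<not> i < j"
        with monoD[OF mono, of j i] i less show False by simp
      qed
      with i eq[of i] show "i \<in> ?S - {j}" by simp
    qed
    have "finite ?S" using 1 unfolding eigenvalue_sequence_def by blast
    moreover have "?S' \<subset> ?S" using sub by blast
    ultimately have "card ?S' < card ?S" by (rule psubset_card_mono)
    moreover have "card ?S \<le> card ?S'"
      using 1 2 has_dim_ae_le unfolding eigenvalue_sequence_def by blast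
    ultimately show False by simp
  qed
  have "\<Lambda> j = \<Lambda>' j" for j
  proof (induction j rule: less_induct)
    case (less j)
    with step[OF assms, of j] step[OF assms(2,1), of j] show ?case by force
  qed
  then show ?thesis by blast
qed

text \<open>Lists are unique whatever the problem, so exhibiting one evaluates the definite
  description. The shift reconciles numbering from 1 with lists indexed from 0.\<close>

lemma kth_eigenvalue_eq:
  assumes "eigenvalue_sequence \<Omega> M S W \<Lambda>"
  shows "kth_eigenvalue \<Omega> M S W k = \<Lambda> (k - 1)"
proof -
  have "(THE \<Lambda>. eigenvalue_sequence \<Omega> M S W \<Lambda>) = \<Lambda>"
    by (intro the_equality assms) (rule eigenvalue_sequence_unique[OF _ assms])
  then show ?thesis by (simp add: kth_eigenvalue_def)
qed

section \<open>Spectral theory of a pair of hermitian forms\<close>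

text \<open>The form is only positive semidefinite, since functions differing on a null set are not
  identified, and it lives on a carrier \<open>W\<close> inside the ambient space. It is linear in
  the first and conjugate linear in the second argument; the metric statements below concern the
  seminorm \<open>sqrt (q u)\<close>.\<close>

locale hermitian_form = vector_space scale
  for scale :: "complex \<Rightarrow> 'b::ab_group_add \<Rightarrow> 'b" +
  fixes W :: "'b set" and F :: "'b \<Rightarrow> 'b \<Rightarrow> complex"
  assumes W_zero: "0 \<in> W"
    and W_add: "u \<in> W \<Longrightarrow> v \<in> W \<Longrightarrow> u + v \<in> W"
    and W_scale: "u \<in> W \<Longrightarrow> scale c u \<in> W"
    and F_add: "u \<in> W \<Longrightarrow> v \<in> W \<Longrightarrow> w \<in> W \<Longrightarrow> F (u + v) w = F u w + F v w"
    and F_scale: "u \<in> W \<Longrightarrow> w \<in> W \<Longrightarrow> F (scale c u) w = c * F u w"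
    and F_herm: "u \<in> W \<Longrightarrow> w \<in> W \<Longrightarrow> F w u = cnj (F u w)"
    and F_pos: "u \<in> W \<Longrightarrow> Re (F u u) \<ge> 0"
begin

abbreviation "q u \<equiv> Re (F u u)"

lemma W_neg: "u \<in> W \<Longrightarrow> - u \<in> W"
  using W_scale[of u "-1"] by (simp add: scale_minus_left)

lemma W_diff: "u \<in> W \<Longrightarrow> v \<in> W \<Longrightarrow> u - v \<in> W"
  using W_add[OF _ W_neg, of u v] by simp

lemma W_sum: "(\<And>i. i \<in> I \<Longrightarrow> f i \<in> W) \<Longrightarrow> sum f I \<in> W"
  by (induction I rule: infinite_finite_induct) (auto intro: W_zero W_add)

lemma F_neg: "u \<in> W \<Longrightarrow> w \<in> W \<Longrightarrow> F (- u) w = - F u w"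
  using F_scale[of u w "-1"] by (simp add: scale_minus_left)

lemma F_diff: "u \<in> W \<Longrightarrow> v \<in> W \<Longrightarrow> w \<in> W \<Longrightarrow> F (u - v) w = F u w - F v w"
  using F_add[of u "- v" w] by (simp add: W_neg F_neg)

lemma F_zero: "w \<in> W \<Longrightarrow> F 0 w = 0"
  using F_scale[of 0 w 0] W_zero by simp

lemma F_add2: "u \<in> W \<Longrightarrow> v \<in> W \<Longrightarrow> w \<in> W \<Longrightarrow> F w (u + v) = F w u + F w v"
  using F_herm[of "u + v" w] F_herm[of u w] F_herm[of v w] by (simp add: W_add F_add)

lemma F_diff2: "u \<in> W \<Longrightarrow> v \<in> W \<Longrightarrow> w \<in> W \<Longrightarrow> F w (u - v) = F w u - F w v"
  using F_herm[of "u - v" w] F_herm[of u w] F_herm[of v w] by (simp add: W_diff F_diff)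

lemma F_scale2: "u \<in> W \<Longrightarrow> w \<in> W \<Longrightarrow> F w (scale c u) = cnj c * F w u"
  using F_herm[of "scale c u" w] F_herm[of u w] by (simp add: W_scale F_scale)

lemma F_zero2: "w \<in> W \<Longrightarrow> F w 0 = 0"
  using F_scale2[of 0 w 0] W_zero by simp

lemma F_sum: "(\<And>i. i \<in> I \<Longrightarrow> f i \<in> W) \<Longrightarrow> w \<in> W \<Longrightarrow> F (\<Sum>i\<in>I. f i) w = (\<Sum>i\<in>I. F (f i) w)"
  by (induction I rule: infinite_finite_induct) (simp_all add: F_zero F_add W_sum)

lemma F_sum2: "(\<And>i. i \<in> I \<Longrightarrow> f i \<in> W) \<Longrightarrow> w \<in> W \<Longrightarrow> F w (\<Sum>i\<in>I. f i) = (\<Sum>i\<in>I. F w (f i))"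
  by (induction I rule: infinite_finite_induct) (simp_all add: F_zero2 F_add2 W_sum)

lemma F_real: "u \<in> W \<Longrightarrow> F u u = of_real (q u)"
  using F_herm[of u u] by (simp add: complex_eq_iff)

lemma q_scale: "u \<in> W \<Longrightarrow> q (scale c u) = (cmod c)\<^sup>2 * q u"
proof -
  assume u: "u \<in> W"
  have "F (scale c u) (scale c u) = c * cnj c * F u u"
    by (simp add: F_scale F_scale2 W_scale u)
  also have "c * cnj c = of_real ((cmod c)\<^sup>2)"
    using complex_norm_square[of c] by simp
  finally show ?thesis by simp
qed

lemma q_add: "u \<in> W \<Longrightarrow> v \<in> W \<Longrightarrow> q (u + v) = q u + 2 * Re (F u v) + q v"
  using F_herm[of u v] by (simp add: F_add F_add2 W_add)

lemma q_diff: "u \<in> W \<Longrightarrow> v \<in> W \<Longrightarrow> q (u - v) = q u - 2 * Re (F u v) + q v"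
  using F_herm[of u v] by (simp add: F_diff F_diff2 W_diff)

lemma parallelogram: "u \<in> W \<Longrightarrow> v \<in> W \<Longrightarrow> q (u - v) + q (u + v) = 2 * q u + 2 * q v"
  by (simp add: q_add q_diff)

text \<open>Subtracting the multiple \<open>t * F u v\<close> of \<open>v\<close> from
  \<open>u\<close> turns positivity into a real quadratic inequality in \<open>t\<close>. For
  \<open>q v > 0\<close> the choice \<open>t = 1 / q v\<close> is optimal; for
  \<open>q v = 0\<close> the inequality is affine in \<open>t\<close> and forces its slope to
  vanish.\<close>

lemma cauchy_schwarz:
  assumes "u \<in> W" "v \<in> W"
  shows "(cmod (F u v))\<^sup>2 \<le> q u * q v"
proof -
  let ?m = "(cmod (F u v))\<^sup>2"
  have *: "0 \<le> q u - 2 * t * ?m + t\<^sup>2 * ?m * q v" for t :: real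
  proof -
    let ?c = "of_real t * F u v"
    have m: "F u v * cnj (F u v) = of_real ?m"
      using complex_norm_square[of "F u v"] by simp
    have "Re (F u (scale ?c v)) = t * ?m"
      using m by (simp add: F_scale2 assms mult.assoc mult.commute[of "cnj _"])
    moreover have "q (scale ?c v) = t\<^sup>2 * ?m * q v"
      by (simp add: q_scale assms norm_mult power_mult_distrib)
    ultimately show ?thesis
      using F_pos[of "u - scale ?c v"] assms by (simp add: q_diff W_diff W_scale)
  qed
  show ?thesis
  proof (cases "q v = 0")
    case True
    have "?m = 0"
    proof (rule ccontr)
      assume "?m \<noteq> 0"
      then have "?m > 0" by simp
      with *[of "(q u + 1) / (2 * ?m)"] True show False by simp
    qed
    with True show ?thesis by simp
  next
    case False
    then have "q v > 0" using F_pos[OF assms(2)] by simp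
    with *[of "1 / q v"] show ?thesis by (simp add: field_simps power2_eq_square)
  qed
qed

lemma cauchy_schwarz_sqrt:
  assumes "u \<in> W" "v \<in> W"
  shows "cmod (F u v) \<le> sqrt (q u) * sqrt (q v)"
  using cauchy_schwarz[OF assms] by (metis norm_ge_zero real_le_rsqrt real_sqrt_mult)

lemma seminorm_triangle:
  assumes "u \<in> W" "v \<in> W"
  shows "sqrt (q (u + v)) \<le> sqrt (q u) + sqrt (q v)"
proof (rule real_le_lsqrt)
  have "Re (F u v) \<le> sqrt (q u) * sqrt (q v)"
    using cauchy_schwarz_sqrt[OF assms] complex_Re_le_cmod order_trans by blast
  then show "q (u + v) \<le> (sqrt (q u) + sqrt (q v))\<^sup>2"
    using assms by (simp add: q_add power2_sum F_pos)
qed (auto simp: assms F_pos)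

lemma q_minus_commute: "u \<in> W \<Longrightarrow> v \<in> W \<Longrightarrow> q (u - v) = q (v - u)"
  using F_herm[of u v] by (simp add: q_diff)

lemma seminorm_diff:
  assumes "u \<in> W" "v \<in> W"
  shows "\<bar>sqrt (q u) - sqrt (q v)\<bar> \<le> sqrt (q (u - v))"
  using seminorm_triangle[of "u - v" v] seminorm_triangle[of "v - u" u] assms
  by (simp add: W_diff q_minus_commute abs_le_iff)

lemma q_tendsto:
  assumes "\<And>n. u n \<in> W" "v \<in> W" "(\<lambda>n. q (u n - v)) \<longlonglongrightarrow> 0"
  shows "(\<lambda>n. q (u n)) \<longlonglongrightarrow> q v"
proof -
  have "(\<lambda>n. sqrt (q (u n)) - sqrt (q v)) \<longlonglongrightarrow> 0"
    by (rule Lim_null_comparison[OF always_eventually])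
      (use seminorm_diff[OF assms(1,2)] tendsto_real_sqrt[OF assms(3)] in auto)
  then have "(\<lambda>n. (sqrt (q (u n)))\<^sup>2) \<longlonglongrightarrow> (sqrt (q v))\<^sup>2"
    by (intro tendsto_power) (simp add: LIM_zero_iff)
  then show ?thesis by (simp add: assms F_pos)
qed

lemma F_tendsto:
  assumes "\<And>n. u n \<in> W" "v \<in> W" "w \<in> W" "(\<lambda>n. q (u n - v)) \<longlonglongrightarrow> 0"
  shows "(\<lambda>n. F (u n) w) \<longlonglongrightarrow> F v w"
proof -
  have "(\<lambda>n. F (u n) w - F v w) \<longlonglongrightarrow> 0"
  proof (rule Lim_null_comparison[OF always_eventually])
    show "\<forall>n. norm (F (u n) w - F v w) \<le> sqrt (q (u n - v)) * sqrt (q w)"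
      using cauchy_schwarz_sqrt[OF W_diff[OF assms(1,2)] assms(3)] assms by (simp add: F_diff)
    show "(\<lambda>n. sqrt (q (u n - v)) * sqrt (q w)) \<longlonglongrightarrow> 0"
      using tendsto_mult_left_zero[OF tendsto_real_sqrt[OF assms(4), simplified]] by simp
  qed
  then show ?thesis by (simp add: LIM_zero_iff)
qed

end

text \<open>The abstract setting: \<open>A\<close> stands for the Dirichlet form and
  \<open>B\<close> for the boundary form, which may vanish on a large subspace.
  \<open>complete\<close> concerns the seminorm of \<open>A + B\<close>; \<open>compact\<close> asks
  for a subsequence that is Cauchy for \<open>B\<close>, its limit being supplied by
  \<open>complete\<close>; \<open>infinite_rank\<close> keeps \<open>B\<close> nonzero on the
  \<open>B\<close>-orthogonal complement of any finite set, so that the construction of eigenvectors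
  never stops.\<close>

locale form_pair = A: hermitian_form scale W A + B: hermitian_form scale W B
  for scale :: "complex \<Rightarrow> 'b::ab_group_add \<Rightarrow> 'b" and W A B +
  assumes complete: "\<And>u. (\<And>n::nat. u n \<in> W) \<Longrightarrow>
      (\<And>e. e > 0 \<Longrightarrow> \<exists>N. \<forall>m\<ge>N. \<forall>n\<ge>N. A.q (u m - u n) + B.q (u m - u n) < e) \<Longrightarrow>
      \<exists>v\<in>W. (\<lambda>n. A.q (u n - v)) \<longlonglongrightarrow> 0 \<and> (\<lambda>n. B.q (u n - v)) \<longlonglongrightarrow> 0"
    and compact: "\<And>u K. (\<And>n::nat. u n \<in> W) \<Longrightarrow> (\<And>n. A.q (u n) + B.q (u n) \<le> K) \<Longrightarrow>
      \<exists>r::nat\<Rightarrow>nat. strict_mono r \<and>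
        (\<forall>e>0. \<exists>N. \<forall>m\<ge>N. \<forall>n\<ge>N. B.q (u (r m) - u (r n)) < e)"
    and infinite_rank: "\<And>n::nat. \<exists>w. (\<forall>i<n. w i \<in> W) \<and>
      (\<forall>c. (\<exists>i<n. c i \<noteq> 0) \<longrightarrow> B.q (\<Sum>i<n. scale (c i) (w i)) > 0)"
begin

definition orthonormal_eigen :: "nat \<Rightarrow> (nat \<Rightarrow> 'b) \<Rightarrow> (nat \<Rightarrow> real) \<Rightarrow> bool" where
  "orthonormal_eigen n e \<Lambda> \<longleftrightarrow> (\<forall>i<n. e i \<in> W) \<and>
     (\<forall>i<n. \<forall>j<n. B (e i) (e j) = (if i = j then 1 else 0)) \<and>
     (\<forall>i<n. \<forall>v\<in>W. A (e i) v = of_real (\<Lambda> i) * B (e i) v)"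

lemma B_lincomb:
  fixes n :: nat
  assumes "\<And>i. i < n \<Longrightarrow> e i \<in> W" "\<And>i j. i < n \<Longrightarrow> j < n \<Longrightarrow> B (e i) (e j) = (if i = j then 1 else 0)"
    and "j < n"
  shows "B (\<Sum>i<n. scale (c i) (e i)) (e j) = c j"
proof -
  have "B (\<Sum>i<n. scale (c i) (e i)) (e j) = (\<Sum>i<n. B (scale (c i) (e i)) (e j))"
    using assms by (intro B.F_sum) (auto intro: B.W_scale)
  also have "\<dots> = (\<Sum>i<n. if i = j then c i else 0)"
    using assms by (intro sum.cong) (auto simp: B.F_scale)
  finally show ?thesis using assms(3) by simp
qed

text \<open>These are \<open>n\<close> linear conditions on \<open>Suc n\<close> coefficients: the
  dimension count behind both the existence of a further eigenvector and the max-min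
  principle.\<close>

lemma nonzero_orthogonal:
  assumes e: "\<And>i. i < n \<Longrightarrow> e i \<in> W" and w: "\<And>i. i < Suc n \<Longrightarrow> w i \<in> W"
  shows "\<exists>c. (\<exists>i<Suc n. c i \<noteq> 0) \<and> (\<forall>j<n. B (\<Sum>i<Suc n. scale (c i) (w i)) (e j) = 0)"
proof -
  from homogeneous_system_nontrivial_solution[where m = n and n = "Suc n" and A = "\<lambda>i j. B (w i) (e j)"]
  obtain c where c: "\<exists>i<Suc n. c i \<noteq> 0" "\<forall>j<n. (\<Sum>i<Suc n. c i * B (w i) (e j)) = 0" by blast
  have "B (\<Sum>i<Suc n. scale (c i) (w i)) (e j) = (\<Sum>i<Suc n. c i * B (w i) (e j))" if "j < n" for j
    using e[OF that] w by (subst B.F_sum) (auto simp: B.F_scale B.W_scale intro!: sum.cong)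
  with c show ?thesis by metis
qed

text \<open>The direct method: the Rayleigh quotient of \<open>A\<close> by \<open>B\<close> is
  minimized on the \<open>B\<close>-orthogonal complement \<open>V\<close> of the eigenvectors found
  so far. Minimality on \<open>V\<close> is recorded in the conclusion because the comparison of
  eigenvalues uses it.\<close>

lemma next_eigenvector:
  assumes "orthonormal_eigen n e \<Lambda>"
  shows "\<exists>u \<mu>. u \<in> W \<and> (\<forall>i<n. B u (e i) = 0) \<and> B u u = 1 \<and> (\<forall>v\<in>W. A u v = of_real \<mu> * B u v) \<and>
    (\<forall>v\<in>W. (\<forall>i<n. B v (e i) = 0) \<longrightarrow> \<mu> * B.q v \<le> A.q v)"
proof -
  note e = assms[unfolded orthonormal_eigen_def]
  define V where "V = {v \<in> W. \<forall>i<n. B v (e i) = 0}"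
  have VW: "v \<in> W" if "v \<in> V" for v using that by (simp add: V_def)
  have V0: "0 \<in> V" using e by (simp add: V_def B.W_zero B.F_zero)
  have Vadd: "u + v \<in> V" if "u \<in> V" "v \<in> V" for u v
    using that e by (simp add: V_def B.W_add B.F_add)
  have Vscale: "scale c v \<in> V" if "v \<in> V" for c v
    using that e by (simp add: V_def B.W_scale B.F_scale)
  have Vdiff: "u - v \<in> V" if "u \<in> V" "v \<in> V" for u v
    using that e by (simp add: V_def B.W_diff B.F_diff)
  define R where "R = A.q ` {v \<in> V. B.q v = 1}"
  obtain w where w: "\<And>i. i < Suc n \<Longrightarrow> w i \<in> W"
     "\<And>c. (\<exists>i<Suc n. c i \<noteq> 0) \<Longrightarrow> B.q (\<Sum>i<Suc n. scale (c i) (w i)) > 0"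
    using infinite_rank[of "Suc n"] by blast
  obtain c where c: "\<exists>i<Suc n. c i \<noteq> 0" "\<forall>j<n. B (\<Sum>i<Suc n. scale (c i) (w i)) (e j) = 0"
    using nonzero_orthogonal[of n e w] e w by blast
  define v0 where "v0 = (\<Sum>i<Suc n. scale (c i) (w i))"
  have v0W: "v0 \<in> W" unfolding v0_def by (intro B.W_sum B.W_scale w) simp
  then have v0: "v0 \<in> V" using c by (simp add: V_def v0_def)
  have qv0: "B.q v0 > 0" unfolding v0_def by (rule w(2)[OF c(1)])
  have normalize: "scale (of_real (1 / sqrt (B.q v))) v \<in> V \<and>
      B.q (scale (of_real (1 / sqrt (B.q v))) v) = 1 \<and>
      A.q (scale (of_real (1 / sqrt (B.q v))) v) = A.q v / B.q v" if "v \<in> V" "B.q v > 0" for v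
    using that VW[OF that(1)] Vscale[OF that(1)]
    by (simp add: A.q_scale B.q_scale norm_divide power_divide del: of_real_divide)
  have R_ne: "R \<noteq> {}" using normalize[OF v0 qv0] by (auto simp: R_def)
  have R_bdd: "bdd_below R" by (rule bdd_belowI[of _ 0]) (auto simp: R_def intro: A.F_pos VW)
  define \<mu> where "\<mu> = Inf R"
  have min: "\<mu> * B.q v \<le> A.q v" if "v \<in> V" for v
  proof (cases "B.q v > 0")
    case True
    then have "A.q v / B.q v \<in> R" using normalize[OF that True] by (auto simp: R_def image_iff)
    then have "\<mu> \<le> A.q v / B.q v" unfolding \<mu>_def by (rule cInf_lower[OF _ R_bdd])
    then show ?thesis using True by (simp add: field_simps)
  next
    case False
    then have "B.q v = 0" using B.F_pos[OF VW[OF that]] by simp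
    then show ?thesis using A.F_pos[OF VW[OF that]] by simp
  qed
  have \<mu>0: "\<mu> \<ge> 0" unfolding \<mu>_def
    by (rule cInf_greatest[OF R_ne]) (auto simp: R_def intro: A.F_pos VW)
  have "\<exists>v. v \<in> V \<and> B.q v = 1 \<and> A.q v < \<mu> + 1 / real (Suc k)" for k
  proof -
    have "Inf R < \<mu> + 1 / real (Suc k)" by (simp add: \<mu>_def)
    from cInf_lessD[OF R_ne this] show ?thesis by (auto simp: R_def)
  qed
  then obtain u where u: "\<And>k. u k \<in> V" "\<And>k. B.q (u k) = 1" "\<And>k. A.q (u k) < \<mu> + 1 / real (Suc k)"
    by metis
  have "A.q (u k) + B.q (u k) \<le> \<mu> + 2" for k
  proof -
    have "1 / real (Suc k) \<le> 1" by simp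
    then show ?thesis using u(2,3)[of k] by linarith
  qed
  from compact[of u, OF VW[OF u(1)] this] obtain r :: "nat \<Rightarrow> nat" where r: "strict_mono r"
      "\<forall>e>0. \<exists>N. \<forall>m\<ge>N. \<forall>n\<ge>N. B.q (u (r m) - u (r n)) < e"
    by (elim exE conjE) (rule that)
  \<comment> \<open>Compactness controls only \<open>B\<close> along the minimizing sequence. The
    parallelogram law transfers this to \<open>A\<close>: the sum \<open>u i + u j\<close> lies in
    \<open>V\<close>, so its energy is at least \<open>\<mu>\<close> times its squared
    \<open>B\<close>-seminorm, which leaves little energy for the difference.\<close>
  have Adiff: "A.q (u i - u j) \<le> 2 / real (Suc i) + 2 / real (Suc j) + \<mu> * B.q (u i - u j)" for i j
  proof -
    have "A.q (u i - u j) + A.q (u i + u j) = 2 * A.q (u i) + 2 * A.q (u j)"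
      using VW[OF u(1)] by (intro A.parallelogram)
    moreover have "B.q (u i - u j) + B.q (u i + u j) = 4"
      using B.parallelogram[OF VW[OF u(1)[of i]] VW[OF u(1)[of j]]] u(2) by simp
    moreover have "\<mu> * B.q (u i + u j) \<le> A.q (u i + u j)"
      by (intro min Vadd u(1))
    moreover have "2 * A.q (u i) + 2 * A.q (u j) \<le> 4 * \<mu> + 2 / real (Suc i) + 2 / real (Suc j)"
      using u(3)[of i] u(3)[of j] by simp
    moreover have "\<mu> * B.q (u i + u j) = 4 * \<mu> - \<mu> * B.q (u i - u j)"
      unfolding eq_diff_eq[THEN iffD2, OF add.commute[THEN trans, OF calculation(2)]] by (simp add: algebra_simps)
    ultimately show ?thesis by linarith
  qed
  have "\<exists>N. \<forall>m\<ge>N. \<forall>n\<ge>N. A.q (u (r m) - u (r n)) + B.q (u (r m) - u (r n)) < \<delta>" if "\<delta> > 0" for \<delta>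
  proof -
    obtain N1 where N1: "\<And>m n. m \<ge> N1 \<Longrightarrow> n \<ge> N1 \<Longrightarrow> B.q (u (r m) - u (r n)) < \<delta> / (4 * (\<mu> + 1))"
      using r(2)[rule_format, of "\<delta> / (4 * (\<mu> + 1))"] \<open>\<delta> > 0\<close> \<mu>0 by auto
    obtain N2 where N2: "1 / real (Suc N2) < \<delta> / 8"
      using nat_approx_posE[of "\<delta> / 8"] \<open>\<delta> > 0\<close> by auto
    show ?thesis
    proof (intro exI[of _ "max N1 N2"] allI impI)
      fix m n assume mn: "max N1 N2 \<le> m" "max N1 N2 \<le> n"
      have inv: "1 / real (Suc (r k)) < \<delta> / 8" if "max N1 N2 \<le> k" for k
      proof -
        have "Suc N2 \<le> Suc (r k)" using that seq_suble[OF r(1), of k] by simp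
        then have "1 / real (Suc (r k)) \<le> 1 / real (Suc N2)" by (simp add: frac_le)
        then show ?thesis using N2 by linarith
      qed
      have "(\<mu> + 1) * B.q (u (r m) - u (r n)) < (\<mu> + 1) * (\<delta> / (4 * (\<mu> + 1)))"
        using N1[of m n] mn \<mu>0 by (intro mult_strict_left_mono) auto
      also have "\<dots> = \<delta> / 4" using \<mu>0 by (simp add: field_simps)
      finally have "\<mu> * B.q (u (r m) - u (r n)) + B.q (u (r m) - u (r n)) < \<delta> / 4"
        by (simp add: algebra_simps)
      then show "A.q (u (r m) - u (r n)) + B.q (u (r m) - u (r n)) < \<delta>"
        using Adiff[of "r m" "r n"] inv[OF mn(1)] inv[OF mn(2)] \<open>\<delta> > 0\<close> by linarith
    qed
  qed
  with complete[of "u \<circ> r"] VW[OF u(1)] obtain v where v: "v \<in> W"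
     "(\<lambda>n. A.q (u (r n) - v)) \<longlonglongrightarrow> 0" "(\<lambda>n. B.q (u (r n) - v)) \<longlonglongrightarrow> 0"
    by auto
  note urW = VW[OF u(1)]
  have "B v (e i) = 0" if "i < n" for i
  proof -
    have "(\<lambda>k. B (u (r k)) (e i)) \<longlonglongrightarrow> B v (e i)"
      using e that by (intro B.F_tendsto urW v) auto
    moreover have "B (u (r k)) (e i) = 0" for k using u(1) that by (simp add: V_def)
    ultimately show ?thesis by (simp add: LIMSEQ_const_iff)
  qed
  then have vV: "v \<in> V" using v by (simp add: V_def)
  have "(\<lambda>k. B.q (u (r k))) \<longlonglongrightarrow> B.q v" by (intro B.q_tendsto urW v)
  then have Bv: "B.q v = 1" by (simp add: u(2) LIMSEQ_const_iff)
  have "(\<lambda>k. A.q (u (r k))) \<longlonglongrightarrow> A.q v" by (intro A.q_tendsto urW v)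
  moreover have "(\<lambda>k. \<mu> + 1 / real (Suc (r k))) \<longlonglongrightarrow> \<mu> + 0"
  proof (intro tendsto_add tendsto_const)
    show "(\<lambda>k. 1 / real (Suc (r k))) \<longlonglongrightarrow> 0"
      using LIMSEQ_subseq_LIMSEQ[OF LIMSEQ_inverse_real_of_nat r(1)]
      by (simp only: o_def inverse_eq_divide)
  qed
  moreover have "\<exists>N. \<forall>k\<ge>N. A.q (u (r k)) \<le> \<mu> + 1 / real (Suc (r k))"
    using u(3) less_imp_le by blast
  ultimately have "A.q v \<le> \<mu> + 0" by (rule LIMSEQ_le)
  then have Av: "A.q v = \<mu>" using min[OF vV] Bv by simp
  \<comment> \<open>The Euler equation without differentiation: by minimality
    \<open>A - \<mu> B\<close> is positive semidefinite on \<open>V\<close>, and it vanishes at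
    \<open>(v, v)\<close>, so Cauchy-Schwarz makes it vanish at \<open>(v, x)\<close> for all
    \<open>x\<close> in \<open>V\<close>.\<close>
  define G where "G x y = A x y - of_real \<mu> * B x y" for x y
  interpret G: hermitian_form scale V G
  proof
    fix u v w c assume uv: "u \<in> V" "v \<in> V"
    show "G v u = cnj (G u v)"
      using A.F_herm[of u v] B.F_herm[of u v] uv by (simp add: G_def VW)
    show "w \<in> V \<Longrightarrow> G (u + v) w = G u w + G v w"
      using uv by (simp add: G_def A.F_add B.F_add VW algebra_simps)
  next
    fix u assume "u \<in> V" then show "0 \<le> Re (G u u)" using min[of u] by (simp add: G_def)
  qed (auto intro: V0 Vadd Vscale simp: G_def A.F_scale B.F_scale VW algebra_simps)
  have "Re (G v v) = 0" by (simp add: G_def Av Bv)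
  then have Gz: "G v x = 0" if "x \<in> V" for x
    using G.cauchy_schwarz[OF vV that] by simp
  have eig: "A v x = of_real \<mu> * B v x" if x: "x \<in> W" for x
  proof -
    \<comment> \<open>A general \<open>x\<close> is reduced to \<open>V\<close> by removing its
      \<open>B\<close>-projection onto the old eigenvectors. For these,
      \<open>B\<close>-orthogonality of \<open>v\<close> entails \<open>A\<close>-orthogonality, so
      the removed part contributes zero on both sides.\<close>
    define p where "p = (\<Sum>i<n. scale (B x (e i)) (e i))"
    have pW: "p \<in> W" unfolding p_def using e by (intro B.W_sum B.W_scale) auto
    have "B p (e j) = B x (e j)" if "j < n" for j
      unfolding p_def using e that by (intro B_lincomb) auto
    then have "x - p \<in> V" using x pW e by (simp add: V_def B.W_diff B.F_diff)
    from Gz[OF this] have 1: "A v x - A v p = of_real \<mu> * (B v x - B v p)"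
      using x pW v by (simp add: G_def A.F_diff2 B.F_diff2)
    have Bz: "B v (e i) = 0" if "i < n" for i using vV that by (simp add: V_def)
    have Az: "A v (e i) = 0" if "i < n" for i
    proof -
      have "A (e i) v = of_real (\<Lambda> i) * B (e i) v" using e that v by blast
      also have "B (e i) v = 0" using Bz[OF that] B.F_herm[of v "e i"] e that v by simp
      finally show ?thesis using A.F_herm[of "e i" v] e that v by simp
    qed
    have "A v p = 0" "B v p = 0" unfolding p_def using e v(1) Az Bz
      by (subst A.F_sum2 B.F_sum2; simp add: A.F_scale2 B.F_scale2 A.W_scale)+
    with 1 show ?thesis by (simp add: algebra_simps)
  qed
  have "B v v = 1" using B.F_real[OF v(1)] Bv by simp
  then show ?thesis using v vV eig min by (intro exI[of _ v] exI[of _ \<mu>]) (auto simp: V_def)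
qed

text \<open>The minimality clause stands in for completeness of the system: together with
  unboundedness of the eigenvalues it shows that \<open>B\<close> vanishes on whatever is orthogonal
  to all \<open>e i\<close>. It also implies that \<open>\<Lambda>\<close> is monotone.\<close>

definition spectral_basis :: "(nat \<Rightarrow> 'b) \<Rightarrow> (nat \<Rightarrow> real) \<Rightarrow> bool" where
  "spectral_basis e \<Lambda> \<longleftrightarrow> (\<forall>n. e n \<in> W) \<and> (\<forall>i j. B (e i) (e j) = (if i = j then 1 else 0)) \<and>
     (\<forall>n. \<forall>v\<in>W. A (e n) v = of_real (\<Lambda> n) * B (e n) v) \<and>
     (\<forall>n. \<forall>v\<in>W. (\<forall>i<n. B v (e i) = 0) \<longrightarrow> \<Lambda> n * B.q v \<le> A.q v)"

lemma spectral_basis_exists: "\<exists>e \<Lambda>. spectral_basis e \<Lambda>"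
proof -
  \<comment> \<open>A pair of eigenvector and eigenvalue admissible at stage \<open>n\<close>.
    Orthogonality is recorded towards earlier members only; the other half follows from the
    hermitian symmetry of \<open>B\<close>.\<close>
  define P where "P f n p \<longleftrightarrow> fst p \<in> W \<and> (\<forall>i<n. B (fst p) (fst (f i)) = 0) \<and> B (fst p) (fst p) = 1 \<and>
     (\<forall>v\<in>W. A (fst p) v = of_real (snd p) * B (fst p) v) \<and>
    (\<forall>v\<in>W. (\<forall>i<n. B v (fst (f i)) = 0) \<longrightarrow> snd p * B.q v \<le> A.q v)"
    for f :: "nat \<Rightarrow> 'b \<times> real" and n p
  have "\<exists>f. \<forall>n. P f n (f n)"
  proof (rule dependent_wellorder_choice)
    fix r and f g :: "nat \<Rightarrow> 'b \<times> real" and n assume "\<And>y. y < n \<Longrightarrow> f y = g y"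
    then show "P f n r = P g n r" by (simp add: P_def)
  next
    fix n and f :: "nat \<Rightarrow> 'b \<times> real" assume f: "\<And>y. y < n \<Longrightarrow> P f y (f y)"
    have "orthonormal_eigen n (fst \<circ> f) (snd \<circ> f)"
      unfolding orthonormal_eigen_def
    proof (intro conjI allI impI ballI)
      fix i j assume ij: "i < n" "j < n"
      consider "i < j" | "i = j" | "j < i" by linarith
      then show "B ((fst \<circ> f) i) ((fst \<circ> f) j) = (if i = j then 1 else 0)"
      proof cases
        case 1
        then show ?thesis using f[OF ij(1)] f[OF ij(2)] B.F_herm[of "fst (f j)" "fst (f i)"]
          by (simp add: P_def)
      qed (use f[OF ij(1)] f[OF ij(2)] in \<open>auto simp: P_def\<close>)
    qed (use f in \<open>auto simp: P_def\<close>)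
    from next_eigenvector[OF this] obtain u \<mu> where "P f n (u, \<mu>)"
      by (auto simp: P_def)
    then show "\<exists>r. P f n r" by blast
  qed
  then obtain f where f: "\<And>n. P f n (f n)" by blast
  have "spectral_basis (fst \<circ> f) (snd \<circ> f)"
    unfolding spectral_basis_def
  proof (intro conjI allI)
    fix i j :: nat
    consider "i < j" | "i = j" | "j < i" by linarith
    then show "B ((fst \<circ> f) i) ((fst \<circ> f) j) = (if i = j then 1 else 0)"
    proof cases
      case 1
      then show ?thesis using f[of i] f[of j] B.F_herm[of "fst (f j)" "fst (f i)"]
        by (simp add: P_def)
    qed (use f[of i] f[of j] in \<open>auto simp: P_def\<close>)
  qed (use f in \<open>auto simp: P_def\<close>)
  then show ?thesis by blast
qed

context
  fixes e \<Lambda> assumes basis: "spectral_basis e \<Lambda>"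
begin

lemma e_in_W: "e n \<in> W"
  and e_orthonormal: "B (e i) (e j) = (if i = j then 1 else 0)"
  and e_eigen: "v \<in> W \<Longrightarrow> A (e n) v = of_real (\<Lambda> n) * B (e n) v"
  and e_minimal: "v \<in> W \<Longrightarrow> (\<And>i. i < n \<Longrightarrow> B v (e i) = 0) \<Longrightarrow> \<Lambda> n * B.q v \<le> A.q v"
  using basis by (auto simp: spectral_basis_def)

lemma A_e: "A.q (e n) = \<Lambda> n"
  using e_eigen[OF e_in_W[of n], of n] e_orthonormal[of n n] by simp

lemma lambda_nonneg: "\<Lambda> n \<ge> 0"
  using A.F_pos[OF e_in_W[of n]] A_e[of n] by simp

lemma lambda_mono: "mono \<Lambda>"
proof (rule incseq_SucI)
  fix n
  show "\<Lambda> n \<le> \<Lambda> (Suc n)"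
    using e_minimal[OF e_in_W, of n "Suc n"] e_orthonormal A_e[of "Suc n"] by simp
qed

lemma q_e_diff: "i \<noteq> j \<Longrightarrow> B.q (e i - e j) = 2"
  using B.q_diff[OF e_in_W e_in_W, of i j] e_orthonormal by simp

text \<open>Bounded eigenvalues would bound the orthonormal \<open>e n\<close> in the seminorm of
  \<open>A + B\<close>, and compactness would give a \<open>B\<close>-Cauchy subsequence; but
  distinct members have squared distance 2.\<close>

lemma lambda_unbounded: "\<exists>n. \<Lambda> n > K"
proof (rule ccontr)
  assume "\<not> ?thesis"
  then have "A.q (e n) + B.q (e n) \<le> K + 1" for n
    using A_e[of n] e_orthonormal[of n n] by (simp add: not_less)
  from compact[of e, OF e_in_W this] obtain r :: "nat \<Rightarrow> nat" where r: "strict_mono r"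
    "\<forall>\<delta>>0. \<exists>N. \<forall>m\<ge>N. \<forall>n\<ge>N. B.q (e (r m) - e (r n)) < \<delta>"
    by (elim exE conjE) (rule that)
  obtain N where N: "\<forall>m\<ge>N. \<forall>n\<ge>N. B.q (e (r m) - e (r n)) < 1"
    using r(2) zero_less_one by blast
  have "B.q (e (r N) - e (r (Suc N))) < 1" by (rule N[rule_format]) simp_all
  moreover have "r N \<noteq> r (Suc N)" using r(1) by (simp add: strict_mono_eq)
  ultimately show False by (simp add: q_e_diff)
qed

lemma finite_level: "finite {j. \<Lambda> j \<le> K}"
proof -
  obtain n where "\<Lambda> n > K" using lambda_unbounded by blast
  then have "j < n" if "\<Lambda> j \<le> K" for j
    using monoD[OF lambda_mono, of n j] that by (cases "j < n") auto
  then have "{j. \<Lambda> j \<le> K} \<subseteq> {..<n}" by blast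
  then show ?thesis by (rule finite_subset) simp
qed

text \<open>Such a \<open>u\<close> is admissible in the minimality clause for every
  \<open>n\<close>, so \<open>\<Lambda> n * B.q u\<close> stays below the energy of \<open>u\<close>
  while \<open>\<Lambda> n\<close> is unbounded.\<close>

lemma B_zeroI:
  assumes "u \<in> W" "\<And>i. B u (e i) = 0"
  shows "B.q u = 0"
proof (rule ccontr)
  assume "B.q u \<noteq> 0"
  then have "B.q u > 0" using B.F_pos[OF assms(1)] by simp
  obtain n where "\<Lambda> n > A.q u / B.q u" using lambda_unbounded by blast
  then have "A.q u < \<Lambda> n * B.q u" using \<open>B.q u > 0\<close> by (simp add: field_simps)
  with e_minimal[OF assms(1), of n] assms(2) show False by simp
qed

text \<open>The remainder \<open>p\<close> solves the same eigenvalue equation. It is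
  \<open>B\<close>-orthogonal to \<open>e i\<close> for \<open>i\<close> in \<open>J\<close> by
  construction, and otherwise because eigenvectors to different eigenvalues are orthogonal; so
  \<open>B\<close> vanishes at \<open>p\<close>, and then the equation makes its energy vanish. Here
  \<open>\<mu>\<close> is any complex number: for a value off the list \<open>J\<close> is empty and
  every eigenvector is null for both forms.\<close>

lemma eigenvector_expansion:
  assumes u: "u \<in> W" "\<And>v. v \<in> W \<Longrightarrow> A u v = \<mu> * B u v"
    and J: "finite J" "J = {j. of_real (\<Lambda> j) = \<mu>}"
  defines "p \<equiv> u - (\<Sum>j\<in>J. scale (B u (e j)) (e j))"
  shows "p \<in> W" "A.q p = 0" "B.q p = 0"
proof -
  have sW: "(\<Sum>j\<in>J. scale (B u (e j)) (e j)) \<in> W"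
    by (intro A.W_sum A.W_scale e_in_W)
  show pW: "p \<in> W" unfolding p_def by (intro A.W_diff u sW)
  have Ap: "A p v = \<mu> * B p v" if v: "v \<in> W" for v
  proof -
    have "A (\<Sum>j\<in>J. scale (B u (e j)) (e j)) v = (\<Sum>j\<in>J. B u (e j) * A (e j) v)"
      using v by (subst A.F_sum) (auto simp: A.W_scale A.F_scale e_in_W)
    also have "\<dots> = (\<Sum>j\<in>J. \<mu> * (B u (e j) * B (e j) v))"
      using v J(2) by (intro sum.cong) (auto simp: e_eigen)
    also have "\<dots> = \<mu> * B (\<Sum>j\<in>J. scale (B u (e j)) (e j)) v"
      using v by (subst B.F_sum) (auto simp: A.W_scale B.F_scale e_in_W sum_distrib_left)
    finally show ?thesis
      unfolding p_def using u v sW by (simp add: A.F_diff B.F_diff algebra_simps)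
  qed
  have "B p (e i) = 0" for i
  proof -
    have "B (\<Sum>j\<in>J. scale (B u (e j)) (e j)) (e i) = (\<Sum>j\<in>J. B u (e j) * B (e j) (e i))"
      by (subst B.F_sum) (auto simp: A.W_scale B.F_scale e_in_W)
    also have "\<dots> = (if i \<in> J then B u (e i) else 0)"
      using J(1) by (simp add: e_orthonormal if_distrib cong: if_cong)
    finally have 1: "B p (e i) = B u (e i) - (if i \<in> J then B u (e i) else 0)"
      unfolding p_def using u sW by (simp add: B.F_diff e_in_W)
    show ?thesis
    proof (cases "i \<in> J")
      case False
      have "A u (e i) = cnj (A (e i) u)" using A.F_herm[of "e i" u] u e_in_W by simp
      also have "\<dots> = of_real (\<Lambda> i) * B u (e i)"
        using e_eigen[OF u(1), of i] B.F_herm[of "e i" u] u e_in_W by simp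
      finally have "of_real (\<Lambda> i) * B u (e i) = \<mu> * B u (e i)"
        unfolding u(2)[OF e_in_W, of i] by (rule sym)
      then have "B u (e i) = 0 \<or> of_real (\<Lambda> i) = \<mu>" using mult_right_cancel by blast
      with False J(2) 1 show ?thesis by auto
    qed (use 1 in simp)
  qed
  then show Bp: "B.q p = 0" by (intro B_zeroI pW)
  have "B p p = 0" using B.F_real[OF pW] Bp by simp
  then show "A.q p = 0" using Ap[OF pW] by simp
qed

text \<open>The Courant-Fischer bound: among the combinations of \<open>n + 1\<close> trial vectors
  a nontrivial one is \<open>B\<close>-orthogonal to the first \<open>n\<close> eigenvectors. Its
  Rayleigh quotient is at least \<open>\<Lambda> n\<close> by minimality and at most
  \<open>L\<close> by assumption; \<open>pos\<close> allows division by its squared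
  \<open>B\<close>-seminorm.\<close>

lemma lambda_le_max:
  assumes w: "\<And>i. i \<le> n \<Longrightarrow> w i \<in> W"
    and pos: "\<And>c. (\<exists>i<Suc n. c i \<noteq> 0) \<Longrightarrow> B.q (\<Sum>i<Suc n. scale (c i) (w i)) > 0"
    and le: "\<And>c. A.q (\<Sum>i<Suc n. scale (c i) (w i)) \<le> L * B.q (\<Sum>i<Suc n. scale (c i) (w i))"
  shows "\<Lambda> n \<le> L"
proof -
  obtain c where c: "\<exists>i<Suc n. c i \<noteq> 0" "\<forall>j<n. B (\<Sum>i<Suc n. scale (c i) (w i)) (e j) = 0"
    using nonzero_orthogonal[of n e w] e_in_W w by auto
  let ?u = "\<Sum>i<Suc n. scale (c i) (w i)"
  have "?u \<in> W" by (intro A.W_sum A.W_scale w) simp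
  then have "\<Lambda> n * B.q ?u \<le> A.q ?u" using c(2) by (intro e_minimal) auto
  also have "\<dots> \<le> L * B.q ?u" by (rule le)
  finally show ?thesis using pos[OF c(1)] by simp
qed

lemma q_lincomb:
  assumes "finite I"
  shows "B.q (\<Sum>i\<in>I. scale (c i) (e i)) = (\<Sum>i\<in>I. (cmod (c i))\<^sup>2)"
    and "A.q (\<Sum>i\<in>I. scale (c i) (e i)) = (\<Sum>i\<in>I. \<Lambda> i * (cmod (c i))\<^sup>2)"
proof -
  let ?u = "\<Sum>i\<in>I. scale (c i) (e i)"
  have uW: "?u \<in> W" by (intro A.W_sum A.W_scale e_in_W)
  have Bu: "B (e i) ?u = cnj (c i)" if "i \<in> I" for i
    using assms that
    by (subst B.F_sum2) (simp_all add: A.W_scale B.F_scale2 e_in_W e_orthonormal if_distrib cong: if_cong)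
  have cc: "Re (c i * cnj (c i)) = (cmod (c i))\<^sup>2" for i
    by (metis Re_complex_of_real complex_norm_square)
  have "B ?u ?u = (\<Sum>i\<in>I. c i * cnj (c i))"
    using uW by (subst B.F_sum) (simp_all add: A.W_scale B.F_scale e_in_W Bu)
  then show "B.q ?u = (\<Sum>i\<in>I. (cmod (c i))\<^sup>2)" by (simp only: Re_sum cc)
  have "A ?u ?u = (\<Sum>i\<in>I. of_real (\<Lambda> i) * (c i * cnj (c i)))"
    using uW by (subst A.F_sum) (simp_all add: A.W_scale A.F_scale e_in_W Bu e_eigen mult.left_commute)
  moreover have "Re (of_real (\<Lambda> i) * (c i * cnj (c i))) = \<Lambda> i * (cmod (c i))\<^sup>2" for i
    by (simp only: Re_complex_of_real Im_complex_of_real times_complex.sel(1) cc mult_zero_left diff_zero cc[unfolded times_complex.sel(1)])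
  ultimately show "A.q ?u = (\<Sum>i\<in>I. \<Lambda> i * (cmod (c i))\<^sup>2)"
    by (simp only: Re_sum)
qed

end

end

section \<open>The space \<open>L\<^sup>2\<close>\<close>

definition cscale :: "complex \<Rightarrow> ('a \<Rightarrow> complex) \<Rightarrow> 'a \<Rightarrow> complex" where
  "cscale c f = (\<lambda>x. c * f x)"

lemma cscale_apply [simp]: "cscale c f x = c * f x"
  by (simp add: cscale_def)

lemma vector_space_cscale: "vector_space cscale"
  by unfold_locales (auto simp: fun_eq_iff algebra_simps)

lemma sum_fun_apply: "(\<Sum>i\<in>I. f i) x = (\<Sum>i\<in>I. f i x)" for f :: "'i \<Rightarrow> 'a \<Rightarrow> complex"
  by (induction I rule: infinite_finite_induct) auto

lemma L2_space_iff:
  "f \<in> L2_space M A \<longleftrightarrow> (\<lambda>x. indicator A x *\<^sub>R f x) \<in> borel_measurable M \<and>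
     integrable M (\<lambda>x. (cmod (indicator A x *\<^sub>R f x))\<^sup>2)"
proof -
  have "indicator A x *\<^sub>R (cmod (f x))\<^sup>2 = (cmod (indicator A x *\<^sub>R f x))\<^sup>2" for x
    by (simp add: indicator_def)
  then show ?thesis
    by (simp only: L2_space_def set_borel_measurable_def set_integrable_def mem_Collect_eq)
qed

lemma L2_measurable: "f \<in> L2_space M A \<Longrightarrow> (\<lambda>x. indicator A x *\<^sub>R f x) \<in> borel_measurable M"
  and L2_integrable: "f \<in> L2_space M A \<Longrightarrow> integrable M (\<lambda>x. (cmod (indicator A x *\<^sub>R f x))\<^sup>2)"
  by (auto simp: L2_space_iff)

lemma cmod_mult_le: "cmod (a * b) \<le> (cmod a)\<^sup>2 + (cmod b)\<^sup>2"
  using sum_squares_bound[of "cmod a" "cmod b"] mult_nonneg_nonneg[OF norm_ge_zero[of a] norm_ge_zero[of b]]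
  unfolding norm_mult by linarith

lemma borel_measurable_cnj [measurable (raw)]:
  "f \<in> borel_measurable M \<Longrightarrow> (\<lambda>x. cnj (f x)) \<in> borel_measurable M"
  by (rule measurable_compose[of f M borel]) (auto intro!: borel_measurable_continuous_onI continuous_intros)

lemma integrable_mult_square:
  fixes f g :: "'a \<Rightarrow> complex"
  assumes "f \<in> borel_measurable M" "integrable M (\<lambda>x. (cmod (f x))\<^sup>2)"
    "g \<in> borel_measurable M" "integrable M (\<lambda>x. (cmod (g x))\<^sup>2)"
  shows "integrable M (\<lambda>x. f x * g x)"
  by (rule Bochner_Integration.integrable_bound[OF Bochner_Integration.integrable_add[OF assms(2,4)]])
    (use assms cmod_mult_le in \<open>auto intro!: AE_I2 simp: norm_mult abs_of_nonneg\<close>)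

lemma L2_inner_integrable:
  assumes "f \<in> L2_space M A" "g \<in> L2_space M A"
  shows "set_integrable M A (\<lambda>x. f x * cnj (g x))"
proof -
  have "integrable M (\<lambda>x. (indicator A x *\<^sub>R f x) * cnj (indicator A x *\<^sub>R g x))"
    using assms by (intro integrable_mult_square borel_measurable_cnj)
      (auto simp: L2_space_iff simp del: complex_cnj_scaleR)
  moreover have "(indicator A x *\<^sub>R f x) * cnj (indicator A x *\<^sub>R g x) = indicator A x *\<^sub>R (f x * cnj (g x))" for x
    by (simp add: indicator_def)
  ultimately show ?thesis by (simp only: set_integrable_def)
qed

lemma L2_add:
  assumes "f \<in> L2_space M A" "g \<in> L2_space M A"
  shows "(\<lambda>x. f x + g x) \<in> L2_space M A"
proof -
  have m: "(\<lambda>x. indicator A x *\<^sub>R (f x + g x)) \<in> borel_measurable M"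
    using borel_measurable_add[OF L2_measurable[OF assms(1)] L2_measurable[OF assms(2)]]
    by (simp add: scaleR_add_right)
  have "(cmod (indicator A x *\<^sub>R (f x + g x)))\<^sup>2 \<le>
      2 * (cmod (indicator A x *\<^sub>R f x))\<^sup>2 + 2 * (cmod (indicator A x *\<^sub>R g x))\<^sup>2" for x
  proof -
    have "(cmod (f x + g x))\<^sup>2 \<le> (cmod (f x) + cmod (g x))\<^sup>2"
      by (intro power_mono norm_triangle_ineq) simp
    also have "\<dots> \<le> 2 * (cmod (f x))\<^sup>2 + 2 * (cmod (g x))\<^sup>2"
      using sum_squares_bound[of "cmod (f x)" "cmod (g x)"] by (simp add: power2_sum)
    finally show ?thesis by (auto simp: indicator_def)
  qed
  then have "integrable M (\<lambda>x. (cmod (indicator A x *\<^sub>R (f x + g x)))\<^sup>2)"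
    by (intro Bochner_Integration.integrable_bound[OF Bochner_Integration.integrable_add[OF
          integrable_mult_right[OF L2_integrable[OF assms(1)], of 2]
          integrable_mult_right[OF L2_integrable[OF assms(2)], of 2]]])
      (use m in \<open>auto intro!: AE_I2 simp: abs_of_nonneg simp del: norm_scaleR\<close>)
  with m show ?thesis by (simp add: L2_space_iff)
qed

lemma L2_cmult:
  assumes "f \<in> L2_space M A"
  shows "(\<lambda>x. c * f x) \<in> L2_space M A"
proof -
  have e: "indicator A x *\<^sub>R (c * f x) = c * (indicator A x *\<^sub>R f x)" for x
    by simp
  have "(\<lambda>x. c * (indicator A x *\<^sub>R f x)) \<in> borel_measurable M"
    by (intro borel_measurable_times borel_measurable_const L2_measurable assms)
  moreover have "integrable M (\<lambda>x. (cmod c)\<^sup>2 * (cmod (indicator A x *\<^sub>R f x))\<^sup>2)"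
    by (intro integrable_mult_right L2_integrable assms)
  ultimately show ?thesis
    by (simp only: L2_space_iff e norm_mult power_mult_distrib)
qed

lemma L2_cnj: "f \<in> L2_space M A \<Longrightarrow> (\<lambda>x. cnj (f x)) \<in> L2_space M A"
proof -
  assume f: "f \<in> L2_space M A"
  have e: "indicator A x *\<^sub>R (cnj (f x)) = cnj (indicator A x *\<^sub>R f x)" for x by simp
  show ?thesis
    unfolding L2_space_iff e complex_mod_cnj
    using f by (auto simp: L2_space_iff simp del: complex_cnj_scaleR intro!: borel_measurable_cnj)
qed

lemma L2_zero: "(\<lambda>x. 0) \<in> L2_space M A"
  by (simp add: L2_space_iff)

lemma L2_bounded_mult:
  assumes "f \<in> L2_space M A" "set_borel_measurable M A h" "\<And>x. x \<in> A \<Longrightarrow> cmod (h x) \<le> C"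
  shows "(\<lambda>x. h x * f x) \<in> L2_space M A"
proof -
  have e: "indicator A x *\<^sub>R (h x * f x) = (indicator A x *\<^sub>R h x) * (indicator A x *\<^sub>R f x)" for x
    by (simp add: indicator_def)
  have m: "(\<lambda>x. indicator A x *\<^sub>R (h x * f x)) \<in> borel_measurable M"
    unfolding e using assms(2) L2_measurable[OF assms(1)]
    by (intro borel_measurable_times) (auto simp: set_borel_measurable_def)
  have "(cmod (indicator A x *\<^sub>R (h x * f x)))\<^sup>2 \<le> C\<^sup>2 * (cmod (indicator A x *\<^sub>R f x))\<^sup>2" for x
  proof (cases "x \<in> A")
    case True
    then have "(cmod (h x) * cmod (f x))\<^sup>2 \<le> (C * cmod (f x))\<^sup>2"
      by (intro power_mono mult_right_mono assms) auto
    with True show ?thesis by (simp add: norm_mult power_mult_distrib)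
  qed simp
  then have "integrable M (\<lambda>x. (cmod (indicator A x *\<^sub>R (h x * f x)))\<^sup>2)"
    by (intro Bochner_Integration.integrable_bound[OF integrable_mult_right[OF L2_integrable[OF assms(1)], of "C\<^sup>2"]])
      (use m in \<open>auto intro!: AE_I2 simp: abs_of_nonneg simp del: norm_scaleR\<close>)
  with m show ?thesis by (simp add: L2_space_iff)
qed

lemma L2_norm_eq: "L2_norm M A f = sqrt (LINT x|M. (cmod (indicator A x *\<^sub>R f x))\<^sup>2)"
proof -
  have "indicator A x *\<^sub>R (cmod (f x))\<^sup>2 = (cmod (indicator A x *\<^sub>R f x))\<^sup>2" for x
    by (simp add: indicator_def)
  then show ?thesis by (simp only: L2_norm_def set_lebesgue_integral_def)
qed

lemma L2_norm_nonneg [simp]: "0 \<le> L2_norm M A f"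
  by (simp add: L2_norm_eq)

lemma L2_norm_power2: "(L2_norm M A f)\<^sup>2 = (LINT x:A|M. (cmod (f x))\<^sup>2)"
  by (simp add: L2_norm_def set_lebesgue_integral_def)

lemma L2_inner_self: "L2_inner M A f f = of_real ((L2_norm M A f)\<^sup>2)"
proof -
  have "indicator A x *\<^sub>R (f x * cnj (f x)) = of_real (indicator A x *\<^sub>R (cmod (f x))\<^sup>2)" for x
    using complex_norm_square[of "f x"] by (simp add: indicator_def)
  then show ?thesis
    by (simp only: L2_inner_def L2_norm_power2 set_lebesgue_integral_def integral_complex_of_real)
qed

lemma L2_hermitian: "hermitian_form cscale (L2_space M A) (L2_inner M A)"
proof -
  interpret vector_space cscale by (rule vector_space_cscale)
  show ?thesis
  proof
    fix u v w :: "'a \<Rightarrow> complex" and c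
    assume u: "u \<in> L2_space M A"
    then show "cscale c u \<in> L2_space M A" using L2_cmult by (simp add: cscale_def)
    show "0 \<le> Re (L2_inner M A u u)" by (simp add: L2_inner_self)
    assume w: "w \<in> L2_space M A"
    show "L2_inner M A (cscale c u) w = c * L2_inner M A u w"
      by (simp add: L2_inner_def cscale_def mult.assoc)
    show "L2_inner M A w u = cnj (L2_inner M A u w)"
    proof -
      have "indicator A x *\<^sub>R (w x * cnj (u x)) = cnj (indicator A x *\<^sub>R (u x * cnj (w x)))" for x
        by (simp add: mult.commute)
      then show ?thesis
        by (simp only: L2_inner_def set_lebesgue_integral_def Bochner_Integration.integral_cnj)
    qed
    assume v: "v \<in> L2_space M A"
    show "u + v \<in> L2_space M A" using L2_add[OF u v] by (simp add: plus_fun_def)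
    show "L2_inner M A (u + v) w = L2_inner M A u w + L2_inner M A v w"
      using set_integral_add(2)[OF L2_inner_integrable[OF u w] L2_inner_integrable[OF v w]]
      by (simp add: L2_inner_def distrib_right)
  qed (use L2_zero in \<open>simp add: zero_fun_def\<close>)
qed

interpretation L2: hermitian_form cscale "L2_space M A" "L2_inner M A" for M A
  by (rule L2_hermitian)

lemma L2_q: "Re (L2_inner M A f f) = (L2_norm M A f)\<^sup>2"
  by (simp add: L2_inner_self)

lemma L2_diff: "f \<in> L2_space M A \<Longrightarrow> g \<in> L2_space M A \<Longrightarrow> (\<lambda>x. f x - g x) \<in> L2_space M A"
  using L2.W_diff[of f M A g] by (simp add: fun_diff_def)

lemma L2_cauchy_schwarz:
  "f \<in> L2_space M A \<Longrightarrow> g \<in> L2_space M A \<Longrightarrow> cmod (L2_inner M A f g) \<le> L2_norm M A f * L2_norm M A g"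
  using L2.cauchy_schwarz_sqrt[of f M A g] by (simp add: L2_q)

lemma L2_triangle:
  "f \<in> L2_space M A \<Longrightarrow> g \<in> L2_space M A \<Longrightarrow>
    L2_norm M A (\<lambda>x. f x + g x) \<le> L2_norm M A f + L2_norm M A g"
  using L2.seminorm_triangle[of f M A g] by (simp add: L2_q plus_fun_def)

lemma L2_norm_minus_commute: "L2_norm M A (\<lambda>x. f x - g x) = L2_norm M A (\<lambda>x. g x - f x)"
  by (simp add: L2_norm_def norm_minus_commute)

lemma L2_triangle_minus:
  assumes "f \<in> L2_space M A" "g \<in> L2_space M A" "h \<in> L2_space M A"
  shows "L2_norm M A (\<lambda>x. f x - h x) \<le> L2_norm M A (\<lambda>x. f x - g x) + L2_norm M A (\<lambda>x. g x - h x)"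
  using L2_triangle[OF L2_diff[OF assms(1,2)] L2_diff[OF assms(2,3)]] by simp

lemma L2_norm_cmult: "L2_norm M A (\<lambda>x. c * f x) = cmod c * L2_norm M A f"
  by (simp add: L2_norm_def norm_mult power_mult_distrib real_sqrt_mult)

lemma L2_norm_bounded_mult:
  assumes "f \<in> L2_space M A" "set_borel_measurable M A h" "\<And>x. x \<in> A \<Longrightarrow> cmod (h x) \<le> C" "C \<ge> 0"
  shows "L2_norm M A (\<lambda>x. h x * f x) \<le> C * L2_norm M A f"
proof -
  have "(LINT x|M. (cmod (indicator A x *\<^sub>R (h x * f x)))\<^sup>2) \<le> (LINT x|M. C\<^sup>2 * (cmod (indicator A x *\<^sub>R f x))\<^sup>2)"
  proof (rule integral_mono)
    show "integrable M (\<lambda>x. (cmod (indicator A x *\<^sub>R (h x * f x)))\<^sup>2)"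
      by (rule L2_integrable[OF L2_bounded_mult[OF assms(1-3)]])
    show "integrable M (\<lambda>x. C\<^sup>2 * (cmod (indicator A x *\<^sub>R f x))\<^sup>2)"
      by (intro integrable_mult_right L2_integrable assms)
    show "(cmod (indicator A x *\<^sub>R (h x * f x)))\<^sup>2 \<le> C\<^sup>2 * (cmod (indicator A x *\<^sub>R f x))\<^sup>2" for x
    proof (cases "x \<in> A")
      case True
      then have "(cmod (h x) * cmod (f x))\<^sup>2 \<le> (C * cmod (f x))\<^sup>2"
        by (intro power_mono mult_right_mono assms) auto
      with True show ?thesis by (simp add: norm_mult power_mult_distrib)
    qed simp
  qed
  then have "L2_norm M A (\<lambda>x. h x * f x) \<le> sqrt (C\<^sup>2 * (LINT x|M. (cmod (indicator A x *\<^sub>R f x))\<^sup>2))"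
    unfolding L2_norm_eq by (intro real_sqrt_le_mono) (simp only: integral_mult_right_zero)
  then show ?thesis using assms(4) by (simp add: L2_norm_eq real_sqrt_mult)
qed

lemma L2_norm_zero_AE:
  assumes "f \<in> L2_space M A" "L2_norm M A f = 0"
  shows "AE x\<in>A in M. f x = 0"
proof -
  have "(LINT x|M. (cmod (indicator A x *\<^sub>R f x))\<^sup>2) = 0"
    using assms(2) by (simp add: L2_norm_eq)
  then have "AE x in M. (cmod (indicator A x *\<^sub>R f x))\<^sup>2 = 0"
    using integral_nonneg_eq_0_iff_AE[OF L2_integrable[OF assms(1)]] by simp
  then show ?thesis by eventually_elim (auto simp: indicator_def)
qed

lemma AE_set_integral_cong:
  assumes "AE x\<in>A in M. f x = g x"
    "(\<lambda>x. indicator A x *\<^sub>R f x) \<in> borel_measurable M" "(\<lambda>x. indicator A x *\<^sub>R g x) \<in> borel_measurable M"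
  shows "(LINT x:A|M. f x) = (LINT x:A|M. g x)"
  unfolding set_lebesgue_integral_def
  by (rule integral_cong_AE) (use assms in \<open>auto simp: indicator_def elim!: eventually_mono\<close>)

lemma L2_norm_cong_AE:
  assumes "f \<in> L2_space M A" "g \<in> L2_space M A" "AE x\<in>A in M. f x = g x"
  shows "L2_norm M A f = L2_norm M A g"
proof -
  have "(LINT x|M. (cmod (indicator A x *\<^sub>R f x))\<^sup>2) = (LINT x|M. (cmod (indicator A x *\<^sub>R g x))\<^sup>2)"
    using assms L2_integrable[OF assms(1)] L2_integrable[OF assms(2)]
    by (intro integral_cong_AE) (auto simp: indicator_def elim!: eventually_mono)
  then show ?thesis by (simp add: L2_norm_eq)
qed

lemma L2_inner_cong_AE:
  assumes "f \<in> L2_space M A" "g \<in> L2_space M A" "f' \<in> L2_space M A" "g' \<in> L2_space M A"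
    "AE x\<in>A in M. f x = f' x" "AE x\<in>A in M. g x = g' x"
  shows "L2_inner M A f g = L2_inner M A f' g'"
  unfolding L2_inner_def
proof (rule AE_set_integral_cong)
  show "AE x\<in>A in M. f x * cnj (g x) = f' x * cnj (g' x)"
    using assms(5,6) by eventually_elim auto
qed (use L2_inner_integrable[OF assms(1,2)] L2_inner_integrable[OF assms(3,4)]
  in \<open>auto simp: set_integrable_def\<close>)

text \<open>The subsequence is chosen so fast that \<open>\<Sum>k 4\<^sup>k |d k|\<^sup>2\<close> is integrable, where \<open>d k\<close> are its
  increments; this makes the increments pointwise summable without Minkowski's inequality.\<close>
theorem L2_complete:
  assumes f: "\<And>n::nat. f n \<in> L2_space M A"
    and cauchy: "\<And>e. e > 0 \<Longrightarrow> \<exists>N. \<forall>m\<ge>N. \<forall>n\<ge>N. L2_norm M A (\<lambda>x. f m x - f n x) < e"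
  shows "\<exists>g\<in>L2_space M A. (\<lambda>n. L2_norm M A (\<lambda>x. f n x - g x)) \<longlonglongrightarrow> 0"
proof -
  define h where "h n x = indicator A x *\<^sub>R f n x" for n x
  have hm [measurable]: "h n \<in> borel_measurable M" for n
    using f[of n] unfolding h_def by (intro L2_measurable)
  have hint: "integrable M (\<lambda>x. (cmod (h m x - h n x))\<^sup>2)"
    and hnorm: "(L2_norm M A (\<lambda>x. f m x - f n x))\<^sup>2 = (LINT x|M. (cmod (h m x - h n x))\<^sup>2)" for m n
  proof -
    have e: "h m x - h n x = indicator A x *\<^sub>R (f m x - f n x)" for x
      by (simp add: h_def scaleR_diff_right)
    show "integrable M (\<lambda>x. (cmod (h m x - h n x))\<^sup>2)"
      unfolding e by (intro L2_integrable L2_diff f)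
    show "(L2_norm M A (\<lambda>x. f m x - f n x))\<^sup>2 = (LINT x|M. (cmod (h m x - h n x))\<^sup>2)"
      unfolding e L2_norm_eq by (simp del: norm_scaleR)
  qed
  have hnn: "(\<integral>\<^sup>+x. ennreal ((cmod (h m x - h n x))\<^sup>2) \<partial>M) = ennreal ((L2_norm M A (\<lambda>x. f m x - f n x))\<^sup>2)" for m n
    unfolding hnorm by (intro nn_integral_eq_integral hint) simp
  \<comment> \<open>The threshold has square \<open>(1/8)^k\<close>, so that after multiplication
    with the weight \<open>4^k\<close> the integrals are still bounded by the summable sequence
    \<open>(1/2)^k\<close>.\<close>
  have "\<exists>N. \<forall>m\<ge>N. \<forall>n\<ge>N. L2_norm M A (\<lambda>x. f m x - f n x) < sqrt ((1/8)^k)" for k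
    by (rule cauchy) simp
  then obtain N where N: "\<And>k m n. m \<ge> N k \<Longrightarrow> n \<ge> N k \<Longrightarrow> L2_norm M A (\<lambda>x. f m x - f n x) < sqrt ((1/8)^k)"
    by metis
  define r where "r k = k + (\<Sum>i\<le>k. N i)" for k
  have rN: "r k \<ge> N k" for k
    using member_le_sum[of k "{..k}" N] by (simp add: r_def)
  have rk: "r k \<ge> k" for k by (simp add: r_def)
  have rSuc: "r (Suc k) \<ge> r k" for k by (simp add: r_def)
  define d where "d k x = h (r (Suc k)) x - h (r k) x" for k x
  have [measurable]: "d k \<in> borel_measurable M" for k unfolding d_def by simp
  have dn: "(\<integral>\<^sup>+x. ennreal (4^k * (cmod (d k x))\<^sup>2) \<partial>M) \<le> ennreal ((1/2)^k)" for k
  proof -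
    have "(L2_norm M A (\<lambda>x. f (r (Suc k)) x - f (r k) x))\<^sup>2 \<le> (sqrt ((1/8)^k))\<^sup>2"
      using N[of k "r (Suc k)" "r k"] rN[of k] rSuc[of k] by (intro power_mono) auto
    then have 1: "(L2_norm M A (\<lambda>x. f (r (Suc k)) x - f (r k) x))\<^sup>2 \<le> (1/8)^k" by simp
    have "(\<integral>\<^sup>+x. ennreal (4^k * (cmod (d k x))\<^sup>2) \<partial>M) = ennreal (4^k) * (\<integral>\<^sup>+x. ennreal ((cmod (d k x))\<^sup>2) \<partial>M)"
      by (subst nn_integral_cmult[symmetric]) (auto simp: ennreal_mult)
    also have "\<dots> = ennreal (4^k) * ennreal ((L2_norm M A (\<lambda>x. f (r (Suc k)) x - f (r k) x))\<^sup>2)"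
      unfolding d_def hnn ..
    also have "\<dots> \<le> ennreal (4^k) * ennreal ((1/8)^k)"
      by (intro mult_left_mono ennreal_leI 1) simp
    also have "\<dots> = ennreal ((1/2)^k)"
      by (simp add: ennreal_mult[symmetric] power_mult_distrib[symmetric])
    finally show ?thesis .
  qed
  have "(\<integral>\<^sup>+x. (\<Sum>k. ennreal (4^k * (cmod (d k x))\<^sup>2)) \<partial>M) = (\<Sum>k. \<integral>\<^sup>+x. ennreal (4^k * (cmod (d k x))\<^sup>2) \<partial>M)"
    by (rule nn_integral_suminf) simp
  also have "\<dots> \<le> (\<Sum>k. ennreal ((1/2)^k))"
    by (intro suminf_le dn) auto
  also have "\<dots> = ennreal (\<Sum>k. (1/2)^k)"
    by (intro suminf_ennreal2) (auto intro: summable_geometric)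
  also have "\<dots> < \<infinity>" by simp
  finally have "AE x in M. (\<Sum>k. ennreal (4^k * (cmod (d k x))\<^sup>2)) \<noteq> \<infinity>"
    by (intro nn_integral_noteq_infinite) auto
  then have conv: "AE x in M. convergent (\<lambda>k. h (r k) x)"
  proof eventually_elim
    fix x assume fin: "(\<Sum>k. ennreal (4^k * (cmod (d k x))\<^sup>2)) \<noteq> \<infinity>"
    then have "summable (\<lambda>k. 4^k * (cmod (d k x))\<^sup>2)"
      by (intro summable_suminf_not_top) auto
    then have "bounded (range (\<lambda>k. 4^k * (cmod (d k x))\<^sup>2))"
      using summable_LIMSEQ_zero convergent_imp_bounded by blast
    then obtain C where C: "\<And>k. norm (4^k * (cmod (d k x))\<^sup>2) \<le> C"
      by (auto simp: bounded_iff)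
    \<comment> \<open>Terms of a convergent series are bounded, and a bound on
      \<open>4^k * (cmod (d k x))\<^sup>2\<close> is geometric decay of \<open>cmod (d k x)\<close>
      itself.\<close>
    have dk: "norm (d k x) \<le> sqrt C * (1/2)^k" for k
    proof -
      have "(2^k * cmod (d k x))\<^sup>2 \<le> C"
      proof -
        have "(2::real)^k * 2^k = 4^k" by (simp add: power_mult_distrib[symmetric])
        then have "(2^k * cmod (d k x))\<^sup>2 = 4^k * (cmod (d k x))\<^sup>2"
          by (simp add: power_mult_distrib power2_eq_square)
        then show ?thesis using C[of k] by simp
      qed
      then have "2^k * cmod (d k x) \<le> sqrt C" by (rule real_le_rsqrt)
      then show ?thesis by (simp add: field_simps)
    qed
    have "norm (1/2 :: real) < 1" by simp
    from summable_comparison_test'[OF summable_mult[OF summable_geometric[OF this], of "sqrt C"] dk]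
    have "summable (\<lambda>k. d k x)" .
    then have "convergent (\<lambda>n. \<Sum>k<n. d k x)" by (simp add: summable_iff_convergent)
    moreover have "(\<Sum>k<n. d k x) = h (r n) x - h (r 0) x" for n
      unfolding d_def by (rule sum_lessThan_telescope)
    ultimately have "convergent (\<lambda>n. (h (r n) x - h (r 0) x) + h (r 0) x)"
      by (intro convergent_add convergent_const) simp
    then show "convergent (\<lambda>n. h (r n) x)" by simp
  qed
  \<comment> \<open>On the exceptional null set \<open>lim\<close> is an unspecified value, which
    does not impair measurability; off \<open>A\<close> the sequence is identically zero, so
    \<open>g\<close> vanishes there exactly.\<close>
  define g where "g x = lim (\<lambda>k. h (r k) x)" for x
  have gm [measurable]: "g \<in> borel_measurable M" unfolding g_def by (intro borel_measurable_lim_metric) simp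
  have gA: "indicator A x *\<^sub>R g x = g x" for x
  proof (cases "x \<in> A")
    case False
    then have "(\<lambda>k. h (r k) x) = (\<lambda>k. 0)" by (simp add: h_def)
    then show ?thesis using False by (simp add: g_def)
  qed simp
  \<comment> \<open>Fatou along the subsequence turns the Cauchy bound into a bound on the distance
    to \<open>g\<close>. It serves both for the membership of \<open>g\<close> and for convergence
    of the whole sequence.\<close>
  have fatou: "(\<integral>\<^sup>+x. ennreal ((cmod (h m x - g x))\<^sup>2) \<partial>M) \<le> ennreal (e\<^sup>2)"
    if "e > 0" and e: "\<And>n. n \<ge> m \<Longrightarrow> L2_norm M A (\<lambda>x. f m x - f n x) \<le> e" for m e
  proof -
    have "(\<integral>\<^sup>+x. ennreal ((cmod (h m x - g x))\<^sup>2) \<partial>M) = (\<integral>\<^sup>+x. liminf (\<lambda>k. ennreal ((cmod (h m x - h (r k) x))\<^sup>2)) \<partial>M)"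
    proof (rule nn_integral_cong_AE)
      show "AE x in M. ennreal ((cmod (h m x - g x))\<^sup>2) = liminf (\<lambda>k. ennreal ((cmod (h m x - h (r k) x))\<^sup>2))"
        using conv
      proof eventually_elim
        fix x assume "convergent (\<lambda>k. h (r k) x)"
        then have "(\<lambda>k. h (r k) x) \<longlonglongrightarrow> g x" by (simp add: g_def convergent_LIMSEQ_iff)
        then have "(\<lambda>k. ennreal ((cmod (h m x - h (r k) x))\<^sup>2)) \<longlonglongrightarrow> ennreal ((cmod (h m x - g x))\<^sup>2)"
          by (intro tendsto_intros)
        from lim_imp_Liminf[OF sequentially_bot this]
        show "ennreal ((cmod (h m x - g x))\<^sup>2) = liminf (\<lambda>k. ennreal ((cmod (h m x - h (r k) x))\<^sup>2))"
          by (rule sym)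
      qed
    qed
    also have "\<dots> \<le> liminf (\<lambda>k. \<integral>\<^sup>+x. ennreal ((cmod (h m x - h (r k) x))\<^sup>2) \<partial>M)"
      by (rule nn_integral_liminf) simp
    also have "\<dots> \<le> ennreal (e\<^sup>2)"
    proof (rule Liminf_le[OF sequentially_bot])
      have "(\<integral>\<^sup>+x. ennreal ((cmod (h m x - h (r k) x))\<^sup>2) \<partial>M) \<le> ennreal (e\<^sup>2)" if "k \<ge> m" for k
        unfolding hnn using e[of "r k"] that rk[of k] by (intro ennreal_leI power_mono) auto
      then show "\<forall>\<^sub>F k in sequentially. (\<integral>\<^sup>+x. ennreal ((cmod (h m x - h (r k) x))\<^sup>2) \<partial>M) \<le> ennreal (e\<^sup>2)"
        by (intro eventually_sequentiallyI[of m])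
    qed
    finally show ?thesis .
  qed
  have diffint: "integrable M (\<lambda>x. (cmod (h m x - g x))\<^sup>2)"
    if "e > 0" "\<And>n. n \<ge> m \<Longrightarrow> L2_norm M A (\<lambda>x. f m x - f n x) \<le> e" for m e
  proof (rule integrableI_bounded)
    show "(\<integral>\<^sup>+x. ennreal (norm ((cmod (h m x - g x))\<^sup>2)) \<partial>M) < \<infinity>"
      using fatou[of e m] that by (simp add: le_less_trans[OF _ ennreal_less_top])
  qed simp
  obtain N1 where N1: "\<And>m n. m \<ge> N1 \<Longrightarrow> n \<ge> N1 \<Longrightarrow> L2_norm M A (\<lambda>x. f m x - f n x) < 1"
    using cauchy[of 1] by auto
  have "(\<lambda>x. h N1 x - g x) \<in> L2_space M A"
  proof -
    have "indicator A x *\<^sub>R (h N1 x - g x) = h N1 x - g x" for x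
      using gA[of x] unfolding scaleR_diff_right by (simp add: h_def indicator_def)
    then show ?thesis using diffint[of 1 N1] N1[of N1] by (simp add: L2_space_iff less_imp_le)
  qed
  moreover have hL: "h m \<in> L2_space M A" for m
  proof -
    have "indicator A x *\<^sub>R h m x = indicator A x *\<^sub>R f m x" for x by (simp add: h_def indicator_def)
    with f[of m] show ?thesis by (simp only: L2_space_iff)
  qed
  ultimately have g: "g \<in> L2_space M A"
    using L2_diff[of "h N1" M A "\<lambda>x. h N1 x - g x"] by simp
  have "(\<lambda>n. L2_norm M A (\<lambda>x. f n x - g x)) \<longlonglongrightarrow> 0"
  proof (rule LIMSEQ_I)
    fix e :: real assume "e > 0"
    then obtain N2 where N2: "\<And>m n. m \<ge> N2 \<Longrightarrow> n \<ge> N2 \<Longrightarrow> L2_norm M A (\<lambda>x. f m x - f n x) < e / 2"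
      using cauchy[of "e / 2"] by auto
    have "L2_norm M A (\<lambda>x. f m x - g x) \<le> e / 2" if "m \<ge> N2" for m
    proof -
      have le: "n \<ge> m \<Longrightarrow> L2_norm M A (\<lambda>x. f m x - f n x) \<le> e / 2" for n
        using N2[of m n] that by simp
      have "ennreal (LINT x|M. (cmod (h m x - g x))\<^sup>2) \<le> ennreal ((e / 2)\<^sup>2)"
        using fatou[of "e / 2" m] le \<open>e > 0\<close> diffint[of "e / 2" m]
        by (subst nn_integral_eq_integral[symmetric]) auto
      then have 1: "(LINT x|M. (cmod (h m x - g x))\<^sup>2) \<le> (e / 2)\<^sup>2" by simp
      have "indicator A x *\<^sub>R (f m x - g x) = h m x - g x" for x
        using gA[of x] by (simp add: scaleR_diff_right h_def)
      then have "L2_norm M A (\<lambda>x. f m x - g x) = sqrt (LINT x|M. (cmod (h m x - g x))\<^sup>2)"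
        by (simp only: L2_norm_eq)
      also have "\<dots> \<le> e / 2" using 1 \<open>e > 0\<close> by (intro real_le_lsqrt) auto
      finally show ?thesis .
    qed
    then show "\<exists>n0. \<forall>n\<ge>n0. norm (L2_norm M A (\<lambda>x. f n x - g x) - 0) < e"
      using \<open>e > 0\<close> by (intro exI[of _ N2]) (force intro: le_less_trans)
  qed
  with g show ?thesis by blast
qed

section \<open>Smooth functions and mollification\<close>

text \<open>Frechet differentiability with the derivative listed by coordinates. Values in an
  arbitrary normed space let one calculus serve real cut-offs and complex mollifications
  alike.\<close>

definition has_grad :: "(real^'n::finite \<Rightarrow> 'b::real_normed_vector) \<Rightarrow> ('n \<Rightarrow> 'b) \<Rightarrow> real^'n \<Rightarrow> bool" where
  "has_grad f G x \<longleftrightarrow> (f has_derivative (\<lambda>h. \<Sum>i\<in>UNIV. (h $ i) *\<^sub>R G i)) (at x)"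

lemma has_gradI:
  assumes "(f has_derivative f') (at x)" "\<And>i. f' (axis i 1) = G i"
  shows "has_grad f G x"
proof -
  interpret linear f' using assms(1) by (simp add: has_derivative_def bounded_linear.linear)
  have "f' h = (\<Sum>i\<in>UNIV. (h $ i) *\<^sub>R G i)" for h
  proof -
    have "f' h = f' (\<Sum>i\<in>UNIV. h $ i *\<^sub>R axis i 1)"
      using basis_expansion[of h] by (simp add: scalar_mult_eq_scaleR)
    then show ?thesis by (simp add: sum scale assms(2))
  qed
  then have "f' = (\<lambda>h. \<Sum>i\<in>UNIV. (h $ i) *\<^sub>R G i)" by (rule ext)
  with assms(1) show ?thesis by (simp only: has_grad_def)
qed

lemma sum_axis_scaleR:
  fixes G :: "'n::finite \<Rightarrow> 'b::real_normed_vector"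
  shows "(\<Sum>j\<in>UNIV. (axis i (1::real) $ j) *\<^sub>R G j) = G i"
proof -
  have "(\<Sum>j\<in>UNIV. (axis i (1::real) $ j) *\<^sub>R G j) = (\<Sum>j\<in>UNIV. if j = i then G j else 0)"
    by (intro sum.cong) (auto simp: axis_def)
  then show ?thesis by simp
qed

lemma partial_eq:
  assumes "has_grad f G x"
  shows "partial i f x = G i"
proof -
  have "frechet_derivative f (at x) = (\<lambda>h. \<Sum>i\<in>UNIV. (h $ i) *\<^sub>R G i)"
    using frechet_derivative_at[OF assms[unfolded has_grad_def]] by simp
  then show ?thesis using sum_axis_scaleR[of i G] by (simp add: partial_def)
qed

lemma has_grad_partial: "f differentiable (at x) \<Longrightarrow> has_grad f (\<lambda>i. partial i f x) x"
  by (rule has_gradI[OF frechet_derivative_works[THEN iffD1]]) (auto simp: partial_def)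

lemma has_grad_differentiable: "has_grad f G x \<Longrightarrow> f differentiable (at x)"
  unfolding has_grad_def by (rule differentiableI)

lemma has_grad_isCont: "has_grad f G x \<Longrightarrow> isCont f x"
  unfolding has_grad_def by (rule has_derivative_continuous)

lemma has_grad_unique:
  assumes "has_grad f G x" "has_grad f H x"
  shows "G = H"
proof
  fix i
  have "(\<lambda>h. \<Sum>i\<in>UNIV. (h $ i) *\<^sub>R G i) = (\<lambda>h. \<Sum>i\<in>UNIV. (h $ i) *\<^sub>R H i)"
    using assms unfolding has_grad_def by (rule has_derivative_unique)
  from fun_cong[OF this, of "axis i 1"] show "G i = H i"
    by (simp only: sum_axis_scaleR)
qed

lemma has_grad_const: "has_grad (\<lambda>_. c) (\<lambda>_. 0) x"
  by (simp add: has_grad_def)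

lemma has_grad_coord: "has_grad (\<lambda>x. x $ j) (\<lambda>i. if i = j then 1 else 0) (x::real^'n::finite)"
proof (rule has_gradI)
  show "((\<lambda>x. x $ j) has_derivative (\<lambda>h. h $ j)) (at x)"
    by (intro bounded_linear_imp_has_derivative bounded_linear_vec_nth)
qed (auto simp: axis_def)

lemma has_grad_add: "has_grad f F x \<Longrightarrow> has_grad g G x \<Longrightarrow> has_grad (\<lambda>x. f x + g x) (\<lambda>i. F i + G i) x"
  unfolding has_grad_def by (drule (1) has_derivative_add) (simp add: scaleR_add_right sum.distrib)

lemma has_grad_mult:
  fixes f g :: "real^'n::finite \<Rightarrow> 'b::real_normed_algebra"
  assumes "has_grad f F x" "has_grad g G x"
  shows "has_grad (\<lambda>x. f x * g x) (\<lambda>i. f x * G i + F i * g x) x"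
  using has_derivative_mult[OF assms[unfolded has_grad_def]] unfolding has_grad_def
  by (simp add: scaleR_add_right sum.distrib sum_distrib_left sum_distrib_right)

lemma has_grad_compose:
  assumes "has_grad f F x" "(g has_real_derivative D) (at (f x))"
  shows "has_grad (\<lambda>x. g (f x)) (\<lambda>i. D * F i) x"
  using has_derivative_compose[OF assms(1)[unfolded has_grad_def] assms(2)[unfolded has_field_derivative_def]]
  unfolding has_grad_def by (simp add: sum_distrib_left mult.left_commute)

lemma has_grad_norm_square:
  "has_grad (\<lambda>x. (x - p) \<bullet> (x - p)) (\<lambda>i. 2 * (x $ i - p $ i)) (x::real^'n::finite)"
  by (rule has_gradI[where f' = "\<lambda>h. 2 * ((x - p) \<bullet> h)"])
    (auto intro!: derivative_eq_intros simp: inner_axis inner_commute algebra_simps)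

lemma has_grad_transform:
  assumes "has_grad f G x" "open S" "x \<in> S" "\<And>y. y \<in> S \<Longrightarrow> f y = g y"
  shows "has_grad g G x"
  using assms unfolding has_grad_def by (blast intro: has_derivative_transform_within_open)

lemma C_k_continuous: "C_k k f \<Longrightarrow> continuous_on UNIV f"
  by (cases k) (auto intro!: differentiable_imp_continuous_on differentiable_at_imp_differentiable_on)

lemma C_k_Suc_imp: "C_k (Suc k) f \<Longrightarrow> C_k k f"
proof (induction k arbitrary: f)
  case 0
  then show ?case using C_k_continuous[of "Suc 0" f] by simp
qed (metis C_k.simps(2))

lemma C_k_SucI:
  assumes "\<And>x. has_grad f (\<lambda>i. G i x) x" "\<And>i. C_k k (G i)"
  shows "C_k (Suc k) f"
proof -
  have "partial i f = G i" for i using partial_eq[OF assms(1)] by blast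
  then show ?thesis using assms by (auto intro: has_grad_differentiable)
qed

lemma C_k_const [intro]: "C_k k (\<lambda>_. c)"
proof (induction k arbitrary: c)
  case (Suc k)
  show ?case by (rule C_k_SucI[OF has_grad_const Suc])
qed simp

lemma C_k_add [intro]: "C_k k f \<Longrightarrow> C_k k g \<Longrightarrow> C_k k (\<lambda>x. f x + g x)"
proof (induction k arbitrary: f g)
  case (Suc k)
  show ?case
    by (rule C_k_SucI[where G = "\<lambda>i x. partial i f x + partial i g x"])
      (use Suc in \<open>auto intro!: has_grad_add has_grad_partial\<close>)
qed (auto intro: continuous_intros)

lemma C_k_mult [intro]: "C_k k f \<Longrightarrow> C_k k g \<Longrightarrow> C_k k (\<lambda>x. f x * g x)"
proof (induction k arbitrary: f g)
  case (Suc k)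
  have "C_k k f" "C_k k g" using Suc.prems by (blast intro: C_k_Suc_imp)+
  then show ?case
    by (intro C_k_SucI[where G = "\<lambda>i x. f x * partial i g x + partial i f x * g x"])
      (use Suc in \<open>auto intro!: has_grad_mult has_grad_partial C_k_add\<close>)
qed (auto intro: continuous_intros)

lemma C_k_coord: "C_k k (\<lambda>x. x $ j)"
proof (cases k)
  case (Suc k')
  show ?thesis unfolding Suc
    by (rule C_k_SucI[OF has_grad_coord]) (rule C_k_const)
qed (auto intro!: continuous_intros)

text \<open>The family \<open>exp (-1/t) / t\<^sup>m\<close>, extended by zero, is closed under differentiation.\<close>
definition flat :: "nat \<Rightarrow> real \<Rightarrow> real" where
  "flat m t = (if t > 0 then exp (- 1 / t) / t ^ m else 0)"

text \<open>A single term of the exponential series gives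
  \<open>y ^ (m + 2) / fact (m + 2) \<le> exp y\<close>; with \<open>y = 1 / t\<close> the two
  surplus powers become \<open>t\<^sup>2\<close>, which yields the zero derivative at the
  origin.\<close>

lemma flat_bound: "\<bar>flat m t\<bar> \<le> fact (m + 2) * t\<^sup>2"
proof (cases "t > 0")
  case True
  define y where "y = 1 / t"
  have y: "y > 0" using True by (simp add: y_def)
  have "y ^ (m + 2) / fact (m + 2) \<le> exp y"
  proof -
    have "(\<lambda>n. y ^ n /\<^sub>R fact n) sums exp y" by (rule exp_converges)
    then have s: "summable (\<lambda>n. y ^ n /\<^sub>R fact n)" and e: "exp y = (\<Sum>n. y ^ n /\<^sub>R fact n)"
      by (auto simp: sums_iff)
    have "(\<Sum>n\<in>{m + 2}. y ^ n /\<^sub>R fact n) \<le> exp y"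
      unfolding e using y by (intro sum_le_suminf s) auto
    moreover have "(\<Sum>n\<in>{m + 2}. y ^ n /\<^sub>R fact n) = y ^ (m + 2) / fact (m + 2)"
      by (simp add: divide_inverse mult.commute)
    ultimately show ?thesis by (simp only:)
  qed
  then have "exp (- y) \<le> fact (m + 2) / y ^ (m + 2)"
    using le_imp_inverse_le[of "y ^ (m + 2) / fact (m + 2)" "exp y"] y
    by (simp only: exp_minus inverse_divide) simp
  also have "\<dots> = fact (m + 2) * t ^ (m + 2)" using True by (simp add: y_def field_simps)
  finally have "exp (- 1 / t) / t ^ m \<le> fact (m + 2) * t ^ (m + 2) / t ^ m"
    using True by (intro divide_right_mono) (auto simp: y_def)
  also have "\<dots> = fact (m + 2) * t\<^sup>2" using True by (simp add: power_add power2_eq_square)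
  finally show ?thesis using True by (simp add: flat_def)
qed (simp add: flat_def)

lemma flat_deriv: "(flat m has_real_derivative (flat (m + 2) t - real m * flat (m + 1) t)) (at t)"
proof -
  consider "t > 0" | "t = 0" | "t < 0" by linarith
  then show ?thesis
  proof cases
    case 1
    have "((\<lambda>t. exp (- 1 / t) / t ^ m) has_real_derivative flat (m + 2) t - real m * flat (m + 1) t) (at t)"
    proof -
      have tm: "real m * (t ^ (m - Suc 0)) * t = real m * t ^ m"
        by (cases m) auto
      have "((\<lambda>t. exp (- 1 / t) * (1 / t) ^ m) has_real_derivative
          exp (- 1 / t) * (1 / t\<^sup>2) * (1 / t) ^ m + exp (- 1 / t) * (real m * (1 / t) ^ (m - 1) * (- 1 / t\<^sup>2))) (at t)"
        using 1 by (auto intro!: derivative_eq_intros simp: power2_eq_square)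
      moreover have "exp (- 1 / t) * (1 / t\<^sup>2) * (1 / t) ^ m + exp (- 1 / t) * (real m * (1 / t) ^ (m - 1) * (- 1 / t\<^sup>2))
        = flat (m + 2) t - real m * flat (m + 1) t"
        using 1 by (cases m) (auto simp: flat_def field_simps power2_eq_square)
      moreover have "(\<lambda>t::real. exp (- 1 / t) / t ^ m) = (\<lambda>t. exp (- 1 / t) * (1 / t) ^ m)"
        unfolding power_one_over by simp
      ultimately show ?thesis by simp
    qed
    then show ?thesis
      by (rule has_field_derivative_transform_within_open[where S = "{0<..}"]) (use 1 in \<open>auto simp: flat_def\<close>)
  next
    case 2
    have "((\<lambda>h. flat m h / h) \<longlongrightarrow> 0) (at 0)"
    proof (rule Lim_null_comparison)
      have "norm (flat m h / h) \<le> fact (m + 2) * \<bar>h\<bar>" for h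
      proof (cases "h = 0")
        case False
        have "\<bar>flat m h\<bar> / \<bar>h\<bar> \<le> (fact (m + 2) * h\<^sup>2) / \<bar>h\<bar>"
          by (intro divide_right_mono flat_bound) simp
        also have "h\<^sup>2 = \<bar>h\<bar> * \<bar>h\<bar>" by (simp add: power2_eq_square)
        also have "fact (m + 2) * (\<bar>h\<bar> * \<bar>h\<bar>) / \<bar>h\<bar> = fact (m + 2) * \<bar>h\<bar>"
          using False by (simp only: times_divide_eq_right[symmetric] nonzero_mult_div_cancel_left[of "\<bar>h\<bar>"] abs_eq_0) simp
        finally show ?thesis by (simp only: real_norm_def abs_divide)
      qed simp
      then show "\<forall>\<^sub>F h in at 0. norm (flat m h / h) \<le> fact (m + 2) * \<bar>h\<bar>" by simp
      show "((\<lambda>h. fact (m + 2) * \<bar>h\<bar>) \<longlongrightarrow> 0) (at (0::real))"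
        by (auto intro!: tendsto_eq_intros)
    qed
    then have "(flat m has_real_derivative 0) (at 0)"
      by (simp add: DERIV_def flat_def)
    with 2 show ?thesis by (simp add: flat_def)
  next
    case 3
    have "((\<lambda>_. 0) has_real_derivative flat (m + 2) t - real m * flat (m + 1) t) (at t)"
      using 3 by (simp add: flat_def)
    then show ?thesis
      by (rule has_field_derivative_transform_within_open[where S = "{..<0}"]) (use 3 in \<open>auto simp: flat_def\<close>)
  qed
qed

text \<open>Differentiation raises \<open>m\<close> and produces a coordinate factor, so the
  induction on \<open>k\<close> has to run over all \<open>m\<close> simultaneously.\<close>

lemma C_k_flat: "C_k k (\<lambda>x::real^'n::finite. flat m (r - x \<bullet> x))"
proof (induction k arbitrary: m)
  case 0
  have "continuous_on UNIV (flat m)"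
    using flat_deriv DERIV_isCont by (blast intro: continuous_at_imp_continuous_on)
  then show ?case
    by (auto intro!: continuous_on_compose2[where g = "flat m" and t = UNIV] continuous_intros)
next
  case (Suc k)
  have g: "has_grad (\<lambda>x. r - x \<bullet> x) (\<lambda>i. - 2 * x $ i) x" for x :: "real^'n"
    by (rule has_gradI[where f' = "\<lambda>h. - 2 * (x \<bullet> h)"])
      (auto intro!: derivative_eq_intros simp: inner_axis inner_commute)
  show ?case
  proof (rule C_k_SucI)
    show "has_grad (\<lambda>x. flat m (r - x \<bullet> x))
        (\<lambda>i. (flat (m + 2) (r - x \<bullet> x) + - real m * flat (m + 1) (r - x \<bullet> x)) * (- 2 * x $ i)) x"
      for x :: "real^'n"
      using has_grad_compose[OF g flat_deriv] by simp
    show "C_k k (\<lambda>x::real^'n. (flat (m + 2) (r - x \<bullet> x) + - real m * flat (m + 1) (r - x \<bullet> x)) * (- 2 * x $ i))" for i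
      by (intro C_k_mult C_k_add C_k_const C_k_coord Suc)
  qed
qed

lemma continuous_compact_support_integrable:
  fixes f :: "real^'n::finite \<Rightarrow> 'b::euclidean_space"
  assumes "continuous_on UNIV f" "compact K" "\<And>x. x \<notin> K \<Longrightarrow> f x = 0"
  shows "integrable lborel f"
proof -
  have "set_integrable lborel K f"
    using borel_integrable_compact[OF assms(2) continuous_on_subset[OF assms(1)]]
    by (simp add: set_integrable_def indicator_def if_distrib[of "\<lambda>c. c *\<^sub>R _"] cong: if_cong)
  moreover have "indicator K x *\<^sub>R f x = f x" for x using assms(3)[of x] by (simp add: indicator_def)
  ultimately show ?thesis by (simp add: set_integrable_def)
qed

lemma bounded_continuous_compact_support:
  fixes f :: "real^'n::finite \<Rightarrow> 'b::real_normed_vector"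
  assumes "continuous_on UNIV f" "compact K" "\<And>x. x \<notin> K \<Longrightarrow> f x = 0"
  obtains B where "B > 0" "\<And>x. norm (f x) \<le> B"
proof -
  have "bounded (f ` K)"
    by (intro compact_imp_bounded compact_continuous_image assms(2) continuous_on_subset[OF assms(1)]) simp
  then obtain B where B: "B > 0" "\<And>x. x \<in> K \<Longrightarrow> norm (f x) \<le> B"
    unfolding bounded_pos by blast
  have "norm (f x) \<le> B" for x using B assms(3)[of x] by (cases "x \<in> K") auto
  with B show thesis by (rule_tac that)
qed

section \<open>Mollifiers and smoothing by convolution\<close>

definition mollifier :: "real \<Rightarrow> (real^'n::finite \<Rightarrow> real) \<Rightarrow> bool" where
  "mollifier r \<rho> \<longleftrightarrow> (\<forall>k. C_k k \<rho>) \<and> (\<forall>x. \<rho> x \<ge> 0) \<and> (\<forall>x. norm x \<ge> r \<longrightarrow> \<rho> x = 0) \<and>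
     integrable lborel \<rho> \<and> (LINT x|lborel. \<rho> x) = 1"

lemma mollifier_exists:
  assumes "r > 0"
  shows "\<exists>\<rho> :: real^'n::finite \<Rightarrow> real. mollifier r \<rho>"
proof -
  define b where "b x = flat 0 (r\<^sup>2 - x \<bullet> x)" for x :: "real^'n"
  have C: "C_k k b" for k unfolding b_def by (rule C_k_flat)
  have nn: "b x \<ge> 0" for x by (simp add: b_def flat_def)
  have z: "b x = 0" if "norm x \<ge> r" for x
    using that assms power_mono[OF that, of 2] by (simp add: b_def flat_def power2_norm_eq_inner[symmetric] not_less)
  have cont: "continuous_on UNIV b" using C C_k_continuous by blast
  have int: "integrable lborel b"
    by (rule continuous_compact_support_integrable[OF cont compact_cball[of 0 r]]) (use z in auto)
  define I where "I = (LINT x|lborel. b x)"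
  \<comment> \<open>A zero integral would make the open set where \<open>b\<close> is nonzero a null
    set, hence empty, although it contains the origin.\<close>
  have "I \<noteq> 0"
  proof
    assume "I = 0"
    then have ae: "AE x in lborel. b x = 0"
      using integral_nonneg_eq_0_iff_AE[OF int] nn by (simp add: I_def)
    have "b x = 0" for x
    proof (rule ccontr)
      assume "b x \<noteq> 0"
      have "open {x. b x \<noteq> 0}" using cont by (intro open_Collect_neq continuous_on_const)
      moreover have "{x. b x \<noteq> 0} \<in> null_sets lborel"
        using ae \<open>open {x. b x \<noteq> 0}\<close> by (subst AE_iff_null_sets) auto
      ultimately have "{x. b x \<noteq> 0} = {}"
        using open_not_negligible null_sets_completion_iff2
        by (metis negligible_iff_null_sets null_sets_completionI)
      with \<open>b x \<noteq> 0\<close> show False by blast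
    qed
    from this[of 0] assms show False by (simp add: b_def flat_def)
  qed
  moreover have "I \<ge> 0" unfolding I_def using nn by (simp add: integral_nonneg_AE)
  ultimately have I: "I > 0" by simp
  have "mollifier r (\<lambda>x. (1 / I) * b x)"
    unfolding mollifier_def
    using I nn z int C_k_mult[OF C_k_const[where c = "1 / I"] C] by (auto simp: I_def[symmetric])
  then show ?thesis by blast
qed

definition conv :: "(real^'n::finite \<Rightarrow> real) \<Rightarrow> (real^'n \<Rightarrow> 'b::euclidean_space) \<Rightarrow> real^'n \<Rightarrow> 'b" where
  "conv \<rho> f x = (LINT y|lborel. \<rho> (x - y) *\<^sub>R f y)"

lemma conv_integrable:
  fixes f :: "real^'n::finite \<Rightarrow> 'b::euclidean_space"
  assumes "integrable lborel f" "continuous_on UNIV \<rho>" "\<And>x. \<bar>\<rho> x\<bar> \<le> B"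
  shows "integrable lborel (\<lambda>y. \<rho> (x - y) *\<^sub>R f y)"
proof (rule Bochner_Integration.integrable_bound[OF integrable_scaleR_right[OF assms(1), of B]])
  have "continuous_on UNIV (\<lambda>y. \<rho> (x - y))"
    by (intro continuous_on_compose2[OF assms(2)] continuous_intros) auto
  then have "(\<lambda>y. \<rho> (x - y)) \<in> borel_measurable lborel"
    by (simp add: borel_measurable_continuous_onI)
  then show "(\<lambda>y. \<rho> (x - y) *\<^sub>R f y) \<in> borel_measurable lborel"
    using assms(1) by (intro borel_measurable_scaleR) auto
  have "\<bar>\<rho> z\<bar> \<le> \<bar>B\<bar>" for z using assms(3)[of z] by linarith
  then show "AE y in lborel. norm (\<rho> (x - y) *\<^sub>R f y) \<le> norm (B *\<^sub>R f y)"
    by (auto intro!: mult_right_mono)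
qed

text \<open>As \<open>f\<close> is merely integrable, differentiability rests on
  \<open>\<rho>\<close>: its gradient is bounded, so \<open>\<rho>\<close> is Lipschitz with
  constant \<open>B\<close>, the remainder quotients are bounded by \<open>2 * B\<close>, and
  dominated convergence applies with the majorant \<open>2 * B * norm (f y)\<close>.\<close>

lemma conv_has_grad:
  fixes f :: "real^'n::finite \<Rightarrow> 'b::euclidean_space"
  assumes f: "integrable lborel f" and \<rho>: "C_k 1 \<rho>" "compact K" "\<And>x. x \<notin> K \<Longrightarrow> \<rho> x = 0"
    and \<rho>': "\<And>i x. x \<notin> K \<Longrightarrow> partial i \<rho> x = 0"
  shows "has_grad (conv \<rho> f) (\<lambda>i. conv (partial i \<rho>) f x) x"
proof -
  have cont: "continuous_on UNIV \<rho>" using \<rho>(1) C_k_continuous by blast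
  have cont': "continuous_on UNIV (partial i \<rho>)" for i using \<rho>(1) by simp
  obtain B0 where B0: "\<And>x. \<bar>\<rho> x\<bar> \<le> B0"
    using bounded_continuous_compact_support[OF cont \<rho>(2,3)] by (metis real_norm_def)
  have "\<exists>B. \<forall>x. \<bar>partial i \<rho> x\<bar> \<le> B" for i
    using bounded_continuous_compact_support[OF cont' \<rho>(2) \<rho>'] by (metis real_norm_def)
  then obtain Bi where Bi: "\<And>i x. \<bar>partial i \<rho> x\<bar> \<le> Bi i" by metis
  define B where "B = (\<Sum>i\<in>UNIV. Bi i)"
  define L where "L z h = (\<Sum>i\<in>UNIV. (h $ i) *\<^sub>R partial i \<rho> z)" for z h
  have L: "(\<rho> has_derivative L z) (at z)" for z
    using has_grad_partial[of \<rho> z] \<rho>(1) by (simp add: has_grad_def L_def[abs_def])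
  have LB: "\<bar>L z h\<bar> \<le> B * norm h" for z h
  proof -
    have "\<bar>L z h\<bar> \<le> (\<Sum>i\<in>UNIV. norm h * Bi i)"
      unfolding L_def real_scaleR_def
      by (rule order_trans[OF sum_abs sum_mono])
        (auto simp: abs_mult intro!: mult_mono component_le_norm_cart Bi)
    then show ?thesis by (simp add: B_def sum_distrib_left mult.commute)
  qed
  have Bpos: "B \<ge> 0" unfolding B_def by (intro sum_nonneg) (use Bi order_trans[OF abs_ge_zero] in blast)
  have lip: "\<bar>\<rho> (z + h) - \<rho> z\<bar> \<le> B * norm h" for z h
  proof -
    have "norm (\<rho> (z + h) - \<rho> z) \<le> B * norm (z + h - z)"
    proof (rule differentiable_bound[of UNIV \<rho> L])
      show "onorm (L x) \<le> B" for x by (rule onorm_bound[OF Bpos]) (use LB in simp)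
    qed (auto intro!: L has_derivative_at_withinI)
    then show ?thesis by simp
  qed
  let ?D = "\<lambda>h. \<Sum>i\<in>UNIV. (h $ i) *\<^sub>R conv (partial i \<rho>) f x"
  have int: "integrable lborel (\<lambda>y. \<rho> (z - y) *\<^sub>R f y)" for z by (rule conv_integrable[OF f cont B0])
  have int': "integrable lborel (\<lambda>y. partial i \<rho> (x - y) *\<^sub>R f y)" for i
    by (rule conv_integrable[OF f cont' Bi])
  have D: "?D h = (LINT y|lborel. L (x - y) h *\<^sub>R f y)"
    and Dint: "integrable lborel (\<lambda>y. L (x - y) h *\<^sub>R f y)" for h
    using int' by (simp_all add: L_def conv_def scaleR_sum_left flip: scaleR_scaleR)
  show ?thesis
    unfolding has_grad_def
  proof (rule has_derivativeI)
    show "bounded_linear ?D"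
      by (intro bounded_linear_sum bounded_linear_scaleR_const bounded_linear_vec_nth)
    show "((\<lambda>z. (conv \<rho> f z - conv \<rho> f x - ?D (z - x)) /\<^sub>R norm (z - x)) \<longlongrightarrow> 0) (at x)"
      unfolding tendsto_at_iff_sequentially o_def
    proof (intro allI impI)
      fix X :: "nat \<Rightarrow> real^'n" assume X: "\<forall>n. X n \<in> UNIV - {x}" "X \<longlonglongrightarrow> x"
      define q where "q n y = (\<rho> (X n - y) - \<rho> (x - y) - L (x - y) (X n - x)) / norm (X n - x)" for n y
      have eq: "(conv \<rho> f (X n) - conv \<rho> f x - ?D (X n - x)) /\<^sub>R norm (X n - x) = (LINT y|lborel. q n y *\<^sub>R f y)"
        and qint: "integrable lborel (\<lambda>y. q n y *\<^sub>R f y)" for n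
      proof -
        have "q n y *\<^sub>R f y = (1 / norm (X n - x)) *\<^sub>R (\<rho> (X n - y) *\<^sub>R f y - \<rho> (x - y) *\<^sub>R f y - L (x - y) (X n - x) *\<^sub>R f y)" for y
          by (simp add: q_def scaleR_diff_left scaleR_diff_right diff_divide_distrib)
        then show "(conv \<rho> f (X n) - conv \<rho> f x - ?D (X n - x)) /\<^sub>R norm (X n - x) = (LINT y|lborel. q n y *\<^sub>R f y)"
          and "integrable lborel (\<lambda>y. q n y *\<^sub>R f y)"
          using int Dint unfolding D unfolding conv_def by (simp_all add: inverse_eq_divide)
      qed
      have "(\<lambda>n. LINT y|lborel. q n y *\<^sub>R f y) \<longlonglongrightarrow> (LINT y|(lborel :: (real^'n) measure). (0::'b))"
      proof (rule integral_dominated_convergence[where w = "\<lambda>y. 2 * B * norm (f y)"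
            and s = "\<lambda>n y. q n y *\<^sub>R f y" and f = "\<lambda>y. 0" and M = lborel])
        show "(\<lambda>y. q n y *\<^sub>R f y) \<in> borel_measurable lborel" for n
          using qint[of n] by auto
        show "integrable lborel (\<lambda>y. 2 * B * norm (f y))"
          using f by (intro integrable_mult_right integrable_norm)
        have "(\<lambda>n. q n y) \<longlonglongrightarrow> 0" for y
        proof -
          have lim: "((\<lambda>h. (\<rho> (x - y + h) - \<rho> (x - y) - L (x - y) h) /\<^sub>R norm h) \<longlongrightarrow> 0) (at 0)"
            using L[of "x - y"] unfolding has_derivative_at
            by (subst tendsto_norm_zero_iff[symmetric]) (simp add: divide_inverse mult.commute abs_mult)
          have "(\<lambda>n. X n - x) \<longlonglongrightarrow> 0" using X(2) by (simp add: LIM_zero)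
          moreover have "X n - x \<noteq> 0" for n using X(1) by auto
          ultimately have "(\<lambda>n. (\<rho> (x - y + (X n - x)) - \<rho> (x - y) - L (x - y) (X n - x)) /\<^sub>R norm (X n - x)) \<longlonglongrightarrow> 0"
            by (intro lim[unfolded tendsto_at_iff_sequentially o_def, rule_format]) auto
          moreover have "x - y + (X n - x) = X n - y" for n by simp
          ultimately show ?thesis by (simp add: q_def divide_inverse mult.commute)
        qed
        then have "(\<lambda>n. q n y *\<^sub>R f y) \<longlonglongrightarrow> 0" for y
          using tendsto_scaleR[OF _ tendsto_const, of "\<lambda>n. q n y" 0 sequentially "f y"] by simp
        then show "AE y in lborel. (\<lambda>n. q n y *\<^sub>R f y) \<longlonglongrightarrow> 0" by simp
        have "\<bar>q n y\<bar> \<le> 2 * B" for n y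
        proof -
          have "X n - x \<noteq> 0" using X(1) by auto
          then have pos: "norm (X n - x) > 0" by simp
          have "\<bar>\<rho> (X n - y) - \<rho> (x - y) - L (x - y) (X n - x)\<bar> \<le> B * norm (X n - x) + B * norm (X n - x)"
            using lip[of "x - y" "X n - x"] LB[of "x - y" "X n - x"] by (simp add: algebra_simps)
          then show ?thesis using pos by (simp add: q_def divide_le_eq)
        qed
        then show "AE y in lborel. norm (q n y *\<^sub>R f y) \<le> 2 * B * norm (f y)" for n
          by (auto intro!: mult_right_mono)
      qed simp
      then show "(\<lambda>n. (conv \<rho> f (X n) - conv \<rho> f x - ?D (X n - x)) /\<^sub>R norm (X n - x)) \<longlonglongrightarrow> 0"
        unfolding eq by simp
    qed
  qed
qed

lemma partial_zero_outside:
  assumes "closed K" "\<And>x. x \<notin> K \<Longrightarrow> \<rho> x = 0" "x \<notin> K"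
  shows "partial i \<rho> x = 0"
proof (rule partial_eq[where G = "\<lambda>_. 0"])
  show "has_grad \<rho> (\<lambda>_. 0) x"
    by (rule has_grad_transform[OF has_grad_const, of "- K" x 0]) (use assms in auto)
qed

text \<open>Derivatives fall on the kernel, whose partial derivatives are again smooth kernels
  vanishing off the same \<open>K\<close>; therefore the induction varies \<open>\<rho>\<close> and
  keeps \<open>f\<close>.\<close>

lemma C_k_conv:
  fixes f :: "real^'n::finite \<Rightarrow> real"
  assumes f: "integrable lborel f" and \<rho>: "\<And>k. C_k k \<rho>" "compact K" "\<And>x. x \<notin> K \<Longrightarrow> \<rho> x = 0"
  shows "C_k k (conv \<rho> f)"
  using \<rho>
proof (induction k arbitrary: \<rho>)
  case 0
  have "has_grad (conv \<rho> f) (\<lambda>i. conv (partial i \<rho>) f x) x" for x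
    by (intro conv_has_grad[OF f, of _ K] 0 partial_zero_outside[OF compact_imp_closed[OF 0(2)]])
  then show ?case by (auto intro!: continuous_at_imp_continuous_on has_grad_isCont)
next
  case (Suc k)
  have z: "partial i \<rho> x = 0" if "x \<notin> K" for i x
    by (intro partial_zero_outside[OF compact_imp_closed[OF Suc(3)]] Suc that)
  have "C_k j (partial i \<rho>)" for i j using Suc(2)[of "Suc j"] by simp
  moreover have "has_grad (conv \<rho> f) (\<lambda>i. conv (partial i \<rho>) f x) x" for x
    by (intro conv_has_grad[OF f, of _ K] Suc z)
  ultimately show ?case
    by (intro C_k_SucI[of _ "\<lambda>i. conv (partial i \<rho>) f"] Suc.IH Suc z) auto
qed

lemma null_seq_bound:
  fixes u :: "nat \<Rightarrow> 'b::real_normed_vector"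
  assumes "\<And>n. norm (u n) \<le> w n" "w \<longlonglongrightarrow> 0"
  shows "u \<longlonglongrightarrow> 0"
  by (rule Lim_null_comparison[OF always_eventually assms(2)]) (use assms(1) in blast)

section \<open>Continuity of translation in L1 and L2\<close>

lemma integrable_shift:
  fixes f :: "real^'n::finite \<Rightarrow> 'b::euclidean_space"
  assumes "integrable lborel f"
  shows "integrable lborel (\<lambda>x. f (x + a))"
proof -
  have "integrable (distr lborel borel ((+) a)) f" using assms by (simp add: lborel_distr_plus)
  then show ?thesis by (subst (asm) integrable_distr_eq) (use assms in \<open>auto simp: add.commute\<close>)
qed

lemma integral_shift:
  fixes f :: "real^'n::finite \<Rightarrow> 'b::euclidean_space"
  assumes "f \<in> borel_measurable borel"
  shows "(LINT x|lborel. f (x + a)) = (LINT x|lborel. f x)"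
proof -
  have "(LINT x|distr lborel borel ((+) a). f x) = (LINT x|lborel. f (a + x))"
    by (rule integral_distr) (use assms in auto)
  then show ?thesis by (simp add: lborel_distr_plus add.commute)
qed

definition L1_shift_continuous :: "(real^'n::finite \<Rightarrow> real) \<Rightarrow> bool" where
  "L1_shift_continuous f \<longleftrightarrow> (\<forall>a. a \<longlonglongrightarrow> 0 \<longrightarrow> (\<lambda>n. LINT x|lborel. \<bar>f (x + a n) - f x\<bar>) \<longlonglongrightarrow> 0)"

text \<open>The usual three-term estimate; translation invariance makes the approximation error the
  same before and after the shift.\<close>

lemma L1_shift_continuous_approx:
  fixes f :: "real^'n::finite \<Rightarrow> real"
  assumes f: "integrable lborel f"
    and approx: "\<And>e. e > 0 \<Longrightarrow> \<exists>g. integrable lborel g \<and> L1_shift_continuous g \<and> (LINT x|lborel. \<bar>f x - g x\<bar>) < e"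
  shows "L1_shift_continuous f"
  unfolding L1_shift_continuous_def
proof (intro allI impI LIMSEQ_I)
  fix a :: "nat \<Rightarrow> real^'n" and e :: real assume a: "a \<longlonglongrightarrow> 0" and "e > 0"
  obtain g where g: "integrable lborel g" "L1_shift_continuous g" "(LINT x|lborel. \<bar>f x - g x\<bar>) < e / 3"
    using approx[of "e / 3"] \<open>e > 0\<close> by auto
  have "(\<lambda>n. LINT x|lborel. \<bar>g (x + a n) - g x\<bar>) \<longlonglongrightarrow> 0"
    using g(2) a by (auto simp: L1_shift_continuous_def)
  from LIMSEQ_D[OF this, of "e / 3"] \<open>e > 0\<close> obtain N
    where N: "\<And>n. n \<ge> N \<Longrightarrow> \<bar>LINT x|lborel. \<bar>g (x + a n) - g x\<bar>\<bar> < e / 3" by auto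
  have "\<bar>LINT x|lborel. \<bar>f (x + a n) - f x\<bar>\<bar> < e" if "n \<ge> N" for n
  proof -
    note i = integrable_shift[OF f, of "a n"] integrable_shift[OF g(1), of "a n"] f g(1)
    have "(LINT x|lborel. \<bar>f (x + a n) - f x\<bar>) \<le>
        (LINT x|lborel. \<bar>f (x + a n) - g (x + a n)\<bar> + \<bar>g (x + a n) - g x\<bar> + \<bar>f x - g x\<bar>)"
      by (rule integral_mono) (use i in auto)
    also have "\<dots> = (LINT x|lborel. \<bar>f (x + a n) - g (x + a n)\<bar>) + (LINT x|lborel. \<bar>g (x + a n) - g x\<bar>)
        + (LINT x|lborel. \<bar>f x - g x\<bar>)"
      using i by (subst Bochner_Integration.integral_add)+ auto
    also have "(LINT x|lborel. \<bar>f (x + a n) - g (x + a n)\<bar>) = (LINT x|lborel. \<bar>f x - g x\<bar>)"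
      using f g(1) by (intro integral_shift[of "\<lambda>x. \<bar>f x - g x\<bar>"]) auto
    finally have "(LINT x|lborel. \<bar>f (x + a n) - f x\<bar>) < e" using g(3) N[OF that] by linarith
    then show ?thesis by (simp add: integral_nonneg_AE)
  qed
  then show "\<exists>N. \<forall>n\<ge>N. norm ((LINT x|lborel. \<bar>f (x + a n) - f x\<bar>) - 0) < e" by auto
qed

text \<open>A point of \<open>U\<close> stays in \<open>U\<close> under small shifts, whereas points
  of the boundary may jump in, so pointwise convergence is available for the loss
  \<open>max 0 (?i x - ?i (x + a n))\<close> only. Both indicators have the same integral, hence
  gain and loss agree and the full difference is twice the loss.\<close>

lemma L1_shift_continuous_open:
  fixes U :: "(real^'n::finite) set"
  assumes U: "open U" "emeasure lborel U < \<infinity>"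
  shows "L1_shift_continuous (indicator U)"
  unfolding L1_shift_continuous_def
proof (intro allI impI)
  fix a :: "nat \<Rightarrow> real^'n" assume a: "a \<longlonglongrightarrow> 0"
  let ?i = "indicator U :: real^'n \<Rightarrow> real"
  have int: "integrable lborel ?i" using U by (intro integrable_real_indicator) auto
  note ints = integrable_shift[OF int]
  have "(\<lambda>n. LINT x|lborel. max 0 (?i x - ?i (x + a n))) \<longlonglongrightarrow> (LINT x|(lborel::(real^'n) measure). 0)"
  proof (rule integral_dominated_convergence[where w = ?i])
    show "(\<lambda>x. max 0 (?i x - ?i (x + a n))) \<in> borel_measurable lborel" for n
      using ints[of "a n"] int by (intro borel_measurable_max) auto
    have "(\<lambda>n. max 0 (?i x - ?i (x + a n))) \<longlonglongrightarrow> 0" for x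
    proof (cases "x \<in> U")
      case True
      have "(\<lambda>n. x + a n) \<longlonglongrightarrow> x + 0" by (intro tendsto_intros a)
      then have "\<forall>\<^sub>F n in sequentially. x + a n \<in> U"
        using topological_tendstoD[OF _ U(1)] True by fastforce
      then have "\<forall>\<^sub>F n in sequentially. max 0 (?i x - ?i (x + a n)) = 0"
        by eventually_elim (simp add: True)
      then show ?thesis by (rule tendsto_eventually)
    qed (simp add: indicator_def)
    then show "AE x in lborel. (\<lambda>n. max 0 (?i x - ?i (x + a n))) \<longlonglongrightarrow> 0" by simp
    show "AE x in lborel. norm (max 0 (?i x - ?i (x + a n))) \<le> ?i x" for n
      by (rule AE_I2) (simp add: indicator_def)
  qed (use int in auto)
  then have lim: "(\<lambda>n. 2 * (LINT x|lborel. max 0 (?i x - ?i (x + a n)))) \<longlonglongrightarrow> 0"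
    by (intro tendsto_mult_right_zero) simp
  have "(LINT x|lborel. \<bar>?i (x + a n) - ?i x\<bar>) = 2 * (LINT x|lborel. max 0 (?i x - ?i (x + a n)))" for n
  proof -
    have e: "\<bar>?i (x + a n) - ?i x\<bar> = 2 * max 0 (?i x - ?i (x + a n)) + (?i (x + a n) - ?i x)" for x
      by (auto simp: indicator_def)
    have "(LINT x|lborel. \<bar>?i (x + a n) - ?i x\<bar>) = (LINT x|lborel. 2 * max 0 (?i x - ?i (x + a n))) + (LINT x|lborel. ?i (x + a n) - ?i x)"
      unfolding e using int ints[of "a n"] by (intro Bochner_Integration.integral_add) (auto intro!: integrable_max)
    also have "(LINT x|lborel. ?i (x + a n) - ?i x) = 0"
      using int ints[of "a n"] integral_shift[of ?i "a n"] by (subst Bochner_Integration.integral_diff) auto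
    finally show ?thesis by simp
  qed
  with lim show "(\<lambda>n. LINT x|lborel. \<bar>?i (x + a n) - ?i x\<bar>) \<longlonglongrightarrow> 0" by simp
qed

lemma L1_shift_continuous_cmult:
  assumes "L1_shift_continuous f"
  shows "L1_shift_continuous (\<lambda>x. f x * c)"
proof -
  have "\<bar>f u * c - f v * c\<bar> = \<bar>c\<bar> * \<bar>f u - f v\<bar>" for u v by (metis abs_mult left_diff_distrib mult.commute)
  then show ?thesis
    using assms by (auto simp: L1_shift_continuous_def intro!: tendsto_mult_right_zero)
qed

lemma L1_shift_continuous_add:
  fixes f g :: "real^'n::finite \<Rightarrow> real"
  assumes "integrable lborel f" "L1_shift_continuous f" "integrable lborel g" "L1_shift_continuous g"
  shows "L1_shift_continuous (\<lambda>x. f x + g x)"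
  unfolding L1_shift_continuous_def
proof (intro allI impI)
  fix a :: "nat \<Rightarrow> real^'n" assume a: "a \<longlonglongrightarrow> 0"
  let ?F = "\<lambda>n. LINT x|lborel. \<bar>f (x + a n) - f x\<bar>" and ?G = "\<lambda>n. LINT x|lborel. \<bar>g (x + a n) - g x\<bar>"
  note i = integrable_shift[OF assms(1)] integrable_shift[OF assms(3)] assms(1,3)
  have "(\<lambda>n. ?F n + ?G n) \<longlonglongrightarrow> 0"
    using assms(2,4) a by (intro tendsto_add_zero) (auto simp: L1_shift_continuous_def)
  moreover have "norm (LINT x|lborel. \<bar>f (x + a n) + g (x + a n) - (f x + g x)\<bar>) \<le> ?F n + ?G n" for n
  proof -
    have "(LINT x|lborel. \<bar>f (x + a n) + g (x + a n) - (f x + g x)\<bar>) \<le>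
       (LINT x|lborel. \<bar>f (x + a n) - f x\<bar> + \<bar>g (x + a n) - g x\<bar>)"
      by (rule integral_mono) (use i in auto)
    also have "\<dots> = ?F n + ?G n" using i by (intro Bochner_Integration.integral_add) auto
    finally show ?thesis by (simp add: integral_nonneg_AE)
  qed
  ultimately show "(\<lambda>n. LINT x|lborel. \<bar>f (x + a n) + g (x + a n) - (f x + g x)\<bar>) \<longlonglongrightarrow> 0"
    by (rule null_seq_bound[rotated])
qed

text \<open>Induction over integrable functions; outer regularity approximates the indicator of a
  Borel set of finite measure by indicators of open sets, and dominated convergence handles limits
  of simple functions.\<close>

lemma L1_shift_continuous_integrable:
  fixes f :: "real^'n::finite \<Rightarrow> real"
  assumes "integrable lborel f"
  shows "L1_shift_continuous f"
  using assms
proof (induct rule: integrable_induct)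
  case (base A c)
  have "L1_shift_continuous (indicator A :: real^'n \<Rightarrow> real)"
  proof (rule L1_shift_continuous_approx)
    show "integrable lborel (indicator A :: real^'n \<Rightarrow> real)"
      using base by (intro integrable_real_indicator) auto
    fix e :: real assume "e > 0"
    obtain U where U: "open U" "A \<subseteq> U" "emeasure lborel (U - A) < e"
      using outer_regular_lborel[of A e] base \<open>e > 0\<close> by auto
    have "emeasure lborel U = emeasure lborel (U - A) + emeasure lborel A"
      using U base by (subst plus_emeasure) (auto simp: Un_absorb2)
    also have "\<dots> < \<infinity>" using U(3) base by (auto simp: less_top[symmetric] elim: order.strict_trans1)
    finally have fin: "emeasure lborel U < \<infinity>" .
    have "\<bar>indicator A x - indicator U x :: real\<bar> = indicator (U - A) x" for x
      using U(2) by (auto simp: indicator_def)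
    then have "(LINT x|lborel. \<bar>indicator A x - indicator U x :: real\<bar>) = measure lborel (U - A)"
      using U base by simp
    also have "\<dots> < e"
    proof -
      have "emeasure lborel (U - A) = ennreal (measure lborel (U - A))"
        by (rule emeasure_eq_ennreal_measure) (use U(3) in auto)
      then show ?thesis using U(3) \<open>e > 0\<close> by (simp add: ennreal_less_iff)
    qed
    finally show "\<exists>g :: real^'n \<Rightarrow> real. integrable lborel g \<and> L1_shift_continuous g \<and> (LINT x|lborel. \<bar>indicator A x - g x\<bar>) < e"
      using U fin by (intro exI[of _ "indicator U"] conjI L1_shift_continuous_open integrable_real_indicator) auto
  qed
  from L1_shift_continuous_cmult[OF this, of c] show ?case by simp
next
  case (add f g)
  then show ?case by (intro L1_shift_continuous_add)
next
  case (lim f s)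
  show ?case
  proof (rule L1_shift_continuous_approx[OF lim(5)])
    fix e :: real assume "e > 0"
    have "(\<lambda>n. LINT x|lborel. \<bar>f x - s n x\<bar>) \<longlonglongrightarrow> (LINT x|(lborel::(real^'n) measure). 0)"
    proof (rule integral_dominated_convergence[where w = "\<lambda>x. 3 * \<bar>f x\<bar>"])
      show "(\<lambda>x. \<bar>f x - s n x\<bar>) \<in> borel_measurable lborel" for n
        using lim(5) lim(1)[of n] by auto
      have "(\<lambda>n. \<bar>f x - s n x\<bar>) \<longlonglongrightarrow> 0" for x
        using tendsto_rabs_zero[OF tendsto_diff[OF tendsto_const[of "f x"] lim(3)[of x], simplified]] by simp
      then show "AE x in lborel. (\<lambda>n. \<bar>f x - s n x\<bar>) \<longlonglongrightarrow> 0" by simp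
      have "\<bar>f x - s n x\<bar> \<le> 3 * \<bar>f x\<bar>" for n x
        using lim(4)[of x n] by auto
      then show "AE x in lborel. norm \<bar>f x - s n x\<bar> \<le> 3 * \<bar>f x\<bar>" for n by simp
    qed (use lim(5) in auto)
    from LIMSEQ_D[OF this, of e] \<open>e > 0\<close> obtain n where "\<bar>LINT x|lborel. \<bar>f x - s n x\<bar>\<bar> < e"
      by (auto simp: dist_real_def)
    then show "\<exists>g. integrable lborel g \<and> L1_shift_continuous g \<and> (LINT x|lborel. \<bar>f x - g x\<bar>) < e"
      using lim by (intro exI[of _ "s n"]) (auto simp: abs_less_iff)
  qed
qed

lemma L2_UNIV: "f \<in> L2_space lborel UNIV \<longleftrightarrow> f \<in> borel_measurable borel \<and> integrable lborel (\<lambda>x. (cmod (f x))\<^sup>2)"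
  by (simp add: L2_space_iff)

lemma L2_norm_UNIV: "L2_norm lborel UNIV f = sqrt (LINT x|lborel. (cmod (f x))\<^sup>2)"
  by (simp add: L2_norm_eq)

lemma L2_shift:
  fixes f :: "real^'n::finite \<Rightarrow> complex"
  assumes "f \<in> L2_space lborel UNIV"
  shows "(\<lambda>x. f (x + a)) \<in> L2_space lborel UNIV"
    and "L2_norm lborel UNIV (\<lambda>x. f (x + a)) = L2_norm lborel UNIV f"
proof -
  have [measurable]: "f \<in> borel_measurable borel" using assms by (simp add: L2_UNIV)
  have "integrable lborel (\<lambda>x. (cmod (f (x + a)))\<^sup>2)"
    using assms integrable_shift[of "\<lambda>x. (cmod (f x))\<^sup>2" a] by (simp add: L2_UNIV)
  then show "(\<lambda>x. f (x + a)) \<in> L2_space lborel UNIV" by (simp add: L2_UNIV)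
  show "L2_norm lborel UNIV (\<lambda>x. f (x + a)) = L2_norm lborel UNIV f"
    using integral_shift[of "\<lambda>x. (cmod (f x))\<^sup>2" a] by (simp add: L2_norm_UNIV)
qed

text \<open>For \<open>f \<ge> 0\<close> the \<open>L\<^sup>2\<close> claim reduces to the \<open>L\<^sup>1\<close> one for \<open>f\<^sup>2\<close>, by
  \<open>|s - t|\<^sup>2 \<le> |s\<^sup>2 - t\<^sup>2|\<close> for \<open>s, t \<ge> 0\<close>.\<close>
lemma L2_shift_continuous:
  fixes f :: "real^'n::finite \<Rightarrow> complex"
  assumes f: "f \<in> L2_space lborel UNIV" and a: "a \<longlonglongrightarrow> 0"
  shows "(\<lambda>n. L2_norm lborel UNIV (\<lambda>x. f (x + a n) - f x)) \<longlonglongrightarrow> 0"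
proof -
  define Q where "Q f \<longleftrightarrow> f \<in> L2_space lborel UNIV \<and> (\<lambda>n. L2_norm lborel UNIV (\<lambda>x. f (x + a n) - f x)) \<longlonglongrightarrow> 0"
    for f :: "real^'n \<Rightarrow> complex"
  have Q_add: "Q (\<lambda>x. g x + h x)" if "Q g" "Q h" for g h
  proof -
    have gh: "g \<in> L2_space lborel UNIV" "h \<in> L2_space lborel UNIV" using that by (auto simp: Q_def)
    have "norm (L2_norm lborel UNIV (\<lambda>x. g (x + a n) + h (x + a n) - (g x + h x))) \<le>
        L2_norm lborel UNIV (\<lambda>x. g (x + a n) - g x) + L2_norm lborel UNIV (\<lambda>x. h (x + a n) - h x)" for n
      using L2_triangle[OF L2_diff[OF L2_shift(1)[OF gh(1), of "a n"] gh(1)] L2_diff[OF L2_shift(1)[OF gh(2), of "a n"] gh(2)]]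
      by (simp add: algebra_simps)
    moreover have "(\<lambda>n. L2_norm lborel UNIV (\<lambda>x. g (x + a n) - g x) + L2_norm lborel UNIV (\<lambda>x. h (x + a n) - h x)) \<longlonglongrightarrow> 0"
      using that by (intro tendsto_add_zero) (auto simp: Q_def)
    ultimately have "(\<lambda>n. L2_norm lborel UNIV (\<lambda>x. g (x + a n) + h (x + a n) - (g x + h x))) \<longlonglongrightarrow> 0"
      by (rule null_seq_bound)
    with L2_add[OF gh] show ?thesis unfolding Q_def by blast
  qed
  have Q_cmult: "Q (\<lambda>x. c * g x)" if "Q g" for g c
  proof -
    have "(\<lambda>n. cmod c * L2_norm lborel UNIV (\<lambda>x. g (x + a n) - g x)) \<longlonglongrightarrow> 0"
      using that by (intro tendsto_mult_right_zero) (auto simp: Q_def)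
    then show ?thesis using that
      by (simp add: Q_def L2_cmult L2_norm_cmult[symmetric] right_diff_distrib)
  qed
  have Q_pos: "Q (\<lambda>x. of_real (p x))"
    if p: "p \<in> borel_measurable borel" "\<And>x. p x \<ge> 0" "\<And>x. p x \<le> cmod (f x)" for p
  proof -
    note [measurable] = p(1)
    have p2: "integrable lborel (\<lambda>x. (p x)\<^sup>2)"
      by (rule Bochner_Integration.integrable_bound[of _ "\<lambda>x. (cmod (f x))\<^sup>2"])
        (use f p in \<open>auto simp: L2_UNIV intro!: power_mono\<close>)
    then have pL: "(\<lambda>x. complex_of_real (p x)) \<in> L2_space lborel UNIV" by (simp add: L2_UNIV)
    have lim: "(\<lambda>n. LINT x|lborel. \<bar>(p (x + a n))\<^sup>2 - (p x)\<^sup>2\<bar>) \<longlonglongrightarrow> 0"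
      using L1_shift_continuous_integrable[OF p2] a by (simp add: L1_shift_continuous_def)
    have le: "L2_norm lborel UNIV (\<lambda>x. of_real (p (x + a n)) - of_real (p x)) \<le> sqrt (LINT x|lborel. \<bar>(p (x + a n))\<^sup>2 - (p x)\<^sup>2\<bar>)" for n
    proof -
      have sq: "(s - t)\<^sup>2 \<le> \<bar>s\<^sup>2 - t\<^sup>2\<bar>" if "s \<ge> 0" "t \<ge> 0" for s t :: real
      proof -
        have "(s - t)\<^sup>2 = \<bar>s - t\<bar> * \<bar>s - t\<bar>" by (simp add: power2_eq_square)
        also have "\<dots> \<le> \<bar>s - t\<bar> * (s + t)" using that by (intro mult_left_mono) auto
        also have "\<dots> = \<bar>s\<^sup>2 - t\<^sup>2\<bar>" using that by (simp add: power2_eq_square square_diff_square_factored abs_mult mult.commute)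
        finally show ?thesis .
      qed
      have "(LINT x|lborel. (p (x + a n) - p x)\<^sup>2) \<le> (LINT x|lborel. \<bar>(p (x + a n))\<^sup>2 - (p x)\<^sup>2\<bar>)"
      proof (rule integral_mono)
        have "integrable lborel (\<lambda>x. (cmod (of_real (p (x + a n)) - of_real (p x)))\<^sup>2)"
          using L2_diff[OF L2_shift(1)[OF pL, of "a n"] pL] by (simp add: L2_UNIV)
        then show "integrable lborel (\<lambda>x. (p (x + a n) - p x)\<^sup>2)"
          by (simp del: of_real_diff add: of_real_diff[symmetric])
      qed (use p2 integrable_shift[OF p2, of "a n"] sq p(2) in auto)
      then show ?thesis
        by (simp add: L2_norm_UNIV del: of_real_diff add: of_real_diff[symmetric])
    qed
    have "norm (L2_norm lborel UNIV (\<lambda>x. of_real (p (x + a n)) - of_real (p x))) \<le> sqrt (LINT x|lborel. \<bar>(p (x + a n))\<^sup>2 - (p x)\<^sup>2\<bar>)" for n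
      using le[of n] by (simp only: real_norm_def abs_of_nonneg[OF L2_norm_nonneg])
    moreover have "(\<lambda>n. sqrt (LINT x|lborel. \<bar>(p (x + a n))\<^sup>2 - (p x)\<^sup>2\<bar>)) \<longlonglongrightarrow> 0"
      using tendsto_real_sqrt[OF lim] by simp
    ultimately have "(\<lambda>n. L2_norm lborel UNIV (\<lambda>x. of_real (p (x + a n)) - of_real (p x))) \<longlonglongrightarrow> 0"
      by (rule null_seq_bound)
    with pL show ?thesis by (simp add: Q_def)
  qed
  have [measurable]: "f \<in> borel_measurable borel" using f by (simp add: L2_UNIV)
  \<comment> \<open>Four nonnegative parts of \<open>f\<close>, each dominated by
    \<open>cmod (f x)\<close>, because the comparison of squared difference and difference of
    squares is made for nonnegative numbers.\<close>
  let ?p = "\<lambda>x. max 0 (Re (f x))" and ?q = "\<lambda>x. max 0 (- Re (f x))"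
  let ?r = "\<lambda>x. max 0 (Im (f x))" and ?s = "\<lambda>x. max 0 (- Im (f x))"
  have bounds: "\<bar>Re z\<bar> \<le> cmod z" "\<bar>Im z\<bar> \<le> cmod z" for z by (rule abs_Re_le_cmod abs_Im_le_cmod)+
  have le_f: "?p x \<le> cmod (f x)" "?q x \<le> cmod (f x)" "?r x \<le> cmod (f x)" "?s x \<le> cmod (f x)" for x
    using bounds[of "f x"] by auto
  have m: "?p \<in> borel_measurable borel" "?q \<in> borel_measurable borel"
     "?r \<in> borel_measurable borel" "?s \<in> borel_measurable borel" by measurable
  have "Q (\<lambda>x. (of_real (?p x) + (-1) * of_real (?q x)) + (\<i> * of_real (?r x) + (- \<i>) * of_real (?s x)))"
    by (intro Q_add Q_cmult Q_pos m le_f max.cobounded1)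
  moreover have "(of_real (?p x) + (-1) * of_real (?q x)) + (\<i> * of_real (?r x) + (- \<i>) * of_real (?s x)) = f x" for x
    by (simp add: complex_eq_iff max_def)
  ultimately show ?thesis by (simp add: Q_def)
qed

text \<open>Averaging against a mollifier involves all shifts in a small ball at once, hence this
  uniform form; its failure would produce a null sequence of shifts contradicting the sequential
  statement.\<close>

lemma L2_shift_continuous_ball:
  fixes f :: "real^'n::finite \<Rightarrow> complex"
  assumes f: "f \<in> L2_space lborel UNIV" and "e > 0"
  shows "\<exists>d>0. \<forall>a. norm a < d \<longrightarrow> L2_norm lborel UNIV (\<lambda>x. f (x + a) - f x) < e"
proof (rule ccontr)
  assume "\<not> ?thesis"
  then have "\<exists>a. norm a < d \<and> \<not> L2_norm lborel UNIV (\<lambda>x. f (x + a) - f x) < e" if "d > 0" for d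
    using that by blast
  then have "\<forall>n. \<exists>a. norm a < inverse (real (Suc n)) \<and> \<not> L2_norm lborel UNIV (\<lambda>x. f (x + a) - f x) < e"
    by simp
  from choice[OF this] obtain a where a: "\<And>n. norm (a n) < inverse (real (Suc n))"
      "\<And>n. \<not> L2_norm lborel UNIV (\<lambda>x. f (x + a n) - f x) < e" by blast
  have "a \<longlonglongrightarrow> 0"
    by (rule null_seq_bound[OF less_imp_le[OF a(1)] LIMSEQ_inverse_real_of_nat])
  from LIMSEQ_D[OF L2_shift_continuous[OF f this] \<open>e > 0\<close>] a(2) show False by auto
qed

lemma conv_alt:
  fixes f :: "real^'n::finite \<Rightarrow> 'b::euclidean_space"
  assumes [measurable]: "f \<in> borel_measurable borel" "\<rho> \<in> borel_measurable borel"
  shows "conv \<rho> f x = (LINT z|lborel. \<rho> z *\<^sub>R f (x - z))"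
proof -
  have "(lborel :: (real^'n) measure) = distr lborel borel (\<lambda>z. x - z)"
    using lborel_affine[of "-1" x] by (simp add: density_1)
  then have "(LINT z|lborel. \<rho> z *\<^sub>R f (x - z)) = (LINT z|distr lborel borel (\<lambda>z. x - z). \<rho> z *\<^sub>R f (x - z))"
    by simp
  also have "\<dots> = (LINT z|lborel. \<rho> (x - z) *\<^sub>R f (x - (x - z)))"
    by (rule integral_distr) auto
  finally show ?thesis by (simp add: conv_def)
qed

text \<open>By Fubini the pairing is the average, against the mollifier, of \<open>I z\<close>, the
  pairing of \<open>F\<close> with the shift of \<open>f\<close> by \<open>z\<close>; and
  \<open>I\<close> is continuous at 0. All later passages to the limit pair a mollification with a
  fixed square integrable function, so weak convergence is the mode that is required.\<close>

lemma conv_weak_limit: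
  fixes F f :: "real^'n::finite \<Rightarrow> complex"
  assumes F: "F \<in> L2_space lborel UNIV" and f: "f \<in> L2_space lborel UNIV"
    and \<rho>: "\<And>n. mollifier (r n) (\<rho> n)" and r: "r \<longlonglongrightarrow> 0"
  shows "(\<lambda>n. LINT x|lborel. F x * conv (\<rho> n) f x) \<longlonglongrightarrow> (LINT x|lborel. F x * f x)"
proof (rule LIMSEQ_I)
  fix e :: real assume "e > 0"
  have [measurable]: "F \<in> borel_measurable borel" "f \<in> borel_measurable borel"
    using F f by (simp_all add: L2_UNIV)
  define NF where "NF = L2_norm lborel UNIV F"
  have NF: "NF \<ge> 0" by (simp add: NF_def)
  define I where "I z = (LINT x|lborel. F x * f (x - z))" for z
  have prod_int: "integrable lborel (\<lambda>x. F x * g x)" if "g \<in> L2_space lborel UNIV" for g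
    using F that by (intro integrable_mult_square) (auto simp: L2_UNIV)
  have prod_le: "cmod (LINT x|lborel. F x * g x) \<le> NF * L2_norm lborel UNIV g"
    if "g \<in> L2_space lborel UNIV" for g
    using L2_cauchy_schwarz[OF F L2_cnj[OF that]]
    by (simp add: L2_inner_def NF_def L2_norm_UNIV set_lebesgue_integral_def)
  have sh: "(\<lambda>x. f (x - z)) \<in> L2_space lborel UNIV" "L2_norm lborel UNIV (\<lambda>x. f (x - z)) = L2_norm lborel UNIV f" for z
    using L2_shift[OF f, of "- z"] by simp_all
  \<comment> \<open>Adding one to \<open>NF\<close> keeps the denominator positive when
    \<open>F\<close> vanishes almost everywhere.\<close>
  obtain d where d: "d > 0" "\<And>a. norm a < d \<Longrightarrow> L2_norm lborel UNIV (\<lambda>x. f (x + a) - f x) < e / (2 * (NF + 1))"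
    using L2_shift_continuous_ball[OF f, of "e / (2 * (NF + 1))"] \<open>e > 0\<close> NF by auto
  have Idiff: "cmod (I z - I 0) \<le> e / 2" if "norm z < d" for z
  proof -
    have "I z - I 0 = (LINT x|lborel. F x * (f (x - z) - f x))"
      unfolding I_def using prod_int[OF sh(1)] prod_int[OF f]
      by (subst Bochner_Integration.integral_diff[symmetric]) (auto simp: right_diff_distrib)
    also have "cmod \<dots> \<le> NF * L2_norm lborel UNIV (\<lambda>x. f (x - z) - f x)"
      by (intro prod_le L2_diff sh f)
    also have "\<dots> \<le> NF * (e / (2 * (NF + 1)))"
      using d(2)[of "- z"] that NF by (intro mult_left_mono) auto
    also have "\<dots> \<le> e / 2" using NF \<open>e > 0\<close> by (simp add: field_simps)
    finally show ?thesis .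
  qed
  have Ibound: "cmod (I z) \<le> NF * L2_norm lborel UNIV f" for z
    using prod_le[OF sh(1), of z] by (simp add: I_def sh)
  have I_meas [measurable]: "I \<in> borel_measurable borel"
    unfolding I_def[abs_def] by measurable
  obtain N where N: "\<And>n. n \<ge> N \<Longrightarrow> \<bar>r n\<bar> < d" using LIMSEQ_D[OF r d(1)] by auto
  have "cmod ((LINT x|lborel. F x * conv (\<rho> n) f x) - (LINT x|lborel. F x * f x)) \<le> e / 2" if n: "n \<ge> N" for n
  proof -
    have \<rho>i: "integrable lborel (\<rho> n)" and \<rho>1: "(LINT x|lborel. \<rho> n x) = 1" and \<rho>0: "\<And>x. \<rho> n x \<ge> 0"
      and \<rho>z: "\<And>x. norm x \<ge> r n \<Longrightarrow> \<rho> n x = 0"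
      using \<rho>[of n] by (auto simp: mollifier_def)
    have [measurable]: "\<rho> n \<in> borel_measurable borel" using \<rho>i by auto
    let ?G = "\<lambda>(z, x). \<rho> n z *\<^sub>R (F x * f (x - z))"
    have fub: "integrable (lborel \<Otimes>\<^sub>M lborel) ?G"
    proof (rule lborel_pair.Fubini_integrable)
      show "?G \<in> borel_measurable (lborel \<Otimes>\<^sub>M lborel)" by measurable
      have eq: "(LINT x|lborel. norm (?G (z, x))) = \<rho> n z * (LINT x|lborel. cmod (F x * f (x - z)))" for z
        using \<rho>0[of z] by simp
      have le: "(LINT x|lborel. cmod (F x * f (x - z))) \<le> NF * L2_norm lborel UNIV f" for z
      proof -
        have 1: "(\<lambda>x. complex_of_real (cmod (F x))) \<in> L2_space lborel UNIV"
          using F by (simp add: L2_UNIV)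
        have 2: "(\<lambda>x. complex_of_real (cmod (f (x - z)))) \<in> L2_space lborel UNIV"
          using sh(1)[of z] by (simp add: L2_UNIV)
        have "(LINT x|lborel. cmod (F x * f (x - z))) = Re (L2_inner lborel UNIV (\<lambda>x. of_real (cmod (F x))) (\<lambda>x. of_real (cmod (f (x - z)))))"
          by (simp add: L2_inner_def set_lebesgue_integral_def norm_mult flip: of_real_mult)
        also have "\<dots> \<le> L2_norm lborel UNIV (\<lambda>x. of_real (cmod (F x))) * L2_norm lborel UNIV (\<lambda>x. of_real (cmod (f (x - z))))"
          using L2_cauchy_schwarz[OF 1 2] complex_Re_le_cmod order_trans by blast
        also have "\<dots> = NF * L2_norm lborel UNIV f"
          using sh(2)[of z] by (simp add: NF_def L2_norm_UNIV)
        finally show ?thesis .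
      qed
      show "integrable lborel (\<lambda>z. LINT x|lborel. norm (?G (z, x)))"
        unfolding eq
      proof (rule Bochner_Integration.integrable_bound[OF integrable_mult_left[OF \<rho>i, of "NF * L2_norm lborel UNIV f"]])
        show "AE z in lborel. norm (\<rho> n z * (LINT x|lborel. cmod (F x * f (x - z)))) \<le> norm (\<rho> n z * (NF * L2_norm lborel UNIV f))"
          using le \<rho>0 NF by (intro AE_I2) (simp add: abs_mult integral_nonneg_AE mult_left_mono)
      qed measurable
      show "AE z in lborel. integrable lborel (\<lambda>x. ?G (z, x))"
        using prod_int[OF sh(1)] by (intro AE_I2) simp
    qed
    have "(LINT x|lborel. F x * conv (\<rho> n) f x) = (LINT x|lborel. LINT z|lborel. ?G (z, x))"
      by (intro Bochner_Integration.integral_cong refl) (simp add: conv_alt flip: integral_mult_right_zero)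
    also have "\<dots> = (LINT z|lborel. LINT x|lborel. ?G (z, x))"
      using lborel_pair.Fubini_integral[of "\<lambda>x z. ?G (z, x)"] fub
        lborel_pair.integrable_product_swap[OF fub] lborel_pair.Fubini_integral[of "\<lambda>z x. ?G (z, x)"] by simp
    also have "\<dots> = (LINT z|lborel. \<rho> n z *\<^sub>R I z)" by (simp add: I_def)
    finally have 1: "(LINT x|lborel. F x * conv (\<rho> n) f x) = (LINT z|lborel. \<rho> n z *\<^sub>R I z)" .
    have 2: "(LINT x|lborel. F x * f x) = (LINT z|lborel. \<rho> n z *\<^sub>R I 0)"
      using \<rho>1 \<rho>i by (simp add: I_def)
    have int1: "integrable lborel (\<lambda>z. \<rho> n z *\<^sub>R I z)"
      by (rule Bochner_Integration.integrable_bound[OF integrable_mult_left[OF \<rho>i, of "NF * L2_norm lborel UNIV f"]])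
        (use Ibound NF in \<open>auto intro!: mult_left_mono simp: abs_mult\<close>)
    have int2: "integrable lborel (\<lambda>z. \<rho> n z *\<^sub>R I 0)" using \<rho>i by simp
    have "cmod ((LINT z|lborel. \<rho> n z *\<^sub>R I z) - (LINT z|lborel. \<rho> n z *\<^sub>R I 0))
       = cmod (LINT z|lborel. \<rho> n z *\<^sub>R (I z - I 0))"
      using int1 int2 by (subst Bochner_Integration.integral_diff[symmetric]) (auto simp: scaleR_diff_right)
    also have "\<dots> \<le> (LINT z|lborel. norm (\<rho> n z *\<^sub>R (I z - I 0)))"
      by (rule integral_norm_bound)
    also have "\<dots> \<le> (LINT z|lborel. \<rho> n z * (e / 2))"
    proof (rule integral_mono)
      show "integrable lborel (\<lambda>z. norm (\<rho> n z *\<^sub>R (I z - I 0)))" using int1 int2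
        by (intro integrable_norm) (simp add: scaleR_diff_right)
      show "norm (\<rho> n z *\<^sub>R (I z - I 0)) \<le> \<rho> n z * (e / 2)" for z
      proof (cases "norm z < r n")
        case True
        then have "norm z < d" using N[OF n] by linarith
        from mult_left_mono[OF Idiff[OF this] \<rho>0[of z]] show ?thesis using \<rho>0[of z] by simp
      qed (use \<rho>z in simp)
    qed (use \<rho>i in simp)
    also have "\<dots> = e / 2" using \<rho>1 \<rho>i by simp
    finally show ?thesis unfolding 1 2 .
  qed
  then show "\<exists>N. \<forall>n\<ge>N. norm ((LINT x|lborel. F x * conv (\<rho> n) f x) - (LINT x|lborel. F x * f x)) < e"
    using \<open>e > 0\<close> by (intro exI[of _ N]) force
qed

section \<open>Testing weak gradients\<close>

text \<open>Extension by zero turns integrals over \<open>\<Omega>\<close> into integrals over the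
  whole space, where translation and convolution are defined.\<close>

definition zero_ext :: "'a set \<Rightarrow> ('a \<Rightarrow> complex) \<Rightarrow> 'a \<Rightarrow> complex" where
  "zero_ext \<Omega> u = (\<lambda>x. indicator \<Omega> x *\<^sub>R u x)"

lemma zero_ext_in [simp]: "x \<in> \<Omega> \<Longrightarrow> zero_ext \<Omega> u x = u x"
  and zero_ext_out [simp]: "x \<notin> \<Omega> \<Longrightarrow> zero_ext \<Omega> u x = 0"
  by (auto simp: zero_ext_def)

lemma zero_ext_L2: "u \<in> L2_space lborel \<Omega> \<Longrightarrow> zero_ext \<Omega> u \<in> L2_space lborel UNIV"
  by (simp add: L2_space_iff zero_ext_def)

lemma zero_ext_cnj: "zero_ext \<Omega> (\<lambda>x. cnj (u x)) x = cnj (zero_ext \<Omega> u x)"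
  by (simp add: zero_ext_def)

lemma set_integral_zero_ext: "(LINT x:\<Omega>|M. \<phi> x *\<^sub>R u x) = (LINT x|M. of_real (\<phi> x) * zero_ext \<Omega> u x)"
  unfolding set_lebesgue_integral_def zero_ext_def
  by (intro Bochner_Integration.integral_cong refl) (simp add: scaleR_conv_of_real indicator_def)

text \<open>Test functions with one continuous derivative, possibly complex valued, with the
  derivative carried along as an argument. Cut-offs that are once differentiable and products with
  complex mollifications thereby become admissible.\<close>

definition C1_test :: "(real^'n::finite) set \<Rightarrow> (real^'n \<Rightarrow> 'b::euclidean_space) \<Rightarrow> ('n \<Rightarrow> real^'n \<Rightarrow> 'b) \<Rightarrow> bool" where
  "C1_test \<Omega> \<phi> \<phi>' \<longleftrightarrow> (\<forall>x. has_grad \<phi> (\<lambda>i. \<phi>' i x) x) \<and> (\<forall>i. continuous_on UNIV (\<phi>' i)) \<and>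
     (\<exists>K. compact K \<and> K \<subseteq> \<Omega> \<and> (\<forall>x. x \<notin> K \<longrightarrow> \<phi> x = 0))"

lemma has_grad_zero_outside:
  assumes "closed K" "\<And>x. x \<notin> K \<Longrightarrow> \<phi> x = 0" "x \<notin> K" "has_grad \<phi> G x"
  shows "G i = 0"
proof -
  have "has_grad \<phi> (\<lambda>_. 0) x"
    by (rule has_grad_transform[OF has_grad_const, of "- K" x 0]) (use assms in auto)
  from has_grad_unique[OF this assms(4)] show ?thesis by (metis)
qed

lemma C1_testE:
  assumes "C1_test \<Omega> \<phi> \<phi>'"
  obtains K where "compact K" "K \<subseteq> \<Omega>" "\<And>x. x \<notin> K \<Longrightarrow> \<phi> x = 0" "\<And>i x. x \<notin> K \<Longrightarrow> \<phi>' i x = 0"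
    "continuous_on UNIV \<phi>" "\<And>i. continuous_on UNIV (\<phi>' i)"
proof -
  obtain K where K: "compact K" "K \<subseteq> \<Omega>" "\<And>x. x \<notin> K \<Longrightarrow> \<phi> x = 0"
    using assms unfolding C1_test_def by blast
  have g: "has_grad \<phi> (\<lambda>i. \<phi>' i x) x" for x using assms unfolding C1_test_def by blast
  have "\<phi>' i x = 0" if "x \<notin> K" for i x
    using has_grad_zero_outside[OF compact_imp_closed[OF K(1)] K(3) that g[of x]] .
  moreover have "continuous_on UNIV \<phi>"
    using g has_grad_isCont by (blast intro: continuous_at_imp_continuous_on)
  ultimately show thesis using that[OF K] assms unfolding C1_test_def by blast
qed

lemma test_function_C1_test:
  assumes "test_function \<Omega> \<phi>"
  shows "C1_test \<Omega> \<phi> (\<lambda>i. partial i \<phi>)"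
proof -
  have "C_k 1 \<phi>" using assms unfolding test_function_def by blast
  then have "\<phi> differentiable (at x)" "continuous_on UNIV (partial i \<phi>)" for x i by simp_all
  then show ?thesis
    using assms has_grad_partial unfolding C1_test_def test_function_def by blast
qed

lemma C1_test_of_real:
  assumes "C1_test \<Omega> \<phi> \<phi>'"
  shows "C1_test \<Omega> (\<lambda>x. complex_of_real (\<phi> x)) (\<lambda>i x. of_real (\<phi>' i x))"
proof -
  have "has_grad (\<lambda>x. complex_of_real (\<phi> x)) (\<lambda>i. of_real (\<phi>' i x)) x" if "has_grad \<phi> (\<lambda>i. \<phi>' i x) x" for x
  proof -
    have "((\<lambda>x. complex_of_real (\<phi> x)) has_derivative (\<lambda>h. of_real (\<Sum>i\<in>UNIV. (h $ i) *\<^sub>R \<phi>' i x))) (at x)"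
      by (rule bounded_linear.has_derivative[OF bounded_linear_of_real that[unfolded has_grad_def]])
    then show ?thesis by (simp add: has_grad_def scaleR_conv_of_real)
  qed
  then show ?thesis using assms unfolding C1_test_def
    by (auto intro!: continuous_intros)
qed

lemma C1_test_Re_Im:
  fixes \<phi> :: "real^'n::finite \<Rightarrow> complex"
  assumes "C1_test \<Omega> \<phi> \<phi>'"
  shows "C1_test \<Omega> (\<lambda>x. Re (\<phi> x)) (\<lambda>i x. Re (\<phi>' i x))" "C1_test \<Omega> (\<lambda>x. Im (\<phi> x)) (\<lambda>i x. Im (\<phi>' i x))"
proof -
  have "has_grad (\<lambda>x. Re (\<phi> x)) (\<lambda>i. Re (\<phi>' i x)) x" "has_grad (\<lambda>x. Im (\<phi> x)) (\<lambda>i. Im (\<phi>' i x)) x"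
    if "has_grad \<phi> (\<lambda>i. \<phi>' i x) x" for x
    using bounded_linear.has_derivative[OF bounded_linear_Re that[unfolded has_grad_def]]
      bounded_linear.has_derivative[OF bounded_linear_Im that[unfolded has_grad_def]]
    by (simp_all add: has_grad_def)
  then show "C1_test \<Omega> (\<lambda>x. Re (\<phi> x)) (\<lambda>i x. Re (\<phi>' i x))" "C1_test \<Omega> (\<lambda>x. Im (\<phi> x)) (\<lambda>i x. Im (\<phi>' i x))"
    using assms unfolding C1_test_def by (auto intro!: continuous_intros)
qed

lemma continuous_compact_support_L2:
  fixes f :: "real^'n::finite \<Rightarrow> complex"
  assumes "continuous_on UNIV f" "compact K" "\<And>x. x \<notin> K \<Longrightarrow> f x = 0"
  shows "f \<in> L2_space lborel UNIV"
  unfolding L2_UNIV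
proof
  show "f \<in> borel_measurable borel" using assms(1) by (rule borel_measurable_continuous_onI)
  show "integrable lborel (\<lambda>x. (cmod (f x))\<^sup>2)"
    by (rule continuous_compact_support_integrable[OF _ assms(2)]) (use assms in \<open>auto intro!: continuous_intros\<close>)
qed

lemma L2_mult_integrable:
  assumes "f \<in> L2_space M UNIV" "g \<in> L2_space M UNIV"
  shows "integrable M (\<lambda>x. f x * g x)"
  using integrable_mult_square[of f M g] assms by (simp add: L2_space_iff)

lemma C1_test_L2:
  fixes \<phi> :: "real^'n::finite \<Rightarrow> complex"
  assumes "C1_test \<Omega> \<phi> \<phi>'"
  shows "\<phi> \<in> L2_space lborel UNIV" "\<phi>' i \<in> L2_space lborel UNIV"
  using assms by (auto elim!: C1_testE intro: continuous_compact_support_L2)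

lemma compact_subset_open_distance:
  fixes K :: "'a::euclidean_space set"
  assumes "compact K" "K \<subseteq> \<Omega>" "open \<Omega>"
  obtains d where "d > 0" "\<And>x y. x \<in> K \<Longrightarrow> dist x y \<le> d \<Longrightarrow> y \<in> \<Omega>"
proof -
  obtain e where e: "e > 0" "(\<Union>x\<in>K. ball x e) \<subseteq> \<Omega>"
    using compact_subset_open_imp_ball_epsilon_subset[OF assms(1,3,2)] by blast
  show thesis
    by (rule that[of "e / 2"]) (use e in \<open>auto simp: dist_commute subset_eq\<close>)
qed

lemma
  fixes \<rho> :: "real^'n::finite \<Rightarrow> real"
  shows C_k_reflect: "C_k k \<rho> \<Longrightarrow> C_k k (\<lambda>y. \<rho> (x - y))"
  and partial_reflect: "\<rho> differentiable (at (x - y)) \<Longrightarrow> partial i (\<lambda>y. \<rho> (x - y)) y = - partial i \<rho> (x - y)"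
proof -
  have grad: "has_grad (\<lambda>y. \<rho> (x - y)) (\<lambda>i. - partial i \<rho> (x - y)) y"
    if "\<rho> differentiable (at (x - y))" for \<rho> :: "real^'n \<Rightarrow> real" and y
  proof (rule has_gradI)
    let ?L = "\<lambda>h. \<Sum>i\<in>UNIV. (h $ i) *\<^sub>R partial i \<rho> (x - y)"
    have "((\<lambda>y. x - y) has_derivative (\<lambda>h. - h)) (at y)" by (auto intro!: derivative_eq_intros)
    from has_derivative_compose[OF this has_grad_partial[OF that, unfolded has_grad_def]]
    show "((\<lambda>y. \<rho> (x - y)) has_derivative (\<lambda>h. ?L (- h))) (at y)" .
    show "?L (- axis i 1) = - partial i \<rho> (x - y)" for i
      using sum_axis_scaleR[of i "\<lambda>i. partial i \<rho> (x - y)"] by (simp add: sum_negf)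
  qed
  then show "\<rho> differentiable (at (x - y)) \<Longrightarrow> partial i (\<lambda>y. \<rho> (x - y)) y = - partial i \<rho> (x - y)"
    by (rule partial_eq)
  show "C_k k \<rho> \<Longrightarrow> C_k k (\<lambda>y. \<rho> (x - y))"
  proof (induction k arbitrary: \<rho>)
    case 0
    then show ?case by (auto intro!: continuous_on_compose2[of UNIV \<rho>] continuous_intros)
  next
    case (Suc k)
    show ?case
    proof (rule C_k_SucI)
      show "has_grad (\<lambda>y. \<rho> (x - y)) (\<lambda>i. (- 1) * partial i \<rho> (x - y)) y" for y
        using grad[of \<rho> y] Suc.prems by simp
      show "C_k k (\<lambda>y. (- 1) * partial i \<rho> (x - y))" for i
        by (intro C_k_mult C_k_const Suc.IH) (use Suc.prems in simp)
    qed
  qed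
qed

lemma mollifierD:
  assumes "mollifier r \<rho>"
  shows "C_k k \<rho>" "\<rho> x \<ge> 0" "norm x \<ge> r \<Longrightarrow> \<rho> x = 0" "integrable lborel \<rho>" "(LINT x|lborel. \<rho> x) = 1"
    "continuous_on UNIV \<rho>" "\<rho> \<in> borel_measurable borel" "\<rho> differentiable (at x)"
    "x \<notin> cball 0 r \<Longrightarrow> \<rho> x = 0" "x \<notin> cball 0 r \<Longrightarrow> partial i \<rho> x = 0"
proof -
  show *: "C_k k \<rho>" "\<rho> x \<ge> 0" "norm x \<ge> r \<Longrightarrow> \<rho> x = 0" "integrable lborel \<rho>" "(LINT x|lborel. \<rho> x) = 1"
    for k x using assms by (auto simp: mollifier_def)
  show c: "continuous_on UNIV \<rho>" using *(1)[of 0] by simp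
  show "\<rho> \<in> borel_measurable borel" using c by (rule borel_measurable_continuous_onI)
  show "\<rho> differentiable (at x)" using *(1)[of 1] by simp
  show z: "x \<notin> cball 0 r \<Longrightarrow> \<rho> x = 0" for x using *(3)[of x] by simp
  show "x \<notin> cball 0 r \<Longrightarrow> partial i \<rho> x = 0"
    by (rule partial_zero_outside[OF closed_cball z])
qed

text \<open>Used as a test function in \<open>y\<close>, the kernel moves a derivative from the
  mollifier onto the mollified function, at every \<open>x\<close> whose closed ball of radius
  \<open>r\<close> lies in \<open>\<Omega>\<close>.\<close>

lemma test_function_reflect:
  assumes "mollifier r \<rho>" "\<And>y. dist x y \<le> r \<Longrightarrow> y \<in> \<Omega>"
  shows "test_function \<Omega> (\<lambda>y. \<rho> (x - y))"
  unfolding test_function_def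
proof (intro conjI allI exI[of _ "cball x r"] impI)
  show "C_k k (\<lambda>y. \<rho> (x - y))" for k by (intro C_k_reflect mollifierD[OF assms(1)])
  show "cball x r \<subseteq> \<Omega>" using assms(2) by auto
  show "y \<notin> cball x r \<Longrightarrow> \<rho> (x - y) = 0" for y
    by (intro mollifierD(9)[OF assms(1)]) (simp add: dist_norm norm_minus_commute)
qed simp

lemma conv_of_real: "conv \<rho> (\<lambda>x. complex_of_real (f x)) x = of_real (conv \<rho> f x)"
  unfolding conv_def
  by (simp add: scaleR_conv_of_real flip: of_real_mult)

lemma conv_commute:
  fixes f \<rho> :: "real^'n::finite \<Rightarrow> real"
  assumes "f \<in> borel_measurable borel" "\<rho> \<in> borel_measurable borel"
  shows "conv \<rho> f = conv f \<rho>"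
proof
  show "conv \<rho> f x = conv f \<rho> x" for x
    unfolding conv_alt[OF assms] by (simp add: conv_def mult.commute)
qed

lemma mollifier_sequence:
  assumes "d > 0"
  obtains \<rho> :: "nat \<Rightarrow> real^'n::finite \<Rightarrow> real" and r
  where "\<And>n. mollifier (r n) (\<rho> n)" "r \<longlonglongrightarrow> 0" "\<And>n. 0 < r n \<and> r n \<le> d"
proof -
  define r where "r n = d * inverse (real (Suc n))" for n
  have pos: "0 < r n" for n using assms by (simp add: r_def)
  have "\<forall>n. \<exists>\<rho> :: real^'n \<Rightarrow> real. mollifier (r n) \<rho>" using mollifier_exists[OF pos] by blast
  from choice[OF this] obtain \<rho> :: "nat \<Rightarrow> real^'n \<Rightarrow> real" where "\<forall>n. mollifier (r n) (\<rho> n)" by blast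
  moreover have "r n \<le> d" for n
    using assms mult_left_mono[of "inverse (real (Suc n))" 1 d] by (simp add: r_def inverse_le_1_iff)
  moreover have "r \<longlonglongrightarrow> 0"
    unfolding r_def[abs_def] by (intro tendsto_mult_right_zero LIMSEQ_inverse_real_of_nat)
  ultimately show thesis using that pos by blast
qed

lemma weak_gradient_L2: "has_weak_gradient \<Omega> u G \<Longrightarrow> (\<lambda>x. G x $ i) \<in> L2_space lborel \<Omega>"
  by (simp add: has_weak_gradient_def)

text \<open>Smoothing is applied to \<open>\<phi>\<close> and leaves \<open>u\<close> and
  \<open>G\<close> untouched: \<open>conv (\<rho> n) \<phi>\<close> is smooth with compact support
  in \<open>\<Omega>\<close>, so it satisfies the defining identity, and both sides converge by
  \<open>conv_weak_limit\<close>.\<close>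

lemma weak_gradient_real_test:
  fixes \<phi> :: "real^'n::finite \<Rightarrow> real"
  assumes \<Omega>: "open \<Omega>" and u: "u \<in> L2_space lborel \<Omega>" "has_weak_gradient \<Omega> u G"
    and \<phi>: "C1_test \<Omega> \<phi> \<phi>'"
  shows "(LINT x|lborel. zero_ext \<Omega> u x * of_real (\<phi>' i x)) =
    - (LINT x|lborel. zero_ext \<Omega> (\<lambda>x. G x $ i) x * of_real (\<phi> x))"
proof -
  obtain K where K: "compact K" "K \<subseteq> \<Omega>" "\<And>x. x \<notin> K \<Longrightarrow> \<phi> x = 0" "\<And>i x. x \<notin> K \<Longrightarrow> \<phi>' i x = 0"
    "continuous_on UNIV \<phi>" "\<And>i. continuous_on UNIV (\<phi>' i)"
    using C1_testE[OF \<phi>] by metis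
  obtain d where d: "d > 0" "\<And>x y. x \<in> K \<Longrightarrow> dist x y \<le> d \<Longrightarrow> y \<in> \<Omega>"
    using compact_subset_open_distance[OF K(1,2) \<Omega>] by blast
  obtain \<rho> :: "nat \<Rightarrow> real^'n \<Rightarrow> real" and r
    where \<rho>: "\<And>n. mollifier (r n) (\<rho> n)" and r: "r \<longlonglongrightarrow> 0" and rd: "\<And>n. 0 < r n \<and> r n \<le> d"
    using mollifier_sequence[OF d(1)] by metis
  have part: "partial j \<phi> = \<phi>' j" for j
  proof
    fix x show "partial j \<phi> x = \<phi>' j x" using \<phi> by (intro partial_eq) (simp add: C1_test_def)
  qed
  have C1: "C_k 1 \<phi>"
    using \<phi> K(6) by (auto simp: part C1_test_def intro: has_grad_differentiable)
  have m: "\<phi> \<in> borel_measurable borel" "\<phi>' j \<in> borel_measurable borel" for j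
    using K(5,6) by (auto intro: borel_measurable_continuous_onI)
  have \<phi>int: "integrable lborel \<phi>" by (rule continuous_compact_support_integrable[OF K(5,1,3)])
  \<comment> \<open>Here \<open>\<phi>\<close> acts as the differentiable kernel and the mollifier
    as the integrable factor, so that the derivative falls on \<open>\<phi>\<close>; commutativity
    of convolution restores the order.\<close>
  have pc: "partial j (conv (\<rho> n) \<phi>) x = conv (\<rho> n) (\<phi>' j) x" for n j x
  proof (rule partial_eq)
    have "has_grad (conv \<phi> (\<rho> n)) (\<lambda>j. conv (partial j \<phi>) (\<rho> n) x) x"
      by (rule conv_has_grad[OF mollifierD(4)[OF \<rho>] C1 K(1,3)]) (simp_all add: part K)
    then show "has_grad (conv (\<rho> n) \<phi>) (\<lambda>j. conv (\<rho> n) (\<phi>' j) x) x"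
      by (simp only: part conv_commute[OF m(1) mollifierD(7)[OF \<rho>]] conv_commute[OF m(2) mollifierD(7)[OF \<rho>]])
  qed
  have tf: "test_function \<Omega> (conv (\<rho> n) \<phi>)" for n
    unfolding test_function_def
  proof (intro conjI allI exI[of _ "{x + y |x y. x \<in> K \<and> y \<in> cball 0 d}"] impI)
    show "C_k k (conv (\<rho> n) \<phi>)" for k
      by (rule C_k_conv[OF \<phi>int, of _ "cball 0 (r n)"]) (auto intro: mollifierD[OF \<rho>])
    show "compact {x + y |x y. x \<in> K \<and> y \<in> cball 0 d}" by (intro compact_sums K compact_cball)
    show "{x + y |x y. x \<in> K \<and> y \<in> cball 0 d} \<subseteq> \<Omega>"
      using d(2) by (force simp: dist_norm)
    fix x assume x: "x \<notin> {x + y |x y. x \<in> K \<and> y \<in> cball 0 d}"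
    have "\<rho> n (x - y) *\<^sub>R \<phi> y = 0" for y
    proof (cases "y \<in> K")
      case True
      have "x - y \<notin> cball 0 d"
      proof
        assume "x - y \<in> cball 0 d"
        moreover have "x = y + (x - y)" by simp
        ultimately show False using x True by blast
      qed
      then show ?thesis using mollifierD(3)[OF \<rho>[of n], of "x - y"] rd[of n] by simp
    qed (use K in simp)
    then show "conv (\<rho> n) \<phi> x = 0" by (simp only: conv_def Bochner_Integration.integral_zero)
  qed
  have "(LINT x|lborel. zero_ext \<Omega> u x * conv (\<rho> n) (\<lambda>x. of_real (\<phi>' i x)) x) =
    - (LINT x|lborel. zero_ext \<Omega> (\<lambda>x. G x $ i) x * conv (\<rho> n) (\<lambda>x. of_real (\<phi> x)) x)" for n
  proof -
    have "(LINT x:\<Omega>|lborel. partial i (conv (\<rho> n) \<phi>) x *\<^sub>R u x) = - (LINT x:\<Omega>|lborel. conv (\<rho> n) \<phi> x *\<^sub>R G x $ i)"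
      using u(2) tf[of n] unfolding has_weak_gradient_def by blast
    then show ?thesis unfolding set_integral_zero_ext pc conv_of_real by (simp only: mult.commute)
  qed
  moreover have "(\<lambda>n. LINT x|lborel. zero_ext \<Omega> u x * conv (\<rho> n) (\<lambda>x. of_real (\<phi>' i x)) x)
      \<longlonglongrightarrow> (LINT x|lborel. zero_ext \<Omega> u x * of_real (\<phi>' i x))"
    by (intro conv_weak_limit[OF _ _ \<rho> r] zero_ext_L2 u C1_test_L2[OF C1_test_of_real[OF \<phi>]])
  moreover have "(\<lambda>n. - (LINT x|lborel. zero_ext \<Omega> (\<lambda>x. G x $ i) x * conv (\<rho> n) (\<lambda>x. of_real (\<phi> x)) x))
      \<longlonglongrightarrow> - (LINT x|lborel. zero_ext \<Omega> (\<lambda>x. G x $ i) x * of_real (\<phi> x))"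
    by (intro tendsto_minus conv_weak_limit[OF _ _ \<rho> r] zero_ext_L2 weak_gradient_L2[OF u(2)] C1_test_L2[OF C1_test_of_real[OF \<phi>]])
  ultimately show ?thesis using LIMSEQ_unique by force
qed

lemma weak_gradient_test:
  fixes \<phi> :: "real^'n::finite \<Rightarrow> complex"
  assumes \<Omega>: "open \<Omega>" and u: "u \<in> L2_space lborel \<Omega>" "has_weak_gradient \<Omega> u G"
    and \<phi>: "C1_test \<Omega> \<phi> \<phi>'"
  shows "(LINT x|lborel. zero_ext \<Omega> u x * \<phi>' i x) = - (LINT x|lborel. zero_ext \<Omega> (\<lambda>x. G x $ i) x * \<phi> x)"
proof -
  note R = C1_test_Re_Im[OF \<phi>]
  note L2 = C1_test_L2[OF C1_test_of_real[OF R(1)]] C1_test_L2[OF C1_test_of_real[OF R(2)]]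
  have split: "(LINT x|lborel. w x * f x) = (LINT x|lborel. w x * of_real (Re (f x))) + \<i> * (LINT x|lborel. w x * of_real (Im (f x)))"
    if "w \<in> L2_space lborel UNIV" "(\<lambda>x. of_real (Re (f x))) \<in> L2_space lborel UNIV"
      "(\<lambda>x. of_real (Im (f x))) \<in> L2_space lborel UNIV" for w f :: "real^'n \<Rightarrow> complex"
  proof -
    have "(LINT x|lborel. w x * f x) = (LINT x|lborel. w x * of_real (Re (f x)) + \<i> * (w x * of_real (Im (f x))))"
      by (intro Bochner_Integration.integral_cong refl) (simp add: complex_eq_iff)
    then show ?thesis
      using L2_mult_integrable[OF that(1,2)] L2_mult_integrable[OF that(1,3)]
      by (simp add: Bochner_Integration.integral_add)
  qed
  show ?thesis
    unfolding split[OF zero_ext_L2[OF u(1)] L2(2,4)] split[OF zero_ext_L2[OF weak_gradient_L2[OF u(2)]] L2(1,3)]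
      weak_gradient_real_test[OF \<Omega> u R(1)] weak_gradient_real_test[OF \<Omega> u R(2)]
    by (simp add: algebra_simps)
qed

lemma L2_bounded_integrable:
  fixes \<Omega> :: "(real^'n::finite) set"
  assumes "bounded \<Omega>" "u \<in> L2_space lborel \<Omega>"
  shows "integrable lborel (zero_ext \<Omega> u)"
proof -
  obtain R where R: "\<Omega> \<subseteq> cball (0::real^'n) R" using bounded_subset_ballD[OF assms(1), of 0] ball_subset_cball by blast
  have sq: "(cmod (indicator (cball 0 R) x))\<^sup>2 = (indicator (cball 0 R) x :: real)" for x :: "real^'n"
    by (simp add: indicator_def)
  have fin: "emeasure lborel (cball (0::real^'n) R) < \<infinity>" by (rule emeasure_lborel_cball_finite)
  have "integrable lborel (indicator (cball (0::real^'n) R) :: real^'n \<Rightarrow> real)"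
    by (rule integrable_real_indicator[OF _ fin]) simp
  moreover have "(\<lambda>x. indicator (cball 0 R) x :: complex) \<in> borel_measurable (borel :: (real^'n) measure)"
    by (rule borel_measurable_indicator) simp
  ultimately have "(\<lambda>x. indicator (cball 0 R) x) \<in> L2_space lborel (UNIV :: (real^'n) set)"
    unfolding L2_UNIV sq by (rule conjI[rotated])
  from L2_mult_integrable[OF this zero_ext_L2[OF assms(2)]]
  have "integrable lborel (\<lambda>x. indicator (cball 0 R) x * zero_ext \<Omega> u x)" .
  moreover have "indicator (cball 0 R) x * zero_ext \<Omega> u x = zero_ext \<Omega> u x" for x
    using R by (auto simp: indicator_def zero_ext_def)
  ultimately show ?thesis by simp
qed

text \<open>Test the weak gradient of \<open>u\<close> with the
  mollification of \<open>cnj v\<close> times \<open>\<Phi>\<close> and pass to the limit.\<close>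
theorem weak_product_rule:
  fixes \<Phi> :: "real^'n::finite \<Rightarrow> real"
  assumes \<Omega>: "open \<Omega>" "bounded \<Omega>"
    and u: "u \<in> L2_space lborel \<Omega>" "has_weak_gradient \<Omega> u G"
    and v: "v \<in> L2_space lborel \<Omega>" "has_weak_gradient \<Omega> v H"
    and \<Phi>: "C1_test \<Omega> \<Phi> \<Phi>'"
  shows "(LINT x:\<Omega>|lborel. u x * cnj (v x) * of_real (\<Phi>' i x)) =
    - (LINT x:\<Omega>|lborel. (G x $ i * cnj (v x) + u x * cnj (H x $ i)) * of_real (\<Phi> x))"
proof -
  obtain K where K: "compact K" "K \<subseteq> \<Omega>" "\<And>x. x \<notin> K \<Longrightarrow> \<Phi> x = 0" "\<And>i x. x \<notin> K \<Longrightarrow> \<Phi>' i x = 0"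
    "continuous_on UNIV \<Phi>" "\<And>i. continuous_on UNIV (\<Phi>' i)"
    using C1_testE[OF \<Phi>] by metis
  obtain d where d: "d > 0" "\<And>x y. x \<in> K \<Longrightarrow> dist x y \<le> d \<Longrightarrow> y \<in> \<Omega>"
    using compact_subset_open_distance[OF K(1,2) \<Omega>(1)] by blast
  obtain \<rho> :: "nat \<Rightarrow> real^'n \<Rightarrow> real" and r
    where \<rho>: "\<And>n. mollifier (r n) (\<rho> n)" and r: "r \<longlonglongrightarrow> 0" and rd: "\<And>n. 0 < r n \<and> r n \<le> d"
    using mollifier_sequence[OF d(1)] by metis
  define w where "w = zero_ext \<Omega> (\<lambda>x. cnj (v x))"
  define h where "h = zero_ext \<Omega> (\<lambda>x. cnj (H x $ i))"
  have wL2: "w \<in> L2_space lborel UNIV" unfolding w_def by (intro zero_ext_L2 L2_cnj v)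
  have hL2: "h \<in> L2_space lborel UNIV" unfolding h_def by (intro zero_ext_L2 L2_cnj weak_gradient_L2[OF v(2)])
  have wint: "integrable lborel w" unfolding w_def by (intro L2_bounded_integrable \<Omega> L2_cnj v)
  have grad: "has_grad (conv (\<rho> n) w) (\<lambda>j. conv (partial j (\<rho> n)) w x) x" for n x
    by (rule conv_has_grad[OF wint mollifierD(1)[OF \<rho>] compact_cball mollifierD(9)[OF \<rho>] mollifierD(10)[OF \<rho>]])
  \<comment> \<open>For \<open>x\<close> in \<open>K\<close> the ball of radius \<open>r n\<close>
    stays in \<open>\<Omega>\<close>, so differentiating the mollified \<open>cnj v\<close>
    mollifies the weak derivative. Off \<open>K\<close>, where this may fail, the factor
    \<open>\<Phi>\<close> is zero.\<close>
  have inK: "conv (partial i (\<rho> n)) w x = conv (\<rho> n) h x" if x: "x \<in> K" for n x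
  proof -
    have inb: "\<And>y. dist x y \<le> r n \<Longrightarrow> y \<in> \<Omega>" using d(2)[OF x] rd[of n] by force
    have tf: "test_function \<Omega> (\<lambda>y. \<rho> n (x - y))" by (rule test_function_reflect[OF \<rho> inb])
    have "(LINT y:\<Omega>|lborel. partial i (\<lambda>y. \<rho> n (x - y)) y *\<^sub>R v y) = - (LINT y:\<Omega>|lborel. \<rho> n (x - y) *\<^sub>R H y $ i)"
      using v(2) tf unfolding has_weak_gradient_def by blast
    then have "- (LINT y|lborel. of_real (partial i (\<rho> n) (x - y)) * zero_ext \<Omega> v y) =
        - (LINT y|lborel. of_real (\<rho> n (x - y)) * zero_ext \<Omega> (\<lambda>y. H y $ i) y)"
      unfolding set_integral_zero_ext partial_reflect[OF mollifierD(8)[OF \<rho>]] by simp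
    then have "cnj (LINT y|lborel. of_real (partial i (\<rho> n) (x - y)) * zero_ext \<Omega> v y) =
        cnj (LINT y|lborel. of_real (\<rho> n (x - y)) * zero_ext \<Omega> (\<lambda>y. H y $ i) y)" by simp
    then show ?thesis
      unfolding conv_def w_def h_def zero_ext_cnj Bochner_Integration.integral_cnj[symmetric]
      by (simp add: scaleR_conv_of_real)
  qed
  let ?\<phi> = "\<lambda>n x. of_real (\<Phi> x) * conv (\<rho> n) w x"
  let ?\<phi>' = "\<lambda>n j x. of_real (\<Phi> x) * conv (partial j (\<rho> n)) w x + of_real (\<Phi>' j x) * conv (\<rho> n) w x"
  have test: "C1_test \<Omega> (?\<phi> n) (?\<phi>' n)" for n
    unfolding C1_test_def
  proof (intro conjI allI exI[of _ K] impI)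
    have "has_grad (\<lambda>x. complex_of_real (\<Phi> x)) (\<lambda>i. of_real (\<Phi>' i x)) x" for x
      using C1_test_of_real[OF \<Phi>] by (simp add: C1_test_def)
    then show "has_grad (?\<phi> n) (\<lambda>j. ?\<phi>' n j x) x" for x by (intro has_grad_mult grad)
    have c1: "continuous_on UNIV (conv (\<rho> n) w)"
      using grad has_grad_isCont by (blast intro: continuous_at_imp_continuous_on)
    have c2: "continuous_on UNIV (conv (partial j (\<rho> n)) w)" for j
    proof -
      have "C_k 1 (partial j (\<rho> n))" using mollifierD(1)[OF \<rho>[of n], where k = 2] by (simp add: numeral_2_eq_2)
      then have "has_grad (conv (partial j (\<rho> n)) w) (\<lambda>k. conv (partial k (partial j (\<rho> n))) w x) x" for x
        by (intro conv_has_grad[OF wint, of _ "cball 0 (r n)"] compact_cball mollifierD(10)[OF \<rho>] partial_zero_outside[OF closed_cball[of 0 "r n"]])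
      then show ?thesis using has_grad_isCont by (blast intro: continuous_at_imp_continuous_on)
    qed
    show "continuous_on UNIV (?\<phi>' n j)" for j by (intro continuous_intros c1 c2 K)
  qed (use K in auto)
  define U where "U = zero_ext \<Omega> u"
  define g where "g = zero_ext \<Omega> (\<lambda>x. G x $ i)"
  have UL2: "U \<in> L2_space lborel UNIV" and gL2: "g \<in> L2_space lborel UNIV"
    unfolding U_def g_def by (intro zero_ext_L2 u weak_gradient_L2[OF u(2)])+
  \<comment> \<open>Putting the bounded weight on the side of the fixed function keeps every limit
    in the form treated by \<open>conv_weak_limit\<close>.\<close>
  have mult_L2: "(\<lambda>x. f x * of_real (p x)) \<in> L2_space lborel UNIV"
    if f: "f \<in> L2_space lborel UNIV" and p: "continuous_on UNIV p" "\<And>x. x \<notin> K \<Longrightarrow> p x = 0" for f :: "real^'n \<Rightarrow> complex" and p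
  proof -
    obtain B where B: "B > 0" "\<And>x. norm (p x) \<le> B"
      using bounded_continuous_compact_support[OF p(1) K(1) p(2)] by blast
    have "(\<lambda>x. of_real (p x) * f x) \<in> L2_space lborel UNIV"
      by (rule L2_bounded_mult[OF f, where C = B]) (use B p in \<open>auto simp: set_borel_measurable_def intro!: borel_measurable_of_real borel_measurable_continuous_onI\<close>)
    then show ?thesis by (simp add: mult.commute)
  qed
  have conv_int: "integrable lborel (\<lambda>x. f x * of_real (p x) * conv (\<rho> n) z x)"
    if f: "f \<in> L2_space lborel UNIV" and p: "continuous_on UNIV p" "\<And>x. x \<notin> K \<Longrightarrow> p x = 0"
     and z: "continuous_on UNIV (conv (\<rho> n) z)" for f z :: "real^'n \<Rightarrow> complex" and p n
  proof -
    have "(\<lambda>x. of_real (p x) * conv (\<rho> n) z x) \<in> L2_space lborel UNIV"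
      by (rule continuous_compact_support_L2[OF _ K(1)]) (use p z in \<open>auto intro!: continuous_intros\<close>)
    from L2_mult_integrable[OF f this] show ?thesis by (simp add: mult.assoc)
  qed
  have hint: "integrable lborel h" unfolding h_def by (intro L2_bounded_integrable \<Omega> L2_cnj weak_gradient_L2[OF v(2)])
  have cw: "continuous_on UNIV (conv (\<rho> n) w)" for n
    using grad has_grad_isCont by (blast intro: continuous_at_imp_continuous_on)
  have ch: "continuous_on UNIV (conv (\<rho> n) h)" for n
  proof -
    have "has_grad (conv (\<rho> n) h) (\<lambda>j. conv (partial j (\<rho> n)) h x) x" for x
      by (rule conv_has_grad[OF hint mollifierD(1)[OF \<rho>] compact_cball mollifierD(9)[OF \<rho>] mollifierD(10)[OF \<rho>]])
    then show ?thesis using has_grad_isCont by (blast intro: continuous_at_imp_continuous_on)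
  qed
  have eq: "(LINT x|lborel. U x * of_real (\<Phi> x) * conv (\<rho> n) h x) + (LINT x|lborel. U x * of_real (\<Phi>' i x) * conv (\<rho> n) w x)
      = - (LINT x|lborel. g x * of_real (\<Phi> x) * conv (\<rho> n) w x)" for n
  proof -
    have "(LINT x|lborel. U x * ?\<phi>' n i x) = - (LINT x|lborel. g x * ?\<phi> n x)"
      unfolding U_def g_def by (rule weak_gradient_test[OF \<Omega>(1) u test])
    moreover have "U x * ?\<phi>' n i x = U x * of_real (\<Phi> x) * conv (\<rho> n) h x + U x * of_real (\<Phi>' i x) * conv (\<rho> n) w x" for x
      using inK[of x n] K(3)[of x] by (cases "x \<in> K") (auto simp: algebra_simps)
    ultimately have "(LINT x|lborel. U x * of_real (\<Phi> x) * conv (\<rho> n) h x + U x * of_real (\<Phi>' i x) * conv (\<rho> n) w x)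
      = - (LINT x|lborel. g x * of_real (\<Phi> x) * conv (\<rho> n) w x)"
      by (simp only: mult.assoc)
    then show ?thesis
      by (subst (asm) Bochner_Integration.integral_add) (use K in \<open>auto intro!: conv_int UL2 cw ch\<close>)
  qed
  have l1: "(\<lambda>n. LINT x|lborel. U x * of_real (\<Phi> x) * conv (\<rho> n) h x) \<longlonglongrightarrow> (LINT x|lborel. U x * of_real (\<Phi> x) * h x)"
    by (intro conv_weak_limit[OF mult_L2[OF UL2 K(5,3)] hL2 \<rho> r])
  have l2: "(\<lambda>n. LINT x|lborel. U x * of_real (\<Phi>' i x) * conv (\<rho> n) w x) \<longlonglongrightarrow> (LINT x|lborel. U x * of_real (\<Phi>' i x) * w x)"
    by (intro conv_weak_limit[OF mult_L2[OF UL2 K(6,4)] wL2 \<rho> r])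
  have l3: "(\<lambda>n. - (LINT x|lborel. g x * of_real (\<Phi> x) * conv (\<rho> n) w x)) \<longlonglongrightarrow> - (LINT x|lborel. g x * of_real (\<Phi> x) * w x)"
    by (intro tendsto_minus conv_weak_limit[OF mult_L2[OF gL2 K(5,3)] wL2 \<rho> r])
  have lim: "(LINT x|lborel. U x * of_real (\<Phi> x) * h x) + (LINT x|lborel. U x * of_real (\<Phi>' i x) * w x) = - (LINT x|lborel. g x * of_real (\<Phi> x) * w x)"
    using LIMSEQ_unique[OF tendsto_add[OF l1 l2]] l3 eq by simp
  have "(LINT x:\<Omega>|lborel. u x * cnj (v x) * of_real (\<Phi>' i x)) = (LINT x|lborel. U x * of_real (\<Phi>' i x) * w x)"
    unfolding set_lebesgue_integral_def U_def w_def zero_ext_def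
    by (intro Bochner_Integration.integral_cong refl) (simp add: indicator_def)
  moreover have "(LINT x:\<Omega>|lborel. (G x $ i * cnj (v x) + u x * cnj (H x $ i)) * of_real (\<Phi> x)) =
     (LINT x|lborel. g x * of_real (\<Phi> x) * w x + U x * of_real (\<Phi> x) * h x)"
    unfolding set_lebesgue_integral_def U_def w_def h_def g_def zero_ext_def
    by (intro Bochner_Integration.integral_cong refl) (simp add: indicator_def algebra_simps)
  moreover have "\<dots> = (LINT x|lborel. g x * of_real (\<Phi> x) * w x) + (LINT x|lborel. U x * of_real (\<Phi> x) * h x)"
    by (intro Bochner_Integration.integral_add L2_mult_integrable mult_L2 UL2 gL2 wL2 hL2 K)
  ultimately show ?thesis using lim by (simp add: algebra_simps eq_neg_iff_add_eq_0)
qed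

section \<open>Sobolev functions\<close>

lemma L2_norm_zero_ext: "L2_norm lborel UNIV (zero_ext \<Omega> w) = L2_norm lborel \<Omega> w"
  by (simp add: L2_norm_eq zero_ext_def)

lemma L2_pairing_bound:
  assumes "w \<in> L2_space lborel \<Omega>" "\<phi> \<in> L2_space lborel UNIV"
  shows "cmod (LINT x|lborel. zero_ext \<Omega> w x * \<phi> x) \<le> L2_norm lborel \<Omega> w * L2_norm lborel UNIV \<phi>"
  using L2_cauchy_schwarz[OF zero_ext_L2[OF assms(1)] L2_cnj[OF assms(2)]]
  unfolding L2_norm_zero_ext
  by (simp add: L2_inner_def set_lebesgue_integral_def L2_norm_eq[of _ _ "\<lambda>x. cnj (\<phi> x)"] L2_norm_eq[of _ _ \<phi>])

lemma zero_ext_restrict_L2: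
  fixes g :: "real^'n::finite \<Rightarrow> complex"
  assumes "g \<in> L2_space lborel \<Omega>" "K \<subseteq> \<Omega>" "K \<in> sets borel"
  shows "zero_ext K g \<in> L2_space lborel UNIV"
proof -
  have "(\<lambda>x. indicator K x * zero_ext \<Omega> g x) \<in> L2_space lborel UNIV"
    by (rule L2_bounded_mult[OF zero_ext_L2[OF assms(1)], where C = 1])
      (use assms(3) in \<open>auto simp: set_borel_measurable_def indicator_def\<close>)
  moreover have "(\<lambda>x. indicator K x * zero_ext \<Omega> g x) = zero_ext K g"
    using assms(2) by (intro ext) (auto simp: indicator_def zero_ext_def)
  ultimately show ?thesis by simp
qed

text \<open>Mollifier kernels centred in a compact \<open>K\<close> are test functions, so the
  mollifications of \<open>g\<close> vanish on \<open>K\<close>. Pairing them with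
  \<open>cnj g\<close> restricted to \<open>K\<close>, the weak limit is the integral of
  \<open>|g|\<^sup>2\<close> over \<open>K\<close>; and \<open>\<Omega>\<close> is exhausted by
  countably many such \<open>K\<close>.\<close>

lemma fundamental_lemma:
  fixes g :: "real^'n::finite \<Rightarrow> complex"
  assumes \<Omega>: "open \<Omega>" and g: "g \<in> L2_space lborel \<Omega>"
    and zero: "\<And>\<phi>. test_function \<Omega> \<phi> \<Longrightarrow> (LINT x:\<Omega>|lborel. \<phi> x *\<^sub>R g x) = 0"
  shows "AE x\<in>\<Omega> in lborel. g x = 0"
proof -
  have K: "AE x\<in>K in lborel. g x = 0" if K: "compact K" "K \<subseteq> \<Omega>" for K
  proof -
    obtain d where d: "d > 0" "\<And>x y. x \<in> K \<Longrightarrow> dist x y \<le> d \<Longrightarrow> y \<in> \<Omega>"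
      using compact_subset_open_distance[OF K \<Omega>] by blast
    obtain \<rho> :: "nat \<Rightarrow> real^'n \<Rightarrow> real" and r
      where \<rho>: "\<And>n. mollifier (r n) (\<rho> n)" and r: "r \<longlonglongrightarrow> 0" and rd: "\<And>n. 0 < r n \<and> r n \<le> d"
      using mollifier_sequence[OF d(1)] by metis
    have Kb: "K \<in> sets borel" using K(1) by (simp add: borel_compact)
    define F where "F = zero_ext K (\<lambda>x. cnj (g x))"
    define f where "f = zero_ext \<Omega> g"
    have FL2: "F \<in> L2_space lborel UNIV"
      unfolding F_def by (rule zero_ext_restrict_L2[OF L2_cnj[OF g] K(2) Kb])
    have z: "F x * conv (\<rho> n) f x = 0" for n x
    proof (cases "x \<in> K")
      case True
      have "test_function \<Omega> (\<lambda>y. \<rho> n (x - y))"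
        using d(2)[OF True] rd[of n] by (intro test_function_reflect[OF \<rho>[of n]]) force
      from zero[OF this] show ?thesis
        unfolding set_integral_zero_ext conv_def f_def by (simp add: scaleR_conv_of_real)
    qed (simp add: F_def)
    have lim: "(\<lambda>n. LINT x|lborel. F x * conv (\<rho> n) f x) \<longlonglongrightarrow> (LINT x|lborel. F x * f x)"
      unfolding f_def by (rule conv_weak_limit[OF FL2 zero_ext_L2[OF g] \<rho> r])
    have 0: "(LINT x|lborel. F x * f x) = 0"
      using lim unfolding z by (simp add: LIMSEQ_const_iff)
    have "F x * f x = of_real ((cmod (zero_ext K g x))\<^sup>2)" for x
      using K(2) complex_norm_square[of "g x"] by (auto simp: F_def f_def zero_ext_def indicator_def mult.commute)
    with 0 have i0: "(LINT x|lborel. (cmod (zero_ext K g x))\<^sup>2) = 0"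
      by (simp only: integral_complex_of_real of_real_eq_0_iff)
    have "integrable lborel (\<lambda>x. (cmod (zero_ext K g x))\<^sup>2)"
      using zero_ext_restrict_L2[OF g K(2) Kb] by (simp add: L2_UNIV)
    from integral_nonneg_eq_0_iff_AE[OF this] i0
    have "AE x in lborel. (cmod (zero_ext K g x))\<^sup>2 = 0" by simp
    then show ?thesis by eventually_elim (auto simp: zero_ext_def indicator_def)
  qed
  obtain C :: "nat \<Rightarrow> (real^'n) set" where C: "\<And>n. compact (C n)" "\<And>n. C n \<subseteq> \<Omega>" "\<Union>(range C) = \<Omega>"
    using open_Union_compact_subsets[OF \<Omega>] by metis
  have "AE x in lborel. \<forall>n. x \<in> C n \<longrightarrow> g x = 0"
    unfolding AE_all_countable using K[OF C(1,2)] by blast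
  then show ?thesis by eventually_elim (use C(3) in blast)
qed

text \<open>Makes the choice in \<open>weak_gradient\<close> immaterial up to null sets.\<close>

lemma weak_gradient_unique:
  fixes u :: "real^'n::finite \<Rightarrow> complex"
  assumes "open \<Omega>" "has_weak_gradient \<Omega> u G" "has_weak_gradient \<Omega> u H"
  shows "AE x\<in>\<Omega> in lborel. G x $ i = H x $ i"
proof -
  note L2 = weak_gradient_L2[OF assms(2), of i] weak_gradient_L2[OF assms(3), of i]
  have "AE x\<in>\<Omega> in lborel. G x $ i - H x $ i = 0"
  proof (rule fundamental_lemma[OF assms(1) L2_diff[OF L2]])
    fix \<phi> :: "real^'n \<Rightarrow> real" assume \<phi>: "test_function \<Omega> \<phi>"
    note \<phi>L2 = C1_test_L2(1)[OF C1_test_of_real[OF test_function_C1_test[OF \<phi>]]]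
    have int: "set_integrable lborel \<Omega> (\<lambda>x. \<phi> x *\<^sub>R g x)" if "g \<in> L2_space lborel \<Omega>" for g
    proof -
      have "indicator \<Omega> x *\<^sub>R \<phi> x *\<^sub>R g x = of_real (\<phi> x) * zero_ext \<Omega> g x" for x
        by (simp add: zero_ext_def scaleR_conv_of_real indicator_def)
      then show ?thesis using L2_mult_integrable[OF \<phi>L2 zero_ext_L2[OF that]]
        by (simp only: set_integrable_def)
    qed
    have "(LINT x:\<Omega>|lborel. \<phi> x *\<^sub>R G x $ i) = (LINT x:\<Omega>|lborel. \<phi> x *\<^sub>R H x $ i)"
    proof -
      have "(LINT x:\<Omega>|lborel. partial i \<phi> x *\<^sub>R u x) = - (LINT x:\<Omega>|lborel. \<phi> x *\<^sub>R G x $ i)"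
        using assms(2) \<phi> unfolding has_weak_gradient_def by blast
      moreover have "(LINT x:\<Omega>|lborel. partial i \<phi> x *\<^sub>R u x) = - (LINT x:\<Omega>|lborel. \<phi> x *\<^sub>R H x $ i)"
        using assms(3) \<phi> unfolding has_weak_gradient_def by blast
      ultimately show ?thesis by (metis neg_equal_iff_equal)
    qed
    then show "(LINT x:\<Omega>|lborel. \<phi> x *\<^sub>R (G x $ i - H x $ i)) = 0"
      using set_integral_diff(2)[OF int[OF L2(1)] int[OF L2(2)]] by (simp add: scaleR_diff_right)
  qed
  then show ?thesis by simp
qed

lemma has_weak_gradientI:
  assumes "\<And>i. (\<lambda>x. G x $ i) \<in> L2_space lborel \<Omega>"
    and "\<And>i \<phi>. C1_test \<Omega> \<phi> (\<lambda>i. partial i \<phi>) \<Longrightarrow> (LINT x|lborel. zero_ext \<Omega> u x * of_real (partial i \<phi> x)) =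
      - (LINT x|lborel. zero_ext \<Omega> (\<lambda>x. G x $ i) x * of_real (\<phi> x))"
  shows "has_weak_gradient \<Omega> u G"
  unfolding has_weak_gradient_def set_integral_zero_ext
proof (intro allI conjI impI assms(1))
  fix i \<phi> assume "test_function \<Omega> \<phi>"
  from assms(2)[OF test_function_C1_test[OF this], of i]
  show "(LINT x|lborel. of_real (partial i \<phi> x) * zero_ext \<Omega> u x) =
      - (LINT x|lborel. of_real (\<phi> x) * zero_ext \<Omega> (\<lambda>x. G x $ i) x)"
    by (simp only: mult.commute)
qed

lemma H1_L2: "u \<in> H1 \<Omega> \<Longrightarrow> u \<in> L2_space lborel \<Omega>"
  by (simp add: H1_def)

lemma weak_gradient_some: "has_weak_gradient \<Omega> u G \<Longrightarrow> has_weak_gradient \<Omega> u (weak_gradient \<Omega> u)"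
  unfolding weak_gradient_def by (rule someI[of "has_weak_gradient \<Omega> u"])

lemma H1_weak_gradient: "u \<in> H1 \<Omega> \<Longrightarrow> has_weak_gradient \<Omega> u (weak_gradient \<Omega> u)"
  unfolding H1_def using weak_gradient_some by blast

lemma H1I: "u \<in> L2_space lborel \<Omega> \<Longrightarrow> has_weak_gradient \<Omega> u G \<Longrightarrow> u \<in> H1 \<Omega>"
  by (auto simp: H1_def)

lemma weak_gradient_add:
  fixes u :: "real^'n::finite \<Rightarrow> complex"
  assumes \<Omega>: "open \<Omega>" and u: "u \<in> L2_space lborel \<Omega>" "has_weak_gradient \<Omega> u G"
    and v: "v \<in> L2_space lborel \<Omega>" "has_weak_gradient \<Omega> v H"
  shows "has_weak_gradient \<Omega> (\<lambda>x. u x + v x) (\<lambda>x. G x + H x)"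
proof (rule has_weak_gradientI)
  show "(\<lambda>x. (G x + H x) $ i) \<in> L2_space lborel \<Omega>" for i
    using L2_add[OF weak_gradient_L2[OF u(2)] weak_gradient_L2[OF v(2)], of i i] by simp
  fix i \<phi> assume \<phi>: "C1_test \<Omega> \<phi> (\<lambda>i. partial i \<phi>)"
  note L = C1_test_L2[OF C1_test_of_real[OF \<phi>]]
  have e: "zero_ext \<Omega> (\<lambda>x. f x + g x) x = zero_ext \<Omega> f x + zero_ext \<Omega> g x" for f g :: "real^'n \<Rightarrow> complex" and x
    by (simp add: zero_ext_def scaleR_add_right)
  show "(LINT x|lborel. zero_ext \<Omega> (\<lambda>x. u x + v x) x * of_real (partial i \<phi> x)) =
      - (LINT x|lborel. zero_ext \<Omega> (\<lambda>x. (G x + H x) $ i) x * of_real (\<phi> x))"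
    using weak_gradient_real_test[OF \<Omega> u \<phi>, of i] weak_gradient_real_test[OF \<Omega> v \<phi>, of i]
      L2_mult_integrable[OF zero_ext_L2[OF u(1)] L(2)] L2_mult_integrable[OF zero_ext_L2[OF v(1)] L(2)]
      L2_mult_integrable[OF zero_ext_L2[OF weak_gradient_L2[OF u(2)]] L(1)]
      L2_mult_integrable[OF zero_ext_L2[OF weak_gradient_L2[OF v(2)]] L(1)]
    by (simp add: e distrib_right Bochner_Integration.integral_add)
qed

lemma weak_gradient_cmult:
  fixes u :: "real^'n::finite \<Rightarrow> complex"
  assumes \<Omega>: "open \<Omega>" and u: "u \<in> L2_space lborel \<Omega>" "has_weak_gradient \<Omega> u G"
  shows "has_weak_gradient \<Omega> (\<lambda>x. c * u x) (\<lambda>x. \<chi> i. c * G x $ i)"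
proof (rule has_weak_gradientI)
  show "(\<lambda>x. (\<chi> i. c * G x $ i) $ i) \<in> L2_space lborel \<Omega>" for i
    using L2_cmult[OF weak_gradient_L2[OF u(2)], of c i] by simp
  fix i \<phi> assume \<phi>: "C1_test \<Omega> \<phi> (\<lambda>i. partial i \<phi>)"
  have e: "zero_ext \<Omega> (\<lambda>x. c * f x) x * z = c * (zero_ext \<Omega> f x * z)" for f :: "real^'n \<Rightarrow> complex" and x z
    by (simp add: zero_ext_def)
  show "(LINT x|lborel. zero_ext \<Omega> (\<lambda>x. c * u x) x * of_real (partial i \<phi> x)) =
      - (LINT x|lborel. zero_ext \<Omega> (\<lambda>x. (\<chi> i. c * G x $ i) $ i) x * of_real (\<phi> x))"
    using weak_gradient_real_test[OF \<Omega> u \<phi>, of i] by (simp add: e)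
qed

lemma weak_gradient_diff:
  assumes \<Omega>: "open \<Omega>" and u: "u \<in> L2_space lborel \<Omega>" "has_weak_gradient \<Omega> u G"
    and v: "v \<in> L2_space lborel \<Omega>" "has_weak_gradient \<Omega> v H"
  shows "has_weak_gradient \<Omega> (\<lambda>x. u x - v x) (\<lambda>x. G x - H x)"
proof -
  have "(\<lambda>x. G x + (\<chi> i. - 1 * H x $ i)) = (\<lambda>x. G x - H x)"
    by (auto simp: vec_eq_iff)
  with weak_gradient_add[OF \<Omega> u L2_cmult[OF v(1)] weak_gradient_cmult[OF \<Omega> v], of "- 1"] show ?thesis
    by simp
qed

lemma weak_gradient_zero:
  fixes u :: "real^'a::finite \<Rightarrow> complex"
  assumes "open \<Omega>" "AE x\<in>\<Omega> in lborel. u x = 0"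
  shows "has_weak_gradient \<Omega> u (\<lambda>_. 0)"
proof (rule has_weak_gradientI)
  fix i \<phi> assume "C1_test \<Omega> \<phi> (\<lambda>i. partial i \<phi>)"
  have "AE x in lborel. zero_ext \<Omega> u x * of_real (partial i \<phi> x) = 0"
    using assms(2) by eventually_elim (auto simp: zero_ext_def indicator_def)
  then have "(LINT x|lborel. zero_ext \<Omega> u x * of_real (partial i \<phi> x)) = 0"
    by (rule integral_eq_zero_AE)
  then show "(LINT x|lborel. zero_ext \<Omega> u x * of_real (partial i \<phi> x)) =
      - (LINT x|lborel. zero_ext \<Omega> (\<lambda>x. (0::complex^'a) $ i) x * of_real (\<phi> x))"
    by (simp add: zero_ext_def)
qed (simp add: L2_zero)

text \<open>The product \<open>\<phi> * X\<close> serves as test function for \<open>u\<close>. As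
  \<open>X\<close> is assumed to have one continuous derivative, this relies on the extension of the
  weak identity to \<open>C1_test\<close>.\<close>

lemma weak_gradient_mult:
  fixes X :: "real^'n::finite \<Rightarrow> real"
  assumes \<Omega>: "open \<Omega>" and u: "u \<in> L2_space lborel \<Omega>" "has_weak_gradient \<Omega> u G"
    and X: "\<And>x. has_grad X (\<lambda>i. X' i x) x" "\<And>i. continuous_on UNIV (X' i)"
      "\<And>x. x \<in> \<Omega> \<Longrightarrow> \<bar>X x\<bar> \<le> C" "\<And>i x. x \<in> \<Omega> \<Longrightarrow> \<bar>X' i x\<bar> \<le> C"
  shows "(\<lambda>x. of_real (X x) * u x) \<in> L2_space lborel \<Omega>"
    and "(\<lambda>x. of_real (X' i x) * u x) \<in> L2_space lborel \<Omega>"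
    and "has_weak_gradient \<Omega> (\<lambda>x. of_real (X x) * u x) (\<lambda>x. \<chi> i. of_real (X x) * G x $ i + of_real (X' i x) * u x)"
proof -
  have cX: "continuous_on UNIV X"
    using X(1) has_grad_isCont by (blast intro: continuous_at_imp_continuous_on)
  have meas: "set_borel_measurable lborel \<Omega> (\<lambda>x. complex_of_real (h x))" if "continuous_on UNIV h" for h
    unfolding set_borel_measurable_def
    by (intro borel_measurable_scaleR borel_measurable_of_real borel_measurable_indicator)
      (use \<Omega> that in \<open>auto intro: borel_measurable_continuous_onI\<close>)
  have mult: "(\<lambda>x. of_real (h x) * w x) \<in> L2_space lborel \<Omega>"
    if "w \<in> L2_space lborel \<Omega>" "continuous_on UNIV h" "\<And>x. x \<in> \<Omega> \<Longrightarrow> \<bar>h x\<bar> \<le> C" for h w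
    by (rule L2_bounded_mult[OF that(1) meas[OF that(2)], where C = C]) (use that(3) in simp)
  show Xu: "(\<lambda>x. of_real (X x) * u x) \<in> L2_space lborel \<Omega>" by (rule mult[OF u(1) cX X(3)])
  show X'u: "(\<lambda>x. of_real (X' i x) * u x) \<in> L2_space lborel \<Omega>" for i by (rule mult[OF u(1) X(2,4)])
  have XG: "(\<lambda>x. of_real (X x) * G x $ i) \<in> L2_space lborel \<Omega>" for i
    by (rule mult[OF weak_gradient_L2[OF u(2)] cX X(3)])
  show "has_weak_gradient \<Omega> (\<lambda>x. of_real (X x) * u x) (\<lambda>x. \<chi> i. of_real (X x) * G x $ i + of_real (X' i x) * u x)"
  proof (rule has_weak_gradientI)
    show "(\<lambda>x. (\<chi> i. of_real (X x) * G x $ i + of_real (X' i x) * u x) $ i) \<in> L2_space lborel \<Omega>" for i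
      using L2_add[OF XG X'u, of i i] by simp
    fix i \<phi> assume \<phi>: "C1_test \<Omega> \<phi> (\<lambda>i. partial i \<phi>)"
    have \<phi>X: "C1_test \<Omega> (\<lambda>x. \<phi> x * X x) (\<lambda>i x. \<phi> x * X' i x + partial i \<phi> x * X x)"
    proof -
      obtain K where K: "compact K" "K \<subseteq> \<Omega>" "\<And>x. x \<notin> K \<Longrightarrow> \<phi> x = 0"
        "continuous_on UNIV \<phi>" "\<And>i. continuous_on UNIV (partial i \<phi>)"
        using C1_testE[OF \<phi>] by metis
      have g\<phi>: "has_grad \<phi> (\<lambda>i. partial i \<phi> x) x" for x using \<phi> by (simp add: C1_test_def)
      show ?thesis unfolding C1_test_def
      proof (intro conjI allI exI[of _ K] impI)
        show "has_grad (\<lambda>x. \<phi> x * X x) (\<lambda>i. \<phi> x * X' i x + partial i \<phi> x * X x) x" for x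
          by (rule has_grad_mult[OF g\<phi> X(1)])
        show "continuous_on UNIV (\<lambda>x. \<phi> x * X' i x + partial i \<phi> x * X x)" for i
          by (intro continuous_intros K X cX)
      qed (use K in auto)
    qed
    note L = C1_test_L2[OF C1_test_of_real[OF \<phi>]]
    note LX = C1_test_L2[OF C1_test_of_real[OF \<phi>X]]
    have main: "(LINT x|lborel. zero_ext \<Omega> u x * of_real (\<phi> x * X' i x + partial i \<phi> x * X x)) =
        - (LINT x|lborel. zero_ext \<Omega> (\<lambda>x. G x $ i) x * of_real (\<phi> x * X x))"
      by (rule weak_gradient_real_test[OF \<Omega> u \<phi>X])
    have i1: "integrable lborel (\<lambda>x. zero_ext \<Omega> (\<lambda>x. of_real (X' i x) * u x) x * of_real (\<phi> x))"
      by (rule L2_mult_integrable[OF zero_ext_L2[OF X'u] L(1)])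
    have i2: "integrable lborel (\<lambda>x. zero_ext \<Omega> (\<lambda>x. of_real (X x) * u x) x * of_real (partial i \<phi> x))"
      by (rule L2_mult_integrable[OF zero_ext_L2[OF Xu] L(2)])
    have i3: "integrable lborel (\<lambda>x. zero_ext \<Omega> (\<lambda>x. of_real (X x) * G x $ i) x * of_real (\<phi> x))"
      by (rule L2_mult_integrable[OF zero_ext_L2[OF XG] L(1)])
    have "(LINT x|lborel. zero_ext \<Omega> u x * of_real (\<phi> x * X' i x + partial i \<phi> x * X x)) =
      (LINT x|lborel. zero_ext \<Omega> (\<lambda>x. of_real (X' i x) * u x) x * of_real (\<phi> x)) +
      (LINT x|lborel. zero_ext \<Omega> (\<lambda>x. of_real (X x) * u x) x * of_real (partial i \<phi> x))"
      by (subst Bochner_Integration.integral_add[OF i1 i2, symmetric])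
        (intro Bochner_Integration.integral_cong refl; simp add: zero_ext_def algebra_simps)
    moreover have "(LINT x|lborel. zero_ext \<Omega> (\<lambda>x. G x $ i) x * of_real (\<phi> x * X x)) =
       (LINT x|lborel. zero_ext \<Omega> (\<lambda>x. of_real (X x) * G x $ i) x * of_real (\<phi> x))"
      by (intro Bochner_Integration.integral_cong refl) (simp add: zero_ext_def algebra_simps)
    moreover have "(LINT x|lborel. zero_ext \<Omega> (\<lambda>x. (\<chi> i. of_real (X x) * G x $ i + of_real (X' i x) * u x) $ i) x * of_real (\<phi> x)) =
      (LINT x|lborel. zero_ext \<Omega> (\<lambda>x. of_real (X x) * G x $ i) x * of_real (\<phi> x)) +
      (LINT x|lborel. zero_ext \<Omega> (\<lambda>x. of_real (X' i x) * u x) x * of_real (\<phi> x))"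
      by (subst Bochner_Integration.integral_add[OF i3 i1, symmetric])
        (intro Bochner_Integration.integral_cong refl; simp add: zero_ext_def algebra_simps scaleR_add_right)
    ultimately show "(LINT x|lborel. zero_ext \<Omega> (\<lambda>x. of_real (X x) * u x) x * of_real (partial i \<phi> x)) =
      - (LINT x|lborel. zero_ext \<Omega> (\<lambda>x. (\<chi> i. of_real (X x) * G x $ i + of_real (X' i x) * u x) $ i) x * of_real (\<phi> x))"
      using main by (simp add: algebra_simps eq_neg_iff_add_eq_0)
  qed
qed

lemma grad_inner_eq:
  assumes "open \<Omega>" "has_weak_gradient \<Omega> u G" "has_weak_gradient \<Omega> v H"
  shows "grad_inner \<Omega> u v = (\<Sum>i\<in>UNIV. L2_inner lborel \<Omega> (\<lambda>x. G x $ i) (\<lambda>x. H x $ i))"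
proof -
  have 1: "has_weak_gradient \<Omega> u (weak_gradient \<Omega> u)" "has_weak_gradient \<Omega> v (weak_gradient \<Omega> v)"
    by (rule weak_gradient_some[OF assms(2)], rule weak_gradient_some[OF assms(3)])
  show ?thesis unfolding grad_inner_def
    by (intro sum.cong refl L2_inner_cong_AE weak_gradient_L2[OF 1(1)] weak_gradient_L2[OF 1(2)]
        weak_gradient_L2[OF assms(2)] weak_gradient_L2[OF assms(3)] weak_gradient_unique[OF assms(1) 1(1) assms(2)]
        weak_gradient_unique[OF assms(1) 1(2) assms(3)])
qed

lemma grad_norm_power2: "(grad_norm \<Omega> u)\<^sup>2 = Re (grad_inner \<Omega> u u)"
  by (simp add: grad_norm_def grad_inner_def L2_q sum_nonneg)

lemma grad_norm_eq:
  assumes "open \<Omega>" "has_weak_gradient \<Omega> u G"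
  shows "(grad_norm \<Omega> u)\<^sup>2 = (\<Sum>i\<in>UNIV. (L2_norm lborel \<Omega> (\<lambda>x. G x $ i))\<^sup>2)"
  unfolding grad_norm_power2 grad_inner_eq[OF assms(1,2,2)] by (simp add: L2_q)

lemma H1_norm_power2: "(H1_norm \<Omega> u)\<^sup>2 = (L2_norm lborel \<Omega> u)\<^sup>2 + (grad_norm \<Omega> u)\<^sup>2"
  by (simp add: H1_norm_def)

lemma H1_norm_nonneg [simp]: "0 \<le> H1_norm \<Omega> u"
  by (simp add: H1_norm_def)

lemma L2_norm_le_H1_norm: "L2_norm lborel \<Omega> u \<le> H1_norm \<Omega> u"
  by (simp add: H1_norm_def real_le_rsqrt)

lemma gradient_le_H1_norm:
  assumes "open \<Omega>" "has_weak_gradient \<Omega> u G"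
  shows "L2_norm lborel \<Omega> (\<lambda>x. G x $ i) \<le> H1_norm \<Omega> u"
proof -
  have "(L2_norm lborel \<Omega> (\<lambda>x. G x $ i))\<^sup>2 \<le> (grad_norm \<Omega> u)\<^sup>2"
    unfolding grad_norm_eq[OF assms] by (rule member_le_sum) auto
  also have "\<dots> \<le> (H1_norm \<Omega> u)\<^sup>2" by (simp add: H1_norm_power2)
  finally show ?thesis by (rule power2_le_imp_le) simp
qed

lemma H1_hermitian:
  assumes "open \<Omega>"
  shows "hermitian_form cscale (H1 \<Omega>) (grad_inner \<Omega>)"
proof -
  interpret vector_space cscale by (rule vector_space_cscale)
  show ?thesis
  proof
    show "0 \<in> H1 \<Omega>"
      using H1I[OF L2_zero weak_gradient_zero[OF assms, of "\<lambda>_. 0"]] by (simp add: zero_fun_def)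
    fix u v w :: "real^'a \<Rightarrow> complex" and c
    show "0 \<le> Re (grad_inner \<Omega> u u)" using grad_norm_power2[of \<Omega> u] by (metis zero_le_power2)
    assume u: "u \<in> H1 \<Omega>"
    note gu = H1_weak_gradient[OF u]
    have cs: "has_weak_gradient \<Omega> (cscale c u) (\<lambda>x. \<chi> i. c * weak_gradient \<Omega> u x $ i)"
      using weak_gradient_cmult[OF assms H1_L2[OF u] gu] by (simp add: cscale_def)
    show "cscale c u \<in> H1 \<Omega>"
      using H1I[OF _ cs] L2_cmult[OF H1_L2[OF u], of c] by (simp add: cscale_def)
    assume w: "w \<in> H1 \<Omega>"
    note gw = H1_weak_gradient[OF w]
    have "L2_inner lborel \<Omega> (\<lambda>x. c * weak_gradient \<Omega> u x $ i) (\<lambda>x. weak_gradient \<Omega> w x $ i) =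
      c * L2_inner lborel \<Omega> (\<lambda>x. weak_gradient \<Omega> u x $ i) (\<lambda>x. weak_gradient \<Omega> w x $ i)" for i
      using L2.F_scale[OF weak_gradient_L2[OF gu] weak_gradient_L2[OF gw], of c i i] by (simp add: cscale_def)
    then show "grad_inner \<Omega> (cscale c u) w = c * grad_inner \<Omega> u w"
      unfolding grad_inner_eq[OF assms cs gw] grad_inner_eq[OF assms gu gw] by (simp add: sum_distrib_left)
    show "grad_inner \<Omega> w u = cnj (grad_inner \<Omega> u w)"
      unfolding grad_inner_def cnj_sum
      by (intro sum.cong refl L2.F_herm weak_gradient_L2[OF gu] weak_gradient_L2[OF gw])
    assume v: "v \<in> H1 \<Omega>"
    note gv = H1_weak_gradient[OF v]
    have add: "has_weak_gradient \<Omega> (u + v) (\<lambda>x. weak_gradient \<Omega> u x + weak_gradient \<Omega> v x)"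
      using weak_gradient_add[OF assms H1_L2[OF u] gu H1_L2[OF v] gv] by (simp add: plus_fun_def)
    show "u + v \<in> H1 \<Omega>"
      using H1I[OF _ add] L2_add[OF H1_L2[OF u] H1_L2[OF v]] by (simp add: plus_fun_def)
    have "L2_inner lborel \<Omega> (\<lambda>x. weak_gradient \<Omega> u x $ i + weak_gradient \<Omega> v x $ i) (\<lambda>x. weak_gradient \<Omega> w x $ i) =
      L2_inner lborel \<Omega> (\<lambda>x. weak_gradient \<Omega> u x $ i) (\<lambda>x. weak_gradient \<Omega> w x $ i) +
      L2_inner lborel \<Omega> (\<lambda>x. weak_gradient \<Omega> v x $ i) (\<lambda>x. weak_gradient \<Omega> w x $ i)" for i
      using L2.F_add[OF weak_gradient_L2[OF gu] weak_gradient_L2[OF gv] weak_gradient_L2[OF gw], of i i i]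
      by (simp add: plus_fun_def)
    then show "grad_inner \<Omega> (u + v) w = grad_inner \<Omega> u w + grad_inner \<Omega> v w"
      unfolding grad_inner_eq[OF assms add gw] grad_inner_eq[OF assms gu gw] grad_inner_eq[OF assms gv gw]
      by (simp add: sum.distrib)
  qed
qed

lemma hermitian_form_sum:
  assumes "hermitian_form s W F" "hermitian_form s W G"
  shows "hermitian_form s W (\<lambda>u v. F u v + G u v)"
proof -
  interpret F: hermitian_form s W F by fact
  interpret G: hermitian_form s W G by fact
  show ?thesis
  proof
    fix u w assume "u \<in> W" "w \<in> W"
    then show "F w u + G w u = cnj (F u w + G u w)"
      using F.F_herm[of u w] G.F_herm[of u w] by simp
  qed (simp_all add: F.W_zero F.W_add F.W_scale F.F_add G.F_add F.F_scale G.F_scale F.F_pos G.F_pos algebra_simps)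
qed

lemma hermitian_form_subspace:
  assumes "hermitian_form s W F" "V \<subseteq> W" "0 \<in> V" "\<And>u v. u \<in> V \<Longrightarrow> v \<in> V \<Longrightarrow> u + v \<in> V"
    "\<And>c u. u \<in> V \<Longrightarrow> s c u \<in> V"
  shows "hermitian_form s V F"
proof -
  interpret F: hermitian_form s W F by fact
  show ?thesis
  proof
    fix u w assume "u \<in> V" "w \<in> V"
    then show "F w u = cnj (F u w)" using assms(2) by (intro F.F_herm) auto
  qed (use assms(2-) in \<open>auto intro!: F.F_add F.F_scale F.F_pos\<close>)
qed

lemma H1_norm_form:
  assumes "open \<Omega>"
  shows "hermitian_form cscale (H1 \<Omega>) (\<lambda>u v. L2_inner lborel \<Omega> u v + grad_inner \<Omega> u v)"
proof -
  interpret G: hermitian_form cscale "H1 \<Omega>" "grad_inner \<Omega>" by (rule H1_hermitian[OF assms])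
  show ?thesis
    by (intro hermitian_form_sum G.hermitian_form_axioms hermitian_form_subspace[OF L2_hermitian])
      (auto intro: H1_L2 G.W_zero G.W_add G.W_scale)
qed

lemma H1_norm_eq: "H1_norm \<Omega> u = sqrt (Re (L2_inner lborel \<Omega> u u + grad_inner \<Omega> u u))"
  by (simp add: H1_norm_def L2_q grad_norm_power2)

lemma H1_triangle:
  assumes "open \<Omega>" "u \<in> H1 \<Omega>" "v \<in> H1 \<Omega>"
  shows "H1_norm \<Omega> (\<lambda>x. u x + v x) \<le> H1_norm \<Omega> u + H1_norm \<Omega> v"
  using hermitian_form.seminorm_triangle[OF H1_norm_form[OF assms(1)] assms(2,3)]
  by (simp only: H1_norm_eq plus_fun_def)

lemma H1_closed_ops:
  assumes "open \<Omega>"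
  shows "u \<in> H1 \<Omega> \<Longrightarrow> v \<in> H1 \<Omega> \<Longrightarrow> (\<lambda>x. u x + v x) \<in> H1 \<Omega>"
    and "u \<in> H1 \<Omega> \<Longrightarrow> v \<in> H1 \<Omega> \<Longrightarrow> (\<lambda>x. u x - v x) \<in> H1 \<Omega>"
    and "u \<in> H1 \<Omega> \<Longrightarrow> (\<lambda>x. c * u x) \<in> H1 \<Omega>"
    and "(\<lambda>x. 0) \<in> H1 \<Omega>"
proof -
  interpret G: hermitian_form cscale "H1 \<Omega>" "grad_inner \<Omega>" by (rule H1_hermitian[OF assms])
  show "u \<in> H1 \<Omega> \<Longrightarrow> v \<in> H1 \<Omega> \<Longrightarrow> (\<lambda>x. u x + v x) \<in> H1 \<Omega>"
    using G.W_add[of u v] by (simp add: plus_fun_def)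
  show "u \<in> H1 \<Omega> \<Longrightarrow> v \<in> H1 \<Omega> \<Longrightarrow> (\<lambda>x. u x - v x) \<in> H1 \<Omega>"
    using G.W_diff[of u v] by (simp add: fun_diff_def)
  show "u \<in> H1 \<Omega> \<Longrightarrow> (\<lambda>x. c * u x) \<in> H1 \<Omega>" using G.W_scale[of u c] by (simp add: cscale_def)
  show "(\<lambda>x. 0) \<in> H1 \<Omega>" using G.W_zero by (simp add: zero_fun_def)
qed

lemma H1_norm_minus_commute:
  assumes "open \<Omega>" "u \<in> H1 \<Omega>" "v \<in> H1 \<Omega>"
  shows "H1_norm \<Omega> (\<lambda>x. u x - v x) = H1_norm \<Omega> (\<lambda>x. v x - u x)"
  using hermitian_form.q_minus_commute[OF H1_norm_form[OF assms(1)] assms(2,3)]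
  by (simp only: H1_norm_eq fun_diff_def)

lemma H1_norm_cmult:
  assumes "open \<Omega>" "u \<in> H1 \<Omega>"
  shows "H1_norm \<Omega> (\<lambda>x. c * u x) = cmod c * H1_norm \<Omega> u"
  using hermitian_form.q_scale[OF H1_norm_form[OF assms(1)] assms(2), of c]
  by (simp only: H1_norm_eq cscale_def real_sqrt_mult real_sqrt_power[symmetric] real_sqrt_abs) simp

lemma H1_triangle_minus:
  assumes "open \<Omega>" "u \<in> H1 \<Omega>" "v \<in> H1 \<Omega>" "w \<in> H1 \<Omega>"
  shows "H1_norm \<Omega> (\<lambda>x. u x - w x) \<le> H1_norm \<Omega> (\<lambda>x. u x - v x) + H1_norm \<Omega> (\<lambda>x. v x - w x)"
  using H1_triangle[OF assms(1) H1_closed_ops(2)[OF assms(1,2,3)] H1_closed_ops(2)[OF assms(1,3,4)]] by simp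

lemma H1_norm_tendsto_zero:
  assumes "open \<Omega>" "\<And>n. has_weak_gradient \<Omega> (w n) (G n)"
    and "(\<lambda>n. L2_norm lborel \<Omega> (w n)) \<longlonglongrightarrow> 0" "\<And>i. (\<lambda>n. L2_norm lborel \<Omega> (\<lambda>x. G n x $ i)) \<longlonglongrightarrow> 0"
  shows "(\<lambda>n. H1_norm \<Omega> (w n)) \<longlonglongrightarrow> 0"
proof -
  have "(\<lambda>n. sqrt ((L2_norm lborel \<Omega> (w n))\<^sup>2 + (\<Sum>i\<in>UNIV. (L2_norm lborel \<Omega> (\<lambda>x. G n x $ i))\<^sup>2))) \<longlonglongrightarrow>
      sqrt (0\<^sup>2 + (\<Sum>i\<in>(UNIV :: 'a set). 0\<^sup>2))"
    by (intro tendsto_intros assms)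
  then show ?thesis by (simp add: H1_norm_def grad_norm_eq[OF assms(1,2)])
qed

text \<open>Function and gradient components converge separately in L2; the tested identity is
  continuous for this convergence, so the limit of the gradients is the gradient of the
  limit.\<close>

theorem H1_complete:
  assumes \<Omega>: "open \<Omega>" and u: "\<And>n::nat. u n \<in> H1 \<Omega>"
    and cauchy: "\<And>e. e > 0 \<Longrightarrow> \<exists>N. \<forall>m\<ge>N. \<forall>n\<ge>N. H1_norm \<Omega> (\<lambda>x. u m x - u n x) < e"
  shows "\<exists>v\<in>H1 \<Omega>. (\<lambda>n. H1_norm \<Omega> (\<lambda>x. u n x - v x)) \<longlonglongrightarrow> 0"
proof -
  let ?G = "\<lambda>n. weak_gradient \<Omega> (u n)"
  note gu = H1_weak_gradient[OF u]
  have gd: "has_weak_gradient \<Omega> (\<lambda>x. u m x - u n x) (\<lambda>x. ?G m x - ?G n x)" for m n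
    by (rule weak_gradient_diff[OF \<Omega> H1_L2[OF u] gu H1_L2[OF u] gu])
  have "\<exists>g\<in>L2_space lborel \<Omega>. (\<lambda>n. L2_norm lborel \<Omega> (\<lambda>x. u n x - g x)) \<longlonglongrightarrow> 0"
  proof (rule L2_complete[OF H1_L2[OF u]])
    fix e :: real assume "e > 0"
    from cauchy[OF this] show "\<exists>N. \<forall>m\<ge>N. \<forall>n\<ge>N. L2_norm lborel \<Omega> (\<lambda>x. u m x - u n x) < e"
      using L2_norm_le_H1_norm le_less_trans by blast
  qed
  then obtain v where v: "v \<in> L2_space lborel \<Omega>" "(\<lambda>n. L2_norm lborel \<Omega> (\<lambda>x. u n x - v x)) \<longlonglongrightarrow> 0"
    by blast
  have "\<exists>g. g \<in> L2_space lborel \<Omega> \<and> (\<lambda>n. L2_norm lborel \<Omega> (\<lambda>x. ?G n x $ i - g x)) \<longlonglongrightarrow> 0" for i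
    unfolding Bex_def[symmetric]
  proof (rule L2_complete[OF weak_gradient_L2[OF gu]])
    fix e :: real assume "e > 0"
    from cauchy[OF this] obtain N where N: "\<And>m n. m \<ge> N \<Longrightarrow> n \<ge> N \<Longrightarrow> H1_norm \<Omega> (\<lambda>x. u m x - u n x) < e"
      by blast
    have "L2_norm lborel \<Omega> (\<lambda>x. ?G m x $ i - ?G n x $ i) < e" if "m \<ge> N" "n \<ge> N" for m n
      using le_less_trans[OF gradient_le_H1_norm[OF \<Omega> gd] N[OF that]] by simp
    then show "\<exists>N. \<forall>m\<ge>N. \<forall>n\<ge>N. L2_norm lborel \<Omega> (\<lambda>x. ?G m x $ i - ?G n x $ i) < e" by blast
  qed
  then have "\<forall>i. \<exists>g. g \<in> L2_space lborel \<Omega> \<and> (\<lambda>n. L2_norm lborel \<Omega> (\<lambda>x. ?G n x $ i - g x)) \<longlonglongrightarrow> 0" by blast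
  from choice[OF this] obtain g where g: "\<And>i. g i \<in> L2_space lborel \<Omega>"
    "\<And>i. (\<lambda>n. L2_norm lborel \<Omega> (\<lambda>x. ?G n x $ i - g i x)) \<longlonglongrightarrow> 0" by blast
  have lim: "(\<lambda>n. LINT x|lborel. zero_ext \<Omega> (w n) x * \<phi> x) \<longlonglongrightarrow> (LINT x|lborel. zero_ext \<Omega> z x * \<phi> x)"
    if w: "\<And>n. w n \<in> L2_space lborel \<Omega>" and z: "z \<in> L2_space lborel \<Omega>"
      and c: "(\<lambda>n. L2_norm lborel \<Omega> (\<lambda>x. w n x - z x)) \<longlonglongrightarrow> 0" and \<phi>: "\<phi> \<in> L2_space lborel UNIV" for w z \<phi>
  proof -
    have eq: "(LINT x|lborel. zero_ext \<Omega> (w n) x * \<phi> x) - (LINT x|lborel. zero_ext \<Omega> z x * \<phi> x)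
        = (LINT x|lborel. zero_ext \<Omega> (\<lambda>x. w n x - z x) x * \<phi> x)" for n
      using L2_mult_integrable[OF zero_ext_L2[OF w] \<phi>] L2_mult_integrable[OF zero_ext_L2[OF z] \<phi>]
      by (subst Bochner_Integration.integral_diff[symmetric])
        (auto simp: zero_ext_def scaleR_diff_right left_diff_distrib)
    have "(\<lambda>n. (LINT x|lborel. zero_ext \<Omega> (w n) x * \<phi> x) - (LINT x|lborel. zero_ext \<Omega> z x * \<phi> x)) \<longlonglongrightarrow> 0"
      unfolding eq
      by (rule null_seq_bound[OF L2_pairing_bound[OF L2_diff[OF w z] \<phi>] tendsto_mult_left_zero[OF c]])
    then show ?thesis by (simp add: LIM_zero_iff)
  qed
  have grad: "has_weak_gradient \<Omega> v (\<lambda>x. \<chi> i. g i x)"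
  proof (rule has_weak_gradientI)
    show "(\<lambda>x. (\<chi> i. g i x) $ i) \<in> L2_space lborel \<Omega>" for i using g(1)[of i] by simp
    fix i \<phi> assume \<phi>: "C1_test \<Omega> \<phi> (\<lambda>i. partial i \<phi>)"
    note L = C1_test_L2[OF C1_test_of_real[OF \<phi>]]
    have "(\<lambda>n. - (LINT x|lborel. zero_ext \<Omega> (\<lambda>x. ?G n x $ i) x * of_real (\<phi> x))) \<longlonglongrightarrow>
        - (LINT x|lborel. zero_ext \<Omega> (g i) x * of_real (\<phi> x))"
      by (intro tendsto_minus lim[OF weak_gradient_L2[OF gu] g(1) g(2) L(1)])
    moreover have "(\<lambda>n. LINT x|lborel. zero_ext \<Omega> (u n) x * of_real (partial i \<phi> x)) \<longlonglongrightarrow>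
        (LINT x|lborel. zero_ext \<Omega> v x * of_real (partial i \<phi> x))"
      by (rule lim[OF H1_L2[OF u] v L(2)])
    ultimately have "(LINT x|lborel. zero_ext \<Omega> v x * of_real (partial i \<phi> x)) = - (LINT x|lborel. zero_ext \<Omega> (g i) x * of_real (\<phi> x))"
      unfolding weak_gradient_real_test[OF \<Omega> H1_L2[OF u] gu \<phi>] by (rule LIMSEQ_unique[rotated])
    then show "(LINT x|lborel. zero_ext \<Omega> v x * of_real (partial i \<phi> x)) = - (LINT x|lborel. zero_ext \<Omega> (\<lambda>x. (\<chi> i. g i x) $ i) x * of_real (\<phi> x))"
      by simp
  qed
  have "(\<lambda>n. H1_norm \<Omega> (\<lambda>x. u n x - v x)) \<longlonglongrightarrow> 0"
    by (rule H1_norm_tendsto_zero[OF \<Omega> weak_gradient_diff[OF \<Omega> H1_L2[OF u] gu v(1) grad] v(2)])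
      (use g(2) in simp)
  with H1I[OF v(1) grad] show ?thesis by blast
qed

section \<open>Traces\<close>

lemma has_traceD:
  assumes "has_trace \<Omega> M S u g"
  shows "u \<in> H1 \<Omega>" "g \<in> L2_space M S"
  using assms by (auto simp: has_trace_def)

lemma has_traceE:
  assumes "has_trace \<Omega> M S u g"
  obtains v where "\<And>n::nat. v n \<in> H1 \<Omega>" "\<And>n. continuous_on (\<Omega> \<union> S) (v n)" "\<And>n. v n \<in> L2_space M S"
    "(\<lambda>n. H1_norm \<Omega> (\<lambda>x. v n x - u x)) \<longlonglongrightarrow> 0" "(\<lambda>n. L2_norm M S (\<lambda>x. v n x - g x)) \<longlonglongrightarrow> 0"
  using assms unfolding has_trace_def by blast

lemma has_traceI:
  assumes "u \<in> H1 \<Omega>" "g \<in> L2_space M S"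
    "\<And>n::nat. v n \<in> H1 \<Omega>" "\<And>n. continuous_on (\<Omega> \<union> S) (v n)" "\<And>n. v n \<in> L2_space M S"
    "(\<lambda>n. H1_norm \<Omega> (\<lambda>x. v n x - u x)) \<longlonglongrightarrow> 0" "(\<lambda>n. L2_norm M S (\<lambda>x. v n x - g x)) \<longlonglongrightarrow> 0"
  shows "has_trace \<Omega> M S u g"
  using assms unfolding has_trace_def by blast

context
  fixes \<Omega> :: "(real^'n::finite) set"
  assumes \<Omega>: "open \<Omega>"
begin

lemma H1_norm_AE_zero:
  assumes "AE x\<in>\<Omega> in lborel. u x = 0" "u \<in> L2_space lborel \<Omega>"
  shows "H1_norm \<Omega> u = 0"
proof -
  have "(grad_norm \<Omega> u)\<^sup>2 = 0"
    using grad_norm_eq[OF \<Omega> weak_gradient_zero[OF \<Omega> assms(1)]] by (simp add: L2_norm_eq)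
  moreover have "L2_norm lborel \<Omega> u = 0"
    using L2_norm_cong_AE[OF assms(2) L2_zero assms(1)] by (simp add: L2_norm_eq)
  ultimately show ?thesis by (simp add: H1_norm_def)
qed

lemma H1_norm_zero [simp]: "H1_norm \<Omega> (\<lambda>x. 0) = 0"
  by (rule H1_norm_AE_zero) (auto simp: L2_zero)

lemma has_trace_continuous:
  assumes "u \<in> H1 \<Omega>" "continuous_on (\<Omega> \<union> S) u" "u \<in> L2_space M S"
  shows "has_trace \<Omega> M S u u"
  by (rule has_traceI[where v = "\<lambda>n. u"]) (use assms in \<open>auto simp: L2_norm_eq\<close>)

lemma has_trace_add:
  assumes "has_trace \<Omega> M S u g" "has_trace \<Omega> M S v h"
  shows "has_trace \<Omega> M S (\<lambda>x. u x + v x) (\<lambda>x. g x + h x)"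
proof -
  note D = has_traceD[OF assms(1)] has_traceD[OF assms(2)]
  obtain a where a: "\<And>n::nat. a n \<in> H1 \<Omega>" "\<And>n. continuous_on (\<Omega> \<union> S) (a n)" "\<And>n. a n \<in> L2_space M S"
    "(\<lambda>n. H1_norm \<Omega> (\<lambda>x. a n x - u x)) \<longlonglongrightarrow> 0" "(\<lambda>n. L2_norm M S (\<lambda>x. a n x - g x)) \<longlonglongrightarrow> 0"
    using has_traceE[OF assms(1)] by blast
  obtain b where b: "\<And>n::nat. b n \<in> H1 \<Omega>" "\<And>n. continuous_on (\<Omega> \<union> S) (b n)" "\<And>n. b n \<in> L2_space M S"
    "(\<lambda>n. H1_norm \<Omega> (\<lambda>x. b n x - v x)) \<longlonglongrightarrow> 0" "(\<lambda>n. L2_norm M S (\<lambda>x. b n x - h x)) \<longlonglongrightarrow> 0"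
    using has_traceE[OF assms(2)] by blast
  show ?thesis
  proof (rule has_traceI[where v = "\<lambda>n x. a n x + b n x"])
    have "norm (H1_norm \<Omega> (\<lambda>x. (a n x + b n x) - (u x + v x))) \<le> H1_norm \<Omega> (\<lambda>x. a n x - u x) + H1_norm \<Omega> (\<lambda>x. b n x - v x)" for n
      using H1_triangle[OF \<Omega> H1_closed_ops(2)[OF \<Omega> a(1) D(1)] H1_closed_ops(2)[OF \<Omega> b(1) D(3)], of n n]
      by (simp add: algebra_simps)
    then show "(\<lambda>n. H1_norm \<Omega> (\<lambda>x. (a n x + b n x) - (u x + v x))) \<longlonglongrightarrow> 0"
      by (rule null_seq_bound) (rule tendsto_add_zero[OF a(4) b(4)])
    have "norm (L2_norm M S (\<lambda>x. (a n x + b n x) - (g x + h x))) \<le> L2_norm M S (\<lambda>x. a n x - g x) + L2_norm M S (\<lambda>x. b n x - h x)" for n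
      using L2_triangle[OF L2_diff[OF a(3) D(2)] L2_diff[OF b(3) D(4)], of n n] by (simp add: algebra_simps)
    then show "(\<lambda>n. L2_norm M S (\<lambda>x. (a n x + b n x) - (g x + h x))) \<longlonglongrightarrow> 0"
      by (rule null_seq_bound) (rule tendsto_add_zero[OF a(5) b(5)])
  qed (auto intro!: H1_closed_ops[OF \<Omega>] L2_add D a b continuous_intros)
qed

lemma has_trace_cmult:
  assumes "has_trace \<Omega> M S u g"
  shows "has_trace \<Omega> M S (\<lambda>x. c * u x) (\<lambda>x. c * g x)"
proof -
  note D = has_traceD[OF assms(1)]
  obtain a where a: "\<And>n::nat. a n \<in> H1 \<Omega>" "\<And>n. continuous_on (\<Omega> \<union> S) (a n)" "\<And>n. a n \<in> L2_space M S"
    "(\<lambda>n. H1_norm \<Omega> (\<lambda>x. a n x - u x)) \<longlonglongrightarrow> 0" "(\<lambda>n. L2_norm M S (\<lambda>x. a n x - g x)) \<longlonglongrightarrow> 0"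
    using has_traceE[OF assms(1)] by blast
  show ?thesis
  proof (rule has_traceI[where v = "\<lambda>n x. c * a n x"])
    have "H1_norm \<Omega> (\<lambda>x. c * a n x - c * u x) = cmod c * H1_norm \<Omega> (\<lambda>x. a n x - u x)" for n
      using H1_norm_cmult[OF \<Omega> H1_closed_ops(2)[OF \<Omega> a(1) D(1)], of c n] by (simp add: right_diff_distrib)
    then show "(\<lambda>n. H1_norm \<Omega> (\<lambda>x. c * a n x - c * u x)) \<longlonglongrightarrow> 0"
      using tendsto_mult_right_zero[OF a(4), of "cmod c"] by simp
    have "L2_norm M S (\<lambda>x. c * a n x - c * g x) = cmod c * L2_norm M S (\<lambda>x. a n x - g x)" for n
      using L2_norm_cmult[of M S c "\<lambda>x. a n x - g x"] by (simp add: right_diff_distrib)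
    then show "(\<lambda>n. L2_norm M S (\<lambda>x. c * a n x - c * g x)) \<longlonglongrightarrow> 0"
      using tendsto_mult_right_zero[OF a(5), of "cmod c"] by simp
  qed (auto intro!: H1_closed_ops[OF \<Omega>] L2_cmult D a continuous_intros)
qed

lemma has_trace_diff:
  assumes "has_trace \<Omega> M S u g" "has_trace \<Omega> M S v h"
  shows "has_trace \<Omega> M S (\<lambda>x. u x - v x) (\<lambda>x. g x - h x)"
  using has_trace_add[OF assms(1) has_trace_cmult[OF assms(2), of "- 1"]] by simp

text \<open>A diagonal choice: continuous approximants of \<open>u n\<close> are taken within
  \<open>1 / (n + 1)\<close> in both norms, and the triangle inequality shows that they approximate
  the limits.\<close>

lemma has_trace_closed:
  assumes t: "\<And>n::nat. has_trace \<Omega> M S (u n) (g n)" and v: "v \<in> H1 \<Omega>" "(\<lambda>n. H1_norm \<Omega> (\<lambda>x. u n x - v x)) \<longlonglongrightarrow> 0"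
    and h: "h \<in> L2_space M S" "(\<lambda>n. L2_norm M S (\<lambda>x. g n x - h x)) \<longlonglongrightarrow> 0"
  shows "has_trace \<Omega> M S v h"
proof -
  note D = has_traceD[OF t]
  have "\<exists>a. a \<in> H1 \<Omega> \<and> continuous_on (\<Omega> \<union> S) a \<and> a \<in> L2_space M S \<and>
    H1_norm \<Omega> (\<lambda>x. a x - u n x) < inverse (real (Suc n)) \<and> L2_norm M S (\<lambda>x. a x - g n x) < inverse (real (Suc n))" for n
  proof -
    obtain a where a: "\<And>n::nat. a n \<in> H1 \<Omega>" "\<And>n. continuous_on (\<Omega> \<union> S) (a n)" "\<And>n. a n \<in> L2_space M S"
      "(\<lambda>m. H1_norm \<Omega> (\<lambda>x. a m x - u n x)) \<longlonglongrightarrow> 0" "(\<lambda>m. L2_norm M S (\<lambda>x. a m x - g n x)) \<longlonglongrightarrow> 0"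
      using has_traceE[OF t[of n]] by blast
    have pos: "inverse (real (Suc n)) > 0" by simp
    have "\<forall>\<^sub>F m in sequentially. H1_norm \<Omega> (\<lambda>x. a m x - u n x) < inverse (real (Suc n))"
      by (rule order_tendstoD(2)[OF a(4) pos])
    moreover have "\<forall>\<^sub>F m in sequentially. L2_norm M S (\<lambda>x. a m x - g n x) < inverse (real (Suc n))"
      by (rule order_tendstoD(2)[OF a(5) pos])
    ultimately have "\<forall>\<^sub>F m in sequentially. H1_norm \<Omega> (\<lambda>x. a m x - u n x) < inverse (real (Suc n)) \<and>
      L2_norm M S (\<lambda>x. a m x - g n x) < inverse (real (Suc n))" by (rule eventually_conj)
    then obtain m where "H1_norm \<Omega> (\<lambda>x. a m x - u n x) < inverse (real (Suc n))"
      "L2_norm M S (\<lambda>x. a m x - g n x) < inverse (real (Suc n))"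
      using eventually_happens'[OF sequentially_bot] by blast
    with a show ?thesis by blast
  qed
  then have "\<forall>n. \<exists>a. a \<in> H1 \<Omega> \<and> continuous_on (\<Omega> \<union> S) a \<and> a \<in> L2_space M S \<and>
    H1_norm \<Omega> (\<lambda>x. a x - u n x) < inverse (real (Suc n)) \<and> L2_norm M S (\<lambda>x. a x - g n x) < inverse (real (Suc n))" by blast
  from choice[OF this] obtain a where a: "\<And>n. a n \<in> H1 \<Omega>" "\<And>n. continuous_on (\<Omega> \<union> S) (a n)" "\<And>n. a n \<in> L2_space M S"
    "\<And>n. H1_norm \<Omega> (\<lambda>x. a n x - u n x) < inverse (real (Suc n))"
    "\<And>n. L2_norm M S (\<lambda>x. a n x - g n x) < inverse (real (Suc n))" by blast
  show ?thesis
  proof (rule has_traceI[where v = a])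
    have "norm (H1_norm \<Omega> (\<lambda>x. a n x - v x)) \<le> inverse (real (Suc n)) + H1_norm \<Omega> (\<lambda>x. u n x - v x)" for n
      using H1_triangle_minus[OF \<Omega> a(1) D(1) v(1), of n n] a(4)[of n] by simp
    then show "(\<lambda>n. H1_norm \<Omega> (\<lambda>x. a n x - v x)) \<longlonglongrightarrow> 0"
      by (rule null_seq_bound) (rule tendsto_add_zero[OF LIMSEQ_inverse_real_of_nat v(2)])
    have "norm (L2_norm M S (\<lambda>x. a n x - h x)) \<le> inverse (real (Suc n)) + L2_norm M S (\<lambda>x. g n x - h x)" for n
      using L2_triangle_minus[OF a(3) D(2) h(1), of n n] a(5)[of n] by simp
    then show "(\<lambda>n. L2_norm M S (\<lambda>x. a n x - h x)) \<longlonglongrightarrow> 0"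
      by (rule null_seq_bound) (rule tendsto_add_zero[OF LIMSEQ_inverse_real_of_nat h(2)])
  qed (use a v h in auto)
qed

lemma H1_mult:
  assumes u: "u \<in> H1 \<Omega>"
    and X: "\<And>x. has_grad X (\<lambda>i. X' i x) x" "\<And>i. continuous_on UNIV (X' i)"
      "\<And>x. x \<in> \<Omega> \<Longrightarrow> \<bar>X x\<bar> \<le> C" "\<And>i x. x \<in> \<Omega> \<Longrightarrow> \<bar>X' i x\<bar> \<le> C"
  shows "(\<lambda>x. of_real (X x) * u x) \<in> H1 \<Omega>"
  using weak_gradient_mult[OF \<Omega> H1_L2[OF u] H1_weak_gradient[OF u] X] by (auto intro: H1I)

lemma H1_norm_mult_tendsto:
  assumes w: "\<And>n::nat. w n \<in> H1 \<Omega>" "(\<lambda>n. H1_norm \<Omega> (w n)) \<longlonglongrightarrow> 0"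
    and X: "\<And>x. has_grad X (\<lambda>i. X' i x) x" "\<And>i. continuous_on UNIV (X' i)"
      "\<And>x. x \<in> \<Omega> \<Longrightarrow> \<bar>X x\<bar> \<le> C" "\<And>i x. x \<in> \<Omega> \<Longrightarrow> \<bar>X' i x\<bar> \<le> C"
  shows "(\<lambda>n. H1_norm \<Omega> (\<lambda>x. of_real (X x) * w n x)) \<longlonglongrightarrow> 0"
proof (rule H1_norm_tendsto_zero[OF \<Omega>])
  let ?G = "\<lambda>n. weak_gradient \<Omega> (w n)"
  note W = weak_gradient_mult[OF \<Omega> H1_L2[OF w(1)] H1_weak_gradient[OF w(1)] X]
  have X'w: "(\<lambda>x. of_real (X' i x) * w n x) \<in> L2_space lborel \<Omega>" for i n by (rule W(2))
  have XG: "(\<lambda>x. of_real (X x) * ?G n x $ i + of_real (X' i x) * w n x) \<in> L2_space lborel \<Omega>" for i n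
    using weak_gradient_L2[OF W(3)[of n]] by simp
  define C' where "C' = max C 0"
  have C': "C' \<ge> 0" "x \<in> \<Omega> \<Longrightarrow> \<bar>X x\<bar> \<le> C'" "x \<in> \<Omega> \<Longrightarrow> \<bar>X' i x\<bar> \<le> C'" for i x
    using X(3)[of x] X(4)[of x i] by (auto simp: C'_def)
  show "has_weak_gradient \<Omega> (\<lambda>x. of_real (X x) * w n x) (\<lambda>x. \<chi> i. of_real (X x) * ?G n x $ i + of_real (X' i x) * w n x)" for n
    by (rule W(3))
  have cX: "continuous_on UNIV X"
    using X(1) has_grad_isCont by (blast intro: continuous_at_imp_continuous_on)
  have bound: "L2_norm lborel \<Omega> (\<lambda>x. of_real (h x) * z x) \<le> C' * L2_norm lborel \<Omega> z"
    if "z \<in> L2_space lborel \<Omega>" "continuous_on UNIV h" "\<And>x. x \<in> \<Omega> \<Longrightarrow> \<bar>h x\<bar> \<le> C'" for h z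
  proof (rule L2_norm_bounded_mult[OF that(1)])
    show "set_borel_measurable lborel \<Omega> (\<lambda>x. complex_of_real (h x))"
      unfolding set_borel_measurable_def
      by (intro borel_measurable_scaleR borel_measurable_of_real borel_measurable_indicator)
        (use \<Omega> that in \<open>auto intro: borel_measurable_continuous_onI\<close>)
  qed (use that(3) C' in auto)
  have lim0: "(\<lambda>n. L2_norm lborel \<Omega> (w n)) \<longlonglongrightarrow> 0"
    by (rule null_seq_bound[OF _ w(2)]) (simp add: L2_norm_le_H1_norm)
  have limG: "(\<lambda>n. L2_norm lborel \<Omega> (\<lambda>x. ?G n x $ i)) \<longlonglongrightarrow> 0" for i
    by (rule null_seq_bound[OF _ w(2)]) (simp add: gradient_le_H1_norm[OF \<Omega> H1_weak_gradient[OF w(1)]])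
  show "(\<lambda>n. L2_norm lborel \<Omega> (\<lambda>x. of_real (X x) * w n x)) \<longlonglongrightarrow> 0"
    by (rule null_seq_bound[OF _ tendsto_mult_right_zero[OF lim0, of C']])
      (simp add: bound[OF H1_L2[OF w(1)] cX C'(2)])
  fix i
  have "L2_norm lborel \<Omega> (\<lambda>x. of_real (X x) * ?G n x $ i + of_real (X' i x) * w n x) \<le>
      C' * L2_norm lborel \<Omega> (\<lambda>x. ?G n x $ i) + C' * L2_norm lborel \<Omega> (w n)" for n
  proof -
    note g = weak_gradient_L2[OF H1_weak_gradient[OF w(1)[of n]], of i]
    have m: "(\<lambda>x. of_real (X x) * ?G n x $ i) \<in> L2_space lborel \<Omega>"
      using L2_diff[OF XG[where i = i and n = n] X'w[where i = i and n = n]] by simp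
    show ?thesis
      using L2_triangle[OF m X'w[where i = i and n = n]] bound[OF g cX C'(2)] bound[OF H1_L2[OF w(1)[of n]] X(2)[of i] C'(3)] by linarith
  qed
  then show "(\<lambda>n. L2_norm lborel \<Omega> (\<lambda>x. (\<chi> i. of_real (X x) * ?G n x $ i + of_real (X' i x) * w n x) $ i)) \<longlonglongrightarrow> 0"
    by (intro null_seq_bound[OF _ tendsto_add_zero[OF tendsto_mult_right_zero[OF limG, of C'] tendsto_mult_right_zero[OF lim0, of C']]]) simp
qed

lemma has_trace_mult:
  assumes t: "has_trace \<Omega> M S u g" and S: "S \<in> sets M" "sets M = sets borel"
    and X: "\<And>x. has_grad X (\<lambda>i. X' i x) x" "\<And>i. continuous_on UNIV (X' i)"
      "\<And>x. x \<in> \<Omega> \<union> S \<Longrightarrow> \<bar>X x\<bar> \<le> C" "\<And>i x. x \<in> \<Omega> \<Longrightarrow> \<bar>X' i x\<bar> \<le> C" and "C \<ge> 0"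
  shows "has_trace \<Omega> M S (\<lambda>x. of_real (X x) * u x) (\<lambda>x. of_real (X x) * g x)"
proof -
  note D = has_traceD[OF t]
  have X3: "\<And>x. x \<in> \<Omega> \<Longrightarrow> \<bar>X x\<bar> \<le> C" using X(3) by blast
  obtain a where a: "\<And>n::nat. a n \<in> H1 \<Omega>" "\<And>n. continuous_on (\<Omega> \<union> S) (a n)" "\<And>n. a n \<in> L2_space M S"
    "(\<lambda>n. H1_norm \<Omega> (\<lambda>x. a n x - u x)) \<longlonglongrightarrow> 0" "(\<lambda>n. L2_norm M S (\<lambda>x. a n x - g x)) \<longlonglongrightarrow> 0"
    using has_traceE[OF t] by blast
  have cX: "continuous_on UNIV X"
    using X(1) has_grad_isCont by (blast intro: continuous_at_imp_continuous_on)
  have Xb: "X \<in> borel_measurable M"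
    unfolding measurable_cong_sets[OF S(2) refl] using cX by (rule borel_measurable_continuous_onI)
  have "(\<lambda>x. complex_of_real (X x)) \<in> borel_measurable M" using Xb by simp
  then have mX: "set_borel_measurable M S (\<lambda>x. complex_of_real (X x))"
    unfolding set_borel_measurable_def
    by (intro borel_measurable_scaleR borel_measurable_indicator S)
  have XL: "(\<lambda>x. of_real (X x) * z x) \<in> L2_space M S" if "z \<in> L2_space M S" for z
    by (rule L2_bounded_mult[OF that mX, where C = C]) (use X(3) in auto)
  show ?thesis
  proof (rule has_traceI[where v = "\<lambda>n x. of_real (X x) * a n x"])
    show "(\<lambda>n. H1_norm \<Omega> (\<lambda>x. of_real (X x) * a n x - of_real (X x) * u x)) \<longlonglongrightarrow> 0"
      using H1_norm_mult_tendsto[OF H1_closed_ops(2)[OF \<Omega> a(1) D(1)] a(4) X(1,2) X3 X(4)]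
      by (simp add: right_diff_distrib)
    have "norm (L2_norm M S (\<lambda>x. of_real (X x) * (a n x - g x))) \<le> C * L2_norm M S (\<lambda>x. a n x - g x)" for n
      using L2_norm_bounded_mult[OF L2_diff[OF a(3) D(2)] mX _ \<open>C \<ge> 0\<close>] X(3) by simp
    from null_seq_bound[OF this tendsto_mult_right_zero[OF a(5)]]
    show "(\<lambda>n. L2_norm M S (\<lambda>x. of_real (X x) * a n x - of_real (X x) * g x)) \<longlonglongrightarrow> 0"
      by (simp add: right_diff_distrib)
    show "continuous_on (\<Omega> \<union> S) (\<lambda>x. of_real (X x) * a n x)" for n
      by (intro continuous_intros a continuous_on_subset[OF cX]) auto
  qed (auto intro!: H1_mult[OF _ X(1,2) X3 X(4)] XL D a)
qed

text \<open>Approximants vanishing near \<open>S'\<close> are continuous up to \<open>S'\<close>; this is why a trace on some other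
  part \<open>S\<close> of the boundary, which provides approximants continuous inside \<open>\<Omega>\<close>, suffices.\<close>
lemma has_trace_zero_near:
  assumes t: "has_trace \<Omega> M S u g"
    and X: "\<And>x. has_grad X (\<lambda>i. X' i x) x" "\<And>i. continuous_on UNIV (X' i)"
      "\<And>x. x \<in> \<Omega> \<Longrightarrow> \<bar>X x\<bar> \<le> C" "\<And>i x. x \<in> \<Omega> \<Longrightarrow> \<bar>X' i x\<bar> \<le> C"
    and N: "open N" "S' \<subseteq> N" "\<And>x. x \<in> N \<Longrightarrow> X x = 0"
  shows "has_trace \<Omega> M' S' (\<lambda>x. of_real (X x) * u x) (\<lambda>x. 0)"
proof -
  note D = has_traceD[OF t]
  obtain a where a: "\<And>n::nat. a n \<in> H1 \<Omega>" "\<And>n. continuous_on (\<Omega> \<union> S) (a n)"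
    "(\<lambda>n. H1_norm \<Omega> (\<lambda>x. a n x - u x)) \<longlonglongrightarrow> 0"
    by (rule has_traceE[OF t]) (rule that)
  have cX: "continuous_on UNIV X"
    using X(1) has_grad_isCont by (blast intro: continuous_at_imp_continuous_on)
  have z: "indicator S' x *\<^sub>R (of_real (X x) * b x) = 0" for x and b :: "real^'n \<Rightarrow> complex"
    using N(2,3) by (auto simp: indicator_def)
  have L: "(\<lambda>x. of_real (X x) * b x) \<in> L2_space M' S'" for b :: "real^'n \<Rightarrow> complex"
    unfolding L2_space_iff z by simp
  show ?thesis
  proof (rule has_traceI[where v = "\<lambda>n x. of_real (X x) * a n x"])
    show "(\<lambda>n. H1_norm \<Omega> (\<lambda>x. of_real (X x) * a n x - of_real (X x) * u x)) \<longlonglongrightarrow> 0"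
      using H1_norm_mult_tendsto[OF H1_closed_ops(2)[OF \<Omega> a(1) D(1)] a(3) X]
      by (simp add: right_diff_distrib)
    show "(\<lambda>n. L2_norm M' S' (\<lambda>x. of_real (X x) * a n x - 0)) \<longlonglongrightarrow> 0"
      unfolding L2_norm_eq diff_zero z by simp
    have "continuous_on (\<Omega> \<union> N) (\<lambda>x. of_real (X x) * a n x)" for n
    proof (rule continuous_on_open_Un[OF \<Omega> N(1)])
      show "continuous_on \<Omega> (\<lambda>x. of_real (X x) * a n x)"
        by (intro continuous_intros continuous_on_subset[OF a(2)] continuous_on_subset[OF cX]) auto
      show "continuous_on N (\<lambda>x. of_real (X x) * a n x)"
        by (rule continuous_on_eq[of N "\<lambda>_. 0"]) (use N in auto)
    qed
    then show "continuous_on (\<Omega> \<union> S') (\<lambda>x. of_real (X x) * a n x)" for n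
      by (rule continuous_on_subset) (use N in auto)
  qed (auto intro!: H1_mult[OF _ X] L L2_zero D a)
qed

end

section \<open>The Steklov problem in a subspace of \<open>H\<^sup>1\<close>\<close>

locale steklov = trace_properties \<Omega> M S
  for \<Omega> :: "(real^'n::finite) set" and M :: "(real^'n) measure" and S :: "(real^'n) set" +
  assumes open_\<Omega>: "open \<Omega>"
begin

definition tr :: "(real^'n \<Rightarrow> complex) \<Rightarrow> real^'n \<Rightarrow> complex" where
  "tr u = (SOME g. has_trace \<Omega> M S u g)"

definition bform :: "(real^'n \<Rightarrow> complex) \<Rightarrow> (real^'n \<Rightarrow> complex) \<Rightarrow> complex" where
  "bform u v = L2_inner M S (tr u) (tr v)"

lemma trace_tr: "u \<in> H1 \<Omega> \<Longrightarrow> has_trace \<Omega> M S u (tr u)"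
  unfolding tr_def using trace_exists by (rule someI_ex)

lemma trace_zero:
  assumes "has_trace \<Omega> M S u g" "H1_norm \<Omega> u = 0"
  shows "L2_norm M S g = 0"
proof -
  obtain C where "\<forall>u g. has_trace \<Omega> M S u g \<longrightarrow> sqrt ((grad_norm \<Omega> u)\<^sup>2 + (L2_norm M S g)\<^sup>2) \<le> C * H1_norm \<Omega> u"
    using norm_equivalence by blast
  then have "sqrt ((grad_norm \<Omega> u)\<^sup>2 + (L2_norm M S g)\<^sup>2) \<le> 0" using assms by fastforce
  then have "(grad_norm \<Omega> u)\<^sup>2 + (L2_norm M S g)\<^sup>2 \<le> 0" by simp
  then have "(L2_norm M S g)\<^sup>2 \<le> 0" using zero_le_power2[of "grad_norm \<Omega> u"] by linarith
  then show ?thesis by simp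
qed

text \<open>The difference of two traces is a trace of the zero function, and the upper estimate in
  the norm equivalence makes it vanish. This renders the choice in \<open>tr\<close>
  harmless.\<close>

lemma trace_unique:
  assumes "has_trace \<Omega> M S u g" "has_trace \<Omega> M S u h"
  shows "AE x\<in>S in M. g x = h x"
proof -
  have "has_trace \<Omega> M S (\<lambda>x. 0) (\<lambda>x. g x - h x)"
    using has_trace_diff[OF open_\<Omega> assms] by simp
  from trace_zero[OF this] have "L2_norm M S (\<lambda>x. g x - h x) = 0" using H1_norm_zero[OF open_\<Omega>] by simp
  from L2_norm_zero_AE[OF _ this] show ?thesis
    using L2_diff has_traceD(2)[OF assms(1)] has_traceD(2)[OF assms(2)] by fastforce
qed

lemma bform_eq:
  assumes "has_trace \<Omega> M S u g" "has_trace \<Omega> M S v h"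
  shows "bform u v = L2_inner M S g h"
  unfolding bform_def
  using trace_tr[OF has_traceD(1)[OF assms(1)]] trace_tr[OF has_traceD(1)[OF assms(2)]] assms
  by (intro L2_inner_cong_AE trace_unique) (auto dest: has_traceD)

lemma bform_self: "has_trace \<Omega> M S u g \<Longrightarrow> Re (bform u u) = (L2_norm M S g)\<^sup>2"
  by (simp add: bform_eq L2_q)

lemma bform_hermitian: "hermitian_form cscale (H1 \<Omega>) bform"
proof -
  interpret H: hermitian_form cscale "H1 \<Omega>" "grad_inner \<Omega>" by (rule H1_hermitian[OF open_\<Omega>])
  show ?thesis
  proof
    fix u v w c
    show "0 \<le> Re (bform u u)" by (simp add: bform_def L2_q)
    assume u: "u \<in> H1 \<Omega>"
    assume w: "w \<in> H1 \<Omega>"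
    note t = trace_tr[OF u] trace_tr[OF w]
    note L = has_traceD(2)[OF t(1)] has_traceD(2)[OF t(2)]
    have c: "has_trace \<Omega> M S (cscale c u) (cscale c (tr u))"
      using has_trace_cmult[OF open_\<Omega> t(1)] by (simp add: cscale_def)
    show "bform (cscale c u) w = c * bform u w"
      unfolding bform_eq[OF c t(2)] bform_eq[OF t] by (rule L2.F_scale[OF L])
    show "bform w u = cnj (bform u w)"
      unfolding bform_eq[OF t] bform_eq[OF t(2,1)] by (rule L2.F_herm[OF L])
    assume v: "v \<in> H1 \<Omega>"
    have a: "has_trace \<Omega> M S (u + v) (tr u + tr v)"
      using has_trace_add[OF open_\<Omega> t(1) trace_tr[OF v]] by (simp add: plus_fun_def)
    show "bform (u + v) w = bform u w + bform v w"
      unfolding bform_eq[OF a t(2)] bform_eq[OF t] bform_eq[OF trace_tr[OF v] t(2)]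
      by (rule L2.F_add[OF L(1) has_traceD(2)[OF trace_tr[OF v]] L(2)])
  qed (simp_all add: H.W_zero H.W_add H.W_scale)
qed

lemma energy_bounds:
  obtains c C where "c > 0" "C > 0"
    "\<And>u. u \<in> H1 \<Omega> \<Longrightarrow> c * (H1_norm \<Omega> u)\<^sup>2 \<le> Re (grad_inner \<Omega> u u) + Re (bform u u)"
    "\<And>u. u \<in> H1 \<Omega> \<Longrightarrow> Re (grad_inner \<Omega> u u) + Re (bform u u) \<le> C * (H1_norm \<Omega> u)\<^sup>2"
proof -
  obtain c C where c: "c > 0" "C > 0" "\<And>u g. has_trace \<Omega> M S u g \<Longrightarrow>
        c * H1_norm \<Omega> u \<le> sqrt ((grad_norm \<Omega> u)\<^sup>2 + (L2_norm M S g)\<^sup>2) \<and>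
        sqrt ((grad_norm \<Omega> u)\<^sup>2 + (L2_norm M S g)\<^sup>2) \<le> C * H1_norm \<Omega> u"
    using norm_equivalence by blast
  have e: "Re (grad_inner \<Omega> u u) + Re (bform u u) = (grad_norm \<Omega> u)\<^sup>2 + (L2_norm M S (tr u))\<^sup>2" if "u \<in> H1 \<Omega>" for u
    using bform_self[OF trace_tr[OF that]] by (simp add: grad_norm_power2)
  show thesis
  proof (rule that[of "c\<^sup>2" "C\<^sup>2"])
    fix u assume u: "u \<in> H1 \<Omega>"
    let ?s = "(grad_norm \<Omega> u)\<^sup>2 + (L2_norm M S (tr u))\<^sup>2"
    note b = c(3)[OF trace_tr[OF u]]
    have "(c * H1_norm \<Omega> u)\<^sup>2 \<le> (sqrt ?s)\<^sup>2"
      using b c(1) by (intro power_mono) auto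
    then show "c\<^sup>2 * (H1_norm \<Omega> u)\<^sup>2 \<le> Re (grad_inner \<Omega> u u) + Re (bform u u)"
      unfolding e[OF u] by (simp add: power_mult_distrib)
    have "(sqrt ?s)\<^sup>2 \<le> (C * H1_norm \<Omega> u)\<^sup>2"
      using b by (intro power_mono) auto
    then show "Re (grad_inner \<Omega> u u) + Re (bform u u) \<le> C\<^sup>2 * (H1_norm \<Omega> u)\<^sup>2"
      unfolding e[OF u] by (simp add: power_mult_distrib)
  qed (use c in auto)
qed

end

text \<open>\<open>W_closed\<close> and \<open>W_rank\<close> are what the spectral construction
  demands of a subspace: the first provides limits of minimizing sequences, the second boundary
  values of arbitrarily large dimension.\<close>

locale steklov_subspace = steklov \<Omega> M S
  for \<Omega> :: "(real^'n::finite) set" and M :: "(real^'n) measure" and S :: "(real^'n) set" +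
  fixes W :: "(real^'n \<Rightarrow> complex) set"
  assumes W_H1: "u \<in> W \<Longrightarrow> u \<in> H1 \<Omega>"
    and zero_in_W: "(\<lambda>x. 0) \<in> W"
    and add_in_W: "u \<in> W \<Longrightarrow> v \<in> W \<Longrightarrow> (\<lambda>x. u x + v x) \<in> W"
    and cmult_in_W: "u \<in> W \<Longrightarrow> (\<lambda>x. c * u x) \<in> W"
    and W_closed: "\<And>u v. (\<And>n::nat. u n \<in> W) \<Longrightarrow> v \<in> H1 \<Omega> \<Longrightarrow>
      (\<lambda>n. H1_norm \<Omega> (\<lambda>x. u n x - v x)) \<longlonglongrightarrow> 0 \<Longrightarrow> v \<in> W"
    and W_rank: "\<And>n::nat. \<exists>w. (\<forall>i<n. w i \<in> W) \<and>
      (\<forall>c. (\<exists>i<n. c i \<noteq> 0) \<longrightarrow> Re (bform (\<Sum>i<n. cscale (c i) (w i)) (\<Sum>i<n. cscale (c i) (w i))) > 0)"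
begin

lemma W_ops: "u \<in> W \<Longrightarrow> v \<in> W \<Longrightarrow> u + v \<in> W" "u \<in> W \<Longrightarrow> cscale c u \<in> W" "0 \<in> W"
  using add_in_W[of u v] cmult_in_W[of u c] zero_in_W
  by (simp_all add: plus_fun_def cscale_def zero_fun_def)

text \<open>The norm equivalence makes the seminorm of \<open>A + B\<close> equivalent to the H1
  norm, so completeness comes from H1 together with closedness of \<open>W\<close>, and compactness
  of \<open>B\<close> is compactness of the trace map.\<close>

sublocale form_pair cscale W "grad_inner \<Omega>" bform
proof -
  interpret A: hermitian_form cscale W "grad_inner \<Omega>"
    by (rule hermitian_form_subspace[OF H1_hermitian[OF open_\<Omega>]]) (auto intro: W_H1 W_ops)
  interpret B: hermitian_form cscale W bform
    by (rule hermitian_form_subspace[OF bform_hermitian]) (auto intro: W_H1 W_ops)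
  obtain c C where c: "c > 0" "C > 0"
    "\<And>u. u \<in> H1 \<Omega> \<Longrightarrow> c * (H1_norm \<Omega> u)\<^sup>2 \<le> A.q u + B.q u"
    "\<And>u. u \<in> H1 \<Omega> \<Longrightarrow> A.q u + B.q u \<le> C * (H1_norm \<Omega> u)\<^sup>2"
    using energy_bounds by blast
  show "form_pair cscale W (grad_inner \<Omega>) bform"
  proof
    fix u :: "nat \<Rightarrow> real^'n \<Rightarrow> complex"
    assume u: "\<And>n. u n \<in> W"
      and cauchy: "\<And>e. e > 0 \<Longrightarrow> \<exists>N. \<forall>m\<ge>N. \<forall>n\<ge>N. A.q (u m - u n) + B.q (u m - u n) < e"
    have "\<exists>v\<in>H1 \<Omega>. (\<lambda>n. H1_norm \<Omega> (\<lambda>x. u n x - v x)) \<longlonglongrightarrow> 0"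
    proof (rule H1_complete[OF open_\<Omega> W_H1[OF u]])
      fix e :: real assume "e > 0"
      then obtain N where N: "\<And>m n. m \<ge> N \<Longrightarrow> n \<ge> N \<Longrightarrow> A.q (u m - u n) + B.q (u m - u n) < c * e\<^sup>2"
        using cauchy[of "c * e\<^sup>2"] c(1) by auto
      have "H1_norm \<Omega> (\<lambda>x. u m x - u n x) < e" if "m \<ge> N" "n \<ge> N" for m n
      proof -
        have "c * (H1_norm \<Omega> (u m - u n))\<^sup>2 < c * e\<^sup>2"
          using c(3)[OF W_H1[OF A.W_diff[OF u[of m] u[of n]]]] N[OF that] by linarith
        then have "(H1_norm \<Omega> (u m - u n))\<^sup>2 < e\<^sup>2" using c(1) by simp
        then have "H1_norm \<Omega> (u m - u n) < e" using \<open>e > 0\<close> by (simp add: power2_less_imp_less)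
        then show ?thesis by (simp add: fun_diff_def)
      qed
      then show "\<exists>N. \<forall>m\<ge>N. \<forall>n\<ge>N. H1_norm \<Omega> (\<lambda>x. u m x - u n x) < e" by blast
    qed
    then obtain v where v: "v \<in> H1 \<Omega>" "(\<lambda>n. H1_norm \<Omega> (\<lambda>x. u n x - v x)) \<longlonglongrightarrow> 0" by blast
    have vW: "v \<in> W" by (rule W_closed[OF u v])
    have lim: "(\<lambda>n. C * (H1_norm \<Omega> (\<lambda>x. u n x - v x))\<^sup>2) \<longlonglongrightarrow> 0"
    proof (rule tendsto_mult_right_zero)
      show "(\<lambda>n. (H1_norm \<Omega> (\<lambda>x. u n x - v x))\<^sup>2) \<longlonglongrightarrow> 0"
        using tendsto_power[OF v(2), of 2] by simp
    qed
    have le: "A.q (u n - v) + B.q (u n - v) \<le> C * (H1_norm \<Omega> (\<lambda>x. u n x - v x))\<^sup>2" for n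
      using c(4)[OF W_H1[OF A.W_diff[OF u[of n] vW]]] by (simp add: fun_diff_def)
    have pos: "A.q (u n - v) \<ge> 0" "B.q (u n - v) \<ge> 0" for n
      using A.F_pos[OF A.W_diff[OF u[of n] vW]] B.F_pos[OF A.W_diff[OF u[of n] vW]] by auto
    have bA: "norm (A.q (u n - v)) \<le> C * (H1_norm \<Omega> (\<lambda>x. u n x - v x))\<^sup>2"
      and bB: "norm (B.q (u n - v)) \<le> C * (H1_norm \<Omega> (\<lambda>x. u n x - v x))\<^sup>2" for n
      using le[of n] pos[of n] by simp_all
    from null_seq_bound[OF bA lim] null_seq_bound[OF bB lim] show "\<exists>v\<in>W. (\<lambda>n. A.q (u n - v)) \<longlonglongrightarrow> 0 \<and> (\<lambda>n. B.q (u n - v)) \<longlonglongrightarrow> 0"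
      using vW by blast
  next
    fix u :: "nat \<Rightarrow> real^'n \<Rightarrow> complex" and K
    assume u: "\<And>n. u n \<in> W" and K: "\<And>n. A.q (u n) + B.q (u n) \<le> K"
    have "norm (H1_norm \<Omega> (u n)) \<le> sqrt (K / c)" for n
    proof -
      have "c * (H1_norm \<Omega> (u n))\<^sup>2 \<le> K" using c(3)[OF W_H1[OF u[of n]]] K[of n] by linarith
      then have "(H1_norm \<Omega> (u n))\<^sup>2 \<le> K / c" using c(1) by (simp add: field_simps)
      then show ?thesis using real_le_rsqrt by simp
    qed
    then have "bounded (range (\<lambda>n. H1_norm \<Omega> (u n)))" by (auto simp: bounded_iff)
    from trace_compact[OF trace_tr[OF W_H1[OF u]] this] obtain r h where r: "strict_mono r" "h \<in> L2_space M S"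
      "(\<lambda>n. L2_norm M S (\<lambda>x. tr (u (r n)) x - h x)) \<longlonglongrightarrow> 0" by blast
    have tL: "tr (u n) \<in> L2_space M S" for n by (rule has_traceD(2)[OF trace_tr[OF W_H1[OF u]]])
    have "\<exists>N. \<forall>m\<ge>N. \<forall>n\<ge>N. B.q (u (r m) - u (r n)) < e" if "e > 0" for e
    proof -
      have "sqrt e / 2 > 0" using that by simp
      from LIMSEQ_D[OF r(3) this] obtain N where N: "\<And>n. n \<ge> N \<Longrightarrow> L2_norm M S (\<lambda>x. tr (u (r n)) x - h x) < sqrt e / 2"
        by auto
      have "B.q (u (r m) - u (r n)) < e" if mn: "m \<ge> N" "n \<ge> N" for m n
      proof -
        have "L2_norm M S (\<lambda>x. tr (u (r m)) x - tr (u (r n)) x) < sqrt e"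
          using L2_triangle_minus[OF tL[of "r m"] r(2) tL[of "r n"]] N[OF mn(1)] N[OF mn(2)]
            L2_norm_minus_commute[of M S h "tr (u (r n))"] by linarith
        then have "(L2_norm M S (\<lambda>x. tr (u (r m)) x - tr (u (r n)) x))\<^sup>2 < (sqrt e)\<^sup>2"
          by (intro power_strict_mono) auto
        moreover have "has_trace \<Omega> M S (u (r m) - u (r n)) (\<lambda>x. tr (u (r m)) x - tr (u (r n)) x)"
          using has_trace_diff[OF open_\<Omega> trace_tr[OF W_H1[OF u]] trace_tr[OF W_H1[OF u]], of "r m" "r n"] by (simp add: fun_diff_def)
        ultimately show ?thesis using \<open>e > 0\<close> bform_self by simp
      qed
      then show ?thesis by blast
    qed
    then show "\<exists>r::nat\<Rightarrow>nat. strict_mono r \<and> (\<forall>e>0. \<exists>N. \<forall>m\<ge>N. \<forall>n\<ge>N. B.q (u (r m) - u (r n)) < e)"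
      using r(1) by (intro exI[of _ r] conjI allI impI)
  qed (rule W_rank)
qed

lemma eigenspace_iff:
  "U \<in> eigenspace \<Omega> M S W \<mu> \<longleftrightarrow> U \<in> W \<and> (\<forall>V\<in>W. grad_inner \<Omega> U V = \<mu> * bform U V)"
proof -
  have "(\<forall>f g. has_trace \<Omega> M S U f \<longrightarrow> has_trace \<Omega> M S V g \<longrightarrow> grad_inner \<Omega> U V = \<mu> * L2_inner M S f g) \<longleftrightarrow>
     grad_inner \<Omega> U V = \<mu> * bform U V" if "U \<in> W" "V \<in> W" for V
    using bform_eq trace_tr[OF W_H1[OF that(1)]] trace_tr[OF W_H1[OF that(2)]] by metis
  then show ?thesis by (auto simp: eigenspace_def)
qed

text \<open>The bridge from the abstract expansion, which ends with a remainder null for both forms,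
  to \<open>has_dim_ae\<close>, which speaks of equality almost everywhere;
  \<open>AE_zero_bform\<close> leads back.\<close>

lemma form_zero_AE:
  assumes "p \<in> W" "A.q p = 0" "B.q p = 0"
  shows "AE x\<in>\<Omega> in lborel. p x = 0"
proof -
  obtain c where c: "c > 0" "c * (H1_norm \<Omega> p)\<^sup>2 \<le> A.q p + B.q p"
    using energy_bounds W_H1[OF assms(1)] by metis
  then have "H1_norm \<Omega> p = 0" using assms by (simp add: mult_le_0_iff)
  then have "L2_norm lborel \<Omega> p = 0"
    using L2_norm_le_H1_norm[of \<Omega> p] by (intro antisym) auto
  then show ?thesis by (rule L2_norm_zero_AE[OF H1_L2[OF W_H1[OF assms(1)]]])
qed

lemma AE_zero_bform:
  assumes "p \<in> W" "AE x\<in>\<Omega> in lborel. p x = 0"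
  shows "B.q p = 0"
  using bform_self[OF trace_tr[OF W_H1[OF assms(1)]]] trace_zero[OF trace_tr[OF W_H1[OF assms(1)]]]
    H1_norm_AE_zero[OF open_\<Omega> assms(2) H1_L2[OF W_H1[OF assms(1)]]] by simp

text \<open>For each complex \<open>\<mu>\<close> the vectors \<open>e j\<close> with
  \<open>\<Lambda> j = \<mu>\<close> are independent by orthonormality and span the eigenspace by
  \<open>eigenvector_expansion\<close>. A value off the list, in particular a nonreal one, gets the
  empty basis.\<close>

theorem spectral_basis_eigenvalue_sequence:
  assumes basis: "spectral_basis e \<Lambda>"
  shows "eigenvalue_sequence \<Omega> M S W \<Lambda>"
  unfolding eigenvalue_sequence_def
proof (intro conjI allI)
  note eW = e_in_W[OF basis]
  show "mono \<Lambda>" by (rule lambda_mono[OF basis])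
  fix \<mu> :: complex
  let ?J = "{j. complex_of_real (\<Lambda> j) = \<mu>}"
  have "?J \<subseteq> {j. \<Lambda> j \<le> Re \<mu>}" by auto
  then show fin: "finite ?J" using finite_level[OF basis] finite_subset by blast
  obtain h where h: "bij_betw h {..<card ?J} ?J"
    using ex_bij_betw_nat_finite[OF fin] by (metis atLeast0LessThan)
  have hJ: "complex_of_real (\<Lambda> (h i)) = \<mu>" if "i < card ?J" for i
    using h that by (auto simp: bij_betw_def)
  have inj: "inj_on h {..<card ?J}" using h by (simp add: bij_betw_def)
  show "has_dim_ae \<Omega> (eigenspace \<Omega> M S W \<mu>) (card ?J)"
    unfolding has_dim_ae_def
  proof (intro exI[of _ "\<lambda>i. e (h i)"] conjI allI impI ballI)
    show "e (h i) \<in> eigenspace \<Omega> M S W \<mu>" if "i < card ?J" for i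
      using hJ[OF that] e_eigen[OF basis, of _ "h i"] eW by (simp add: eigenspace_iff)
  next
    fix c i assume ae: "AE x\<in>\<Omega> in lborel. (\<Sum>i<card ?J. c i * e (h i) x) = 0" and i: "i < card ?J"
    \<comment> \<open>Coefficients indexed by \<open>i < card ?J\<close> are transported to the
      index set \<open>?J\<close>, where \<open>q_lincomb\<close> reads off the sum of their squared
      moduli.\<close>
    let ?c = "\<lambda>j. c (inv_into {..<card ?J} h j)"
    let ?p = "\<Sum>j\<in>?J. cscale (?c j) (e j)"
    have p: "?p = (\<Sum>i<card ?J. cscale (c i) (e (h i)))"
      unfolding sum.reindex_bij_betw[OF h, of "\<lambda>j. cscale (?c j) (e j)", symmetric]
      by (intro sum.cong refl) (simp add: inv_into_f_f[OF inj])
    have pW: "?p \<in> W" by (intro A.W_sum A.W_scale eW)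
    have "AE x\<in>\<Omega> in lborel. ?p x = 0" unfolding p sum_fun_apply cscale_apply by (rule ae)
    from AE_zero_bform[OF pW this] have "(\<Sum>j\<in>?J. (cmod (?c j))\<^sup>2) = 0"
      using q_lincomb(1)[OF basis fin, of ?c] by simp
    then have "\<forall>j\<in>?J. (cmod (?c j))\<^sup>2 = 0" using fin by (subst (asm) sum_nonneg_eq_0_iff) auto
    moreover have "h i \<in> ?J" using hJ[OF i] by simp
    ultimately have "(cmod (?c (h i)))\<^sup>2 = 0" by blast
    then show "c i = 0" using inj i by simp
  next
    fix u assume u: "u \<in> eigenspace \<Omega> M S W \<mu>"
    then have uW: "u \<in> W" and ue: "\<And>v. v \<in> W \<Longrightarrow> grad_inner \<Omega> u v = \<mu> * bform u v"
      by (auto simp: eigenspace_iff)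
    let ?s = "\<Sum>j\<in>?J. cscale (bform u (e j)) (e j)"
    have "AE x\<in>\<Omega> in lborel. (u - ?s) x = 0"
      by (rule form_zero_AE[OF eigenvector_expansion[OF basis uW ue fin refl]])
    moreover have "?s x = (\<Sum>i<card ?J. bform u (e (h i)) * e (h i) x)" for x
      unfolding sum_fun_apply cscale_apply
      using sum.reindex_bij_betw[OF h, of "\<lambda>j. bform u (e j) * e j x"] by simp
    ultimately have "AE x\<in>\<Omega> in lborel. u x = (\<Sum>i<card ?J. bform u (e (h i)) * e (h i) x)"
      by (auto elim!: eventually_mono)
    then show "\<exists>c. AE x\<in>\<Omega> in lborel. u x = (\<Sum>i<card ?J. c i * e (h i) x)"
      by (intro exI[of _ "\<lambda>i. bform u (e (h i))"])
  qed
qed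

lemma kth_eigenvalue_spectral_basis:
  "spectral_basis e \<Lambda> \<Longrightarrow> kth_eigenvalue \<Omega> M S W k = \<Lambda> (k - 1)"
  by (rule kth_eigenvalue_eq[OF spectral_basis_eigenvalue_sequence])

end

section \<open>Cut-off functions and slices\<close>

text \<open>A once differentiable spline, equal to \<open>1 - (1 - (t - 1)\<^sup>2)\<^sup>2\<close>
  between 1 and 2, constantly 0 before and 1 after. One continuous derivative is what
  \<open>C1_test\<close> asks for.\<close>

definition cutoff :: "real \<Rightarrow> real" where
  "cutoff t = 1 - (max 0 (1 - (max 0 (t - 1))\<^sup>2))\<^sup>2"

definition cutoff' :: "real \<Rightarrow> real" where
  "cutoff' t = 4 * max 0 (1 - (max 0 (t - 1))\<^sup>2) * max 0 (t - 1)"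

lemma pos_part_square_deriv: "((\<lambda>t. (max 0 t)\<^sup>2) has_real_derivative 2 * max 0 t) (at (t::real))"
proof -
  consider "t > 0" | "t < 0" | "t = 0" by linarith
  then show ?thesis
  proof cases
    case 1
    have "((\<lambda>t. t\<^sup>2) has_real_derivative 2 * max 0 t) (at t)"
      using 1 by (auto intro!: derivative_eq_intros)
    then show ?thesis
      by (rule has_field_derivative_transform_within_open[where S = "{0<..}"]) (use 1 in auto)
  next
    case 2
    have "((\<lambda>t. 0) has_real_derivative 2 * max 0 t) (at t)" using 2 by simp
    then show ?thesis
      by (rule has_field_derivative_transform_within_open[where S = "{..<0}"]) (use 2 in auto)
  next
    case 3
    have "((\<lambda>h. (max 0 h)\<^sup>2 / h) \<longlongrightarrow> 0) (at (0::real))"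
    proof (rule Lim_null_comparison)
      have "norm ((max 0 h)\<^sup>2 / h) \<le> \<bar>h\<bar>" for h :: real
        by (cases "h > 0") (auto simp: power2_eq_square max_def)
      then show "\<forall>\<^sub>F h in at 0. norm ((max 0 h)\<^sup>2 / h) \<le> \<bar>h :: real\<bar>" by simp
      show "((\<lambda>h. \<bar>h\<bar>) \<longlongrightarrow> 0) (at (0::real))" by (auto intro!: tendsto_eq_intros)
    qed
    then show ?thesis using 3 by (simp add: DERIV_def)
  qed
qed

lemma cutoff_deriv: "(cutoff has_real_derivative cutoff' t) (at t)"
proof -
  have 1: "((\<lambda>t. (max 0 (t - 1))\<^sup>2) has_real_derivative 2 * max 0 (t - 1)) (at (t::real))"
    using DERIV_shift[of "\<lambda>t. (max 0 t)\<^sup>2" "2 * max 0 (t - 1)" t "- 1"] pos_part_square_deriv[of "t - 1"] by simp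
  have "((\<lambda>t. 1 - (max 0 (t - 1))\<^sup>2) has_real_derivative - (2 * max 0 (t - 1))) (at (t::real))"
    using DERIV_diff[OF DERIV_const 1] by simp
  from DERIV_chain2[OF pos_part_square_deriv this]
  have "((\<lambda>t. (max 0 (1 - (max 0 (t - 1))\<^sup>2))\<^sup>2) has_real_derivative
     2 * max 0 (1 - (max 0 (t - 1))\<^sup>2) * (- (2 * max 0 (t - 1)))) (at t)" .
  from DERIV_diff[OF DERIV_const this, of 1] show ?thesis
    by (simp add: cutoff_def[abs_def] cutoff'_def mult.assoc)
qed

lemma continuous_cutoff': "continuous_on A cutoff'"
  unfolding cutoff'_def[abs_def] by (intro continuous_intros)

lemma continuous_cutoff: "continuous_on A cutoff"
  unfolding cutoff_def[abs_def] by (intro continuous_intros)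

lemma cutoff_zero: "t \<le> 1 \<Longrightarrow> cutoff t = 0" "t \<le> 1 \<Longrightarrow> cutoff' t = 0"
  by (simp_all add: cutoff_def cutoff'_def max_def)

lemma cutoff_one:
  assumes "t \<ge> 2"
  shows "cutoff t = 1" "cutoff' t = 0"
proof -
  have "max 0 (t - 1) = t - 1" using assms by simp
  moreover have "1 \<le> (t - 1)\<^sup>2" using assms by (intro one_le_power) auto
  ultimately have "max 0 (1 - (max 0 (t - 1))\<^sup>2) = 0" by (intro max_absorb1) simp
  then show "cutoff t = 1" "cutoff' t = 0" by (simp_all add: cutoff_def cutoff'_def)
qed

lemma cutoff_bounds: "0 \<le> cutoff t" "cutoff t \<le> 1" "0 \<le> cutoff' t" "cutoff' t \<le> 4"
proof -
  let ?a = "max 0 (1 - (max 0 (t - 1))\<^sup>2)"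
  have a: "0 \<le> ?a" "?a \<le> 1" by auto
  then have "?a\<^sup>2 \<le> 1" by (simp add: power_le_one)
  then show "0 \<le> cutoff t" "cutoff t \<le> 1" "0 \<le> cutoff' t" using a by (auto simp: cutoff_def cutoff'_def)
  show "cutoff' t \<le> 4"
  proof (cases "t \<ge> 2")
    case False
    then have "?a * max 0 (t - 1) \<le> 1 * 1" using a by (intro mult_mono) auto
    then show ?thesis by (simp add: cutoff'_def)
  qed (simp add: cutoff_one)
qed

text \<open>A uniform slope on a fixed interval inside the transition zone; it becomes the weight of
  the slab from which boundary values are recovered. The value is
  \<open>4 * (3/4) * (1/4)\<close>.\<close>

lemma cutoff'_ge: "5 / 4 \<le> t \<Longrightarrow> t \<le> 3 / 2 \<Longrightarrow> 3 / 4 \<le> cutoff' t"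
proof -
  assume t: "5 / 4 \<le> t" "t \<le> 3 / 2"
  have "(t - 1)\<^sup>2 \<le> (1 / 2)\<^sup>2" using t by (intro power_mono) auto
  then have a: "1 - (t - 1)\<^sup>2 \<ge> 3 / 4" by (simp add: power2_eq_square)
  have "(3 / 4) * (1 / 4) \<le> (1 - (t - 1)\<^sup>2) * (t - 1)"
    using a t by (intro mult_mono) auto
  moreover have "max 0 (t - 1) = t - 1" "max 0 (1 - (t - 1)\<^sup>2) = 1 - (t - 1)\<^sup>2" using t a by simp_all
  then have "cutoff' t = 4 * ((1 - (t - 1)\<^sup>2) * (t - 1))" by (simp only: cutoff'_def mult.assoc)
  ultimately show ?thesis by linarith
qed

lemma has_grad_cutoff:
  assumes "has_grad f F x"
  shows "has_grad (\<lambda>x. cutoff (f x)) (\<lambda>i. cutoff' (f x) * F i) x"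
  by (rule has_grad_compose[OF assms cutoff_deriv])

lemma has_grad_divide:
  fixes f :: "real^'n::finite \<Rightarrow> real"
  assumes "has_grad f F x"
  shows "has_grad (\<lambda>x. f x / c) (\<lambda>i. F i / c) x"
  using has_grad_mult[OF assms has_grad_const[of "1 / c" x]] by simp

text \<open>The squared distance keeps the function differentiable at \<open>p\<close>. The
  transition takes place between the distances \<open>a\<close> and \<open>sqrt 2 * a\<close>,
  inside the ball of radius \<open>2 * a\<close> used in the estimates.\<close>

definition radial_cutoff :: "real^'n::finite \<Rightarrow> real \<Rightarrow> real^'n \<Rightarrow> real" where
  "radial_cutoff p a x = cutoff ((x - p) \<bullet> (x - p) / a\<^sup>2)"

definition radial_cutoff' :: "real^'n::finite \<Rightarrow> real \<Rightarrow> 'n \<Rightarrow> real^'n \<Rightarrow> real" where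
  "radial_cutoff' p a i x = cutoff' ((x - p) \<bullet> (x - p) / a\<^sup>2) * (2 * (x $ i - p $ i) / a\<^sup>2)"

lemma has_grad_radial_cutoff: "has_grad (radial_cutoff p a) (\<lambda>i. radial_cutoff' p a i x) x"
  unfolding radial_cutoff_def[abs_def] radial_cutoff'_def
  by (rule has_grad_cutoff[OF has_grad_divide[OF has_grad_norm_square]])

lemma continuous_radial_cutoff: "continuous_on A (radial_cutoff p a)"
  unfolding radial_cutoff_def[abs_def]
  by (rule continuous_on_compose2[OF continuous_cutoff[of UNIV]]) (auto intro!: continuous_intros simp: divide_inverse)

lemma continuous_radial_cutoff': "continuous_on A (radial_cutoff' p a i)"
  unfolding radial_cutoff'_def[abs_def] divide_inverse
  by (intro continuous_intros continuous_on_compose2[OF continuous_cutoff'[of UNIV]]) auto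

lemma radial_cutoff_zero:
  assumes "a > 0" "dist x p \<le> a"
  shows "radial_cutoff p a x = 0"
proof -
  have "(norm (x - p))\<^sup>2 \<le> a\<^sup>2" using assms by (intro power_mono) (auto simp: dist_norm)
  then show ?thesis using assms unfolding radial_cutoff_def
    by (intro cutoff_zero) (simp add: power2_norm_eq_inner[symmetric])
qed

lemma radial_cutoff_one:
  assumes "a > 0" "dist x p \<ge> 2 * a"
  shows "radial_cutoff p a x = 1" "radial_cutoff' p a i x = 0"
proof -
  have "(2 * a)\<^sup>2 \<le> (norm (x - p))\<^sup>2" using assms by (intro power_mono) (auto simp: dist_norm)
  moreover have "2 * a\<^sup>2 \<le> (2 * a)\<^sup>2" by (simp add: power_mult_distrib)
  ultimately have "2 * a\<^sup>2 \<le> (norm (x - p))\<^sup>2" by linarith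
  then have "(x - p) \<bullet> (x - p) / a\<^sup>2 \<ge> 2" using assms by (simp add: power2_norm_eq_inner[symmetric] field_simps)
  then show "radial_cutoff p a x = 1" "radial_cutoff' p a i x = 0"
    unfolding radial_cutoff_def radial_cutoff'_def by (simp_all add: cutoff_one)
qed

lemma radial_cutoff_bounds: "0 \<le> radial_cutoff p a x" "radial_cutoff p a x \<le> 1"
  by (simp_all add: radial_cutoff_def cutoff_bounds)

lemma radial_cutoff'_bound:
  assumes "a > 0"
  shows "\<bar>radial_cutoff' p a i x\<bar> \<le> 16 / a"
proof (cases "dist x p \<ge> 2 * a")
  case True
  then show ?thesis using radial_cutoff_one(2)[OF assms True, of i] assms by simp
next
  case False
  have "\<bar>x $ i - p $ i\<bar> \<le> 2 * a"
    using component_le_norm_cart[of "x - p" i] False by (simp add: dist_norm)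
  then have "\<bar>2 * (x $ i - p $ i) / a\<^sup>2\<bar> \<le> 4 / a"
    using assms by (simp add: abs_mult field_simps power2_eq_square)
  then have "\<bar>cutoff' ((x - p) \<bullet> (x - p) / a\<^sup>2)\<bar> * \<bar>2 * (x $ i - p $ i) / a\<^sup>2\<bar> \<le> 4 * (4 / a)"
    using cutoff_bounds(3,4) by (intro mult_mono) auto
  then show ?thesis by (simp add: radial_cutoff'_def abs_mult)
qed

text \<open>The profile \<open>bump d s\<close>: the function \<open>1 / sqrt (d\<^sup>2 + t)\<close> minus its second Taylor polynomial at
  \<open>s\<close>, cut off at \<open>s\<close>; \<open>d\<^sup>2 / sqrt (d\<^sup>2 + |x|\<^sup>2)\<^sup>5\<close> is up to a factor minus its Laplacian in space.\<close>
definition taylor0 :: "real \<Rightarrow> real \<Rightarrow> real \<Rightarrow> real" where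
  "taylor0 d s t = 1 / sqrt (d\<^sup>2 + t) - 1 / sqrt (d\<^sup>2 + s) + (t - s) / (2 * sqrt (d\<^sup>2 + s) ^ 3)
     - 3 / 8 * (t - s)\<^sup>2 / sqrt (d\<^sup>2 + s) ^ 5"

definition taylor1 :: "real \<Rightarrow> real \<Rightarrow> real \<Rightarrow> real" where
  "taylor1 d s t = - 1 / (2 * sqrt (d\<^sup>2 + t) ^ 3) + 1 / (2 * sqrt (d\<^sup>2 + s) ^ 3)
     - 3 / 4 * (t - s) / sqrt (d\<^sup>2 + s) ^ 5"

definition taylor2 :: "real \<Rightarrow> real \<Rightarrow> real \<Rightarrow> real" where
  "taylor2 d s t = 3 / (4 * sqrt (d\<^sup>2 + t) ^ 5) - 3 / (4 * sqrt (d\<^sup>2 + s) ^ 5)"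

lemma sqrt_inverse_deriv:
  assumes "d\<^sup>2 + t > 0"
  shows "((\<lambda>t. c / sqrt (d\<^sup>2 + t) ^ m) has_real_derivative - (real m * c) / (2 * sqrt (d\<^sup>2 + t) ^ (m + 2))) (at t)"
proof -
  let ?y = "sqrt (d\<^sup>2 + t)"
  have y: "?y > 0" using assms by simp
  have "((\<lambda>t. sqrt (d\<^sup>2 + t)) has_real_derivative 1 / (2 * ?y)) (at t)"
    using assms by (auto intro!: derivative_eq_intros simp: field_simps)
  from DERIV_power[OF this, of m]
  have 1: "((\<lambda>t. sqrt (d\<^sup>2 + t) ^ m) has_real_derivative real m * (1 / (2 * ?y) * ?y ^ (m - Suc 0))) (at t)" .
  from DERIV_divide[OF DERIV_const this, of c] y
  have 2: "((\<lambda>t. c / sqrt (d\<^sup>2 + t) ^ m) has_real_derivative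
      - (c * (real m * (1 / (2 * ?y) * ?y ^ (m - Suc 0)))) / (?y ^ m * ?y ^ m)) (at t)" by simp
  have "- (c * (real m * (1 / (2 * ?y) * ?y ^ (m - Suc 0)))) / (?y ^ m * ?y ^ m) = - (real m * c) / (2 * ?y ^ (m + 2))"
  proof (cases m)
    case (Suc k)
    obtain z where z: "z = ?y" "z > 0" using y by blast
    show ?thesis unfolding Suc z(1)[symmetric] using z(2) by (simp add: field_simps)
  qed simp
  with 2 show ?thesis by simp
qed

lemma taylor_derivs:
  assumes "d > 0" "t \<ge> 0"
  shows "(taylor0 d s has_real_derivative taylor1 d s t) (at t)"
    and "(taylor1 d s has_real_derivative taylor2 d s t) (at t)"
proof -
  have p: "d\<^sup>2 + t > 0" using assms by (simp add: add_pos_nonneg)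
  define Y where "Y = sqrt (d\<^sup>2 + s)"
  have D1: "((\<lambda>t. 1 / sqrt (d\<^sup>2 + t)) has_real_derivative - 1 / (2 * sqrt (d\<^sup>2 + t) ^ 3)) (at t)"
    using sqrt_inverse_deriv[OF p, of 1 1] by (simp add: eval_nat_numeral)
  have D3: "((\<lambda>t. (- 1 / 2) / sqrt (d\<^sup>2 + t) ^ 3) has_real_derivative 3 / (4 * sqrt (d\<^sup>2 + t) ^ 5)) (at t)"
    using sqrt_inverse_deriv[OF p, of "- 1 / 2" 3] by simp
  have "((\<lambda>t. c + (t - s) * k - 3 / 8 * (t - s)\<^sup>2 * l) has_real_derivative k - 3 / 4 * (t - s) * l) (at t)" for c k l
    by (auto intro!: derivative_eq_intros simp: field_simps)
  from this[of "- 1 / Y" "1 / (2 * Y ^ 3)" "1 / Y ^ 5"]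
  have "((\<lambda>t. - 1 / Y + (t - s) / (2 * Y ^ 3) - 3 / 8 * (t - s)\<^sup>2 / Y ^ 5) has_real_derivative
      1 / (2 * Y ^ 3) - 3 / 4 * (t - s) / Y ^ 5) (at t)" by simp
  from DERIV_add[OF D1 this] show "(taylor0 d s has_real_derivative taylor1 d s t) (at t)"
    unfolding taylor0_def[abs_def] taylor1_def Y_def[symmetric] by (simp add: algebra_simps)
  have "((\<lambda>t. 1 / (2 * Y ^ 3) - 3 / 4 * (t - s) / Y ^ 5) has_real_derivative - 3 / (4 * Y ^ 5)) (at t)"
    unfolding divide_inverse by (auto intro!: derivative_eq_intros simp: algebra_simps)
  from DERIV_add[OF D3 this] show "(taylor1 d s has_real_derivative taylor2 d s t) (at t)"
    unfolding taylor1_def[abs_def] taylor2_def Y_def[symmetric] by (simp add: algebra_simps)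
qed

lemma taylor_at: "taylor0 d s s = 0" "taylor1 d s s = 0" "taylor2 d s s = 0"
  by (simp_all add: taylor0_def taylor1_def taylor2_def)

lemma taylor0_nonneg:
  assumes "d > 0" "0 \<le> t" "t \<le> s"
  shows "taylor0 d s t \<ge> 0"
proof -
  define y where "y = sqrt (d\<^sup>2 + t)"
  define Y where "Y = sqrt (d\<^sup>2 + s)"
  have y: "y > 0" "Y > 0" using assms by (auto simp: y_def Y_def add_pos_nonneg)
  have yY: "y \<le> Y" using assms by (simp add: y_def Y_def)
  have ts: "t - s = y\<^sup>2 - Y\<^sup>2" using assms by (simp add: y_def Y_def)
  \<comment> \<open>In \<open>y\<close> and \<open>Y\<close> the remainder factors explicitly: the
    triple zero at \<open>y = Y\<close> reflects the degree two of the Taylor polynomial, and the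
    remaining quadratic has positive coefficients.\<close>
  have "taylor0 d s t = (Y - y) ^ 3 * (3 * y\<^sup>2 + 9 * y * Y + 8 * Y\<^sup>2) / (8 * y * Y ^ 5)"
    unfolding taylor0_def y_def[symmetric] Y_def[symmetric] ts
    using y by (simp add: field_simps eval_nat_numeral)
  also have "\<dots> \<ge> 0" using y yY by (intro divide_nonneg_nonneg mult_nonneg_nonneg zero_le_power) auto
  finally show ?thesis .
qed

text \<open>In three dimensions the Laplacian of \<open>f (|x|\<^sup>2)\<close> is
  \<open>4 * t * f'' + 6 * f'\<close> at \<open>t = |x|\<^sup>2\<close>, so the left side is the
  Laplacian of the profile. Its main part is exactly \<open>- 3 * d\<^sup>2 / y ^ 5\<close>; the
  polynomial correction is at most \<open>(15 / 2) / Y ^ 3\<close>, and \<open>15 / 2\<close> is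
  rounded up to 8.\<close>

lemma taylor_laplacian:
  assumes "d > 0" "0 \<le> t" "t \<le> s" "s > 0"
  shows "4 * t * taylor2 d s t + 6 * taylor1 d s t \<le> - 3 * d\<^sup>2 / sqrt (d\<^sup>2 + t) ^ 5 + 8 / sqrt s ^ 3"
proof -
  define y where "y = sqrt (d\<^sup>2 + t)"
  define Y where "Y = sqrt (d\<^sup>2 + s)"
  have y: "y > 0" "Y > 0" using assms by (auto simp: y_def Y_def add_pos_nonneg)
  have Y: "sqrt s \<le> Y" by (simp add: Y_def)
  have t: "t = y\<^sup>2 - d\<^sup>2" using assms by (simp add: y_def)
  have e: "4 * t * taylor2 d s t + 6 * taylor1 d s t =
      (3 * t / y ^ 5 - 3 / y ^ 3) + (- 3 * t / Y ^ 5 + 3 / Y ^ 3 + 9 / 2 * (s - t) / Y ^ 5)"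
    unfolding taylor1_def taylor2_def y_def[symmetric] Y_def[symmetric]
    by (simp add: algebra_simps diff_divide_distrib add_divide_distrib)
  have 1: "3 * t / y ^ 5 - 3 / y ^ 3 = - 3 * d\<^sup>2 / y ^ 5"
    unfolding t using y by (simp add: field_simps eval_nat_numeral)
  have sY: "s \<le> Y\<^sup>2" using assms by (simp add: Y_def)
  have "- 3 * t / Y ^ 5 + 3 / Y ^ 3 + 9 / 2 * (s - t) / Y ^ 5 \<le> 3 / Y ^ 3 + 9 / 2 * Y\<^sup>2 / Y ^ 5"
  proof -
    have "- 3 * t / Y ^ 5 \<le> 0" using assms y by (simp add: divide_nonneg_pos)
    moreover have "9 / 2 * (s - t) / Y ^ 5 \<le> 9 / 2 * Y\<^sup>2 / Y ^ 5"
      using assms y sY by (intro divide_right_mono) auto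
    ultimately show ?thesis by linarith
  qed
  also have "\<dots> = (15 / 2) / Y ^ 3" using y by (simp add: field_simps eval_nat_numeral)
  also have "\<dots> \<le> 8 / Y ^ 3" using y by (intro divide_right_mono) auto
  also have "\<dots> \<le> 8 / sqrt s ^ 3"
    using assms Y by (intro divide_left_mono power_mono mult_pos_pos zero_less_power y) auto
  finally show ?thesis unfolding y_def[symmetric] e 1 by linarith
qed

text \<open>Freezing the argument at \<open>s\<close> preserves differentiability because
  \<open>f\<close> and its derivative vanish there; at \<open>s\<close> the truncated difference
  quotient is dominated by the original one.\<close>

lemma deriv_truncate:
  assumes f: "(f has_real_derivative f' t) (at t)" "(f has_real_derivative 0) (at s)" and z: "f s = 0" "f' s = 0"
  shows "((\<lambda>t. f (min t s)) has_real_derivative f' (min t s)) (at t)"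
proof -
  consider "t < s" | "s < t" | "t = s" by linarith
  then show ?thesis
  proof cases
    case 1
    have "(f has_real_derivative f' (min t s)) (at t)" using 1 f by simp
    then show ?thesis
      by (rule has_field_derivative_transform_within_open[where S = "{..<s}"]) (use 1 in auto)
  next
    case 2
    have "((\<lambda>_. 0) has_real_derivative f' (min t s)) (at t)" using 2 z by simp
    then show ?thesis
      by (rule has_field_derivative_transform_within_open[where S = "{s<..}"]) (use 2 z in auto)
  next
    case 3
    have l: "((\<lambda>h. f (s + h) / h) \<longlongrightarrow> 0) (at 0)" using f(2) z by (simp add: DERIV_def)
    have "((\<lambda>h. f (min (s + h) s) / h) \<longlongrightarrow> 0) (at 0)"
    proof (rule Lim_null_comparison)
      show "\<forall>\<^sub>F h in at 0. norm (f (min (s + h) s) / h) \<le> norm (f (s + h) / h)"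
        by (rule always_eventually) (auto simp: min_def z)
      show "((\<lambda>h. norm (f (s + h) / h)) \<longlongrightarrow> 0) (at 0)" using tendsto_norm_zero[OF l] .
    qed
    then show ?thesis using 3 z by (simp add: DERIV_def)
  qed
qed

text \<open>Taking \<open>min t s\<close> cuts the profile off at \<open>s\<close>, where it
  vanishes with its first two derivatives; so on \<open>t \<ge> 0\<close> the result is twice
  continuously differentiable, and it is zero for \<open>t \<ge> s\<close>.\<close>

definition bump0 :: "real \<Rightarrow> real \<Rightarrow> real \<Rightarrow> real" where "bump0 d s t = taylor0 d s (min t s)"
definition bump1 :: "real \<Rightarrow> real \<Rightarrow> real \<Rightarrow> real" where "bump1 d s t = taylor1 d s (min t s)"
definition bump2 :: "real \<Rightarrow> real \<Rightarrow> real \<Rightarrow> real" where "bump2 d s t = taylor2 d s (min t s)"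

lemma bump_derivs:
  assumes "d > 0" "t \<ge> 0" "s \<ge> 0"
  shows "(bump0 d s has_real_derivative bump1 d s t) (at t)" "(bump1 d s has_real_derivative bump2 d s t) (at t)"
  using deriv_truncate[of "taylor0 d s" "taylor1 d s" t s] deriv_truncate[of "taylor1 d s" "taylor2 d s" t s]
    taylor_derivs[OF assms(1,2), of s] taylor_derivs[OF assms(1,3), of s]
  by (simp_all add: taylor_at bump0_def[abs_def] bump1_def[abs_def] bump2_def[abs_def])

lemma bump_zero: "t \<ge> s \<Longrightarrow> bump0 d s t = 0" "t \<ge> s \<Longrightarrow> bump1 d s t = 0" "t \<ge> s \<Longrightarrow> bump2 d s t = 0"
  by (simp_all add: bump0_def bump1_def bump2_def taylor_at min_def)

lemma continuous_bump2:
  assumes "d > 0" "s \<ge> 0"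
  shows "continuous_on {0..} (bump2 d s)"
proof -
  have "d\<^sup>2 + t \<noteq> 0" if "t \<ge> 0" for t
    using add_pos_nonneg[of "d\<^sup>2" t] assms that by simp
  then show ?thesis
    unfolding bump2_def[abs_def] taylor2_def using assms
    by (intro continuous_intros) (auto simp: min_def)
qed

section \<open>Slicing space by planes orthogonal to the first axis\<close>

lemma at_x1_components [simp]:
  "at_x1 a y $ 1 = a" "at_x1 a y $ 2 = y $ 1" "at_x1 a y $ 3 = y $ 2"
  by (simp_all add: at_x1_def)

lemma at_x3_components [simp]:
  "at_x3 a y $ 1 = y $ 1" "at_x3 a y $ 2 = y $ 2" "at_x3 a y $ 3 = a"
  by (simp_all add: at_x3_def)

lemma continuous_at_x1: "continuous_on A (\<lambda>z. at_x1 (f z) (g z))"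
  if "continuous_on A f" "continuous_on A g"
proof -
  have "at_x1 a y = a *\<^sub>R axis 1 1 + (y $ 1) *\<^sub>R axis 2 1 + (y $ 2) *\<^sub>R axis 3 1" for a y
    by (simp add: vec_eq_iff forall_3 axis_def)
  then show ?thesis using that by (simp add: continuous_intros)
qed

lemma continuous_at_x3: "continuous_on A (\<lambda>z. at_x3 (f z) (g z))"
  if "continuous_on A f" "continuous_on A g"
proof -
  have "at_x3 a y = (y $ 1) *\<^sub>R axis 1 1 + (y $ 2) *\<^sub>R axis 2 1 + a *\<^sub>R axis 3 1" for a y
    by (simp add: vec_eq_iff forall_3 axis_def)
  then show ?thesis using that by (simp add: continuous_intros)
qed

lemma at_x1_measurable [measurable]: "(\<lambda>z. at_x1 (fst z) (snd z)) \<in> borel_measurable (borel \<Otimes>\<^sub>M borel)"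
  unfolding borel_prod by (intro borel_measurable_continuous_onI continuous_at_x1 continuous_intros)

lemma at_x1_measurable2 [measurable]: "at_x1 a \<in> borel_measurable borel"
  by (intro borel_measurable_continuous_onI continuous_at_x1 continuous_intros)

lemma at_x3_measurable [measurable]: "at_x3 a \<in> borel_measurable borel"
  by (intro borel_measurable_continuous_onI continuous_at_x3 continuous_intros)

lemma prod_Basis_cart: "(\<Prod>b\<in>Basis. (x::real^'n::finite) \<bullet> b) = (\<Prod>i\<in>UNIV. x $ i)"
proof -
  have eq: "(Basis :: (real^'n) set) = range (\<lambda>i. axis i 1)" by (auto simp: Basis_vec_def)
  have inj: "inj (\<lambda>i::'n. axis i (1::real))" by (auto simp: inj_on_def axis_eq_axis)
  show ?thesis unfolding eq by (subst prod.reindex[OF inj]) (simp add: inner_axis)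
qed

text \<open>Lebesgue measure is determined by its values on boxes, and a box is the product of an
  interval in the first coordinate and a rectangle in the other two.\<close>

lemma lborel_slices: "lborel = distr (lborel \<Otimes>\<^sub>M lborel) borel (\<lambda>z. at_x1 (fst z) (snd z))"
proof (rule lborel_eqI)
  fix l u :: "real^3" assume le: "\<And>b. b \<in> Basis \<Longrightarrow> l \<bullet> b \<le> u \<bullet> b"
  have le': "l $ i \<le> u $ i" for i
    using le[of "axis i 1"] by (simp add: inner_axis axis_in_Basis_iff)
  let ?l = "vector [l $ 2, l $ 3] :: real^2" and ?u = "vector [u $ 2, u $ 3] :: real^2"
  have "(\<lambda>z. at_x1 (fst z) (snd z)) -` box l u \<inter> space (lborel \<Otimes>\<^sub>M lborel) = box (l $ 1) (u $ 1) \<times> box ?l ?u"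
    by (auto simp: space_pair_measure mem_box_cart forall_3 forall_2 mem_box)
  then have "emeasure (distr (lborel \<Otimes>\<^sub>M lborel) borel (\<lambda>z. at_x1 (fst z) (snd z))) (box l u) =
      emeasure lborel (box (l $ 1) (u $ 1)) * emeasure lborel (box ?l ?u)"
    by (subst emeasure_distr) (auto simp: lborel.emeasure_pair_measure_Times)
  also have "emeasure lborel (box (l $ 1) (u $ 1)) = ennreal (u $ 1 - l $ 1)"
    using le' by (simp add: emeasure_lborel_box_eq)
  also have "emeasure lborel (box ?l ?u) = ennreal (\<Prod>i\<in>UNIV. (?u - ?l) $ i)"
  proof -
    have "\<forall>b\<in>Basis. ?l \<bullet> b \<le> ?u \<bullet> b"
      using le' by (auto simp: Basis_vec_def inner_axis forall_2 UNIV_2)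
    then have "emeasure lborel (box ?l ?u) = ennreal (\<Prod>b\<in>Basis. (?u - ?l) \<bullet> b)"
      by (intro emeasure_lborel_box) blast
    then show ?thesis by (simp only: prod_Basis_cart)
  qed
  also have "ennreal (u $ 1 - l $ 1) * ennreal (\<Prod>i\<in>UNIV. (?u - ?l) $ i) = ennreal (\<Prod>i\<in>UNIV. (u - l) $ i)"
  proof -
    have "(1::2) \<noteq> 2" "(1::3) \<noteq> 2" "(1::3) \<noteq> 3" "(2::3) \<noteq> 3" by simp_all
    then have 2: "(\<Prod>i\<in>(UNIV::2 set). g i) = g 1 * g 2" and 3: "(\<Prod>i\<in>(UNIV::3 set). h i) = h 1 * (h 2 * h 3)"
      for g :: "2 \<Rightarrow> real" and h :: "3 \<Rightarrow> real" unfolding UNIV_2 UNIV_3 by simp_all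
    have "(?u - ?l) $ 1 = u $ 2 - l $ 2" "(?u - ?l) $ 2 = u $ 3 - l $ 3" by simp_all
    note 2 = 2[of "($) (?u - ?l)", unfolded this]
    have 3: "(\<Prod>i\<in>UNIV. (u - l) $ i) = (u $ 1 - l $ 1) * ((u $ 2 - l $ 2) * (u $ 3 - l $ 3))"
      by (simp only: 3 vector_minus_component)
    show ?thesis unfolding 2 3
      by (intro ennreal_mult[symmetric] mult_nonneg_nonneg) (simp_all only: diff_ge_0_iff_ge le')
  qed
  finally show "emeasure (distr (lborel \<Otimes>\<^sub>M lborel) borel (\<lambda>z. at_x1 (fst z) (snd z))) (box l u) = ennreal (\<Prod>b\<in>Basis. (u - l) \<bullet> b)"
    by (simp only: prod_Basis_cart)
qed simp

lemma nn_integral_slices: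
  fixes f :: "real^3 \<Rightarrow> ennreal"
  assumes [measurable]: "f \<in> borel_measurable borel"
  shows "(\<integral>\<^sup>+x. f x \<partial>lborel) = (\<integral>\<^sup>+s. \<integral>\<^sup>+y. f (at_x1 s y) \<partial>lborel \<partial>lborel)"
proof -
  have "(\<integral>\<^sup>+x. f x \<partial>lborel) = (\<integral>\<^sup>+z. f (at_x1 (fst z) (snd z)) \<partial>(lborel \<Otimes>\<^sub>M lborel))"
    by (subst lborel_slices) (subst nn_integral_distr; simp)
  also have "\<dots> = (\<integral>\<^sup>+s. \<integral>\<^sup>+y. f (at_x1 s y) \<partial>lborel \<partial>lborel)"
    by (subst lborel.nn_integral_fst[symmetric]) simp_all
  finally show ?thesis .
qed

section \<open>Estimates near a flat piece of the boundary\<close>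

text \<open>Within distance \<open>r\<close> of \<open>p\<close> the domain is exactly one side of
  the plane through \<open>p\<close> orthogonal to the first axis. The sign tells which side: 1 will
  be used at the left end of the cell, -1 at the right end.\<close>

locale half_ball =
  fixes \<Omega> :: "(real^3) set" and p :: "real^3" and \<sigma> r :: real
  assumes open_\<Omega>: "open \<Omega>" and bounded_\<Omega>: "bounded \<Omega>"
    and sign: "\<sigma> = 1 \<or> \<sigma> = - 1" and r_pos: "r > 0"
    and half: "\<And>x. dist x p < r \<Longrightarrow> x \<in> \<Omega> \<longleftrightarrow> \<sigma> * (x $ 1 - p $ 1) > 0"
begin

definition depth :: "real^3 \<Rightarrow> real" where "depth x = \<sigma> * (x $ 1 - p $ 1)"

lemma sign_square: "\<sigma> * \<sigma> = 1" "\<sigma> \<noteq> 0" "\<bar>\<sigma>\<bar> = 1" "\<sigma> * (\<sigma> * t) = t"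
  using sign by auto

lemma has_grad_depth: "has_grad depth (\<lambda>i. if i = 1 then \<sigma> else 0) x"
proof -
  have "has_grad (\<lambda>x. \<sigma> * (x $ 1 + - p $ 1)) (\<lambda>i. \<sigma> * ((if i = 1 then 1 else 0) + 0) + 0 * (x $ 1 + - p $ 1)) x"
    by (intro has_grad_mult has_grad_add has_grad_const has_grad_coord)
  moreover have "(\<lambda>x::real^3. \<sigma> * (x $ 1 + - p $ 1)) = depth" by (auto simp: depth_def)
  moreover have "(\<lambda>i. \<sigma> * ((if i = 1 then 1 else 0) + 0) + 0 * (x $ 1 + - p $ 1)) = (\<lambda>i. if i = (1::3) then \<sigma> else 0)" by auto
  ultimately show ?thesis by simp
qed

lemma continuous_depth: "continuous_on A depth"
  unfolding depth_def[abs_def] by (intro continuous_intros)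

text \<open>\<open>Z\<close> need not vanish on the flat boundary; the factor removes the layer
  \<open>depth x < \<tau>\<close> and leaves a compact support inside \<open>\<Omega>\<close>. Its
  derivative, of size \<open>1 / \<tau>\<close>, is where boundary terms come from as
  \<open>\<tau>\<close> tends to 0.\<close>

lemma C1_test_layer:
  assumes Z: "\<And>x. has_grad Z (\<lambda>i. Z' i x) x" "\<And>i. continuous_on UNIV (Z' i)"
    and supp: "\<And>x. dist x p > a \<Longrightarrow> Z x = 0" and a: "a < r" and \<tau>: "\<tau> > 0"
  shows "C1_test \<Omega> (\<lambda>x. cutoff (depth x / \<tau>) * Z x)
    (\<lambda>i x. cutoff (depth x / \<tau>) * Z' i x + cutoff' (depth x / \<tau>) * ((if i = 1 then \<sigma> else 0) / \<tau>) * Z x)"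
  unfolding C1_test_def
proof (intro conjI allI)
  have cZ: "continuous_on UNIV Z"
    using Z(1) has_grad_isCont by (blast intro: continuous_at_imp_continuous_on)
  have d: "continuous_on UNIV (\<lambda>x. depth x / \<tau>)" unfolding divide_inverse by (intro continuous_intros continuous_depth)
  show "has_grad (\<lambda>x. cutoff (depth x / \<tau>) * Z x)
    (\<lambda>i. cutoff (depth x / \<tau>) * Z' i x + cutoff' (depth x / \<tau>) * ((if i = 1 then \<sigma> else 0) / \<tau>) * Z x) x" for x
    by (rule has_grad_mult[OF has_grad_cutoff[OF has_grad_divide[OF has_grad_depth]] Z(1)])
  show "continuous_on UNIV (\<lambda>x. cutoff (depth x / \<tau>) * Z' i x + cutoff' (depth x / \<tau>) * ((if i = 1 then \<sigma> else 0) / \<tau>) * Z x)" for i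
    by (intro continuous_intros Z cZ continuous_on_compose2[OF continuous_cutoff[of UNIV] d]
        continuous_on_compose2[OF continuous_cutoff'[of UNIV] d]) auto
  have "closed {x. \<tau> \<le> depth x}"
    by (intro closed_Collect_le continuous_on_const continuous_depth)
  then have "compact (cball p a \<inter> {x. \<tau> \<le> depth x})" by (intro compact_Int_closed) auto
  moreover have "cball p a \<inter> {x. \<tau> \<le> depth x} \<subseteq> \<Omega>"
    using half a \<tau> by (auto simp: depth_def dist_commute)
  moreover have "cutoff (depth x / \<tau>) * Z x = 0" if "x \<notin> cball p a \<inter> {x. \<tau> \<le> depth x}" for x
  proof (cases "dist x p > a")
    case False
    then have "depth x < \<tau>" using that by (auto simp: dist_commute)
    then show ?thesis using \<tau> by (simp add: cutoff_zero)
  qed (simp add: supp)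
  ultimately show "\<exists>K. compact K \<and> K \<subseteq> \<Omega> \<and> (\<forall>x. x \<notin> K \<longrightarrow> cutoff (depth x / \<tau>) * Z x = 0)" by blast
qed

lemma integrable_L2_products:
  assumes "f \<in> L2_space lborel \<Omega>" "g \<in> L2_space lborel \<Omega>" and h: "continuous_on UNIV h" "\<And>x. x \<in> \<Omega> \<Longrightarrow> \<bar>h x\<bar> \<le> C"
  shows "set_integrable lborel \<Omega> (\<lambda>x. f x * cnj (g x) * of_real (h x))"
proof -
  have m: "set_borel_measurable lborel \<Omega> (\<lambda>x. complex_of_real (h x))"
    unfolding set_borel_measurable_def
    by (intro borel_measurable_scaleR borel_measurable_of_real borel_measurable_indicator)
      (use open_\<Omega> h in \<open>auto intro: borel_measurable_continuous_onI\<close>)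
  have "(\<lambda>x. of_real (h x) * g x) \<in> L2_space lborel \<Omega>"
    by (rule L2_bounded_mult[OF assms(2) m, where C = C]) (use h in simp)
  from L2_inner_integrable[OF assms(1) this] show ?thesis
    by (simp add: mult_ac)
qed

lemma norm_square_integrable:
  assumes "f \<in> L2_space lborel \<Omega>" and h: "continuous_on UNIV h" "\<And>x. x \<in> \<Omega> \<Longrightarrow> \<bar>h x\<bar> \<le> C"
  shows "set_integrable lborel \<Omega> (\<lambda>x. (cmod (f x))\<^sup>2 * h x)"
    and "(LINT x:\<Omega>|lborel. f x * cnj (f x) * of_real (h x)) = of_real (LINT x:\<Omega>|lborel. (cmod (f x))\<^sup>2 * h x)"
proof -
  have e: "indicator \<Omega> x *\<^sub>R (f x * cnj (f x) * of_real (h x)) = of_real (indicator \<Omega> x *\<^sub>R ((cmod (f x))\<^sup>2 * h x))" for x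
    using complex_norm_square[of "f x"] by (simp add: indicator_def)
  show "set_integrable lborel \<Omega> (\<lambda>x. (cmod (f x))\<^sup>2 * h x)"
    using integrable_L2_products[OF assms(1,1) h] unfolding set_integrable_def e by (simp only: complex_of_real_integrable_eq)
  show "(LINT x:\<Omega>|lborel. f x * cnj (f x) * of_real (h x)) = of_real (LINT x:\<Omega>|lborel. (cmod (f x))\<^sup>2 * h x)"
    unfolding set_lebesgue_integral_def e by (rule integral_complex_of_real)
qed

text \<open>For \<open>v = u\<close> the two terms of the product rule are conjugate to each other
  and add up to twice a real part.\<close>

lemma product_rule_square:
  assumes u: "u \<in> L2_space lborel \<Omega>" "has_weak_gradient \<Omega> u G" and \<Phi>: "C1_test \<Omega> \<Phi> \<Phi>'"
  shows "(LINT x:\<Omega>|lborel. (cmod (u x))\<^sup>2 * \<Phi>' i x) = - 2 * Re (LINT x:\<Omega>|lborel. G x $ i * cnj (u x) * of_real (\<Phi> x))"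
proof -
  obtain K where K: "compact K" "K \<subseteq> \<Omega>" "\<And>x. x \<notin> K \<Longrightarrow> \<Phi> x = 0" "\<And>i x. x \<notin> K \<Longrightarrow> \<Phi>' i x = 0"
    "continuous_on UNIV \<Phi>" "\<And>i. continuous_on UNIV (\<Phi>' i)"
    using C1_testE[OF \<Phi>] by metis
  obtain B where B: "\<And>x. norm (\<Phi> x) \<le> B" using bounded_continuous_compact_support[OF K(5,1,3)] by metis
  obtain B' where B': "\<And>x. norm (\<Phi>' i x) \<le> B'" using bounded_continuous_compact_support[OF K(6,1,4)] by metis
  note g = weak_gradient_L2[OF u(2), of i]
  have 1: "(LINT x:\<Omega>|lborel. u x * cnj (u x) * of_real (\<Phi>' i x)) =
    - (LINT x:\<Omega>|lborel. (G x $ i * cnj (u x) + u x * cnj (G x $ i)) * of_real (\<Phi> x))"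
    by (rule weak_product_rule[OF open_\<Omega> bounded_\<Omega> u u \<Phi>])
  have i1: "set_integrable lborel \<Omega> (\<lambda>x. G x $ i * cnj (u x) * of_real (\<Phi> x))"
    using B by (intro integrable_L2_products[OF g u(1) K(5)]) auto
  have i2: "set_integrable lborel \<Omega> (\<lambda>x. u x * cnj (G x $ i) * of_real (\<Phi> x))"
    using B by (intro integrable_L2_products[OF u(1) g K(5)]) auto
  have "(LINT x:\<Omega>|lborel. u x * cnj (G x $ i) * of_real (\<Phi> x)) = cnj (LINT x:\<Omega>|lborel. G x $ i * cnj (u x) * of_real (\<Phi> x))"
  proof -
    have "indicator \<Omega> x *\<^sub>R (u x * cnj (G x $ i) * of_real (\<Phi> x)) = cnj (indicator \<Omega> x *\<^sub>R (G x $ i * cnj (u x) * of_real (\<Phi> x)))" for x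
      by (simp add: mult.commute)
    then show ?thesis by (simp only: set_lebesgue_integral_def Bochner_Integration.integral_cnj)
  qed
  then have "(LINT x:\<Omega>|lborel. (G x $ i * cnj (u x) + u x * cnj (G x $ i)) * of_real (\<Phi> x)) =
     of_real (2 * Re (LINT x:\<Omega>|lborel. G x $ i * cnj (u x) * of_real (\<Phi> x)))"
    using set_integral_add(2)[OF i1 i2] complex_add_cnj by (simp add: distrib_right)
  moreover have "(LINT x:\<Omega>|lborel. u x * cnj (u x) * of_real (\<Phi>' i x)) = of_real (LINT x:\<Omega>|lborel. (cmod (u x))\<^sup>2 * \<Phi>' i x)"
    using B' by (intro norm_square_integrable(2)[OF u(1) K(6)]) auto
  ultimately have "complex_of_real (LINT x:\<Omega>|lborel. (cmod (u x))\<^sup>2 * \<Phi>' i x) = of_real (- 2 * Re (LINT x:\<Omega>|lborel. G x $ i * cnj (u x) * of_real (\<Phi> x)))"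
    using 1 by simp
  then show ?thesis by (simp only: of_real_eq_iff)
qed

lemma cross_term_bound:
  assumes "f \<in> L2_space lborel \<Omega>" "g \<in> L2_space lborel \<Omega>" and h: "continuous_on UNIV h" "\<And>x. x \<in> \<Omega> \<Longrightarrow> \<bar>h x\<bar> \<le> C" "C \<ge> 0"
  shows "cmod (LINT x:\<Omega>|lborel. f x * cnj (g x) * of_real (h x)) \<le> C * (L2_norm lborel \<Omega> f * L2_norm lborel \<Omega> g)"
proof -
  have m: "set_borel_measurable lborel \<Omega> (\<lambda>x. complex_of_real (h x))"
    unfolding set_borel_measurable_def
    by (intro borel_measurable_scaleR borel_measurable_of_real borel_measurable_indicator)
      (use open_\<Omega> h in \<open>auto intro: borel_measurable_continuous_onI\<close>)
  have hg: "(\<lambda>x. of_real (h x) * g x) \<in> L2_space lborel \<Omega>"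
    by (rule L2_bounded_mult[OF assms(2) m, where C = C]) (use h in simp)
  have "(LINT x:\<Omega>|lborel. f x * cnj (g x) * of_real (h x)) = L2_inner lborel \<Omega> f (\<lambda>x. of_real (h x) * g x)"
    by (simp add: L2_inner_def mult_ac)
  also have "cmod \<dots> \<le> L2_norm lborel \<Omega> f * L2_norm lborel \<Omega> (\<lambda>x. of_real (h x) * g x)"
    by (rule L2_cauchy_schwarz[OF assms(1) hg])
  also have "\<dots> \<le> L2_norm lborel \<Omega> f * (C * L2_norm lborel \<Omega> g)"
    using h by (intro mult_left_mono L2_norm_bounded_mult[OF assms(2) m]) auto
  finally show ?thesis by (simp add: mult_ac)
qed

text \<open>The weight is the derivative of the cut-off in the direction of depth, localized near
  \<open>p\<close>. Moving this derivative onto \<open>|v|\<^sup>2\<close> costs at most twice the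
  squared H1 norm, and the derivative of the localization, of size \<open>16 / (r / 3)\<close>,
  accounts for \<open>48 / r\<close>; both are uniform in \<open>\<tau>\<close>.\<close>

lemma layer_bound:
  assumes v: "v \<in> H1 \<Omega>" and \<tau>: "\<tau> > 0"
  shows "(LINT x:\<Omega>|lborel. (cmod (v x))\<^sup>2 * (cutoff' (depth x / \<tau>) / \<tau> * (1 - radial_cutoff p (r/3) x)))
    \<le> (2 + 48 / r) * (H1_norm \<Omega> v)\<^sup>2"
proof -
  let ?Z = "\<lambda>x. 1 - radial_cutoff p (r/3) x" and ?Z' = "\<lambda>i x. - radial_cutoff' p (r/3) i x"
  let ?G = "weak_gradient \<Omega> v"
  note u = H1_L2[OF v] H1_weak_gradient[OF v]
  have r3: "r / 3 > 0" using r_pos by simp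
  have Z: "has_grad ?Z (\<lambda>i. ?Z' i x) x" for x
    using has_grad_add[OF has_grad_const[of 1 x] has_grad_mult[OF has_grad_const[of "-1" x] has_grad_radial_cutoff[of p "r/3" x]]] by simp
  have cZ': "continuous_on UNIV (?Z' i)" for i by (intro continuous_intros continuous_radial_cutoff')
  have cZ: "continuous_on UNIV ?Z" by (intro continuous_intros continuous_radial_cutoff)
  have supp: "?Z x = 0" if "dist x p > 2 * (r/3)" for x
    using radial_cutoff_one(1)[OF r3, of x p] that by simp
  have cd: "continuous_on UNIV (\<lambda>x. cutoff (depth x / \<tau>))" "continuous_on UNIV (\<lambda>x. cutoff' (depth x / \<tau>))"
    unfolding divide_inverse
    by (intro continuous_on_compose2[OF continuous_cutoff[of UNIV]] continuous_on_compose2[OF continuous_cutoff'[of UNIV]]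
        continuous_intros continuous_depth; simp)+
  let ?\<Phi> = "\<lambda>x. cutoff (depth x / \<tau>) * ?Z x"
  let ?A = "\<lambda>x. cutoff (depth x / \<tau>) * ?Z' 1 x" and ?B = "\<lambda>x. cutoff' (depth x / \<tau>) / \<tau> * ?Z x"
  have test: "C1_test \<Omega> ?\<Phi> (\<lambda>i x. cutoff (depth x / \<tau>) * ?Z' i x + cutoff' (depth x / \<tau>) * ((if i = 1 then \<sigma> else 0) / \<tau>) * ?Z x)"
    by (rule C1_test_layer[where a = "2 * (r / 3)", OF Z cZ' supp _ \<tau>]) (use r_pos in auto)
  have main: "(LINT x:\<Omega>|lborel. (cmod (v x))\<^sup>2 * (?A x + \<sigma> * ?B x)) = - 2 * Re (LINT x:\<Omega>|lborel. ?G x $ 1 * cnj (v x) * of_real (?\<Phi> x))"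
    using product_rule_square[OF u test, of 1] by (simp add: mult_ac)
  have Zb: "\<bar>?Z x\<bar> \<le> 1" for x using radial_cutoff_bounds[of p "r/3" x] by auto
  have cb: "\<bar>cutoff t\<bar> \<le> 1" "\<bar>cutoff' t\<bar> \<le> 4" for t using cutoff_bounds[of t] by auto
  have Ab: "\<bar>?A x\<bar> \<le> 48 / r" for x
  proof -
    have "\<bar>cutoff (depth x / \<tau>)\<bar> * \<bar>?Z' 1 x\<bar> \<le> 1 * (16 / (r / 3))"
      using radial_cutoff'_bound[OF r3, of p 1 x] cb by (intro mult_mono) auto
    then show ?thesis by (simp add: abs_mult)
  qed
  have Bb: "\<bar>?B x\<bar> \<le> 4 / \<tau>" for x
  proof -
    have "\<bar>cutoff' (depth x / \<tau>) / \<tau>\<bar> * \<bar>?Z x\<bar> \<le> (4 / \<tau>) * 1"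
      using cb(2) Zb \<tau> by (intro mult_mono) (auto intro!: divide_right_mono)
    then show ?thesis by (simp only: abs_mult mult_1_right)
  qed
  have \<Phi>b: "\<bar>?\<Phi> x\<bar> \<le> 1" for x
  proof -
    have "\<bar>cutoff (depth x / \<tau>)\<bar> * \<bar>?Z x\<bar> \<le> 1 * 1" by (intro mult_mono cb Zb) auto
    then show ?thesis by (simp only: abs_mult mult_1_right)
  qed
  have cA: "continuous_on UNIV ?A" and cB: "continuous_on UNIV ?B" and c\<Phi>: "continuous_on UNIV ?\<Phi>"
    using \<tau> by (auto intro!: continuous_intros cd cZ cZ' continuous_radial_cutoff continuous_radial_cutoff')
  have iA: "set_integrable lborel \<Omega> (\<lambda>x. (cmod (v x))\<^sup>2 * ?A x)"
    by (rule norm_square_integrable(1)[OF u(1) cA Ab])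
  have iB: "set_integrable lborel \<Omega> (\<lambda>x. (cmod (v x))\<^sup>2 * ?B x)"
    by (rule norm_square_integrable(1)[OF u(1) cB Bb])
  have sum: "(LINT x:\<Omega>|lborel. (cmod (v x))\<^sup>2 * (?A x + \<sigma> * ?B x)) =
      (LINT x:\<Omega>|lborel. (cmod (v x))\<^sup>2 * ?A x) + \<sigma> * (LINT x:\<Omega>|lborel. (cmod (v x))\<^sup>2 * ?B x)"
  proof -
    have "(LINT x:\<Omega>|lborel. w x * (A x + \<sigma> * B x)) = (LINT x:\<Omega>|lborel. w x * A x) + \<sigma> * (LINT x:\<Omega>|lborel. w x * B x)"
      if "set_integrable lborel \<Omega> (\<lambda>x. w x * A x)" "set_integrable lborel \<Omega> (\<lambda>x. w x * B x)" for w A B :: "real^3 \<Rightarrow> real"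
      using set_integral_add(2)[OF that(1) set_integrable_mult_right[of \<sigma>, OF that(2)]]
      by (simp add: distrib_left mult.left_commute)
    from this[OF iA iB] show ?thesis .
  qed
  have b1: "\<bar>Re (LINT x:\<Omega>|lborel. ?G x $ 1 * cnj (v x) * of_real (?\<Phi> x))\<bar> \<le> (H1_norm \<Omega> v)\<^sup>2"
  proof -
    have "\<bar>Re (LINT x:\<Omega>|lborel. ?G x $ 1 * cnj (v x) * of_real (?\<Phi> x))\<bar> \<le> 1 * (L2_norm lborel \<Omega> (\<lambda>x. ?G x $ 1) * L2_norm lborel \<Omega> v)"
      using cross_term_bound[OF weak_gradient_L2[OF u(2)] u(1) c\<Phi> \<Phi>b] abs_Re_le_cmod order_trans by fastforce
    also have "\<dots> \<le> H1_norm \<Omega> v * H1_norm \<Omega> v"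
      unfolding mult_1
      by (intro mult_mono gradient_le_H1_norm[OF open_\<Omega> u(2)] L2_norm_le_H1_norm) auto
    finally show ?thesis by (simp add: power2_eq_square)
  qed
  have b2: "\<bar>LINT x:\<Omega>|lborel. (cmod (v x))\<^sup>2 * ?A x\<bar> \<le> 48 / r * (H1_norm \<Omega> v)\<^sup>2"
  proof -
    have "cmod (LINT x:\<Omega>|lborel. v x * cnj (v x) * of_real (?A x)) \<le> 48 / r * (L2_norm lborel \<Omega> v * L2_norm lborel \<Omega> v)"
      using r_pos by (intro cross_term_bound[OF u(1) u(1) cA Ab]) auto
    also have "\<dots> \<le> 48 / r * (H1_norm \<Omega> v * H1_norm \<Omega> v)"
      using r_pos by (intro mult_left_mono mult_mono L2_norm_le_H1_norm) auto
    finally show ?thesis unfolding norm_square_integrable(2)[OF u(1) cA Ab] norm_of_real by (simp add: power2_eq_square)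
  qed
  have "\<sigma> * (LINT x:\<Omega>|lborel. (cmod (v x))\<^sup>2 * ?B x) = - 2 * Re (LINT x:\<Omega>|lborel. ?G x $ 1 * cnj (v x) * of_real (?\<Phi> x)) - (LINT x:\<Omega>|lborel. (cmod (v x))\<^sup>2 * ?A x)"
    using main sum by simp
  moreover have "(LINT x:\<Omega>|lborel. (cmod (v x))\<^sup>2 * ?B x) \<le> \<bar>\<sigma> * (LINT x:\<Omega>|lborel. (cmod (v x))\<^sup>2 * ?B x)\<bar>"
    unfolding abs_mult sign_square(3) mult_1 by (rule abs_ge_self)
  ultimately have "(LINT x:\<Omega>|lborel. (cmod (v x))\<^sup>2 * ?B x) \<le> 2 * (H1_norm \<Omega> v)\<^sup>2 + 48 / r * (H1_norm \<Omega> v)\<^sup>2"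
    using b1 b2 by linarith
  then show ?thesis by (simp add: distrib_right)
qed

text \<open>The layers \<open>\<tau> < depth < 2 \<tau>\<close> of \<open>layer_bound\<close> are rescaled to a fixed thickness; Fatou's
  lemma then yields the boundary values as \<open>\<tau> \<longlonglongrightarrow> 0\<close>.\<close>
theorem trace_inequality:
  assumes v: "v \<in> H1 \<Omega>" and T: "\<And>y. y \<in> T \<Longrightarrow> dist (at_x1 (p $ 1) y) p < r / 3"
    and cont: "continuous_on (\<Omega> \<union> at_x1 (p $ 1) ` T) v"
    and L2: "v \<in> L2_space (area_x1 (p $ 1)) (at_x1 (p $ 1) ` T)"
  shows "(L2_norm (area_x1 (p $ 1)) (at_x1 (p $ 1) ` T) v)\<^sup>2 \<le> 16 / 3 * (2 + 48 / r) * (H1_norm \<Omega> v)\<^sup>2"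
proof -
  let ?a = "at_x1 (p $ 1)"
  let ?S = "?a ` T"
  define C where "C = (2 + 48 / r) * (H1_norm \<Omega> v)\<^sup>2"
  have C: "C \<ge> 0" using r_pos by (simp add: C_def)
  define V where "V x = (cmod (zero_ext \<Omega> v x))\<^sup>2" for x
  have zm: "zero_ext \<Omega> v \<in> borel_measurable borel" using zero_ext_L2[OF H1_L2[OF v]] by (simp add: L2_UNIV)
  have Vm [measurable]: "V \<in> borel_measurable borel" unfolding V_def[abs_def] using zm by measurable
  have V0: "V x \<ge> 0" for x by (simp add: V_def)
  have rm [measurable]: "radial_cutoff p (r/3) \<in> borel_measurable borel"
    by (intro borel_measurable_continuous_onI continuous_radial_cutoff)
  have cm [measurable]: "cutoff' \<in> borel_measurable borel"
    by (intro borel_measurable_continuous_onI continuous_cutoff')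
  have dm [measurable]: "depth \<in> borel_measurable borel"
    by (intro borel_measurable_continuous_onI continuous_depth)
  \<comment> \<open>The point over \<open>y\<close> at depth \<open>\<tau> * s\<close>: in the
    variable \<open>s\<close> all layers have the same thickness, and the factor
    \<open>1 / \<tau>\<close> of the weight is absorbed by the change of variables.\<close>
  define X where "X \<tau> s y = at_x1 (p $ 1 + \<sigma> * \<tau> * s) y" for \<tau> s y
  have Xm [measurable]: "(\<lambda>z. X \<tau> (fst z) (snd z)) \<in> borel_measurable (borel \<Otimes>\<^sub>M borel)" for \<tau>
    unfolding X_def borel_prod by (intro borel_measurable_continuous_onI continuous_at_x1 continuous_intros)
  have Xm2 [measurable]: "(\<lambda>y. X \<tau> s y) \<in> borel_measurable borel" for \<tau> s
    unfolding X_def by measurable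
  define g where "g \<tau> s y = ennreal (V (X \<tau> s y) * (cutoff' s * (1 - radial_cutoff p (r/3) (X \<tau> s y))))" for \<tau> s y
  have gm [measurable]: "(\<lambda>z. g \<tau> (fst z) (snd z)) \<in> borel_measurable (lborel \<Otimes>\<^sub>M lborel)" for \<tau>
    unfolding g_def by measurable
  have gm2 [measurable]: "(\<lambda>y. g \<tau> s y) \<in> borel_measurable lborel" for \<tau> s
    unfolding g_def by measurable
  have gbound: "(\<integral>\<^sup>+s. \<integral>\<^sup>+y. g \<tau> s y \<partial>lborel \<partial>lborel) \<le> ennreal C" if \<tau>: "\<tau> > 0" for \<tau>
  proof -
    let ?B = "\<lambda>x. cutoff' (depth x / \<tau>) / \<tau> * (1 - radial_cutoff p (r/3) x)"
    have Bn: "?B x \<ge> 0" for x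
      using cutoff_bounds(3)[of "depth x / \<tau>"] radial_cutoff_bounds(2)[of p "r/3" x] \<tau> by simp
    have Bb: "\<bar>?B x\<bar> \<le> 4 / \<tau>" for x
    proof -
      have "\<bar>cutoff' (depth x / \<tau>) / \<tau>\<bar> * \<bar>1 - radial_cutoff p (r/3) x\<bar> \<le> (4 / \<tau>) * 1"
        using cutoff_bounds(3,4)[of "depth x / \<tau>"] radial_cutoff_bounds[of p "r/3" x] \<tau>
        by (intro mult_mono) (auto intro!: divide_right_mono)
      then show ?thesis by (simp only: abs_mult mult_1_right)
    qed
    have cB: "continuous_on UNIV ?B"
      unfolding divide_inverse
      by (intro continuous_on_compose2[OF continuous_cutoff'[of UNIV]] continuous_intros continuous_depth continuous_radial_cutoff) auto
    have int: "integrable lborel (\<lambda>x. V x * ?B x)" and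
      eq: "(LINT x|lborel. V x * ?B x) = (LINT x:\<Omega>|lborel. (cmod (v x))\<^sup>2 * ?B x)"
    proof -
      have e: "indicator \<Omega> x *\<^sub>R ((cmod (v x))\<^sup>2 * ?B x) = V x * ?B x" for x
        by (simp add: V_def zero_ext_def indicator_def)
      show "integrable lborel (\<lambda>x. V x * ?B x)"
        using norm_square_integrable(1)[OF H1_L2[OF v] cB Bb] unfolding set_integrable_def e .
      show "(LINT x|lborel. V x * ?B x) = (LINT x:\<Omega>|lborel. (cmod (v x))\<^sup>2 * ?B x)"
        unfolding set_lebesgue_integral_def e ..
    qed
    have "(\<integral>\<^sup>+x. ennreal (V x * ?B x) \<partial>lborel) = ennreal (LINT x|lborel. V x * ?B x)"
      by (rule nn_integral_eq_integral[OF int AE_I2[OF mult_nonneg_nonneg[OF V0 Bn]]])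
    also have "\<dots> \<le> ennreal C"
      unfolding eq C_def by (intro ennreal_leI layer_bound v \<tau>)
    finally have 1: "(\<integral>\<^sup>+x. ennreal (V x * ?B x) \<partial>lborel) \<le> ennreal C" .
    have Bm: "?B \<in> borel_measurable borel" using cB by (rule borel_measurable_continuous_onI)
    let ?f = "\<lambda>x. ennreal (V x * ?B x)"
    have fm [measurable]: "?f \<in> borel_measurable borel"
      by (intro measurable_compose[OF _ measurable_ennreal] borel_measurable_times Vm Bm)
    have gf: "?f (X \<tau> s y) = ennreal (1 / \<tau>) * g \<tau> s y" for s y
    proof -
      have "depth (X \<tau> s y) / \<tau> = s" using \<tau> sign_square by (simp add: depth_def X_def mult.assoc)
      then have "V (X \<tau> s y) * ?B (X \<tau> s y) = (1 / \<tau>) * (V (X \<tau> s y) * (cutoff' s * (1 - radial_cutoff p (r/3) (X \<tau> s y))))"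
        by simp
      then show ?thesis unfolding g_def using \<tau> by (simp only: ennreal_mult'[of "1 / \<tau>"] divide_nonneg_pos zero_le_one)
    qed
    have "(\<integral>\<^sup>+x. ?f x \<partial>lborel) = (\<integral>\<^sup>+s. \<integral>\<^sup>+y. ?f (at_x1 s y) \<partial>lborel \<partial>lborel)"
      by (rule nn_integral_slices[OF fm])
    also have "\<dots> = ennreal \<bar>\<sigma> * \<tau>\<bar> * (\<integral>\<^sup>+s. \<integral>\<^sup>+y. ?f (at_x1 (p $ 1 + \<sigma> * \<tau> * s) y) \<partial>lborel \<partial>lborel)"
    proof (rule nn_integral_real_affine)
      have "(\<lambda>z. ?f (at_x1 (fst z) (snd z))) \<in> borel_measurable (lborel \<Otimes>\<^sub>M lborel)"
        by (rule measurable_compose[OF _ fm]) measurable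
      then show "(\<lambda>s. \<integral>\<^sup>+y. ?f (at_x1 s y) \<partial>lborel) \<in> borel_measurable borel"
        using lborel.borel_measurable_nn_integral_fst[of "\<lambda>z. ?f (at_x1 (fst z) (snd z))" lborel] by simp
      show "\<sigma> * \<tau> \<noteq> 0" using sign_square \<tau> by simp
    qed
    also have "(\<integral>\<^sup>+s. \<integral>\<^sup>+y. ?f (at_x1 (p $ 1 + \<sigma> * \<tau> * s) y) \<partial>lborel \<partial>lborel) = (\<integral>\<^sup>+s. \<integral>\<^sup>+y. ennreal (1 / \<tau>) * g \<tau> s y \<partial>lborel \<partial>lborel)"
      by (intro nn_integral_cong) (rule gf[unfolded X_def])
    also have "\<bar>\<sigma> * \<tau>\<bar> = \<tau>" using sign_square \<tau> by (simp add: abs_mult)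
    also have "(\<integral>\<^sup>+s. \<integral>\<^sup>+y. ennreal (1 / \<tau>) * g \<tau> s y \<partial>lborel \<partial>lborel) = ennreal (1 / \<tau>) * (\<integral>\<^sup>+s. \<integral>\<^sup>+y. g \<tau> s y \<partial>lborel \<partial>lborel)"
    proof -
      have "(\<integral>\<^sup>+y. ennreal (1 / \<tau>) * g \<tau> s y \<partial>lborel) = ennreal (1 / \<tau>) * (\<integral>\<^sup>+y. g \<tau> s y \<partial>lborel)" for s
        by (rule nn_integral_cmult[OF gm2])
      moreover have "(\<lambda>s. \<integral>\<^sup>+y. g \<tau> s y \<partial>lborel) \<in> borel_measurable lborel"
        using lborel.borel_measurable_nn_integral_fst[OF gm[of \<tau>]] by simp
      ultimately show ?thesis by (simp add: nn_integral_cmult)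
    qed
    also have "ennreal \<tau> * (ennreal (1 / \<tau>) * (\<integral>\<^sup>+s. \<integral>\<^sup>+y. g \<tau> s y \<partial>lborel \<partial>lborel)) = (\<integral>\<^sup>+s. \<integral>\<^sup>+y. g \<tau> s y \<partial>lborel \<partial>lborel)"
      using \<tau> by (simp add: mult.assoc[symmetric] ennreal_mult[symmetric])
    finally show ?thesis using 1 by simp
  qed
  define w where "w y = ennreal ((cmod (indicator ?S (?a y) *\<^sub>R v (?a y)))\<^sup>2)" for y
  have inS: "?a y \<in> ?S \<longleftrightarrow> y \<in> T" for y
  proof
    assume "?a y \<in> ?S"
    then obtain z where z: "z \<in> T" "?a y = ?a z" by blast
    then have "y = z" by (metis (mono_tags) at_x1_components(2,3) exhaust_2 vec_eq_iff)
    with z show "y \<in> T" by simp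
  qed blast
  have sm: "(\<lambda>x. indicator ?S x *\<^sub>R v x) \<in> borel_measurable borel"
    using L2_measurable[OF L2] by (simp add: area_x1_def)
  have cm: "cmod \<in> borel_measurable borel"
    by (intro borel_measurable_continuous_onI continuous_intros)
  note nm = measurable_compose[OF measurable_compose[OF at_x1_measurable2 sm] cm, of "p $ 1"]
  have wm [measurable]: "w \<in> borel_measurable borel"
    unfolding w_def[abs_def] by (rule measurable_compose[OF borel_measurable_power[OF nm] measurable_ennreal])
  define \<tau> where "\<tau> n = inverse (real (Suc n))" for n
  have \<tau>: "\<tau> n > 0" "\<tau> \<longlonglongrightarrow> 0" for n
    unfolding \<tau>_def[abs_def] by (simp, rule LIMSEQ_inverse_real_of_nat)
  \<comment> \<open>Only the slab \<open>5/4 \<le> s \<le> 3/2\<close> is kept, where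
    \<open>cutoff'\<close> is at least \<open>3/4\<close>; for small \<open>\<tau>\<close> the
    radial factor equals one there. The points approach the boundary point from inside, so
    continuity of \<open>v\<close> up to the aperture identifies the limit.\<close>
  have low: "indicator {5/4..3/2::real} s * (ennreal (3 / 4) * w y) \<le> liminf (\<lambda>n. g (\<tau> n) s y)" for s y
  proof (cases "s \<in> {5/4..3/2} \<and> y \<in> T")
    case False
    then show ?thesis using inS by (auto simp: w_def indicator_def)
  next
    case True
    have Xlim: "(\<lambda>n. X (\<tau> n) s y) \<longlonglongrightarrow> ?a y"
    proof -
      have "isCont (\<lambda>t. at_x1 (p $ 1 + \<sigma> * t * s) y) 0"
        by (rule continuous_on_interior[of UNIV]) (auto intro!: continuous_at_x1 continuous_intros)
      from isCont_tendsto_compose[OF this \<tau>(2)] show ?thesis by (simp add: X_def)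
    qed
    have "(\<lambda>n. dist (X (\<tau> n) s y) p) \<longlonglongrightarrow> dist (?a y) p" by (intro tendsto_intros Xlim)
    from order_tendstoD(2)[OF this T] True
    have ev: "\<forall>\<^sub>F n in sequentially. dist (X (\<tau> n) s y) p < r / 3" by blast
    have inO: "X (\<tau> n) s y \<in> \<Omega>" if "dist (X (\<tau> n) s y) p < r / 3" for n
    proof -
      have "\<sigma> * (X (\<tau> n) s y $ 1 - p $ 1) = \<tau> n * s" using sign_square by (simp add: X_def mult.assoc)
      moreover have "\<tau> n * s > 0" using True \<tau>(1)[of n] by simp
      ultimately show ?thesis using half[of "X (\<tau> n) s y"] that r_pos by simp
    qed
    have ev': "\<forall>\<^sub>F n in sequentially. X (\<tau> n) s y \<in> \<Omega> \<union> ?S" using ev by eventually_elim (use inO in blast)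
    have aS: "?a y \<in> \<Omega> \<union> ?S" using True by blast
    have vlim: "(\<lambda>n. v (X (\<tau> n) s y)) \<longlonglongrightarrow> v (?a y)"
      by (rule continuous_on_tendsto_compose[OF cont Xlim aS ev'])
    have "(\<lambda>n. ennreal ((cmod (v (X (\<tau> n) s y)))\<^sup>2 * (3 / 4))) \<longlonglongrightarrow> ennreal ((cmod (v (?a y)))\<^sup>2 * (3 / 4))"
      by (intro tendsto_intros vlim)
    from lim_imp_Liminf[OF sequentially_bot this]
    have "ennreal (3 / 4) * w y = liminf (\<lambda>n. ennreal ((cmod (v (X (\<tau> n) s y)))\<^sup>2 * (3 / 4)))"
      using True inS by (simp add: w_def ennreal_mult[symmetric] mult.commute)
    also have "\<dots> \<le> liminf (\<lambda>n. g (\<tau> n) s y)"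
    proof (rule Liminf_mono, use ev in eventually_elim)
      fix n assume n: "dist (X (\<tau> n) s y) p < r / 3"
      have "radial_cutoff p (r/3) (X (\<tau> n) s y) = 0" using n r_pos by (intro radial_cutoff_zero) auto
      moreover have "3 / 4 \<le> cutoff' s" using True by (intro cutoff'_ge) auto
      ultimately show "ennreal ((cmod (v (X (\<tau> n) s y)))\<^sup>2 * (3 / 4)) \<le> g (\<tau> n) s y"
        unfolding g_def V_def using inO[OF n] mult_left_mono[of "3 / 4" "cutoff' s" "(cmod (v (X (\<tau> n) s y)))\<^sup>2"]
        by (intro ennreal_leI) simp
    qed
    finally show ?thesis using True by simp
  qed
  have "(\<integral>\<^sup>+s. \<integral>\<^sup>+y. indicator {5/4..3/2::real} s * (ennreal (3 / 4) * w y) \<partial>lborel \<partial>lborel) \<le>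
      (\<integral>\<^sup>+s. \<integral>\<^sup>+y. liminf (\<lambda>n. g (\<tau> n) s y) \<partial>lborel \<partial>lborel)"
    by (intro nn_integral_mono low)
  also have "\<dots> \<le> (\<integral>\<^sup>+s. liminf (\<lambda>n. \<integral>\<^sup>+y. g (\<tau> n) s y \<partial>lborel) \<partial>lborel)"
    by (intro nn_integral_mono nn_integral_liminf gm2)
  also have "\<dots> \<le> liminf (\<lambda>n. \<integral>\<^sup>+s. \<integral>\<^sup>+y. g (\<tau> n) s y \<partial>lborel \<partial>lborel)"
    using lborel.borel_measurable_nn_integral_fst[OF gm] by (intro nn_integral_liminf) simp
  also have "\<dots> \<le> ennreal C"
    by (rule Liminf_le[OF sequentially_bot always_eventually]) (use gbound[OF \<tau>(1)] in blast)
  finally have fin: "(\<integral>\<^sup>+s. \<integral>\<^sup>+y. indicator {5/4..3/2::real} s * (ennreal (3 / 4) * w y) \<partial>lborel \<partial>lborel) \<le> ennreal C" .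
  have "(\<integral>\<^sup>+y. indicator {5/4..3/2::real} s * (ennreal (3 / 4) * w y) \<partial>lborel) = indicator {5/4..3/2} s * (ennreal (3 / 4) * (\<integral>\<^sup>+y. w y \<partial>lborel))" for s :: real
    by (simp add: nn_integral_cmult)
  then have "(\<integral>\<^sup>+s. \<integral>\<^sup>+y. indicator {5/4..3/2::real} s * (ennreal (3 / 4) * w y) \<partial>lborel \<partial>lborel) =
      (\<integral>\<^sup>+s. (ennreal (3 / 4) * (\<integral>\<^sup>+y. w y \<partial>lborel)) * indicator {5/4..3/2::real} s \<partial>lborel)"
    by (simp add: mult.commute)
  \<comment> \<open>The factor \<open>1/4\<close> is the length of the slab; with the slope
    \<open>3/4\<close> it produces the constant \<open>16/3\<close>.\<close>
  also have "\<dots> = ennreal (3 / 4) * (\<integral>\<^sup>+y. w y \<partial>lborel) * ennreal (1 / 4)"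
    by (subst nn_integral_cmult_indicator) simp_all
  also have "(\<integral>\<^sup>+y. w y \<partial>lborel) = ennreal ((L2_norm (area_x1 (p $ 1)) ?S v)\<^sup>2)"
  proof -
    have "(\<integral>\<^sup>+y. w y \<partial>lborel) = (\<integral>\<^sup>+x. ennreal ((cmod (indicator ?S x *\<^sub>R v x))\<^sup>2) \<partial>area_x1 (p $ 1))"
      unfolding area_x1_def w_def
      by (rule nn_integral_distr[symmetric])
        (simp, simp only: measurable_distr_eq1 measurable_compose[OF borel_measurable_power[OF measurable_compose[OF sm cm]] measurable_ennreal])
    also have "\<dots> = ennreal (LINT x|area_x1 (p $ 1). (cmod (indicator ?S x *\<^sub>R v x))\<^sup>2)"
      by (rule nn_integral_eq_integral[OF L2_integrable[OF L2]]) simp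
    finally show ?thesis by (simp add: L2_norm_eq)
  qed
  finally have "ennreal (3 / 4) * ennreal ((L2_norm (area_x1 (p $ 1)) ?S v)\<^sup>2) * ennreal (1 / 4) \<le> ennreal C"
    using fin by (simp only:)
  moreover have "ennreal (3 / 4 * N * (1 / 4)) = ennreal (3 / 4) * ennreal N * ennreal (1 / 4)" for N
    by (subst ennreal_mult'', simp, subst ennreal_mult', simp_all)
  ultimately have "ennreal (3 / 4 * (L2_norm (area_x1 (p $ 1)) ?S v)\<^sup>2 * (1 / 4)) \<le> ennreal C"
    by (simp only:)
  then have "3 / 4 * (L2_norm (area_x1 (p $ 1)) ?S v)\<^sup>2 * (1 / 4) \<le> C"
    using C by (simp only: ennreal_le_iff)
  then have "(L2_norm (area_x1 (p $ 1)) ?S v)\<^sup>2 \<le> 16 / 3 * C" by simp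
  then show ?thesis by (simp only: C_def mult.assoc)
qed

text \<open>Used to remove the layer cut-offs: their weights converge pointwise inside
  \<open>\<Omega>\<close> but not uniformly up to the boundary.\<close>

lemma bounded_convergence:
  fixes f :: "real^3 \<Rightarrow> 'b::{banach, second_countable_topology}"
  assumes f: "set_integrable lborel \<Omega> f" and h: "\<And>n. continuous_on UNIV (h n)" "\<And>n x. x \<in> \<Omega> \<Longrightarrow> \<bar>h n x\<bar> \<le> C"
    and lim: "\<And>x. x \<in> \<Omega> \<Longrightarrow> (\<lambda>n::nat. h n x) \<longlonglongrightarrow> g x" and g: "continuous_on UNIV g"
  shows "(\<lambda>n. LINT x:\<Omega>|lborel. h n x *\<^sub>R f x) \<longlonglongrightarrow> (LINT x:\<Omega>|lborel. g x *\<^sub>R f x)"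
proof -
  let ?F = "\<lambda>x. indicator \<Omega> x *\<^sub>R f x"
  have F: "integrable lborel ?F" using f by (simp add: set_integrable_def)
  have e: "indicator \<Omega> x *\<^sub>R (k x *\<^sub>R f x) = k x *\<^sub>R ?F x" for k :: "real^3 \<Rightarrow> real" and x
    by (simp add: mult.commute)
  have m: "(\<lambda>x. k x *\<^sub>R ?F x) \<in> borel_measurable lborel" if "continuous_on UNIV k" for k :: "real^3 \<Rightarrow> real"
  proof (rule borel_measurable_scaleR)
    show "k \<in> borel_measurable lborel" using that by (simp add: borel_measurable_continuous_onI)
  qed (use F in auto)
  have l: "(\<lambda>n. h n x *\<^sub>R ?F x) \<longlonglongrightarrow> g x *\<^sub>R ?F x" for x
  proof (cases "x \<in> \<Omega>")
    case True
    then show ?thesis by (intro tendsto_scaleR lim tendsto_const)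
  qed simp
  have b: "norm (h n x *\<^sub>R ?F x) \<le> C * norm (?F x)" for n x
    using h(2)[of x n] by (cases "x \<in> \<Omega>") (auto intro!: mult_right_mono)
  show ?thesis
    unfolding set_lebesgue_integral_def e
    by (rule integral_dominated_convergence[where w = "\<lambda>x. C * norm (?F x)", OF m[OF g] m[OF h(1)]
          integrable_mult_right[OF integrable_norm[OF F]] AE_I2[OF l] AE_I2[OF b]])
qed

lemma squared_distance: "(x - p) \<bullet> (x - p) = (dist x p)\<^sup>2"
  by (simp add: dist_norm power2_norm_eq_inner)

text \<open>Testing with \<open>\<Psi> u\<close> for a radial \<open>\<Psi> \<ge> 0\<close> centred at the boundary point gives
  \<open>\<integral> |u|\<^sup>2 \<Delta>\<Psi> = 2 \<integral> \<Psi> |grad u|\<^sup>2 \<ge> 0\<close>: as \<open>\<Psi>\<close> satisfies the Neumann condition on the flat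
  part of the boundary, no boundary terms arise.\<close>
theorem mean_square_near_boundary_point:
  assumes u: "u \<in> H1 \<Omega>"
    and test: "\<And>\<Psi> \<Psi>'. (\<And>x. has_grad \<Psi> (\<lambda>i. \<Psi>' i x) x) \<Longrightarrow> (\<And>i. continuous_on UNIV (\<Psi>' i)) \<Longrightarrow>
       (\<And>x. dist x p \<ge> r / 2 \<Longrightarrow> \<Psi> x = 0) \<Longrightarrow> grad_inner \<Omega> u (\<lambda>x. of_real (\<Psi> x) * u x) = 0"
    and d: "0 < d" "d \<le> r / 2"
  shows "(LINT x:\<Omega>|lborel. (cmod (u x))\<^sup>2 * indicator (cball p d) x) \<le> 16 * d ^ 3 / (r / 2) ^ 3 * (L2_norm lborel \<Omega> u)\<^sup>2"
proof -
  define s where "s = (r / 2)\<^sup>2"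
  define \<rho> where "\<rho> x = (x - p) \<bullet> (x - p)" for x
  have s: "s > 0" "sqrt s = r / 2" using r_pos by (simp_all add: s_def real_sqrt_power)
  have \<rho>0: "\<rho> x \<ge> 0" for x by (simp add: \<rho>_def)
  have \<rho>s: "\<rho> x \<ge> s" if "dist x p \<ge> r / 2" for x
    unfolding s_def \<rho>_def squared_distance using that r_pos by (intro power_mono) auto
  note bd = bump_derivs[OF d(1) \<rho>0 less_imp_le[OF s(1)]]
  have g\<rho>: "has_grad \<rho> (\<lambda>i. 2 * (x $ i - p $ i)) x" for x
    unfolding \<rho>_def[abs_def] by (rule has_grad_norm_square)
  define \<Psi> where "\<Psi> x = bump0 d s (\<rho> x)" for x
  define \<Psi>' where "\<Psi>' i x = bump1 d s (\<rho> x) * (2 * (x $ i - p $ i))" for i x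
  \<comment> \<open>The second derivatives of \<open>\<Psi>\<close>; the diagonal enters the
    estimates, and its sum \<open>L\<close> is the Laplacian.\<close>
  define H where "H i j x = bump1 d s (\<rho> x) * (2 * (if j = i then 1 else 0)) + bump2 d s (\<rho> x) * (2 * (x $ j - p $ j)) * (2 * (x $ i - p $ i))" for i j x
  have g\<Psi>: "has_grad \<Psi> (\<lambda>i. \<Psi>' i x) x" for x
    unfolding \<Psi>_def[abs_def] \<Psi>'_def by (rule has_grad_compose[OF g\<rho> bd(1)])
  have g\<Psi>': "has_grad (\<Psi>' i) (\<lambda>j. H i j x) x" for i x
  proof -
    have "has_grad (\<lambda>x. bump1 d s (\<rho> x)) (\<lambda>j. bump2 d s (\<rho> x) * (2 * (x $ j - p $ j))) x"
      by (rule has_grad_compose[OF g\<rho> bd(2)])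
    moreover have "has_grad (\<lambda>x. 2 * (x $ i + - p $ i)) (\<lambda>j. 2 * ((if j = i then 1 else 0) + 0) + 0 * (x $ i + - p $ i)) x"
      by (intro has_grad_mult has_grad_add has_grad_const has_grad_coord)
    ultimately have "has_grad (\<lambda>x. bump1 d s (\<rho> x) * (2 * (x $ i + - p $ i)))
       (\<lambda>j. bump1 d s (\<rho> x) * (2 * ((if j = i then 1 else 0) + 0) + 0 * (x $ i + - p $ i)) + bump2 d s (\<rho> x) * (2 * (x $ j - p $ j)) * (2 * (x $ i + - p $ i))) x"
      by (rule has_grad_mult)
    then show ?thesis by (simp add: \<Psi>'_def[abs_def] H_def[abs_def])
  qed
  have c\<rho>: "continuous_on UNIV \<rho>" unfolding \<rho>_def[abs_def] by (intro continuous_intros)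
  have c1: "continuous_on {0..} (bump1 d s)"
    by (rule DERIV_continuous_on[where D = "bump2 d s"])
      (use bump_derivs(2)[OF d(1) _ less_imp_le[OF s(1)]] in \<open>auto intro: DERIV_subset\<close>)
  have c1\<rho>: "continuous_on UNIV (\<lambda>x. bump1 d s (\<rho> x))"
    by (rule continuous_on_compose2[OF c1 c\<rho>]) (use \<rho>0 in auto)
  have c2\<rho>: "continuous_on UNIV (\<lambda>x. bump2 d s (\<rho> x))"
    by (rule continuous_on_compose2[OF continuous_bump2[OF d(1) less_imp_le[OF s(1)]] c\<rho>]) (use \<rho>0 in auto)
  have cH: "continuous_on UNIV (H i j)" for i j
    unfolding H_def[abs_def] by (intro continuous_intros c1\<rho> c2\<rho>)
  have c\<Psi>': "continuous_on UNIV (\<Psi>' i)" for i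
    unfolding \<Psi>'_def[abs_def] by (intro continuous_intros c1\<rho>)
  have c\<Psi>: "continuous_on UNIV \<Psi>"
    using g\<Psi> has_grad_isCont by (blast intro: continuous_at_imp_continuous_on)
  have z: "\<Psi> x = 0" "\<Psi>' i x = 0" "H i j x = 0" "bump1 d s (\<rho> x) = 0" if "dist x p \<ge> r / 2" for x i j
    using bump_zero[OF \<rho>s[OF that], of d] by (simp_all add: \<Psi>_def \<Psi>'_def H_def)
  have outside: "dist x p \<ge> r / 2" if "x \<notin> cball p (r / 2)" for x using that by (simp add: dist_commute)
  have "\<exists>B. \<forall>x. \<bar>h x\<bar> \<le> B" if "continuous_on UNIV h" "\<And>x. dist x p \<ge> r / 2 \<Longrightarrow> h x = 0" for h :: "real^3 \<Rightarrow> real"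
    using bounded_continuous_compact_support[OF that(1) compact_cball[of p "r / 2"]] that(2) outside by (metis real_norm_def)
  note bdd = this
  obtain B0 where B0: "\<And>x. \<bar>\<Psi> x\<bar> \<le> B0" using bdd[OF c\<Psi> z(1)] by blast
  have "\<forall>i. \<exists>B. \<forall>x. \<bar>\<Psi>' i x\<bar> \<le> B" using bdd[OF c\<Psi>' z(2)] by blast
  from choice[OF this] obtain B1 where B1: "\<And>i x. \<bar>\<Psi>' i x\<bar> \<le> B1 i" by blast
  have "\<forall>i. \<exists>B. \<forall>x. \<bar>H i i x\<bar> \<le> B" using bdd[OF cH z(3)] by blast
  from choice[OF this] obtain B2 where B2: "\<And>i x. \<bar>H i i x\<bar> \<le> B2 i" by blast
  obtain B3 where B3: "\<And>x. \<bar>bump1 d s (\<rho> x)\<bar> \<le> B3" using bdd[OF c1\<rho> z(4)] by blast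
  have B3p: "B3 \<ge> 0" using B3[of p] by linarith
  let ?G = "weak_gradient \<Omega> u"
  note u2 = H1_L2[OF u] H1_weak_gradient[OF u]
  have gL: "(\<lambda>x. ?G x $ i) \<in> L2_space lborel \<Omega>" for i by (rule weak_gradient_L2[OF u2(2)])
  define \<tau> where "\<tau> n = inverse (real (Suc n))" for n
  have \<tau>: "\<tau> n > 0" "\<tau> \<longlonglongrightarrow> 0" for n
    unfolding \<tau>_def[abs_def] by (simp, rule LIMSEQ_inverse_real_of_nat)
  have ev: "\<forall>\<^sub>F n in sequentially. depth x / \<tau> n \<ge> 2" if x: "x \<in> \<Omega>" "dist x p < r" for x
  proof -
    have "depth x > 0" using half[OF x(2)] x(1) by (simp add: depth_def)
    then have "depth x / 2 > 0" by simp
    from order_tendstoD(2)[OF \<tau>(2) this] show ?thesis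
      by eventually_elim (use \<tau>(1) in \<open>simp add: field_simps less_imp_le\<close>)
  qed
  have cd: "continuous_on UNIV (\<lambda>x. cutoff (depth x / \<tau> n))" "continuous_on UNIV (\<lambda>x. cutoff' (depth x / \<tau> n))" for n
    unfolding divide_inverse
    by (intro continuous_on_compose2[OF continuous_cutoff[of UNIV]] continuous_on_compose2[OF continuous_cutoff'[of UNIV]]
        continuous_intros continuous_depth; simp)+
  have cb: "\<bar>cutoff t\<bar> \<le> 1" "\<bar>cutoff' t\<bar> \<le> 4" for t using cutoff_bounds[of t] by auto
  \<comment> \<open>Integration by parts without boundary term: the layer cut-off makes the identity
    legitimate for each \<open>\<tau> n\<close>, and dominated convergence removes it.\<close>
  have key: "(LINT x:\<Omega>|lborel. (cmod (u x))\<^sup>2 * H i i x) = - 2 * Re (LINT x:\<Omega>|lborel. ?G x $ i * cnj (u x) * of_real (\<Psi>' i x))" for i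
  proof -
    define h where "h n x = cutoff (depth x / \<tau> n) * H i i x + cutoff' (depth x / \<tau> n) * ((if i = 1 then \<sigma> else 0) / \<tau> n) * \<Psi>' i x" for n x
    define k where "k n x = cutoff (depth x / \<tau> n) * \<Psi>' i x" for n x
    have eq: "(LINT x:\<Omega>|lborel. (cmod (u x))\<^sup>2 * h n x) = - 2 * Re (LINT x:\<Omega>|lborel. ?G x $ i * cnj (u x) * of_real (k n x))" for n
      unfolding h_def k_def
      by (rule product_rule_square[OF u2 C1_test_layer[where a = "r / 2", OF g\<Psi>' cH _ _ \<tau>(1)]]) (use z r_pos in auto)
    have ch: "continuous_on UNIV (h n)" for n unfolding h_def[abs_def] by (intro continuous_intros cd cH c\<Psi>')
    have ck: "continuous_on UNIV (k n)" for n unfolding k_def[abs_def] by (intro continuous_intros cd c\<Psi>')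
    have kb: "\<bar>k n x\<bar> \<le> B1 i" for n x
      using mult_mono[OF cb(1)[of "depth x / \<tau> n"] B1[of i x]] by (simp add: k_def abs_mult)
    \<comment> \<open>The dangerous term carries \<open>1 / \<tau> n\<close> in the layer. The
      normal derivative of \<open>\<Psi>\<close> contains the factor \<open>x $ 1 - p $ 1\<close>,
      which is at most \<open>2 * \<tau> n\<close> in modulus there: this is the Neumann condition,
      and it gives the uniform bound \<open>4 * B3 * (2 * 2)\<close>.\<close>
    have hb: "\<bar>h n x\<bar> \<le> B2 i + 16 * B3" for n x
    proof -
      have "\<bar>cutoff (depth x / \<tau> n) * H i i x\<bar> \<le> 1 * B2 i"
        unfolding abs_mult by (intro mult_mono cb B2) auto
      moreover have "\<bar>cutoff' (depth x / \<tau> n) * ((if i = 1 then \<sigma> else 0) / \<tau> n) * \<Psi>' i x\<bar> \<le> 16 * B3"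
      proof (cases "i = 1 \<and> 1 < depth x / \<tau> n \<and> depth x / \<tau> n < 2")
        case True
        have "\<bar>x $ 1 - p $ 1\<bar> = \<bar>depth x\<bar>" using sign_square by (simp add: depth_def abs_mult)
        also have "\<dots> \<le> 2 * \<tau> n" using True \<tau>(1)[of n] by (simp add: field_simps)
        finally have "\<bar>x $ 1 - p $ 1\<bar> / \<tau> n \<le> 2" using \<tau>(1)[of n] by (simp add: field_simps)
        then have 1: "\<bar>cutoff' (depth x / \<tau> n)\<bar> * \<bar>bump1 d s (\<rho> x)\<bar> * (2 * (\<bar>x $ 1 - p $ 1\<bar> / \<tau> n)) \<le> 4 * B3 * (2 * 2)"
          using B3p \<tau>(1)[of n] by (intro mult_mono cb B3) (auto intro!: divide_nonneg_pos)
        have "\<bar>cutoff' (depth x / \<tau> n) * (\<sigma> / \<tau> n) * \<Psi>' 1 x\<bar> = \<bar>cutoff' (depth x / \<tau> n)\<bar> * \<bar>bump1 d s (\<rho> x)\<bar> * (2 * (\<bar>x $ 1 - p $ 1\<bar> / \<tau> n))"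
          using sign_square \<tau>(1)[of n] by (simp add: \<Psi>'_def abs_mult del: right_diff_distrib_numeral)
        with 1 True show ?thesis by simp
      next
        case False
        then have "i \<noteq> 1 \<or> cutoff' (depth x / \<tau> n) = 0" using cutoff_zero(2) cutoff_one(2) by force
        then show ?thesis using B3p by auto
      qed
      ultimately show ?thesis unfolding h_def by linarith
    qed
    have hl: "(\<lambda>n. h n x) \<longlonglongrightarrow> H i i x" and kl: "(\<lambda>n. k n x) \<longlonglongrightarrow> \<Psi>' i x" if "x \<in> \<Omega>" for x
    proof -
      have "\<forall>\<^sub>F n in sequentially. h n x = H i i x \<and> k n x = \<Psi>' i x"
      proof (cases "dist x p < r")
        case True
        from ev[OF that True] show ?thesis
          by eventually_elim (simp add: h_def k_def cutoff_one)
      next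
        case False
        then have "dist x p \<ge> r / 2" using r_pos by simp
        then show ?thesis using z by (simp add: h_def k_def)
      qed
      then show "(\<lambda>n. h n x) \<longlonglongrightarrow> H i i x" "(\<lambda>n. k n x) \<longlonglongrightarrow> \<Psi>' i x"
        by (auto intro!: tendsto_eventually elim: eventually_mono)
    qed
    have iu: "set_integrable lborel \<Omega> (\<lambda>x. (cmod (u x))\<^sup>2)"
      using norm_square_integrable(1)[OF u2(1), of "\<lambda>_. 1" 1] by simp
    have l1: "(\<lambda>n. LINT x:\<Omega>|lborel. (cmod (u x))\<^sup>2 * h n x) \<longlonglongrightarrow> (LINT x:\<Omega>|lborel. (cmod (u x))\<^sup>2 * H i i x)"
      using bounded_convergence[OF iu ch hb hl cH] by (simp add: mult.commute)
    have iG: "set_integrable lborel \<Omega> (\<lambda>x. ?G x $ i * cnj (u x))"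
      by (rule L2_inner_integrable[OF gL u2(1)])
    have l2: "(\<lambda>n. LINT x:\<Omega>|lborel. ?G x $ i * cnj (u x) * of_real (k n x)) \<longlonglongrightarrow> (LINT x:\<Omega>|lborel. ?G x $ i * cnj (u x) * of_real (\<Psi>' i x))"
      using bounded_convergence[OF iG ck kb kl c\<Psi>'] by (simp add: mult.commute scaleR_conv_of_real)
    have "(\<lambda>n. - 2 * Re (LINT x:\<Omega>|lborel. ?G x $ i * cnj (u x) * of_real (k n x))) \<longlonglongrightarrow> - 2 * Re (LINT x:\<Omega>|lborel. ?G x $ i * cnj (u x) * of_real (\<Psi>' i x))"
      by (intro tendsto_intros l2)
    with l1 show ?thesis unfolding eq by (rule LIMSEQ_unique)
  qed
  define B where "B = \<bar>B0\<bar> + (\<Sum>i\<in>UNIV. \<bar>B1 i\<bar>)"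
  have B: "\<bar>\<Psi> x\<bar> \<le> B" "\<bar>\<Psi>' i x\<bar> \<le> B" for i x
  proof -
    have "\<bar>B1 i\<bar> \<le> (\<Sum>i\<in>UNIV. \<bar>B1 i\<bar>)" for i by (rule member_le_sum) auto
    moreover have "0 \<le> (\<Sum>i\<in>(UNIV::3 set). \<bar>B1 i\<bar>)" by (intro sum_nonneg) auto
    ultimately show "\<bar>\<Psi> x\<bar> \<le> B" "\<bar>\<Psi>' i x\<bar> \<le> B" unfolding B_def using B0[of x] B1[of i x] by (smt (verit))+
  qed
  have wg: "has_weak_gradient \<Omega> (\<lambda>x. of_real (\<Psi> x) * u x) (\<lambda>x. \<chi> i. of_real (\<Psi> x) * ?G x $ i + of_real (\<Psi>' i x) * u x)"
    by (rule weak_gradient_mult(3)[OF open_\<Omega> u2 g\<Psi> c\<Psi>' B])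
  \<comment> \<open>The contribution of \<open>\<Psi>\<close> times the squared derivative is
    dropped; it is nonnegative because \<open>taylor0\<close> is.\<close>
  have term_i: "Re (L2_inner lborel \<Omega> (\<lambda>x. ?G x $ i) (\<lambda>x. of_real (\<Psi> x) * ?G x $ i + of_real (\<Psi>' i x) * u x)) \<ge>
      Re (LINT x:\<Omega>|lborel. ?G x $ i * cnj (u x) * of_real (\<Psi>' i x))" for i
  proof -
    have i1: "set_integrable lborel \<Omega> (\<lambda>x. ?G x $ i * cnj (?G x $ i) * of_real (\<Psi> x))"
      by (rule integrable_L2_products[OF gL gL c\<Psi> B(1)])
    have i2: "set_integrable lborel \<Omega> (\<lambda>x. ?G x $ i * cnj (u x) * of_real (\<Psi>' i x))"
      by (rule integrable_L2_products[OF gL u2(1) c\<Psi>' B(2)])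
    have "L2_inner lborel \<Omega> (\<lambda>x. ?G x $ i) (\<lambda>x. of_real (\<Psi> x) * ?G x $ i + of_real (\<Psi>' i x) * u x) =
      (LINT x:\<Omega>|lborel. ?G x $ i * cnj (?G x $ i) * of_real (\<Psi> x) + ?G x $ i * cnj (u x) * of_real (\<Psi>' i x))"
      unfolding L2_inner_def by (simp add: distrib_left mult_ac)
    also have "\<dots> = (LINT x:\<Omega>|lborel. ?G x $ i * cnj (?G x $ i) * of_real (\<Psi> x)) + (LINT x:\<Omega>|lborel. ?G x $ i * cnj (u x) * of_real (\<Psi>' i x))"
      by (rule set_integral_add(2)[OF i1 i2])
    also have "(LINT x:\<Omega>|lborel. ?G x $ i * cnj (?G x $ i) * of_real (\<Psi> x)) = of_real (LINT x:\<Omega>|lborel. (cmod (?G x $ i))\<^sup>2 * \<Psi> x)"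
      by (rule norm_square_integrable(2)[OF gL c\<Psi> B(1)])
    moreover have "\<Psi> x \<ge> 0" for x
      unfolding \<Psi>_def bump0_def using \<rho>0[of x] s d by (intro taylor0_nonneg) auto
    then have "(LINT x:\<Omega>|lborel. (cmod (?G x $ i))\<^sup>2 * \<Psi> x) \<ge> 0"
      unfolding set_lebesgue_integral_def by (intro integral_nonneg_AE AE_I2) simp
    ultimately show ?thesis by simp
  qed
  have "grad_inner \<Omega> u (\<lambda>x. of_real (\<Psi> x) * u x) = 0" by (rule test[OF g\<Psi> c\<Psi>' z(1)])
  then have "(\<Sum>i\<in>UNIV. Re (L2_inner lborel \<Omega> (\<lambda>x. ?G x $ i) (\<lambda>x. of_real (\<Psi> x) * ?G x $ i + of_real (\<Psi>' i x) * u x))) = 0"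
    unfolding grad_inner_eq[OF open_\<Omega> u2(2) wg] by (simp flip: Re_sum)
  then have zero: "(\<Sum>i\<in>UNIV. Re (L2_inner lborel \<Omega> (\<lambda>x. ?G x $ i) (\<lambda>x. of_real (\<Psi> x) * ?G x $ i + of_real (\<Psi>' i x) * u x))) \<le> 0"
    by simp
  have "(\<Sum>i\<in>UNIV. Re (LINT x:\<Omega>|lborel. ?G x $ i * cnj (u x) * of_real (\<Psi>' i x))) \<le>
      (\<Sum>i\<in>UNIV. Re (L2_inner lborel \<Omega> (\<lambda>x. ?G x $ i) (\<lambda>x. of_real (\<Psi> x) * ?G x $ i + of_real (\<Psi>' i x) * u x)))"
    by (intro sum_mono term_i)
  then have neg: "(\<Sum>i\<in>UNIV. Re (LINT x:\<Omega>|lborel. ?G x $ i * cnj (u x) * of_real (\<Psi>' i x))) \<le> 0"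
    using zero by (rule order_trans)
  have iH: "set_integrable lborel \<Omega> (\<lambda>x. (cmod (u x))\<^sup>2 * H i i x)" for i
    by (rule norm_square_integrable(1)[OF u2(1) cH B2])
  define L where "L x = (\<Sum>i\<in>UNIV. H i i x)" for x
  have iL: "set_integrable lborel \<Omega> (\<lambda>x. (cmod (u x))\<^sup>2 * L x)"
    using Bochner_Integration.integrable_sum[where I = UNIV, OF iH[unfolded set_integrable_def]]
    by (simp only: set_integrable_def L_def sum_distrib_left scaleR_sum_right)
  have "(LINT x:\<Omega>|lborel. (cmod (u x))\<^sup>2 * L x) = (\<Sum>i\<in>UNIV. LINT x:\<Omega>|lborel. (cmod (u x))\<^sup>2 * H i i x)"
    unfolding L_def sum_distrib_left set_lebesgue_integral_def scaleR_sum_right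
    by (intro Bochner_Integration.integral_sum iH[unfolded set_integrable_def])
  also have "\<dots> = - 2 * (\<Sum>i\<in>UNIV. Re (LINT x:\<Omega>|lborel. ?G x $ i * cnj (u x) * of_real (\<Psi>' i x)))"
    unfolding key sum_distrib_left ..
  finally have pos: "0 \<le> (LINT x:\<Omega>|lborel. (cmod (u x))\<^sup>2 * L x)" using neg by simp
  \<comment> \<open>On the ball of radius \<open>d\<close> the root is at most
    \<open>sqrt 2 * d\<close>, and \<open>sqrt 2 ^ 5 = 4 * sqrt 2 \<le> 6\<close> turns
    \<open>3 * d\<^sup>2 / (6 * d ^ 5)\<close> into \<open>1 / (2 * d ^ 3)\<close>. Elsewhere in the
    support the negative part is discarded, and beyond it \<open>L\<close> is zero.\<close>
  have L_le: "L x \<le> 8 / (r / 2) ^ 3 - indicator (cball p d) x / (2 * d ^ 3)" for x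
  proof -
    have Leq: "L x = 4 * \<rho> x * bump2 d s (\<rho> x) + 6 * bump1 d s (\<rho> x)"
    proof -
      have gen: "(\<Sum>i\<in>UNIV. b * (2 * 1) + c * (2 * z i) * (2 * z i)) = 4 * (\<Sum>i\<in>UNIV. z i * z i) * c + 6 * b"
        for b c and z :: "3 \<Rightarrow> real" by (simp add: sum_3 algebra_simps)
      have "L x = (\<Sum>i\<in>UNIV. bump1 d s (\<rho> x) * (2 * 1) + bump2 d s (\<rho> x) * (2 * (x $ i - p $ i)) * (2 * (x $ i - p $ i)))"
        unfolding L_def H_def by (simp only: simp_thms if_True)
      also have "\<dots> = 4 * (\<Sum>i\<in>UNIV. (x $ i - p $ i) * (x $ i - p $ i)) * bump2 d s (\<rho> x) + 6 * bump1 d s (\<rho> x)"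
        by (rule gen)
      also have "(\<Sum>i\<in>UNIV. (x $ i - p $ i) * (x $ i - p $ i)) = \<rho> x" by (simp add: \<rho>_def inner_vec_def)
      finally show ?thesis .
    qed
    show ?thesis
    proof (cases "\<rho> x \<le> s")
      case True
      have "L x \<le> - 3 * d\<^sup>2 / sqrt (d\<^sup>2 + \<rho> x) ^ 5 + 8 / (r / 2) ^ 3"
        using taylor_laplacian[OF d(1) \<rho>0 True s(1)] True by (simp add: Leq bump1_def bump2_def s(2))
      moreover have "- 3 * d\<^sup>2 / sqrt (d\<^sup>2 + \<rho> x) ^ 5 \<le> - indicator (cball p d) x / (2 * d ^ 3)"
      proof (cases "x \<in> cball p d")
        case True
        then have "\<rho> x \<le> d\<^sup>2" unfolding \<rho>_def squared_distance by (intro power_mono) (auto simp: dist_commute)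
        then have "sqrt (d\<^sup>2 + \<rho> x) \<le> sqrt (2 * d\<^sup>2)" by simp
        also have "\<dots> = sqrt 2 * d" using d by (simp add: real_sqrt_mult)
        finally have "sqrt (d\<^sup>2 + \<rho> x) ^ 5 \<le> (sqrt 2 * d) ^ 5" using \<rho>0 by (intro power_mono) auto
        also have "(sqrt 2 * d) ^ 5 = 4 * sqrt 2 * d ^ 5"
        proof -
          have "sqrt 2 ^ 5 = (sqrt 2 ^ 2) ^ 2 * sqrt 2" by (simp only: power_mult[symmetric] power_Suc2[symmetric]) simp
          then show ?thesis by (simp add: power_mult_distrib)
        qed
        also have "\<dots> \<le> 6 * d ^ 5"
        proof -
          have "sqrt 2 \<le> 3 / 2" by (rule real_le_lsqrt) (auto simp: power2_eq_square)
          then show ?thesis using d by (intro mult_right_mono) auto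
        qed
        finally have y: "sqrt (d\<^sup>2 + \<rho> x) ^ 5 \<le> 6 * d ^ 5" .
        have "d\<^sup>2 + \<rho> x > 0" using d(1) \<rho>0[of x] by (simp add: add_pos_nonneg)
        then have "3 * d\<^sup>2 / (6 * d ^ 5) \<le> 3 * d\<^sup>2 / sqrt (d\<^sup>2 + \<rho> x) ^ 5"
          using d y by (intro divide_left_mono) (auto intro!: mult_pos_pos)
        moreover have "3 * d\<^sup>2 / (6 * d ^ 5) = 1 / (2 * d ^ 3)" using d by (simp add: field_simps eval_nat_numeral)
        ultimately show ?thesis using True by simp
      qed (use \<rho>0 d in \<open>simp add: add_nonneg_nonneg\<close>)
      ultimately show ?thesis by linarith
    next
      case False
      have "d\<^sup>2 \<le> s" unfolding s_def using d by (intro power_mono) auto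
      then have "x \<notin> cball p d"
        using False power_mono[of "dist x p" d 2] unfolding \<rho>_def squared_distance by (auto simp: dist_commute)
      then show ?thesis using False r_pos bump_zero[of s "\<rho> x" d] by (simp add: Leq)
    qed
  qed
  have iu: "set_integrable lborel \<Omega> (\<lambda>x. (cmod (u x))\<^sup>2)"
    using norm_square_integrable(1)[OF u2(1), of "\<lambda>_. 1" 1] by simp
  have ii: "set_integrable lborel \<Omega> (\<lambda>x. (cmod (u x))\<^sup>2 * indicator (cball p d) x)"
  proof -
    have "integrable lborel (\<lambda>x. indicator (cball p d) x *\<^sub>R (indicator \<Omega> x *\<^sub>R (cmod (u x))\<^sup>2))"
      by (rule integrable_mult_indicator) (use iu in \<open>simp_all add: set_integrable_def\<close>)
    then show ?thesis by (simp add: set_integrable_def mult_ac)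
  qed
  let ?c = "8 / (r / 2) ^ 3" and ?k = "1 / (2 * d ^ 3)"
  let ?I = "LINT x:\<Omega>|lborel. (cmod (u x))\<^sup>2 * indicator (cball p d) x"
  have "(LINT x:\<Omega>|lborel. (cmod (u x))\<^sup>2 * L x) \<le>
     (LINT x:\<Omega>|lborel. ?c * (cmod (u x))\<^sup>2 - ?k * ((cmod (u x))\<^sup>2 * indicator (cball p d) x))"
  proof (rule set_integral_mono[OF iL])
    show "set_integrable lborel \<Omega> (\<lambda>x. ?c * (cmod (u x))\<^sup>2 - ?k * ((cmod (u x))\<^sup>2 * indicator (cball p d) x))"
      by (rule set_integral_diff(1)[OF set_integrable_mult_right[OF iu] set_integrable_mult_right[OF ii]])
    fix x
    from mult_left_mono[OF L_le[of x], of "(cmod (u x))\<^sup>2"]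
    show "(cmod (u x))\<^sup>2 * L x \<le> ?c * (cmod (u x))\<^sup>2 - ?k * ((cmod (u x))\<^sup>2 * indicator (cball p d) x)"
      by (simp add: right_diff_distrib mult.commute)
  qed
  also have "\<dots> = ?c * (L2_norm lborel \<Omega> u)\<^sup>2 - ?k * ?I"
    using set_integral_diff(2)[OF set_integrable_mult_right[OF iu, of ?c] set_integrable_mult_right[OF ii, of ?k]]
    by (simp add: L2_norm_power2 del: times_divide_eq_left)
  finally have fin: "?k * ?I \<le> ?c * (L2_norm lborel \<Omega> u)\<^sup>2" using pos by linarith
  \<comment> \<open>Solving for the mass in the ball; \<open>2 * d ^ 3\<close> times the 8 in
    \<open>?c\<close> gives the constant 16.\<close>
  have "?I = 2 * d ^ 3 * (?k * ?I)" using d by simp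
  also have "\<dots> \<le> 2 * d ^ 3 * (?c * (L2_norm lborel \<Omega> u)\<^sup>2)"
    using fin d by (intro mult_left_mono) auto
  finally show ?thesis by simp
qed

end

section \<open>The cell without small neighbourhoods of the apertures\<close>

text \<open>Convolution with the indicator of a large ball is constant near the origin, its value
  being the integral of the kernel. So its gradient at the origin is zero; but the components of
  that gradient are the integrals of the partial derivatives.\<close>

lemma integral_partial_eq_0:
  fixes \<phi> :: "real^'n::finite \<Rightarrow> real"
  assumes "C1_test UNIV \<phi> \<phi>'"
  shows "(LINT x|lborel. \<phi>' i x) = 0"
proof -
  obtain K where K: "compact K" "\<And>x. x \<notin> K \<Longrightarrow> \<phi> x = 0" "\<And>i x. x \<notin> K \<Longrightarrow> \<phi>' i x = 0"
    "continuous_on UNIV \<phi>" "\<And>i. continuous_on UNIV (\<phi>' i)"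
    using C1_testE[OF assms] by metis
  have part: "partial j \<phi> = \<phi>' j" for j
    using assms partial_eq[of \<phi> "\<lambda>i. \<phi>' i _" _ j] unfolding C1_test_def by blast
  have C1: "C_k 1 \<phi>"
    using assms K(5) by (auto simp: part C1_test_def intro: has_grad_differentiable)
  obtain R where R: "0 < R" "K \<subseteq> ball 0 R" using bounded_subset_ballD[OF compact_imp_bounded[OF K(1)], of 0] by blast
  let ?f = "indicator (ball (0::real^'n) (2 * R)) :: real^'n \<Rightarrow> real"
  have fint: "integrable lborel ?f"
    by (intro integrable_real_indicator emeasure_bounded_finite) auto
  have fm: "?f \<in> borel_measurable borel" by (intro borel_measurable_indicator) simp
  have const: "conv \<psi> ?f x = (LINT z|lborel. \<psi> z)"
    if x: "x \<in> ball 0 R" and \<psi>: "continuous_on UNIV \<psi>" "\<And>z. z \<notin> K \<Longrightarrow> \<psi> z = 0" for \<psi> x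
  proof -
    have "\<psi> z *\<^sub>R ?f (x - z) = \<psi> z" for z
    proof (cases "z \<in> K")
      case True
      then have "norm (x - z) < 2 * R" using R(2) x norm_triangle_ineq4[of x z] by (auto simp: dist_norm)
      then show ?thesis by (simp add: indicator_def)
    qed (simp add: \<psi>)
    then show ?thesis using conv_alt[OF fm borel_measurable_continuous_onI[OF \<psi>(1)], of x] by (simp only:)
  qed
  have 0: "(0::real^'n) \<in> ball 0 R" using R by simp
  have "has_grad (conv \<phi> ?f) (\<lambda>i. conv (partial i \<phi>) ?f 0) 0"
    by (rule conv_has_grad[OF fint C1 K(1,2)]) (simp_all add: part K(3))
  moreover have "has_grad (conv \<phi> ?f) (\<lambda>_. 0) 0"
    by (rule has_grad_transform[OF has_grad_const open_ball 0]) (rule const[OF _ K(4,2), symmetric])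
  ultimately have "(\<lambda>i. conv (partial i \<phi>) ?f 0) = (\<lambda>_. 0)" by (rule has_grad_unique)
  from fun_cong[OF this, of i] have "conv (\<phi>' i) ?f 0 = 0" unfolding part .
  moreover have "conv (\<phi>' i) ?f 0 = (LINT x|lborel. \<phi>' i x)" by (rule const[OF 0 K(5) K(3)])
  ultimately show ?thesis by (rule trans[OF sym, rotated])
qed

text \<open>The starting point for explicit elements of H1: powers of the first coordinate arise
  from the constant by repeated multiplication.\<close>

lemma const_H1:
  fixes \<Omega> :: "(real^'n::finite) set"
  assumes "open \<Omega>" "bounded \<Omega>"
  shows "(\<lambda>x. 1) \<in> H1 \<Omega>"
proof (rule H1I)
  have fin: "emeasure lborel \<Omega> < \<infinity>" by (rule emeasure_bounded_finite[OF assms(2)])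
  have e: "(cmod (indicator \<Omega> x *\<^sub>R 1))\<^sup>2 = indicator \<Omega> x" for x by (simp add: indicator_def)
  have i: "integrable lborel (indicator \<Omega> :: real^'n \<Rightarrow> real)"
    by (rule integrable_real_indicator[OF _ fin]) (use assms in simp)
  have "(\<lambda>x. indicator \<Omega> x *\<^sub>R (1::complex)) \<in> borel_measurable lborel"
    by (rule borel_measurable_scaleR) (use assms in simp_all)
  then show "(\<lambda>x. 1) \<in> L2_space lborel \<Omega>" unfolding L2_space_iff e using i by blast
  show "has_weak_gradient \<Omega> (\<lambda>x. 1) (\<lambda>_. 0)"
  proof (rule has_weak_gradientI)
    fix i \<phi> assume \<phi>: "C1_test \<Omega> \<phi> (\<lambda>i. partial i \<phi>)"
    have "C1_test UNIV \<phi> (\<lambda>i. partial i \<phi>)" using \<phi> unfolding C1_test_def by blast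
    from integral_partial_eq_0[OF this] have 0: "(LINT x|lborel. partial i \<phi> x) = 0" .
    obtain K where K: "K \<subseteq> \<Omega>" "\<And>i x. x \<notin> K \<Longrightarrow> partial i \<phi> x = 0" using C1_testE[OF \<phi>] by metis
    have "zero_ext \<Omega> (\<lambda>x. 1) x * of_real (partial i \<phi> x) = of_real (partial i \<phi> x)" for x
      using K by (cases "x \<in> \<Omega>") auto
    then show "(LINT x|lborel. zero_ext \<Omega> (\<lambda>x. 1) x * of_real (partial i \<phi> x)) =
      - (LINT x|lborel. zero_ext \<Omega> (\<lambda>x. (0 :: complex^'n) $ i) x * of_real (\<phi> x))"
      using 0 by (simp add: zero_ext_def)
  qed (simp add: L2_zero)
qed

lemma at_x1_eq_iff [simp]: "at_x1 a y = at_x1 a z \<longleftrightarrow> y = z"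
  by (metis (mono_tags) at_x1_components(2,3) exhaust_2 vec_eq_iff)

lemma at_x1_in_image [simp]: "at_x1 a y \<in> at_x1 a ` T \<longleftrightarrow> y \<in> T"
  by (auto simp: image_iff)

lemma dist_at_x1: "dist (at_x1 a y) (at_x1 a z) = dist y z"
  by (simp add: dist_vec_def L2_set_def sum_3 sum_2)

lemma component_le_dist: "\<bar>(x::real^'n::finite) $ i - y $ i\<bar> \<le> dist x y"
  using component_le_norm_cart[of "x - y" i] by (simp add: dist_norm)

text \<open>Quasi-periodicity compares traces on two different planes; pulling both back to plane
  coordinates places them in one L2 space.\<close>

lemma L2_area_x1:
  assumes "g \<in> L2_space (area_x1 a) (at_x1 a ` T)"
  shows "(\<lambda>y. g (at_x1 a y)) \<in> L2_space lborel T"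
    and "L2_norm lborel T (\<lambda>y. g (at_x1 a y)) = L2_norm (area_x1 a) (at_x1 a ` T) g"
proof -
  let ?h = "\<lambda>x. indicator (at_x1 a ` T) x *\<^sub>R g x"
  have e: "indicator T y *\<^sub>R g (at_x1 a y) = ?h (at_x1 a y)" for y by (simp add: indicator_def)
  have m: "?h \<in> borel_measurable borel" using L2_measurable[OF assms] by (simp add: area_x1_def)
  have m': "(\<lambda>y. ?h (at_x1 a y)) \<in> borel_measurable borel" by (rule measurable_compose[OF at_x1_measurable2 m])
  have cm: "cmod \<in> borel_measurable borel" by (intro borel_measurable_continuous_onI continuous_intros)
  have m2: "(\<lambda>x. (cmod (?h x))\<^sup>2) \<in> borel_measurable borel"
    by (rule borel_measurable_power[OF measurable_compose[OF m cm]])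
  have "integrable (distr lborel borel (at_x1 a)) (\<lambda>x. (cmod (?h x))\<^sup>2)"
    using L2_integrable[OF assms] by (simp only: area_x1_def)
  then have "integrable lborel (\<lambda>y. (cmod (?h (at_x1 a y)))\<^sup>2)"
    by (subst (asm) integrable_distr_eq[OF _ m2]) simp_all
  with m' show "(\<lambda>y. g (at_x1 a y)) \<in> L2_space lborel T"
    unfolding L2_space_iff e by simp
  have "(LINT x|distr lborel borel (at_x1 a). (cmod (?h x))\<^sup>2) = (LINT y|lborel. (cmod (?h (at_x1 a y)))\<^sup>2)"
    by (rule integral_distr[OF _ m2]) simp
  then show "L2_norm lborel T (\<lambda>y. g (at_x1 a y)) = L2_norm (area_x1 a) (at_x1 a ` T) g"
    unfolding L2_norm_eq e area_x1_def by simp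
qed

text \<open>The inequality for functions continuous up to the aperture passes to all traces through
  the approximation that defines them.\<close>

lemma (in half_ball) trace_bound:
  assumes t: "has_trace \<Omega> (area_x1 (p $ 1)) (at_x1 (p $ 1) ` T) w h"
    and T: "\<And>y. y \<in> T \<Longrightarrow> dist (at_x1 (p $ 1) y) p < r / 3"
  shows "L2_norm (area_x1 (p $ 1)) (at_x1 (p $ 1) ` T) h \<le> sqrt (16 / 3 * (2 + 48 / r)) * H1_norm \<Omega> w"
proof -
  let ?M = "area_x1 (p $ 1)" and ?S = "at_x1 (p $ 1) ` T" and ?K = "sqrt (16 / 3 * (2 + 48 / r))"
  note D = has_traceD[OF t]
  obtain v where v: "\<And>n::nat. v n \<in> H1 \<Omega>" "\<And>n. continuous_on (\<Omega> \<union> ?S) (v n)" "\<And>n. v n \<in> L2_space ?M ?S"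
    "(\<lambda>n. H1_norm \<Omega> (\<lambda>x. v n x - w x)) \<longlonglongrightarrow> 0" "(\<lambda>n. L2_norm ?M ?S (\<lambda>x. v n x - h x)) \<longlonglongrightarrow> 0"
    using has_traceE[OF t] by blast
  have b: "L2_norm ?M ?S (v n) \<le> ?K * H1_norm \<Omega> (v n)" for n
  proof -
    have "sqrt ((L2_norm ?M ?S (v n))\<^sup>2) \<le> sqrt (16 / 3 * (2 + 48 / r) * (H1_norm \<Omega> (v n))\<^sup>2)"
      by (intro real_sqrt_le_mono trace_inequality v T)
    moreover have "sqrt (k * h\<^sup>2) = sqrt k * h" if "h \<ge> 0" for k h :: real
      using that by (simp add: real_sqrt_mult)
    from this[OF L2_norm_nonneg, of 1] this[OF H1_norm_nonneg]
    have "sqrt ((L2_norm ?M ?S (v n))\<^sup>2) = L2_norm ?M ?S (v n)"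
      "sqrt (16 / 3 * (2 + 48 / r) * (H1_norm \<Omega> (v n))\<^sup>2) = ?K * H1_norm \<Omega> (v n)" by (simp, blast)
    ultimately show ?thesis by (simp only:)
  qed
  have K: "?K \<ge> 0" using r_pos by simp
  have "L2_norm ?M ?S h \<le> ?K * H1_norm \<Omega> w + (L2_norm ?M ?S (\<lambda>x. v n x - h x) + ?K * H1_norm \<Omega> (\<lambda>x. v n x - w x))" for n
  proof -
    have "L2_norm ?M ?S h \<le> L2_norm ?M ?S (\<lambda>x. h x - v n x) + L2_norm ?M ?S (v n)"
      using L2_triangle[OF L2_diff[OF D(2) v(3)[of n]] v(3)[of n]] by simp
    moreover have "H1_norm \<Omega> (v n) \<le> H1_norm \<Omega> (\<lambda>x. v n x - w x) + H1_norm \<Omega> w"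
      using H1_triangle[OF open_\<Omega> H1_closed_ops(2)[OF open_\<Omega> v(1)[of n] D(1)] D(1)] by simp
    then have "?K * H1_norm \<Omega> (v n) \<le> ?K * (H1_norm \<Omega> (\<lambda>x. v n x - w x) + H1_norm \<Omega> w)"
      using K by (rule mult_left_mono)
    ultimately show ?thesis using b[of n] L2_norm_minus_commute[of ?M ?S h "v n"] by (simp add: distrib_left)
  qed
  moreover have "(\<lambda>n. ?K * H1_norm \<Omega> w + (L2_norm ?M ?S (\<lambda>x. v n x - h x) + ?K * H1_norm \<Omega> (\<lambda>x. v n x - w x))) \<longlonglongrightarrow> ?K * H1_norm \<Omega> w + (0 + ?K * 0)"
    by (intro tendsto_intros v)
  ultimately show ?thesis by (intro LIMSEQ_le_const[of _ "?K * H1_norm \<Omega> w"]) auto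
qed

lemma has_trace_zero: "open \<Omega> \<Longrightarrow> has_trace \<Omega> M S (\<lambda>x. 0) (\<lambda>x. 0)"
  by (rule has_trace_continuous) (auto intro: H1_closed_ops L2_zero)

lemma has_trace_sum:
  assumes "open \<Omega>" "\<And>i. i < (n::nat) \<Longrightarrow> has_trace \<Omega> M S (w i) (g i)"
  shows "has_trace \<Omega> M S (\<Sum>i<n. cscale (c i) (w i)) (\<Sum>i<n. cscale (c i) (g i))"
  using assms(2)
proof (induction n)
  case 0
  then show ?case using has_trace_zero[OF assms(1)] by (simp add: zero_fun_def)
next
  case (Suc n)
  from has_trace_add[OF assms(1) Suc.IH has_trace_cmult[OF assms(1) Suc.prems[of n], of "c n"]] Suc.prems
  show ?case by (simp add: plus_fun_def cscale_def)
qed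

lemma C1_compact_support_bound:
  fixes \<Psi> :: "real^'n::finite \<Rightarrow> real"
  assumes "\<And>x. has_grad \<Psi> (\<lambda>i. \<Psi>' i x) x" "\<And>i. continuous_on UNIV (\<Psi>' i)" "\<And>x. dist x p \<ge> d \<Longrightarrow> \<Psi> x = 0"
  obtains C where "C \<ge> 0" "\<And>x. \<bar>\<Psi> x\<bar> \<le> C" "\<And>i x. \<bar>\<Psi>' i x\<bar> \<le> C"
proof -
  have t: "C1_test UNIV \<Psi> \<Psi>'"
    unfolding C1_test_def using assms by (auto intro!: exI[of _ "cball p d"] simp: dist_commute)
  obtain K where K: "compact K" "K \<subseteq> UNIV" "\<And>x. x \<notin> K \<Longrightarrow> \<Psi> x = 0" "\<And>i x. x \<notin> K \<Longrightarrow> \<Psi>' i x = 0"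
    "continuous_on UNIV \<Psi>" "\<And>i. continuous_on UNIV (\<Psi>' i)"
    by (rule C1_testE[OF t]) (rule that)
  obtain B where B: "B > 0" "\<And>x. norm (\<Psi> x) \<le> B" using bounded_continuous_compact_support[OF K(5,1,3)] by metis
  have "\<exists>B. \<forall>x. norm (\<Psi>' i x) \<le> B" for i using bounded_continuous_compact_support[OF K(6) K(1) K(4)] by metis
  then have "\<forall>i. \<exists>B. \<forall>x. norm (\<Psi>' i x) \<le> B" by blast
  from choice[OF this] obtain B' where B': "\<And>i x. norm (\<Psi>' i x) \<le> B' i" by blast
  define C where "C = B + (\<Sum>i\<in>UNIV. \<bar>B' i\<bar>)"
  have "\<bar>B' i\<bar> \<le> (\<Sum>i\<in>UNIV. \<bar>B' i\<bar>)" for i by (rule member_le_sum) auto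
  then have 1: "\<bar>\<Psi>' i x\<bar> \<le> C" for i x
    using B'[of i x] B(1) unfolding C_def real_norm_def by (meson abs_ge_self add_increasing less_imp_le order_trans)
  have "0 \<le> (\<Sum>i\<in>UNIV. \<bar>B' i\<bar>)" by (intro sum_nonneg) auto
  then have 2: "\<bar>\<Psi> x\<bar> \<le> C" for x using B(2)[of x] unfolding C_def real_norm_def by linarith
  have "C \<ge> 0" using 2[of 0] abs_ge_zero order_trans by blast
  then show thesis using that 1 2 by blast
qed

text \<open>What the estimates retain of the geometry: flat half balls of a common radius about both
  aperture centres, and a free surface of positive area that stays away from them.\<close>

locale punctured_cell = steklov \<Omega> area_x3 S +
  N0: half_ball \<Omega> "at_x1 0 P" 1 r + N1: half_ball \<Omega> "at_x1 1 P" "- 1" r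
  for \<Omega> S :: "(real^3) set" and P :: "real^2" and r :: real +
  assumes S_sets: "S \<in> sets borel" and S_bounded: "bounded S"
    and S_positive: "emeasure area_x3 S > 0"
    and S_far: "\<And>x j. x \<in> S \<Longrightarrow> j \<in> {0, 1} \<Longrightarrow> r \<le> dist x (at_x1 j P)"
begin

text \<open>The function \<open>X\<close> of the overview, with one factor for each
  aperture.\<close>

definition plug :: "real \<Rightarrow> real^3 \<Rightarrow> real" where
  "plug a x = radial_cutoff (at_x1 0 P) a x * radial_cutoff (at_x1 1 P) a x"

definition plug' :: "real \<Rightarrow> 3 \<Rightarrow> real^3 \<Rightarrow> real" where
  "plug' a i x = radial_cutoff (at_x1 0 P) a x * radial_cutoff' (at_x1 1 P) a i x +
     radial_cutoff' (at_x1 0 P) a i x * radial_cutoff (at_x1 1 P) a x"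

lemma has_grad_plug: "has_grad (plug a) (\<lambda>i. plug' a i x) x"
  unfolding plug_def[abs_def] plug'_def by (rule has_grad_mult[OF has_grad_radial_cutoff has_grad_radial_cutoff])

lemma continuous_plug': "continuous_on UNIV (plug' a i)"
  unfolding plug'_def[abs_def] by (intro continuous_intros continuous_radial_cutoff continuous_radial_cutoff')

lemma plug_bounds: "0 \<le> plug a x" "plug a x \<le> 1" "\<bar>plug a x\<bar> \<le> 1"
  using radial_cutoff_bounds[of "at_x1 0 P" a x] radial_cutoff_bounds[of "at_x1 1 P" a x]
  by (auto simp: plug_def mult_le_one abs_mult)

lemma plug'_bound: "a > 0 \<Longrightarrow> \<bar>plug' a i x\<bar> \<le> 32 / a"
proof -
  assume a: "a > 0"
  have "\<bar>radial_cutoff (at_x1 0 P) a x * radial_cutoff' (at_x1 1 P) a i x\<bar> \<le> 1 * (16 / a)"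
    unfolding abs_mult using radial_cutoff_bounds[of "at_x1 0 P" a x] a by (intro mult_mono radial_cutoff'_bound) auto
  moreover have "\<bar>radial_cutoff' (at_x1 0 P) a i x * radial_cutoff (at_x1 1 P) a x\<bar> \<le> (16 / a) * 1"
    unfolding abs_mult using radial_cutoff_bounds[of "at_x1 1 P" a x] a by (intro mult_mono radial_cutoff'_bound) auto
  ultimately show ?thesis unfolding plug'_def by (simp add: abs_le_iff)
qed

lemma plug'_square_le:
  assumes "a > 0"
  shows "(plug' a i x)\<^sup>2 \<le> 1024 / a\<^sup>2 * (indicator (cball (at_x1 0 P) (2 * a)) x + indicator (cball (at_x1 1 P) (2 * a)) x)"
proof (cases "dist x (at_x1 0 P) \<ge> 2 * a \<and> dist x (at_x1 1 P) \<ge> 2 * a")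
  case True
  then have "plug' a i x = 0"
    using radial_cutoff_one(2)[OF assms conjunct1[OF True]] radial_cutoff_one(2)[OF assms conjunct2[OF True]]
    by (simp add: plug'_def)
  then show ?thesis by simp
next
  case False
  then have 1: "(1::real) \<le> indicator (cball (at_x1 0 P) (2 * a)) x + indicator (cball (at_x1 1 P) (2 * a)) x"
    by (auto simp: indicator_def dist_commute)
  have "(plug' a i x)\<^sup>2 \<le> (32 / a)\<^sup>2" using plug'_bound[OF assms, of i x] by (metis abs_ge_zero power2_abs power_mono)
  also have "\<dots> = 1024 / a\<^sup>2 * 1" by (simp add: power_divide)
  also have "\<dots> \<le> 1024 / a\<^sup>2 * (indicator (cball (at_x1 0 P) (2 * a)) x + indicator (cball (at_x1 1 P) (2 * a)) x)"
    using 1 by (intro mult_left_mono) auto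
  finally show ?thesis .
qed

lemma plug_on_S: "0 < a \<Longrightarrow> 2 * a \<le> r \<Longrightarrow> x \<in> S \<Longrightarrow> plug a x = 1"
  using S_far[of x 0] S_far[of x 1] radial_cutoff_one(1)[of a x] by (simp add: plug_def)

lemma plug_zero: "0 < a \<Longrightarrow> j \<in> {0, 1} \<Longrightarrow> x \<in> ball (at_x1 j P) a \<Longrightarrow> plug a x = 0"
  using radial_cutoff_zero[of a x "at_x1 j P"] by (auto simp: plug_def dist_commute)

lemma area_sets: "sets area_x3 = sets borel"
  by (simp add: area_x3_def)

lemma S_in_sets: "S \<in> sets area_x3"
  using S_sets by (simp add: area_sets)

lemma trace_plug:
  assumes "has_trace \<Omega> area_x3 S u g" "a > 0"
  shows "has_trace \<Omega> area_x3 S (\<lambda>x. of_real (plug a x) * u x) (\<lambda>x. of_real (plug a x) * g x)"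
proof (rule has_trace_mult[OF open_\<Omega> assms(1) S_in_sets area_sets has_grad_plug continuous_plug'])
  show "\<bar>plug a x\<bar> \<le> 1 + 32 / a" "\<bar>plug' a i x\<bar> \<le> 1 + 32 / a" for x i
    using plug_bounds(3)[of a x] plug'_bound[OF assms(2), of i x] assms(2) divide_pos_pos[of 32 a] by linarith+
  show "0 \<le> 1 + 32 / a" using assms(2) divide_pos_pos[of 32 a] by linarith
qed

lemma trace_plug_aperture:
  assumes "has_trace \<Omega> area_x3 S u g" "a > 0" "T \<subseteq> ball P a" "j \<in> {0, 1}"
  shows "has_trace \<Omega> M (at_x1 j ` T) (\<lambda>x. of_real (plug a x) * u x) (\<lambda>x. 0)"
proof (rule has_trace_zero_near[OF open_\<Omega> assms(1) has_grad_plug continuous_plug'])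
  show "\<bar>plug a x\<bar> \<le> 1 + 32 / a" "\<bar>plug' a i x\<bar> \<le> 1 + 32 / a" for x i
    using plug_bounds(3)[of a x] plug'_bound[OF assms(2), of i x] assms(2) divide_pos_pos[of 32 a] by linarith+
  show "at_x1 j ` T \<subseteq> ball (at_x1 j P) a" using assms(3) by (auto simp: dist_at_x1)
  show "x \<in> ball (at_x1 j P) a \<Longrightarrow> plug a x = 0" for x by (rule plug_zero[OF assms(2,4)])
qed simp

definition quasiperiodic :: "(real^2) set \<Rightarrow> real \<Rightarrow> (real^3 \<Rightarrow> complex) set" where
  "quasiperiodic T \<eta> = {u \<in> H1 \<Omega>. \<exists>g0 g1. has_trace \<Omega> (area_x1 0) (at_x1 0 ` T) u g0 \<and>
     has_trace \<Omega> (area_x1 1) (at_x1 1 ` T) u g1 \<and>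
     (AE y in lborel. at_x1 0 y \<in> at_x1 0 ` T \<longrightarrow> g0 (at_x1 0 y) = exp (- \<i> * of_real \<eta>) * g1 (at_x1 1 y))}"

lemma quasiperiodic_iff:
  "u \<in> quasiperiodic T \<eta> \<longleftrightarrow> (\<exists>g0 g1. has_trace \<Omega> (area_x1 0) (at_x1 0 ` T) u g0 \<and>
     has_trace \<Omega> (area_x1 1) (at_x1 1 ` T) u g1 \<and>
     (AE y\<in>T in lborel. g0 (at_x1 0 y) = exp (- \<i> * of_real \<eta>) * g1 (at_x1 1 y)))"
  by (auto simp: quasiperiodic_def dest: has_traceD)

lemma quasiperiodic_ops:
  "(\<lambda>x. 0) \<in> quasiperiodic T \<eta>"
  "u \<in> quasiperiodic T \<eta> \<Longrightarrow> v \<in> quasiperiodic T \<eta> \<Longrightarrow> (\<lambda>x. u x + v x) \<in> quasiperiodic T \<eta>"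
  "u \<in> quasiperiodic T \<eta> \<Longrightarrow> (\<lambda>x. c * u x) \<in> quasiperiodic T \<eta>"
proof -
  show "(\<lambda>x. 0) \<in> quasiperiodic T \<eta>"
    unfolding quasiperiodic_iff using has_trace_zero[OF open_\<Omega>] by (intro exI[of _ "\<lambda>x. 0"]) simp
next
  assume "u \<in> quasiperiodic T \<eta>" "v \<in> quasiperiodic T \<eta>"
  then obtain g0 g1 h0 h1 where
    g: "has_trace \<Omega> (area_x1 0) (at_x1 0 ` T) u g0" "has_trace \<Omega> (area_x1 1) (at_x1 1 ` T) u g1"
      "AE y\<in>T in lborel. g0 (at_x1 0 y) = exp (- \<i> * of_real \<eta>) * g1 (at_x1 1 y)" and
    h: "has_trace \<Omega> (area_x1 0) (at_x1 0 ` T) v h0" "has_trace \<Omega> (area_x1 1) (at_x1 1 ` T) v h1"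
      "AE y\<in>T in lborel. h0 (at_x1 0 y) = exp (- \<i> * of_real \<eta>) * h1 (at_x1 1 y)"
    unfolding quasiperiodic_iff by blast
  have "AE y\<in>T in lborel. g0 (at_x1 0 y) + h0 (at_x1 0 y) = exp (- \<i> * of_real \<eta>) * (g1 (at_x1 1 y) + h1 (at_x1 1 y))"
    using g(3) h(3) by eventually_elim (simp add: distrib_left)
  then show "(\<lambda>x. u x + v x) \<in> quasiperiodic T \<eta>"
    unfolding quasiperiodic_iff using has_trace_add[OF open_\<Omega> g(1) h(1)] has_trace_add[OF open_\<Omega> g(2) h(2)]
    by (intro exI[of _ "\<lambda>x. g0 x + h0 x"] exI[of _ "\<lambda>x. g1 x + h1 x"]) simp
next
  assume "u \<in> quasiperiodic T \<eta>"
  then obtain g0 g1 where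
    g: "has_trace \<Omega> (area_x1 0) (at_x1 0 ` T) u g0" "has_trace \<Omega> (area_x1 1) (at_x1 1 ` T) u g1"
      "AE y\<in>T in lborel. g0 (at_x1 0 y) = exp (- \<i> * of_real \<eta>) * g1 (at_x1 1 y)"
    unfolding quasiperiodic_iff by blast
  have "AE y\<in>T in lborel. c * g0 (at_x1 0 y) = exp (- \<i> * of_real \<eta>) * (c * g1 (at_x1 1 y))"
    using g(3) by eventually_elim simp
  then show "(\<lambda>x. c * u x) \<in> quasiperiodic T \<eta>"
    unfolding quasiperiodic_iff using has_trace_cmult[OF open_\<Omega> g(1), of c] has_trace_cmult[OF open_\<Omega> g(2), of c]
    by (intro exI[of _ "\<lambda>x. c * g0 x"] exI[of _ "\<lambda>x. c * g1 x"]) simp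
qed

lemma plug_quasiperiodic:
  assumes "has_trace \<Omega> area_x3 S u g" "a > 0" "T \<subseteq> ball P a"
  shows "(\<lambda>x. of_real (plug a x) * u x) \<in> quasiperiodic T \<eta>"
  unfolding quasiperiodic_iff
  using trace_plug_aperture[OF assms, of 0 "area_x1 0"] trace_plug_aperture[OF assms, of 1 "area_x1 1"]
  by (intro exI[of _ "\<lambda>x. 0"]) simp

text \<open>The trace estimate on the flat part makes the traces a Cauchy sequence; its limit in L2
  is a trace of \<open>v\<close> by \<open>has_trace_closed\<close>.\<close>

lemma trace_limit:
  assumes j: "half_ball \<Omega> (at_x1 j P) \<sigma> r" and T: "T \<subseteq> ball P (r / 3)"
    and t: "\<And>n::nat. has_trace \<Omega> (area_x1 j) (at_x1 j ` T) (u n) (g n)"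
    and v: "v \<in> H1 \<Omega>" "(\<lambda>n. H1_norm \<Omega> (\<lambda>x. u n x - v x)) \<longlonglongrightarrow> 0"
  shows "\<exists>h. has_trace \<Omega> (area_x1 j) (at_x1 j ` T) v h \<and> (\<lambda>n. L2_norm (area_x1 j) (at_x1 j ` T) (\<lambda>x. g n x - h x)) \<longlonglongrightarrow> 0"
proof -
  interpret N: half_ball \<Omega> "at_x1 j P" \<sigma> r by (rule j)
  let ?M = "area_x1 j" and ?S = "at_x1 j ` T"
  define K where "K = sqrt (16 / 3 * (2 + 48 / r))"
  have Tb: "dist (at_x1 (at_x1 j P $ 1) y) (at_x1 j P) < r / 3" if "y \<in> T" for y
    using T that by (auto simp: dist_at_x1 dist_commute)
  have bound: "L2_norm ?M ?S h \<le> K * H1_norm \<Omega> w" if "has_trace \<Omega> ?M ?S w h" for w h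
    using N.trace_bound[of T w h] that Tb by (simp add: K_def)
  have K: "K > 0" using N.r_pos by (simp add: K_def add_pos_pos)
  note D = has_traceD[OF t]
  have "\<exists>h\<in>L2_space ?M ?S. (\<lambda>n. L2_norm ?M ?S (\<lambda>x. g n x - h x)) \<longlonglongrightarrow> 0"
  proof (rule L2_complete[OF D(2)])
    fix e :: real assume "e > 0"
    then have "e / (2 * K) > 0" using K by simp
    from LIMSEQ_D[OF v(2) this] obtain N where N: "\<And>n. n \<ge> N \<Longrightarrow> H1_norm \<Omega> (\<lambda>x. u n x - v x) < e / (2 * K)" by auto
    have "L2_norm ?M ?S (\<lambda>x. g m x - g n x) < e" if mn: "m \<ge> N" "n \<ge> N" for m n
    proof -
      have "H1_norm \<Omega> (\<lambda>x. u m x - u n x) \<le> H1_norm \<Omega> (\<lambda>x. u m x - v x) + H1_norm \<Omega> (\<lambda>x. u n x - v x)"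
        using H1_triangle_minus[OF open_\<Omega> D(1) v(1) D(1), of m n] H1_norm_minus_commute[OF open_\<Omega> v(1) D(1), of n] by simp
      also have "\<dots> < e / (2 * K) + e / (2 * K)" using N[OF mn(1)] N[OF mn(2)] by simp
      also have "\<dots> = e / K" by simp
      finally have "K * H1_norm \<Omega> (\<lambda>x. u m x - u n x) < e" using K by (simp add: field_simps)
      moreover have "L2_norm ?M ?S (\<lambda>x. g m x - g n x) \<le> K * H1_norm \<Omega> (\<lambda>x. u m x - u n x)"
        by (rule bound[OF has_trace_diff[OF open_\<Omega> t t]])
      ultimately show ?thesis by linarith
    qed
    then show "\<exists>N. \<forall>m\<ge>N. \<forall>n\<ge>N. L2_norm ?M ?S (\<lambda>x. g m x - g n x) < e" by blast
  qed
  then obtain h where h: "h \<in> L2_space ?M ?S" "(\<lambda>n. L2_norm ?M ?S (\<lambda>x. g n x - h x)) \<longlonglongrightarrow> 0" by blast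
  from has_trace_closed[OF open_\<Omega> t v h] h show ?thesis by blast
qed

text \<open>The defect \<open>?z\<close> of the phase relation in the limit is controlled by the
  distances of the two limit traces from those of \<open>u n\<close>, for which the relation holds
  almost everywhere; hence its norm is zero.\<close>

lemma quasiperiodic_closed:
  assumes T: "T \<subseteq> ball P (r / 3)" and u: "\<And>n::nat. u n \<in> quasiperiodic T \<eta>"
    and v: "v \<in> H1 \<Omega>" "(\<lambda>n. H1_norm \<Omega> (\<lambda>x. u n x - v x)) \<longlonglongrightarrow> 0"
  shows "v \<in> quasiperiodic T \<eta>"
proof -
  let ?e = "exp (- \<i> * of_real \<eta>)"
  have "\<forall>n. \<exists>g. has_trace \<Omega> (area_x1 0) (at_x1 0 ` T) (u n) (fst g) \<and> has_trace \<Omega> (area_x1 1) (at_x1 1 ` T) (u n) (snd g) \<and>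
     (AE y\<in>T in lborel. fst g (at_x1 0 y) = ?e * snd g (at_x1 1 y))"
  proof
    fix n
    from u[of n] obtain g0 g1 where "has_trace \<Omega> (area_x1 0) (at_x1 0 ` T) (u n) g0"
      "has_trace \<Omega> (area_x1 1) (at_x1 1 ` T) (u n) g1" "AE y\<in>T in lborel. g0 (at_x1 0 y) = ?e * g1 (at_x1 1 y)"
      unfolding quasiperiodic_iff by (elim exE conjE)
    then show "\<exists>g. has_trace \<Omega> (area_x1 0) (at_x1 0 ` T) (u n) (fst g) \<and> has_trace \<Omega> (area_x1 1) (at_x1 1 ` T) (u n) (snd g) \<and>
       (AE y\<in>T in lborel. fst g (at_x1 0 y) = ?e * snd g (at_x1 1 y))"
      by (intro exI[of _ "(g0, g1)"]) simp
  qed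
  from choice[OF this] obtain g where g: "\<And>n. has_trace \<Omega> (area_x1 0) (at_x1 0 ` T) (u n) (fst (g n))"
    "\<And>n. has_trace \<Omega> (area_x1 1) (at_x1 1 ` T) (u n) (snd (g n))"
    "\<And>n. AE y\<in>T in lborel. fst (g n) (at_x1 0 y) = ?e * snd (g n) (at_x1 1 y)" by blast
  obtain h0 where h0: "has_trace \<Omega> (area_x1 0) (at_x1 0 ` T) v h0" "(\<lambda>n. L2_norm (area_x1 0) (at_x1 0 ` T) (\<lambda>x. fst (g n) x - h0 x)) \<longlonglongrightarrow> 0"
    using trace_limit[OF N0.half_ball_axioms T g(1) v] by blast
  obtain h1 where h1: "has_trace \<Omega> (area_x1 1) (at_x1 1 ` T) v h1" "(\<lambda>n. L2_norm (area_x1 1) (at_x1 1 ` T) (\<lambda>x. snd (g n) x - h1 x)) \<longlonglongrightarrow> 0"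
    using trace_limit[OF N1.half_ball_axioms T g(2) v] by blast
  let ?z = "\<lambda>y. h0 (at_x1 0 y) - ?e * h1 (at_x1 1 y)"
  note L0 = has_traceD(2)[OF h0(1)] and L1 = has_traceD(2)[OF h1(1)]
  note Lg0 = has_traceD(2)[OF g(1)] and Lg1 = has_traceD(2)[OF g(2)]
  note d0 = L2_area_x1[OF L2_diff[OF Lg0 L0]] and d1 = L2_area_x1[OF L2_diff[OF Lg1 L1]]
  have zL: "?z \<in> L2_space lborel T"
    by (rule L2_diff[OF L2_area_x1(1)[OF L0] L2_cmult[OF L2_area_x1(1)[OF L1]]])
  have le: "L2_norm lborel T ?z \<le> L2_norm (area_x1 0) (at_x1 0 ` T) (\<lambda>x. fst (g n) x - h0 x) +
      cmod ?e * L2_norm (area_x1 1) (at_x1 1 ` T) (\<lambda>x. snd (g n) x - h1 x)" for n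
  proof -
    let ?a = "\<lambda>y. fst (g n) (at_x1 0 y) - h0 (at_x1 0 y)" and ?b = "\<lambda>y. ?e * (snd (g n) (at_x1 1 y) - h1 (at_x1 1 y))"
    have bL: "?b \<in> L2_space lborel T" by (rule L2_cmult[OF d1(1)])
    have aL: "(\<lambda>y. (- 1) * ?a y) \<in> L2_space lborel T" by (rule L2_cmult[OF d0(1)])
    have "L2_norm lborel T ?z = L2_norm lborel T (\<lambda>y. (- 1) * ?a y + ?b y)"
    proof (rule L2_norm_cong_AE[OF zL L2_add[OF aL bL]])
      show "AE y\<in>T in lborel. ?z y = (- 1) * ?a y + ?b y"
        using g(3)[of n] by eventually_elim (simp add: algebra_simps)
    qed
    also have "\<dots> \<le> L2_norm lborel T (\<lambda>y. (- 1) * ?a y) + L2_norm lborel T ?b" by (rule L2_triangle[OF aL bL])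
    also have "\<dots> = L2_norm lborel T ?a + cmod ?e * L2_norm lborel T (\<lambda>y. snd (g n) (at_x1 1 y) - h1 (at_x1 1 y))"
      unfolding L2_norm_cmult by simp
    finally show ?thesis unfolding d0(2) d1(2) .
  qed
  have "(\<lambda>n. L2_norm (area_x1 0) (at_x1 0 ` T) (\<lambda>x. fst (g n) x - h0 x) +
      cmod ?e * L2_norm (area_x1 1) (at_x1 1 ` T) (\<lambda>x. snd (g n) x - h1 x)) \<longlonglongrightarrow> 0 + cmod ?e * 0"
    by (intro tendsto_intros h0 h1)
  then have "L2_norm lborel T ?z \<le> 0 + cmod ?e * 0" by (rule LIMSEQ_le_const) (use le in blast)
  then have "L2_norm lborel T ?z = 0" by (intro antisym) simp_all
  from L2_norm_zero_AE[OF zL this] have "AE y\<in>T in lborel. h0 (at_x1 0 y) = ?e * h1 (at_x1 1 y)" by simp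
  with h0 h1 show ?thesis unfolding quasiperiodic_iff by blast
qed

end

section \<open>Monotonicity in the space and independent boundary values\<close>

lemma hyperplane_null_sets: "{y::real^'n::finite. y $ k = t} \<in> null_sets lborel"
proof -
  have "closed {y::real^'n. y $ k = t}" by (intro closed_Collect_eq continuous_intros)
  then have b: "{y::real^'n. y $ k = t} \<in> sets lborel" by simp
  have "{y::real^'n. y $ k = t} \<in> null_sets lebesgue"
    using negligible_standard_hyperplane[of "axis k (1::real)" t] axis_in_Basis_iff[of k "1::real"]
    by (simp add: negligible_iff_null_sets inner_axis)
  then show ?thesis using b by (simp add: null_sets_def)
qed

lemma norm_at_x3_zero: "norm (at_x3 0 y) = norm y"
  by (simp add: norm_vec_def L2_set_def sum_3 sum_2)

context steklov
begin

lemma bform_cong: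
  assumes "has_trace \<Omega> M S u f" "has_trace \<Omega> M S v g" "has_trace \<Omega> M S w h" "\<And>x. x \<in> S \<Longrightarrow> g x = h x"
  shows "bform u v = bform u w"
  unfolding bform_eq[OF assms(1,2)] bform_eq[OF assms(1,3)] L2_inner_def
    set_lebesgue_integral_def
  using assms(4) by (intro Bochner_Integration.integral_cong) (auto simp: indicator_def)

text \<open>Eigenvectors of the smaller space are trial vectors in the larger one, and on the span
  of the first of them up to index \<open>k - 1\<close> the Rayleigh quotient does not exceed the
  last eigenvalue involved.\<close>

lemma kth_eigenvalue_antimono:
  assumes "steklov_subspace \<Omega> M S V" "steklov_subspace \<Omega> M S W" "W \<subseteq> V"
  shows "kth_eigenvalue \<Omega> M S V k \<le> kth_eigenvalue \<Omega> M S W k"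
proof -
  interpret V: steklov_subspace \<Omega> M S V by (rule assms(1))
  interpret W: steklov_subspace \<Omega> M S W by (rule assms(2))
  obtain E L where V: "V.spectral_basis E L" using V.spectral_basis_exists by blast
  obtain e \<Lambda> where W: "W.spectral_basis e \<Lambda>" using W.spectral_basis_exists by blast
  note q = W.q_lincomb[OF W finite_lessThan]
  let ?n = "k - 1"
  have "L ?n \<le> \<Lambda> ?n"
  proof (rule V.lambda_le_max[OF V, where w = e])
    show "e i \<in> V" for i using W.e_in_W[OF W] assms(3) by blast
    fix c :: "nat \<Rightarrow> complex"
    show "Re (bform (\<Sum>i<Suc ?n. cscale (c i) (e i)) (\<Sum>i<Suc ?n. cscale (c i) (e i))) > 0" if "\<exists>i<Suc ?n. c i \<noteq> 0"
    proof -
      from that obtain i where "i < Suc ?n" "c i \<noteq> 0" by blast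
      then have "0 < (\<Sum>i<Suc ?n. (cmod (c i))\<^sup>2)" by (intro sum_pos2[of _ i]) auto
      then show ?thesis unfolding q .
    qed
    have "(\<Sum>i<Suc ?n. \<Lambda> i * (cmod (c i))\<^sup>2) \<le> (\<Sum>i<Suc ?n. \<Lambda> ?n * (cmod (c i))\<^sup>2)"
      using monoD[OF W.lambda_mono[OF W]] by (intro sum_mono mult_right_mono) auto
    then show "Re (grad_inner \<Omega> (\<Sum>i<Suc ?n. cscale (c i) (e i)) (\<Sum>i<Suc ?n. cscale (c i) (e i))) \<le>
      \<Lambda> ?n * Re (bform (\<Sum>i<Suc ?n. cscale (c i) (e i)) (\<Sum>i<Suc ?n. cscale (c i) (e i)))"
      unfolding q by (simp only: sum_distrib_left)
  qed
  then show ?thesis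
    unfolding V.kth_eigenvalue_spectral_basis[OF V] W.kth_eigenvalue_spectral_basis[OF W] .
qed

end

context punctured_cell
begin

lemma S_finite: "emeasure area_x3 S < \<infinity>"
proof -
  obtain B where "\<And>x. x \<in> S \<Longrightarrow> norm x \<le> B" using S_bounded by (auto simp: bounded_iff)
  then have "bounded (at_x3 0 -` S)" by (auto simp: bounded_iff norm_at_x3_zero[symmetric])
  from emeasure_bounded_finite[OF this] show ?thesis
    by (simp add: area_x3_def emeasure_distr S_sets)
qed

lemma trace_power: "has_trace \<Omega> area_x3 S (\<lambda>x. of_real (x $ 1) ^ i) (\<lambda>x. of_real (x $ 1) ^ i)"
proof (induction i)
  case 0
  have e: "(cmod (indicator S x *\<^sub>R 1))\<^sup>2 = indicator S x" for x by (simp add: indicator_def)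
  have i: "integrable area_x3 (indicator S :: real^3 \<Rightarrow> real)"
    by (rule integrable_real_indicator[OF S_in_sets S_finite])
  have "(\<lambda>x. indicator S x *\<^sub>R (1::complex)) \<in> borel_measurable area_x3"
    by (rule borel_measurable_scaleR) (use S_in_sets in simp_all)
  then have "(\<lambda>x. 1) \<in> L2_space area_x3 S" unfolding L2_space_iff e using i by blast
  then show ?case using has_trace_continuous[OF open_\<Omega> const_H1[OF open_\<Omega> N0.bounded_\<Omega>]] by simp
next
  case (Suc i)
  have "bounded (\<Omega> \<union> S)" using N0.bounded_\<Omega> S_bounded by simp
  then obtain B where B: "\<And>x. x \<in> \<Omega> \<union> S \<Longrightarrow> norm x \<le> B" unfolding bounded_iff by blast
  let ?C = "\<bar>B\<bar> + 1"
  have "has_trace \<Omega> area_x3 S (\<lambda>x. of_real (x $ 1) * of_real (x $ 1) ^ i) (\<lambda>x. of_real (x $ 1) * of_real (x $ 1) ^ i)"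
  proof (rule has_trace_mult[OF open_\<Omega> Suc.IH S_in_sets area_sets has_grad_coord])
    show "\<bar>x $ 1\<bar> \<le> ?C" if "x \<in> \<Omega> \<union> S" for x
      using B[OF that] component_le_norm_cart[of x 1] by linarith
  qed auto
  then show ?case by simp
qed

text \<open>On \<open>S\<close> the factor \<open>plug a\<close> is one, so a combination with
  vanishing boundary form is a polynomial in \<open>x $ 1\<close> that vanishes almost everywhere on
  \<open>S\<close>. Its finitely many roots would confine \<open>S\<close>, up to a null set, to
  finitely many lines of the plane \<open>x $ 3 = 0\<close>, contradicting the positive
  area.\<close>

lemma plugged_powers_independent:
  assumes a: "0 < a" "2 * a \<le> r" and c: "\<exists>i<n. c i \<noteq> 0"
  defines "U \<equiv> \<Sum>i<n. cscale (c i) (\<lambda>x. of_real (plug a x) * of_real (x $ 1) ^ i)"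
  shows "Re (bform U U) > 0"
proof (rule ccontr)
  define g :: "real^3 \<Rightarrow> complex" where "g = (\<Sum>i<n. cscale (c i) (\<lambda>x. of_real (plug a x) * of_real (x $ 1) ^ i))"
  have t: "has_trace \<Omega> area_x3 S U g"
    unfolding U_def g_def by (rule has_trace_sum[OF open_\<Omega> trace_plug[OF trace_power a(1)]])
  assume "\<not> 0 < Re (bform U U)"
  then have "(L2_norm area_x3 S g)\<^sup>2 \<le> 0" using bform_self[OF t] by simp
  then have "L2_norm area_x3 S g = 0" by simp
  from L2_norm_zero_AE[OF has_traceD(2)[OF t] this] have ae: "AE x\<in>S in area_x3. g x = 0" .
  obtain m where m: "n = Suc m" using c by (cases n) auto
  define F where "F = {t::real. (\<Sum>i\<le>m. c i * of_real t ^ i) = 0}"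
  have "finite {z. (\<Sum>i\<le>m. c i * z ^ i) = 0}"
    using polyfun_finite_roots[of c m] c by (auto simp: m less_Suc_eq_le)
  from finite_vimageI[OF this, of complex_of_real] have F: "finite F"
    by (simp add: F_def vimage_def inj_on_def)
  have "x $ 1 \<in> F" if "x \<in> S" "g x = 0" for x
    using that plug_on_S[OF a that(1)] by (simp add: g_def F_def sum_fun_apply m lessThan_Suc_atMost)
  then have ae': "AE x in area_x3. x \<in> S \<longrightarrow> x $ 1 \<in> F" using ae by auto
  have "(\<Union>t\<in>F. {y::real^2. y $ 1 = t}) \<in> null_sets lborel"
    using F hyperplane_null_sets by (intro null_sets_UN' countable_finite) auto
  then have "AE y in lborel. y \<notin> (\<Union>t\<in>F. {y::real^2. y $ 1 = t})" by (rule AE_not_in)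
  then have "AE y in lborel. at_x3 0 y $ 1 \<notin> F" by simp
  moreover have "{x::real^3. x $ 1 \<notin> F} \<in> sets borel"
  proof -
    have "closed ((\<lambda>x::real^3. x $ 1) -` F)"
      by (intro closed_vimage finite_imp_closed F continuous_intros)
    then have "- ((\<lambda>x::real^3. x $ 1) -` F) \<in> sets borel" by (intro borel_comp) simp
    then show ?thesis by (simp add: vimage_def Compl_eq)
  qed
  ultimately have "AE x in area_x3. x $ 1 \<notin> F"
    unfolding area_x3_def by (subst AE_distr_iff) auto
  then have "AE x in area_x3. x \<notin> S" using ae' by eventually_elim auto
  then have "emeasure area_x3 S = 0" using S_in_sets by (subst (asm) AE_iff_measurable[of S]) (auto simp: area_x3_def)
  then show False using S_positive by simp
qed

lemma quasiperiodic_subspace: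
  assumes a: "0 < a" "a \<le> r / 3" and T: "T \<subseteq> ball P a"
  shows "steklov_subspace \<Omega> area_x3 S (quasiperiodic T \<eta>)"
proof unfold_locales
  have T3: "T \<subseteq> ball P (r / 3)" using T a(2) by (auto simp: subset_iff)
  show "u \<in> quasiperiodic T \<eta> \<Longrightarrow> u \<in> H1 \<Omega>" for u by (simp add: quasiperiodic_def)
  show "v \<in> quasiperiodic T \<eta>" if "\<And>n::nat. u n \<in> quasiperiodic T \<eta>" "v \<in> H1 \<Omega>"
    "(\<lambda>n. H1_norm \<Omega> (\<lambda>x. u n x - v x)) \<longlonglongrightarrow> 0" for u v
    by (rule quasiperiodic_closed[OF T3 that])
  show "\<exists>w. (\<forall>i<n. w i \<in> quasiperiodic T \<eta>) \<and> (\<forall>c. (\<exists>i<n. c i \<noteq> 0) \<longrightarrow>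
     Re (bform (\<Sum>i<n. cscale (c i) (w i)) (\<Sum>i<n. cscale (c i) (w i))) > 0)" for n :: nat
    using plug_quasiperiodic[OF trace_power a(1) T] plugged_powers_independent[of a n] a
    by (intro exI[of _ "\<lambda>i x. of_real (plug a x) * of_real (x $ 1) ^ i"]) auto
qed (rule quasiperiodic_ops; assumption)+

text \<open>Independent boundary values are inherited from the quasi-periodic space with empty
  aperture.\<close>

lemma H1_subspace: "steklov_subspace \<Omega> area_x3 S (H1 \<Omega>)"
proof -
  interpret Q: steklov_subspace \<Omega> area_x3 S "quasiperiodic {} 0"
    by (rule quasiperiodic_subspace[of "r / 3"]) (use N0.r_pos in auto)
  show ?thesis
  proof unfold_locales
    show "(\<lambda>x. 0) \<in> H1 \<Omega>" by (rule Q.W_H1[OF Q.zero_in_W])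
    show "\<exists>w. (\<forall>i<n. w i \<in> H1 \<Omega>) \<and> (\<forall>c. (\<exists>i<n. c i \<noteq> 0) \<longrightarrow>
       Re (bform (\<Sum>i<n. cscale (c i) (w i)) (\<Sum>i<n. cscale (c i) (w i))) > 0)" for n :: nat
      using Q.W_rank[of n] Q.W_H1 by blast
  qed (simp_all add: H1_closed_ops[OF open_\<Omega>])
qed

end

section \<open>The upper bound\<close>

text \<open>Applied with \<open>g\<close> a derivative of \<open>U\<close> and \<open>w\<close> the
  product of \<open>U\<close> with the same derivative of \<open>X\<close>: then
  \<open>X * (X * g + 2 * w)\<close> is the derivative of \<open>X\<^sup>2 * U\<close>, which
  absorbs the mixed terms of the square.\<close>

lemma L2_norm_real_mult_add:
  fixes X :: "'a \<Rightarrow> real"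
  assumes g: "(\<lambda>x. of_real (X x) * g x) \<in> L2_space M A" and w: "w \<in> L2_space M A"
  shows "(L2_norm M A (\<lambda>x. of_real (X x) * g x + w x))\<^sup>2 =
    Re (L2_inner M A g (\<lambda>x. of_real (X x) * (of_real (X x) * g x + 2 * w x))) + (L2_norm M A w)\<^sup>2"
proof -
  define f where "f = (\<lambda>x. of_real (X x) * g x)"
  have f: "f \<in> L2_space M A" using g by (simp add: f_def)
  have "L2_inner M A g (\<lambda>x. of_real (X x) * (of_real (X x) * g x + 2 * w x)) = L2_inner M A f (f + cscale 2 w)"
    unfolding L2_inner_def f_def by (simp add: mult.assoc mult.left_commute)
  also have "\<dots> = L2_inner M A f f + 2 * L2_inner M A f w"
    using f w by (simp add: L2.F_add2 L2.F_scale2 L2.W_scale)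
  finally have "Re (L2_inner M A g (\<lambda>x. of_real (X x) * (of_real (X x) * g x + 2 * w x))) =
      (L2_norm M A f)\<^sup>2 + 2 * Re (L2_inner M A f w)"
    by (simp add: L2_q)
  moreover have "(L2_norm M A (f + w))\<^sup>2 = (L2_norm M A f)\<^sup>2 + 2 * Re (L2_inner M A f w) + (L2_norm M A w)\<^sup>2"
    using L2.q_add[OF f w] by (simp add: L2_q)
  ultimately show ?thesis by (simp add: f_def plus_fun_def)
qed

lemma weighted_square_bound:
  fixes u :: "real^'n::finite \<Rightarrow> complex"
  assumes \<Omega>: "\<Omega> \<in> sets borel" and u: "u \<in> L2_space lborel \<Omega>" "(\<lambda>x. of_real (Y x) * u x) \<in> L2_space lborel \<Omega>"
    and Y: "\<And>x. (Y x)\<^sup>2 \<le> K * (indicator (cball p d) x + indicator (cball p' d) x)"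
  shows "(L2_norm lborel \<Omega> (\<lambda>x. of_real (Y x) * u x))\<^sup>2 \<le>
    K * ((LINT x:\<Omega>|lborel. (cmod (u x))\<^sup>2 * indicator (cball p d) x) + (LINT x:\<Omega>|lborel. (cmod (u x))\<^sup>2 * indicator (cball p' d) x))"
proof -
  have i: "set_integrable lborel \<Omega> (\<lambda>x. (cmod (u x))\<^sup>2 * indicator (cball q d) x)" for q :: "real^'n"
  proof -
    have "set_integrable lborel \<Omega> (\<lambda>x. (cmod (u x))\<^sup>2)" using u(1) by (simp add: L2_space_def)
    then have "integrable lborel (\<lambda>x. indicator \<Omega> x *\<^sub>R (cmod (u x))\<^sup>2)" unfolding set_integrable_def .
    from integrable_mult_indicator[OF _ this, of "cball q d"]
    have "integrable lborel (\<lambda>x. indicator (cball q d) x *\<^sub>R (indicator \<Omega> x *\<^sub>R (cmod (u x))\<^sup>2))" by simp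
    then show ?thesis unfolding set_integrable_def by (simp add: mult.commute mult.left_commute)
  qed
  let ?I = "\<lambda>q x. (cmod (u x))\<^sup>2 * indicator (cball q d) x :: real"
  have s: "set_integrable lborel \<Omega> (\<lambda>x. ?I p x + ?I p' x)" by (rule set_integral_add(1)[OF i i])
  have "(L2_norm lborel \<Omega> (\<lambda>x. of_real (Y x) * u x))\<^sup>2 \<le> (LINT x:\<Omega>|lborel. K * (?I p x + ?I p' x))"
    unfolding L2_norm_power2
  proof (rule set_integral_mono)
    show "set_integrable lborel \<Omega> (\<lambda>x. (cmod (complex_of_real (Y x) * u x))\<^sup>2)" using u(2) by (simp add: L2_space_def)
    show "set_integrable lborel \<Omega> (\<lambda>x. K * (?I p x + ?I p' x))" using s by simp
    fix x
    have "(cmod (complex_of_real (Y x) * u x))\<^sup>2 = (cmod (u x))\<^sup>2 * (Y x)\<^sup>2" by (simp add: norm_mult power_mult_distrib)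
    also have "\<dots> \<le> (cmod (u x))\<^sup>2 * (K * (indicator (cball p d) x + indicator (cball p' d) x))"
      by (intro mult_left_mono Y) simp
    finally show "(cmod (complex_of_real (Y x) * u x))\<^sup>2 \<le> K * (?I p x + ?I p' x)" by (simp add: algebra_simps)
  qed
  also have "\<dots> = K * ((LINT x:\<Omega>|lborel. ?I p x) + (LINT x:\<Omega>|lborel. ?I p' x))"
    using set_integral_add(2)[OF i i, of p p'] by simp
  finally show ?thesis .
qed

context punctured_cell
begin

lemma energy_plug_mult:
  assumes u: "u \<in> H1 \<Omega>" and a: "0 < a"
  defines "v \<equiv> \<lambda>x. of_real (plug a x) * u x"
  shows "Re (grad_inner \<Omega> v v) = Re (grad_inner \<Omega> u (\<lambda>x. of_real (plug a x * plug a x) * u x)) +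
    (\<Sum>i\<in>UNIV. (L2_norm lborel \<Omega> (\<lambda>x. of_real (plug' a i x) * u x))\<^sup>2)"
    and "(\<lambda>x. of_real (plug' a i x) * u x) \<in> L2_space lborel \<Omega>"
proof -
  let ?X = "plug a" and ?X' = "plug' a" and ?G = "weak_gradient \<Omega> u" and ?C = "1 + 64 / a"
  have "64 / a = 32 / a + 32 / a" "0 < 32 / a" using a by simp_all
  then have b: "\<bar>?X x\<bar> \<le> ?C" "\<bar>?X' i x\<bar> \<le> ?C" for x i
    using plug_bounds(3)[of a x] plug'_bound[OF a, of i x] by linarith+
  have b2: "\<bar>?X x * ?X x\<bar> \<le> ?C" "\<bar>?X x * ?X' i x + ?X' i x * ?X x\<bar> \<le> ?C" for x i
  proof -
    have "\<bar>?X x * ?X x\<bar> \<le> 1" using plug_bounds[of a x] by (simp add: abs_mult mult_le_one)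
    then show "\<bar>?X x * ?X x\<bar> \<le> ?C" using a divide_pos_pos[of 64 a] by linarith
    have "\<bar>?X x * ?X' i x\<bar> \<le> 1 * (32 / a)"
      unfolding abs_mult by (rule mult_mono) (use plug_bounds(3) plug'_bound[OF a] in auto)
    then show "\<bar>?X x * ?X' i x + ?X' i x * ?X x\<bar> \<le> ?C" by (simp add: mult.commute[of "?X' i x"])
  qed
  note gu = H1_weak_gradient[OF u]
  have hg2: "has_grad (\<lambda>x. ?X x * ?X x) (\<lambda>i. ?X x * ?X' i x + ?X' i x * ?X x) x" for x
    by (rule has_grad_mult[OF has_grad_plug has_grad_plug])
  have cX: "continuous_on UNIV ?X"
    using has_grad_plug has_grad_isCont by (blast intro: continuous_at_imp_continuous_on)
  have c2: "continuous_on UNIV (\<lambda>x. ?X x * ?X' i x + ?X' i x * ?X x)" for i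
    by (intro continuous_intros cX continuous_plug')
  note w = weak_gradient_mult[OF open_\<Omega> H1_L2[OF u] gu has_grad_plug continuous_plug' b]
  note w2 = weak_gradient_mult(3)[OF open_\<Omega> H1_L2[OF u] gu hg2 c2 b2]
  show wL: "(\<lambda>x. of_real (?X' i x) * u x) \<in> L2_space lborel \<Omega>" for i by (rule w(2))
  have gL: "(\<lambda>x. ?G x $ i) \<in> L2_space lborel \<Omega>" for i using gu by (simp add: has_weak_gradient_def)
  have XgL: "(\<lambda>x. of_real (?X x) * ?G x $ i) \<in> L2_space lborel \<Omega>" for i
  proof (rule L2_bounded_mult[OF gL, where C = 1])
    show "set_borel_measurable lborel \<Omega> (\<lambda>x. complex_of_real (?X x))"
      unfolding set_borel_measurable_def
      by (intro borel_measurable_scaleR borel_measurable_of_real borel_measurable_indicator)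
        (use open_\<Omega> cX in \<open>auto intro: borel_measurable_continuous_onI\<close>)
  qed (use plug_bounds(3) in auto)
  have "Re (grad_inner \<Omega> v v) = (\<Sum>i\<in>UNIV. (L2_norm lborel \<Omega> (\<lambda>x. of_real (?X x) * ?G x $ i + of_real (?X' i x) * u x))\<^sup>2)"
    unfolding grad_norm_power2[symmetric] v_def grad_norm_eq[OF open_\<Omega> w(3)] by simp
  also have "\<dots> = (\<Sum>i\<in>UNIV. Re (L2_inner lborel \<Omega> (\<lambda>x. ?G x $ i)
      (\<lambda>x. of_real (?X x) * (of_real (?X x) * ?G x $ i + 2 * (of_real (?X' i x) * u x)))) +
      (L2_norm lborel \<Omega> (\<lambda>x. of_real (?X' i x) * u x))\<^sup>2)"
    by (intro sum.cong refl L2_norm_real_mult_add[OF XgL wL])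
  also have "\<dots> = Re (\<Sum>i\<in>UNIV. L2_inner lborel \<Omega> (\<lambda>x. ?G x $ i)
      (\<lambda>x. of_real (?X x) * (of_real (?X x) * ?G x $ i + 2 * (of_real (?X' i x) * u x)))) +
      (\<Sum>i\<in>UNIV. (L2_norm lborel \<Omega> (\<lambda>x. of_real (?X' i x) * u x))\<^sup>2)"
    by (simp add: sum.distrib)
  also have "(\<Sum>i\<in>UNIV. L2_inner lborel \<Omega> (\<lambda>x. ?G x $ i)
      (\<lambda>x. of_real (?X x) * (of_real (?X x) * ?G x $ i + 2 * (of_real (?X' i x) * u x)))) =
      grad_inner \<Omega> u (\<lambda>x. of_real (?X x * ?X x) * u x)"
    unfolding grad_inner_eq[OF open_\<Omega> gu w2]
    by (intro sum.cong refl arg_cong[where f = "L2_inner lborel \<Omega> _"]) (simp add: fun_eq_iff algebra_simps)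
  finally show "Re (grad_inner \<Omega> v v) = Re (grad_inner \<Omega> u (\<lambda>x. of_real (?X x * ?X x) * u x)) +
    (\<Sum>i\<in>UNIV. (L2_norm lborel \<Omega> (\<lambda>x. of_real (?X' i x) * u x))\<^sup>2)" .
qed

text \<open>The hypothesis \<open>det\<close> isolates what a combination of limit eigenfunctions
  inherits from their equations: pairing its gradient with another gradient sees only boundary
  values. It is used with functions supported near an aperture, whose boundary values are zero, and
  with \<open>(plug a)\<^sup>2 * u\<close>, whose boundary values are those of
  \<open>u\<close>.\<close>

lemma plug_energy:
  assumes u: "u \<in> H1 \<Omega>" and a: "0 < a" "a \<le> r / 4"
    and det: "\<And>v w g h. has_trace \<Omega> area_x3 S v g \<Longrightarrow> has_trace \<Omega> area_x3 S w h \<Longrightarrow>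
      (\<And>x. x \<in> S \<Longrightarrow> g x = h x) \<Longrightarrow> grad_inner \<Omega> u v = grad_inner \<Omega> u w"
  defines "v \<equiv> \<lambda>x. of_real (plug a x) * u x"
  shows "Re (grad_inner \<Omega> v v) \<le> Re (grad_inner \<Omega> u u) + 3 * 2 ^ 21 / r ^ 3 * a * (L2_norm lborel \<Omega> u)\<^sup>2"
proof -
  interpret G: hermitian_form cscale "H1 \<Omega>" "grad_inner \<Omega>" by (rule H1_hermitian[OF open_\<Omega>])
  have r: "r > 0" by (rule N0.r_pos)
  have test: "grad_inner \<Omega> u (\<lambda>x. of_real (\<Psi> x) * u x) = 0"
    if j: "j \<in> {0, 1}" and \<Psi>: "\<And>x. has_grad \<Psi> (\<lambda>i. \<Psi>' i x) x" "\<And>i. continuous_on UNIV (\<Psi>' i)"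
      "\<And>x. dist x (at_x1 j P) \<ge> r / 2 \<Longrightarrow> \<Psi> x = 0" for \<Psi> \<Psi>' j
  proof -
    obtain C where C: "C \<ge> 0" "\<And>x. \<bar>\<Psi> x\<bar> \<le> C" "\<And>i x. \<bar>\<Psi>' i x\<bar> \<le> C"
      using C1_compact_support_bound[where p = "at_x1 j P" and d = "r / 2", OF \<Psi>] by blast
    have "grad_inner \<Omega> u (\<lambda>x. of_real (\<Psi> x) * u x) = grad_inner \<Omega> u (\<lambda>x. 0)"
    proof (rule det[OF has_trace_mult[OF open_\<Omega> trace_tr[OF u] S_in_sets area_sets \<Psi>(1,2) C(2,3,1)] has_trace_zero[OF open_\<Omega>]])
      fix x assume "x \<in> S"
      from S_far[OF this j] have "\<Psi> x = 0" using r by (intro \<Psi>(3)) simp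
      then show "complex_of_real (\<Psi> x) * tr u x = 0" by simp
    qed
    then show ?thesis using G.F_zero2[OF u] by (simp add: zero_fun_def)
  qed
  have d: "0 < 2 * a" "2 * a \<le> r / 2" using a by auto
  let ?m = "(L2_norm lborel \<Omega> u)\<^sup>2"
  \<comment> \<open>The mean value bound is taken at radius \<open>2 * a\<close>, so that
    \<open>16 * 8 * 8 = 1024\<close>; the condition \<open>a \<le> r / 4\<close> puts this radius
    below \<open>r / 2\<close>.\<close>
  have e: "16 * (2 * a) ^ 3 / (r / 2) ^ 3 = 1024 * a ^ 3 / r ^ 3" by (simp add: power_divide power_mult_distrib)
  have m: "(LINT x:\<Omega>|lborel. (cmod (u x))\<^sup>2 * indicator (cball (at_x1 0 P) (2 * a)) x) \<le> 1024 * a ^ 3 / r ^ 3 * ?m"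
    "(LINT x:\<Omega>|lborel. (cmod (u x))\<^sup>2 * indicator (cball (at_x1 1 P) (2 * a)) x) \<le> 1024 * a ^ 3 / r ^ 3 * ?m"
    using N0.mean_square_near_boundary_point[OF u test[OF insertI1] d]
      N1.mean_square_near_boundary_point[OF u test[OF insertI2[OF singletonI]] d]
    unfolding e by fast+
  have "(L2_norm lborel \<Omega> (\<lambda>x. of_real (plug' a i x) * u x))\<^sup>2 \<le> 2 ^ 21 / r ^ 3 * a * ?m" for i
  proof -
    have "(L2_norm lborel \<Omega> (\<lambda>x. of_real (plug' a i x) * u x))\<^sup>2 \<le> 1024 / a\<^sup>2 *
      ((LINT x:\<Omega>|lborel. (cmod (u x))\<^sup>2 * indicator (cball (at_x1 0 P) (2 * a)) x) +
       (LINT x:\<Omega>|lborel. (cmod (u x))\<^sup>2 * indicator (cball (at_x1 1 P) (2 * a)) x))"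
      by (rule weighted_square_bound[OF _ H1_L2[OF u] energy_plug_mult(2)[OF u a(1)] plug'_square_le[OF a(1)]])
        (use open_\<Omega> in simp)
    \<comment> \<open>The factor 1024 from \<open>(32 / a)\<^sup>2\<close>, the two balls and the
      mean value constant combine to \<open>1024 * 2 * 1024 = 2 ^ 21\<close>, and the cube over the
      square leaves one power of \<open>a\<close>. Summation over three components adds the factor
      3.\<close>
    also have "\<dots> \<le> 1024 / a\<^sup>2 * (1024 * a ^ 3 / r ^ 3 * ?m + 1024 * a ^ 3 / r ^ 3 * ?m)"
      by (intro mult_left_mono add_mono m) simp
    also have "\<dots> = 2 ^ 21 / r ^ 3 * a * ?m"
      using a(1) r by (simp add: field_simps power2_eq_square power3_eq_cube)
    finally show ?thesis .
  qed
  then have s: "(\<Sum>i\<in>(UNIV::3 set). (L2_norm lborel \<Omega> (\<lambda>x. of_real (plug' a i x) * u x))\<^sup>2) \<le> 3 * 2 ^ 21 / r ^ 3 * a * ?m"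
    using sum_bounded_above[of "UNIV::3 set" "\<lambda>i. (L2_norm lborel \<Omega> (\<lambda>x. of_real (plug' a i x) * u x))\<^sup>2" "2 ^ 21 / r ^ 3 * a * ?m"]
    by simp
  have X2: "has_trace \<Omega> area_x3 S (\<lambda>x. of_real (plug a x * plug a x) * u x) (\<lambda>x. of_real (plug a x) * (of_real (plug a x) * tr u x))"
    using trace_plug[OF trace_plug[OF trace_tr[OF u] a(1)] a(1)] by (simp add: mult.assoc)
  have "grad_inner \<Omega> u (\<lambda>x. of_real (plug a x * plug a x) * u x) = grad_inner \<Omega> u u"
    by (rule det[OF X2 trace_tr[OF u]]) (use plug_on_S[OF a(1)] a in simp)
  then show ?thesis using energy_plug_mult(1)[OF u a(1)] s unfolding v_def by simp
qed

text \<open>The trial vectors are limit eigenfunctions times \<open>plug a\<close>. Their boundary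
  values are unchanged, so they stay orthonormal for the boundary form and only the energy grows;
  the constant is fixed before \<open>a\<close>, \<open>T\<close> and \<open>\<eta>\<close>.\<close>

theorem quasiperiodic_eigenvalue_bound:
  "\<exists>C>0. \<forall>a T \<eta>. 0 < a \<longrightarrow> a \<le> r / 4 \<longrightarrow> T \<subseteq> ball P a \<longrightarrow>
     kth_eigenvalue \<Omega> area_x3 S (quasiperiodic T \<eta>) k \<le> kth_eigenvalue \<Omega> area_x3 S (H1 \<Omega>) k + C * a"
proof -
  interpret H: steklov_subspace \<Omega> area_x3 S "H1 \<Omega>" by (rule H1_subspace)
  obtain E L where H: "H.spectral_basis E L" using H.spectral_basis_exists by blast
  note E = H.e_in_W[OF H]
  obtain c\<^sub>0 where c0: "c\<^sub>0 > 0"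
    "\<And>u. u \<in> H1 \<Omega> \<Longrightarrow> c\<^sub>0 * (H1_norm \<Omega> u)\<^sup>2 \<le> Re (grad_inner \<Omega> u u) + Re (bform u u)"
    using energy_bounds by metis
  have r: "r > 0" by (rule N0.r_pos)
  let ?n = "k - 1"
  \<comment> \<open>Coercivity of energy plus boundary form bounds the squared L2 norm of a
    combination with squared boundary norm \<open>s c\<close> by
    \<open>(L ?n + 1) / c\<^sub>0 * s c\<close>; the other factor is the constant of
    \<open>plug_energy\<close>.\<close>
  define C where "C = 3 * 2 ^ 21 / r ^ 3 * ((L ?n + 1) / c\<^sub>0)"
  have Lp: "L ?n \<ge> 0" by (rule H.lambda_nonneg[OF H])
  have C: "C > 0" unfolding C_def using r c0(1) Lp by (intro mult_pos_pos divide_pos_pos) auto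
  have "kth_eigenvalue \<Omega> area_x3 S (quasiperiodic T \<eta>) k \<le> L ?n + C * a"
    if a: "0 < a" "a \<le> r / 4" and T: "T \<subseteq> ball P a" for a T \<eta>
  proof -
    interpret Q: steklov_subspace \<Omega> area_x3 S "quasiperiodic T \<eta>"
      by (rule quasiperiodic_subspace[OF a(1) _ T]) (use a r in simp)
    obtain e \<Lambda> where Q: "Q.spectral_basis e \<Lambda>" using Q.spectral_basis_exists by blast
    let ?w = "\<lambda>i x. of_real (plug a x) * E i x"
    define U where "U c = (\<Sum>i<Suc ?n. cscale (c i) (E i))" for c
    define s where "s c = (\<Sum>i<Suc ?n. (cmod (c i))\<^sup>2)" for c :: "nat \<Rightarrow> complex"
    have UH: "U c \<in> H1 \<Omega>" for c unfolding U_def by (intro H.A.W_sum H.A.W_scale E)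
    have W: "(\<Sum>i<Suc ?n. cscale (c i) (?w i)) = (\<lambda>x. of_real (plug a x) * U c x)" for c
      unfolding fun_eq_iff U_def sum_fun_apply cscale_apply sum_distrib_left by (intro allI sum.cong) simp_all
    have BU: "Re (bform (U c) (U c)) = s c" for c
      unfolding U_def s_def by (rule H.q_lincomb(1)[OF H finite_lessThan])
    have AU: "Re (grad_inner \<Omega> (U c) (U c)) \<le> L ?n * s c" for c
    proof -
      have "Re (grad_inner \<Omega> (U c) (U c)) = (\<Sum>i<Suc ?n. L i * (cmod (c i))\<^sup>2)"
        unfolding U_def by (rule H.q_lincomb(2)[OF H finite_lessThan])
      also have "\<dots> \<le> (\<Sum>i<Suc ?n. L ?n * (cmod (c i))\<^sup>2)"
        using monoD[OF H.lambda_mono[OF H]] by (intro sum_mono mult_right_mono) auto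
      finally show ?thesis unfolding s_def sum_distrib_left .
    qed
    have BW: "Re (bform (\<lambda>x. of_real (plug a x) * U c x) (\<lambda>x. of_real (plug a x) * U c x)) = s c" for c
    proof -
      note t = trace_tr[OF UH[of c]]
      have "L2_norm area_x3 S (\<lambda>x. of_real (plug a x) * tr (U c) x) = L2_norm area_x3 S (tr (U c))"
        by (rule L2_norm_cong_AE[OF has_traceD(2)[OF trace_plug[OF t a(1)]] has_traceD(2)[OF t]])
          (use plug_on_S[OF a(1)] a r in auto)
      then show ?thesis unfolding bform_self[OF trace_plug[OF t a(1)]] BU[symmetric] bform_self[OF t] by simp
    qed
    have AW: "Re (grad_inner \<Omega> (\<lambda>x. of_real (plug a x) * U c x) (\<lambda>x. of_real (plug a x) * U c x)) \<le> (L ?n + C * a) * s c" for c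
    proof -
      have "Re (grad_inner \<Omega> (\<lambda>x. of_real (plug a x) * U c x) (\<lambda>x. of_real (plug a x) * U c x)) \<le>
        Re (grad_inner \<Omega> (U c) (U c)) + 3 * 2 ^ 21 / r ^ 3 * a * (L2_norm lborel \<Omega> (U c))\<^sup>2"
      proof (rule plug_energy[OF UH a])
        fix v w g h assume t: "has_trace \<Omega> area_x3 S v g" "has_trace \<Omega> area_x3 S w h" "\<And>x. x \<in> S \<Longrightarrow> g x = h x"
        \<comment> \<open>By the eigenvalue equations the energy pairing with \<open>U c\<close> is
          a combination of boundary pairings, which depend on the traces on \<open>S\<close>
          alone.\<close>
        have "grad_inner \<Omega> (U c) z = (\<Sum>i<Suc ?n. c i * (of_real (L i) * bform (E i) z))" if "z \<in> H1 \<Omega>" for z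
          unfolding U_def using that E H.e_eigen[OF H that]
          by (subst H.A.F_sum) (auto simp: H.A.F_scale H.A.W_scale)
        moreover have "bform (E i) v = bform (E i) w" for i
          by (rule bform_cong[OF trace_tr[OF E] t])
        ultimately show "grad_inner \<Omega> (U c) v = grad_inner \<Omega> (U c) w"
          using has_traceD(1)[OF t(1)] has_traceD(1)[OF t(2)] by simp
      qed
      also have "\<dots> \<le> L ?n * s c + 3 * 2 ^ 21 / r ^ 3 * a * ((L ?n + 1) / c\<^sub>0 * s c)"
      proof (intro add_mono AU mult_left_mono)
        have "c\<^sub>0 * (L2_norm lborel \<Omega> (U c))\<^sup>2 \<le> c\<^sub>0 * (H1_norm \<Omega> (U c))\<^sup>2"
          using c0(1) L2_norm_le_H1_norm[of \<Omega> "U c"] by (intro mult_left_mono power_mono) auto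
        also have "\<dots> \<le> (L ?n + 1) * s c"
          using c0(2)[OF UH[of c]] AU[of c] BU[of c] by (simp add: distrib_right)
        finally show "(L2_norm lborel \<Omega> (U c))\<^sup>2 \<le> (L ?n + 1) / c\<^sub>0 * s c"
          using c0(1) by (simp add: field_simps)
        show "0 \<le> 3 * 2 ^ 21 / r ^ 3 * a" using r a by simp
      qed
      also have "\<dots> = (L ?n + C * a) * s c" by (simp add: C_def algebra_simps)
      finally show ?thesis .
    qed
    have "\<Lambda> ?n \<le> L ?n + C * a"
    proof (rule Q.lambda_le_max[OF Q, where w = ?w])
      show "?w i \<in> quasiperiodic T \<eta>" for i by (rule plug_quasiperiodic[OF trace_tr[OF E] a(1) T])
      fix c :: "nat \<Rightarrow> complex"
      show "Re (bform (\<Sum>i<Suc ?n. cscale (c i) (?w i)) (\<Sum>i<Suc ?n. cscale (c i) (?w i))) > 0" if c: "\<exists>i<Suc ?n. c i \<noteq> 0"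
      proof -
        from c obtain i where "i < Suc ?n" "c i \<noteq> 0" by blast
        then have "0 < s c" unfolding s_def by (intro sum_pos2[of _ i]) auto
        then show ?thesis unfolding W BW .
      qed
      show "Re (grad_inner \<Omega> (\<Sum>i<Suc ?n. cscale (c i) (?w i)) (\<Sum>i<Suc ?n. cscale (c i) (?w i))) \<le>
        (L ?n + C * a) * Re (bform (\<Sum>i<Suc ?n. cscale (c i) (?w i)) (\<Sum>i<Suc ?n. cscale (c i) (?w i)))"
        unfolding W BW by (rule AW)
    qed
    then show ?thesis unfolding Q.kth_eigenvalue_spectral_basis[OF Q] .
  qed
  then show ?thesis unfolding H.kth_eigenvalue_spectral_basis[OF H] using C by blast
qed

end

section \<open>The geometry of the cell\<close>

lemma (in cell_geometry) punctured_cell_exists: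
  assumes "trace_properties (cell D) area_x3 (free_surface D)"
  obtains r where "punctured_cell (cell D) (free_surface D) P r"
proof -
  have P: "at_x1 j P \<in> at_x1 j ` ((\<lambda>y. y + P) ` closure \<theta>)" for j
    using subsetD[OF closure_subset domain_\<theta>(3)] by (auto intro!: image_eqI[of _ _ 0] imageI)
  obtain N0 where N0: "open N0" "at_x1 0 ` ((\<lambda>y. y + P) ` closure \<theta>) \<subseteq> N0" "N0 \<inter> {x. x $ 1 > 0} \<subseteq> cell D"
    using neighbourhood_0 by (elim exE conjE)
  obtain N1 where N1: "open N1" "at_x1 1 ` ((\<lambda>y. y + P) ` closure \<theta>) \<subseteq> N1" "N1 \<inter> {x. x $ 1 < 1} \<subseteq> cell D"
    using neighbourhood_1 by (elim exE conjE)
  obtain r0 where r0: "r0 > 0" "ball (at_x1 0 P) r0 \<subseteq> N0" using openE[OF N0(1) subsetD[OF N0(2) P]] by metis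
  obtain r1 where r1: "r1 > 0" "ball (at_x1 1 P) r1 \<subseteq> N1" using openE[OF N1(1) subsetD[OF N1(2) P]] by metis
  \<comment> \<open>Both centres have distance \<open>- P $ 2\<close> from the plane of the free
    surface, which secures the separation from \<open>S\<close>; the other two radii come from the
    flat neighbourhoods.\<close>
  define r where "r = min (min r0 r1) (- P $ 2)"
  have r: "r > 0" "r \<le> r0" "r \<le> r1" "r \<le> - P $ 2" using r0 r1 P3_neg by (auto simp: r_def)
  interpret trace_properties "cell D" area_x3 "free_surface D" by (rule assms)
  show thesis
  proof (rule that, unfold_locales)
    show "open (cell D)" "bounded (cell D)" using domain_cell by (auto simp: domain_def)
    \<comment> \<open>One direction is part of the definition of the cell, the other is the
      inclusion of the half neighbourhood in it.\<close>
    show "x \<in> cell D \<longleftrightarrow> 1 * (x $ 1 - at_x1 0 P $ 1) > 0" if "dist x (at_x1 0 P) < r" for x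
      using that r(2) r0(2) N0(3) by (auto simp: cell_def dist_commute subset_iff)
    show "x \<in> cell D \<longleftrightarrow> - 1 * (x $ 1 - at_x1 1 P $ 1) > 0" if "dist x (at_x1 1 P) < r" for x
      using that r(3) r1(2) N1(3) by (auto simp: cell_def dist_commute subset_iff)
    have "closed {x::real^3. x $ 3 = 0}" by (intro closed_Collect_eq continuous_intros)
    then have "closed (free_surface D)" by (simp add: free_surface_def closed_Int)
    then show "free_surface D \<in> sets borel" by simp
    show "bounded (free_surface D)"
      using bounded_closure[OF domain_cell(2)] by (rule bounded_subset) (auto simp: free_surface_def frontier_def)
    show "emeasure area_x3 (free_surface D) > 0" by (rule free_surface_pos)
    show "r \<le> dist x (at_x1 j P)" if "x \<in> free_surface D" for x j
      using that component_le_dist[of x 3 "at_x1 j P"] r(4) by (simp add: free_surface_def)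
  qed (use r in auto)
qed

theorem theorem3p1:
  fixes D :: "(real^3) set" and P :: "real^2" and \<theta> :: "(real^2) set"
  assumes "cell_geometry D P \<theta>"
    and "trace_properties (cell D) area_x3 (free_surface D)"
  shows "\<forall>k::nat. k \<ge> 1 \<longrightarrow>
    (\<exists>\<epsilon>\<^sub>k>0. \<exists>C\<^sub>k>0. \<forall>\<epsilon>\<in>{0<..<\<epsilon>\<^sub>k}. \<forall>\<eta>\<in>{0..<2 * pi}.
       limit_eigenvalue D k \<le> model_eigenvalue D P \<theta> \<epsilon> \<eta> k \<and>
       model_eigenvalue D P \<theta> \<epsilon> \<eta> k \<le> limit_eigenvalue D k + C\<^sub>k * \<epsilon>)"
proof (intro allI impI)
  fix k :: nat
  interpret cell_geometry D P \<theta> by (rule assms(1))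
  obtain r where "punctured_cell (cell D) (free_surface D) P r" by (rule punctured_cell_exists[OF assms(2)])
  then interpret punctured_cell "cell D" "free_surface D" P r .
  have r: "r > 0" by (rule N0.r_pos)
  \<comment> \<open>The scaled aperture lies in the ball of radius \<open>R * \<epsilon>\<close>
    about \<open>P\<close>, so the plug radius is \<open>a = R * \<epsilon>\<close>. This turns
    \<open>a \<le> r / 4\<close> into the threshold \<open>r / (4 * R)\<close>, common to all
    \<open>k\<close>, and the constant into \<open>C * R\<close>.\<close>
  obtain R where R: "R > 0" "\<theta> \<subseteq> ball 0 R" using bounded_subset_ballD[OF domain_\<theta>(2), of 0] by blast
  obtain C where C: "C > 0" "\<And>a T \<eta>. 0 < a \<Longrightarrow> a \<le> r / 4 \<Longrightarrow> T \<subseteq> ball P a \<Longrightarrow>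
     kth_eigenvalue (cell D) area_x3 (free_surface D) (quasiperiodic T \<eta>) k \<le>
     kth_eigenvalue (cell D) area_x3 (free_surface D) (H1 (cell D)) k + C * a"
    using quasiperiodic_eigenvalue_bound[of k] by blast
  have "limit_eigenvalue D k \<le> model_eigenvalue D P \<theta> \<epsilon> \<eta> k \<and>
       model_eigenvalue D P \<theta> \<epsilon> \<eta> k \<le> limit_eigenvalue D k + (C * R) * \<epsilon>" if \<epsilon>: "\<epsilon> \<in> {0<..<r / (4 * R)}" for \<epsilon> \<eta>
  proof -
    define T where "T = {y. (1 / \<epsilon>) *\<^sub>R (y - P) \<in> \<theta>}"
    have H: "H1_quasiperiodic D P \<theta> \<epsilon> \<eta> = quasiperiodic T \<eta>"
      unfolding H1_quasiperiodic_def quasiperiodic_def aperture_def T_def ..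
    have a: "0 < R * \<epsilon>" "R * \<epsilon> \<le> r / 4" using \<epsilon> R(1) by (auto simp: field_simps)
    have T: "T \<subseteq> ball P (R * \<epsilon>)"
    proof
      fix y assume "y \<in> T"
      then have "norm ((1 / \<epsilon>) *\<^sub>R (y - P)) < R" using R(2) unfolding T_def by auto
      then have "norm (y - P) / \<epsilon> < R" using \<epsilon> by (simp only: norm_scaleR) simp
      then show "y \<in> ball P (R * \<epsilon>)" using \<epsilon> by (simp add: dist_norm norm_minus_commute pos_divide_less_eq)
    qed
    have "steklov_subspace (cell D) area_x3 (free_surface D) (quasiperiodic T \<eta>)"
      by (rule quasiperiodic_subspace[OF a(1) _ T]) (use a r in simp)
    then have "limit_eigenvalue D k \<le> model_eigenvalue D P \<theta> \<epsilon> \<eta> k"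
      unfolding limit_eigenvalue_def model_eigenvalue_def H
      by (rule kth_eigenvalue_antimono[OF H1_subspace]) (auto simp: quasiperiodic_def)
    moreover have "model_eigenvalue D P \<theta> \<epsilon> \<eta> k \<le> limit_eigenvalue D k + (C * R) * \<epsilon>"
      using C(2)[OF a T, of \<eta>] unfolding limit_eigenvalue_def model_eigenvalue_def H by (simp add: mult.assoc)
    ultimately show ?thesis ..
  qed
  then show "\<exists>\<epsilon>\<^sub>k>0. \<exists>C\<^sub>k>0. \<forall>\<epsilon>\<in>{0<..<\<epsilon>\<^sub>k}. \<forall>\<eta>\<in>{0..<2 * pi}.
       limit_eigenvalue D k \<le> model_eigenvalue D P \<theta> \<epsilon> \<eta> k \<and>
       model_eigenvalue D P \<theta> \<epsilon> \<eta> k \<le> limit_eigenvalue D k + C\<^sub>k * \<epsilon>"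
    using C(1) R(1) r by (intro exI[of _ "r / (4 * R)"] exI[of _ "C * R"] conjI ballI) auto
qed

end
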